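(* Assume (A1) (stated in the context), and let $t_0\in[0,T)$. Then $u^*\in L^2_{\mathbb F}(t_0,T;\mathbb R^m)$ is an optimal control of Problem (P) (for the data $(t_0,\xi,\varsigma)$) if and only if $u^*$ minimizes, over $u\in L^2_{\mathbb F}(t_0,T;\mathbb R^m)$, the functional $$\mathbb E\int_{t_0}^T\big[X(t)^\top Q(t)X(t)+u(t)^\top R(t)u(t)\big]dt+\mathbb E\int_{t_0}^{(t_0+\delta)\wedge T}\varsigma(t-t_0-\delta)^\top R_2(t)\varsigma(t-t_0-\delta)dt$$ subject to the stochastic Volterra integral equation, for $t\in(t_0,T)$, $$X(t)=\varphi(t)+\int_{t_0}^t\big[A(t,s)X(s)+B(t,s)u(s)+\tilde b(t,s)\big]ds+\int_{t_0}^t\big[C(t,s)X(s)+D(t,s)u(s)+\tilde\sigma(t,s)\big]dW(s),$$ where $\varphi,A,B,C,D,\tilde b,\tilde\sigma,Q,R$ are the coefficients defined in the context.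
   Context: $T>0$, $\delta>0$. $(\Omega,\mathcal F,\mathbb F,\mathbb P)$ is a complete filtered probability space whose filtration is generated by a one-dimensional standard Brownian motion $W$. $\triangle_2(a,T)=\{(t,s):a<s<t<T\}$; $\mathbb S^k$: symmetric $k\times k$ matrices; $\mathbf 1_E$: indicator of $E$. $L^2_{\mathbb F}(a,T;\mathbb R^k)$: $\mathbb F$-adapted processes with $\mathbb E\int_a^T|\phi|^2dt<\infty$; $L^2_{\mathbb F}(\Omega;L^1(0,T;\mathbb R^n))$: $\mathbb F$-adapted processes with $\mathbb E(\int_0^T|\phi|dt)^2<\infty$. Assumption (A1): $A_1,A_2,A_3\in L^2(0,T;\mathbb R^{n\times n})$; $B_1,B_2,B_3\in L^\infty(0,T;\mathbb R^{n\times m})$; $C_1,C_2,C_3\in L^\infty(0,T;\mathbb R^{n\times n})$; $D_1\in L^\infty(0,T;\mathbb R^{n\times m})$; $b\in L^2_{\mathbb F}(\Omega;L^1(0,T;\mathbb R^n))$; $\sigma\in L^2_{\mathbb F}(0,T;\mathbb R^n)$; $F\in L^\infty(\triangle_2(0,T);\mathbb R^{n\times n})$; $\tilde F\in L^\infty(\triangle_2(0,T);\mathbb R^{m\times m})$; $Q_1,Q_2,Q_3\in L^\infty(0,T;\mathbb S^n)$; $R_1,R_2\in L^\infty(0,T;\mathbb S^m)$; $\xi\in C([-\delta,0];\mathbb R^n)$; $\varsigma\in L^2(-\delta,0;\mathbb R^m)$. (All but $b,\sigma$ deterministic.) Problem (P): minimize over $u\in L^2_{\mathbb F}(t_0,T;\mathbb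 R^m)$ the cost $$J(t_0,\xi,\varsigma;u)=\mathbb E\int_{t_0}^T\big[x^\top Q_1x+y^\top Q_2y+z^\top Q_3z+u^\top R_1u+\nu^\top R_2\nu\big](t)dt$$ subject to $$dx=[A_1x+A_2y+A_3z+B_1u+B_2\nu+B_3\mu+b](t)dt+[C_1x+C_2y+C_3z+D_1u+\sigma](t)dW(t),\ t\in(t_0,T),$$ $x(t)=\xi(t-t_0)$, $u(t)=\varsigma(t-t_0)$ for $t\in[t_0-\delta,t_0]$, where for $t\in(t_0,T)$: $y(t)=x(t-\delta)$, $z(t)=\int_{t_0}^tF(t,s)x(s)ds$, $\nu(t)=u(t-\delta)$, $\mu(t)=\int_{t_0}^t\tilde F(t,s)u(s)ds$. An optimal control is a minimizer. Coefficients of the Volterra problem. Let $\mathcal E(t,s)=\int_s^tF(t,r)dr\,\mathbf 1_{[0,t]}(s)$ (so $\mathcal E(t,s)=0$ if $s>t$); $B_2(t)$ is set to $0$ for $t>T$ (such values are always multiplied by $0$). With block columns stacked (components separated by semicolons): $\varphi(t)=\big(\ \xi(0)+\int_{t_0}^{t_0+\delta}B_2(s)\varsigma(s-t_0-\delta)\mathbf 1_{[t_0,t)}(s)ds\ ;\ \ \xi(t-t_0-\delta)\mathbf 1_{[t_0,t_0+\delta]}(t)+[\xi(0)+\int_{t_0}^{(t_0+\delta)\wedge(t-\delta)}B_2(s)\varsigma(s-t_0-\delta)ds]\mathbf 1_{(t_0+\delta,\infty)}(t)\ ;\ \ \int_{t_0}^tF(t,s)[\xi(0)+\int_{t_0}^{t_0+\delta}B_2(r)\varsigma(r-t_0-\delta)\mathbf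 1_{[t_0,s)}(r)dr]ds\ \big)$. With $\Upsilon(t,s)=\begin{bmatrix}I\\ \mathbf 1_{(\delta,\infty)}(t-s)I\\ \mathcal E(t,s)\end{bmatrix}$: $A(t,s)=\Upsilon(t,s)(A_1(s),A_2(s),A_3(s))$, $C(t,s)=\Upsilon(t,s)(C_1(s),C_2(s),C_3(s))$, $D(t,s)=\Upsilon(t,s)D_1(s)$, $\tilde b(t,s)=\Upsilon(t,s)b(s)$, $\tilde\sigma(t,s)=\Upsilon(t,s)\sigma(s)$, $$B(t,s)=\begin{bmatrix}B_1(s)+B_2(s+\delta)\mathbf 1_{(\delta,\infty)}(t-s)+\int_s^tB_3(r)\tilde F(r,s)dr\\ \mathbf 1_{(\delta,\infty)}(t-s)\big[B_1(s)+B_2(s+\delta)\mathbf 1_{(2\delta,\infty)}(t-s)+\int_s^{t-\delta}B_3(r)\tilde F(r,s)dr\big]\\ \mathcal E(t,s)B_1(s)+\mathcal E(t,s+\delta)B_2(s+\delta)+\int_s^t\mathcal E(t,\theta)B_3(\theta)\tilde F(\theta,s)d\theta\end{bmatrix},$$ $Q(t)=\mathrm{diag}(Q_1(t),Q_2(t),Q_3(t))$, $R(t)=R_1(t)+R_2(t+\delta)\mathbf 1_{[0,T-\delta)}(t)$. *)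

theory Defs
  imports "HOL-Probability.Probability"
begin

section \<open>Deterministic function spaces\<close>

text \<open>Elements of the Lebesgue spaces are represented by Borel functions; every class of
  Lebesgue measurable functions contains one.\<close>

definition L2_space :: "'a measure \<Rightarrow> ('a \<Rightarrow> 'b::real_normed_vector) set" where
  "L2_space N = {f \<in> borel_measurable N. integrable N (\<lambda>x. (norm (f x))\<^sup>2)}"

definition Linf_space :: "'a measure \<Rightarrow> ('a \<Rightarrow> 'b::real_normed_vector) set" where
  "Linf_space N = {f \<in> borel_measurable N. \<exists>K. AE x in N. norm (f x) \<le> K}"

abbreviation leb_ivl :: "real \<Rightarrow> real \<Rightarrow> real measure" where
  "leb_ivl a b \<equiv> restrict_space lborel {a<..<b}"

definition triangle :: "real \<Rightarrow> real \<Rightarrow> (real \<times> real) set" where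
  "triangle a T = {(t, s). a < s \<and> s < t \<and> t < T}"


section \<open>Brownian motion, adapted processes and the Ito integral\<close>

text \<open>The filtration generated by the process \<open>W\<close>, augmented by the null sets.\<close>

definition bm_filtration :: "'w measure \<Rightarrow> (real \<Rightarrow> 'w \<Rightarrow> real) \<Rightarrow> real \<Rightarrow> 'w measure" where
  "bm_filtration M W t =
     sigma (space M)
       ({W s -` E \<inter> space M | s E. 0 \<le> s \<and> s \<le> t \<and> E \<in> sets borel} \<union> null_sets M)"

definition brownian_motion :: "'w measure \<Rightarrow> (real \<Rightarrow> 'w \<Rightarrow> real) \<Rightarrow> bool" where
  "brownian_motion M W \<longleftrightarrow>
     (\<forall>t\<ge>0. W t \<in> borel_measurable M) \<and>
     (AE \<omega> in M. W 0 \<omega> = 0) \<and>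
     (AE \<omega> in M. continuous_on {0..} (\<lambda>t. W t \<omega>)) \<and>
     (\<forall>s t. 0 \<le> s \<and> s < t \<longrightarrow>
        distributed M lborel (\<lambda>\<omega>. W t \<omega> - W s \<omega>) (normal_density 0 (sqrt (t - s))) \<and>
        prob_space.indep_set M
          (sets (vimage_algebra (space M) (\<lambda>\<omega>. W t \<omega> - W s \<omega>) borel))
          (sets (bm_filtration M W s)))"

text \<open>Jointly measurable, adapted processes on the time interval \<open>(a, b)\<close>.\<close>

definition adapted_processes ::
  "'w measure \<Rightarrow> (real \<Rightarrow> 'w \<Rightarrow> real) \<Rightarrow> real \<Rightarrow> real
    \<Rightarrow> (real \<Rightarrow> 'w \<Rightarrow> 'b::topological_space) set" where
  "adapted_processes M W a b =
     {\<phi>. (\<lambda>(t, \<omega>). \<phi> t \<omega>) \<in> borel_measurable (restrict_space borel {a<..<b} \<Otimes>\<^sub>M M) \<and>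
         (\<forall>t\<in>{a<..<b}. \<phi> t \<in> borel_measurable (bm_filtration M W t))}"

definition L2F ::
  "'w measure \<Rightarrow> (real \<Rightarrow> 'w \<Rightarrow> real) \<Rightarrow> real \<Rightarrow> real
    \<Rightarrow> (real \<Rightarrow> 'w \<Rightarrow> 'b::real_normed_vector) set" where
  "L2F M W a b =
     {\<phi> \<in> adapted_processes M W a b.
        (\<integral>\<^sup>+\<omega>. (\<integral>\<^sup>+t\<in>{a<..<b}. ennreal ((norm (\<phi> t \<omega>))\<^sup>2) \<partial>lborel) \<partial>M) < \<infinity>}"

definition L2F_L1 ::
  "'w measure \<Rightarrow> (real \<Rightarrow> 'w \<Rightarrow> real) \<Rightarrow> real \<Rightarrow> real
    \<Rightarrow> (real \<Rightarrow> 'w \<Rightarrow> 'b::real_normed_vector) set" where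
  "L2F_L1 M W a b =
     {\<phi> \<in> adapted_processes M W a b.
        (\<integral>\<^sup>+\<omega>. (\<integral>\<^sup>+t\<in>{a<..<b}. ennreal (norm (\<phi> t \<omega>)) \<partial>lborel)\<^sup>2 \<partial>M) < \<infinity>}"

text \<open>A simple process takes the \<open>\<F>\<close>-measurable bounded value \<open>\<eta> i\<close> on \<open>(p i, p (i + 1)]\<close>,
  where \<open>a = p 0 < \<dots> < p k = b\<close>.\<close>

definition simple_data ::
  "'w measure \<Rightarrow> (real \<Rightarrow> 'w \<Rightarrow> real) \<Rightarrow> real \<Rightarrow> real
    \<Rightarrow> nat \<Rightarrow> (nat \<Rightarrow> real) \<Rightarrow> (nat \<Rightarrow> 'w \<Rightarrow> 'b::real_normed_vector) \<Rightarrow> bool" where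
  "simple_data M W a b k p \<eta> \<longleftrightarrow>
     p 0 = a \<and> p k = b \<and>
     (\<forall>i<k. p i < p (Suc i) \<and>
        \<eta> i \<in> borel_measurable (bm_filtration M W (p i)) \<and>
        (\<exists>K. \<forall>\<omega>\<in>space M. norm (\<eta> i \<omega>) \<le> K))"

definition simple_process ::
  "nat \<Rightarrow> (nat \<Rightarrow> real) \<Rightarrow> (nat \<Rightarrow> 'w \<Rightarrow> 'b::real_normed_vector) \<Rightarrow> real \<Rightarrow> 'w \<Rightarrow> 'b" where
  "simple_process k p \<eta> s \<omega> = (\<Sum>i<k. indicator {p i<..p (Suc i)} s *\<^sub>R \<eta> i \<omega>)"

definition simple_ito ::
  "(real \<Rightarrow> 'w \<Rightarrow> real) \<Rightarrow> nat \<Rightarrow> (nat \<Rightarrow> real) \<Rightarrow> (nat \<Rightarrow> 'w \<Rightarrow> 'b::real_normed_vector)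
    \<Rightarrow> 'w \<Rightarrow> 'b" where
  "simple_ito W k p \<eta> \<omega> = (\<Sum>i<k. (W (p (Suc i)) \<omega> - W (p i) \<omega>) *\<^sub>R \<eta> i \<omega>)"

text \<open>\<open>has_ito_integral M W a b f I\<close>: the random variable \<open>I\<close> is (a version of) the Ito integral
  of \<open>f\<close> over \<open>(a, b)\<close>, that is, the mean square limit of the integrals of simple processes
  converging to \<open>f\<close> in mean square.\<close>

definition has_ito_integral ::
  "'w measure \<Rightarrow> (real \<Rightarrow> 'w \<Rightarrow> real) \<Rightarrow> real \<Rightarrow> real
    \<Rightarrow> (real \<Rightarrow> 'w \<Rightarrow> 'b::real_normed_vector) \<Rightarrow> ('w \<Rightarrow> 'b) \<Rightarrow> bool" where
  "has_ito_integral M W a b f I \<longleftrightarrow>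
     f \<in> L2F M W a b \<and> I \<in> borel_measurable M \<and>
     (\<exists>k p \<eta>.
        (\<forall>j. simple_data M W a b (k j) (p j) (\<eta> j)) \<and>
        (\<lambda>j. \<integral>\<^sup>+\<omega>. (\<integral>\<^sup>+s\<in>{a<..<b}.
               ennreal ((norm (simple_process (k j) (p j) (\<eta> j) s \<omega> - f s \<omega>))\<^sup>2) \<partial>lborel) \<partial>M)
          \<longlonglongrightarrow> 0 \<and>
        (\<lambda>j. \<integral>\<^sup>+\<omega>. ennreal ((norm (simple_ito W (k j) (p j) (\<eta> j) \<omega> - I \<omega>))\<^sup>2) \<partial>M)
          \<longlonglongrightarrow> 0)"


section \<open>Block vectors and matrices\<close>

text \<open>Vertical stacking. A matrix is the vector of its rows, so this also stacks matrices with
  the same number of columns.\<close>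

definition vstack3 :: "'a^'p \<Rightarrow> 'a^'q \<Rightarrow> 'a^'r \<Rightarrow> 'a^('p + 'q + 'r)" where
  "vstack3 u v w =
     (\<chi> i. case i of Inl j \<Rightarrow> u $ j
           | Inr i' \<Rightarrow> (case i' of Inl j \<Rightarrow> v $ j | Inr j \<Rightarrow> w $ j))"

definition hstack3 :: "'a^'p^'k \<Rightarrow> 'a^'q^'k \<Rightarrow> 'a^'r^'k \<Rightarrow> 'a^('p + 'q + 'r)^'k" where
  "hstack3 U V Z = (\<chi> i. vstack3 (U $ i) (V $ i) (Z $ i))"

definition diag3 ::
  "real^'p^'p \<Rightarrow> real^'q^'q \<Rightarrow> real^'r^'r \<Rightarrow> real^('p + 'q + 'r)^('p + 'q + 'r)" where
  "diag3 U V Z = vstack3 (hstack3 U 0 0) (hstack3 0 V 0) (hstack3 0 0 Z)"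

definition quad :: "real^'k^'k \<Rightarrow> real^'k \<Rightarrow> real" where
  "quad S v = v \<bullet> (S *v v)"


section \<open>The data\<close>

record ('w, 'n::finite, 'm::finite) coeffs =
  A1 :: "real \<Rightarrow> real^'n^'n"
  A2 :: "real \<Rightarrow> real^'n^'n"
  A3 :: "real \<Rightarrow> real^'n^'n"
  B1 :: "real \<Rightarrow> real^'m^'n"
  B2 :: "real \<Rightarrow> real^'m^'n"
  B3 :: "real \<Rightarrow> real^'m^'n"
  C1 :: "real \<Rightarrow> real^'n^'n"
  C2 :: "real \<Rightarrow> real^'n^'n"
  C3 :: "real \<Rightarrow> real^'n^'n"
  D1 :: "real \<Rightarrow> real^'m^'n"
  b_coeff :: "real \<Rightarrow> 'w \<Rightarrow> real^'n"
  \<sigma>_coeff :: "real \<Rightarrow> 'w \<Rightarrow> real^'n"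
  F_ker :: "real \<Rightarrow> real \<Rightarrow> real^'n^'n"
  F'_ker :: "real \<Rightarrow> real \<Rightarrow> real^'m^'m"  \<comment> \<open>the kernel \<open>F\<close> with a tilde\<close>
  Q1 :: "real \<Rightarrow> real^'n^'n"
  Q2 :: "real \<Rightarrow> real^'n^'n"
  Q3 :: "real \<Rightarrow> real^'n^'n"
  R1 :: "real \<Rightarrow> real^'m^'m"
  R2 :: "real \<Rightarrow> real^'m^'m"

definition symmetric_on :: "real set \<Rightarrow> (real \<Rightarrow> real^'k^'k) \<Rightarrow> bool" where
  "symmetric_on S G \<longleftrightarrow> (AE t in lborel. t \<in> S \<longrightarrow> transpose (G t) = G t)"

definition assumption_A1 ::
  "'w measure \<Rightarrow> (real \<Rightarrow> 'w \<Rightarrow> real) \<Rightarrow> real \<Rightarrow> real \<Rightarrow> ('w, 'n::finite, 'm::finite) coeffs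
    \<Rightarrow> (real \<Rightarrow> real^'n) \<Rightarrow> (real \<Rightarrow> real^'m) \<Rightarrow> bool" where
  "assumption_A1 M W T \<delta> P \<xi> \<zeta> \<longleftrightarrow>
     {A1 P, A2 P, A3 P} \<subseteq> L2_space (leb_ivl 0 T) \<and>
     {B1 P, B2 P, B3 P} \<subseteq> Linf_space (leb_ivl 0 T) \<and>
     {C1 P, C2 P, C3 P} \<subseteq> Linf_space (leb_ivl 0 T) \<and>
     D1 P \<in> Linf_space (leb_ivl 0 T) \<and>
     b_coeff P \<in> L2F_L1 M W 0 T \<and>
     \<sigma>_coeff P \<in> L2F M W 0 T \<and>
     (\<lambda>(t, s). F_ker P t s) \<in> Linf_space (restrict_space lborel (triangle 0 T)) \<and>
     (\<lambda>(t, s). F'_ker P t s) \<in> Linf_space (restrict_space lborel (triangle 0 T)) \<and>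
     {Q1 P, Q2 P, Q3 P} \<subseteq> Linf_space (leb_ivl 0 T) \<and>
     (\<forall>G\<in>{Q1 P, Q2 P, Q3 P}. symmetric_on {0<..<T} G) \<and>
     {R1 P, R2 P} \<subseteq> Linf_space (leb_ivl 0 T) \<and>
     (\<forall>G\<in>{R1 P, R2 P}. symmetric_on {0<..<T} G) \<and>
     continuous_on {-\<delta>..0} \<xi> \<and>
     \<zeta> \<in> L2_space (leb_ivl (-\<delta>) 0)"

text \<open>Minimization of \<open>J u x\<close> over controls \<open>u \<in> U\<close> subject to the state equation \<open>sol u x\<close>:
  \<open>u\<close> is a minimizer if it has a state whose cost is at most that of every control
  together with any of its states. (States are unique up to modification, and the costs
  below do not distinguish modifications.)\<close>

definition is_minimizer :: "'u set \<Rightarrow> ('u \<Rightarrow> 'x \<Rightarrow> bool) \<Rightarrow> ('u \<Rightarrow> 'x \<Rightarrow> real) \<Rightarrow> 'u \<Rightarrow> bool" where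
  "is_minimizer U sol J u \<longleftrightarrow>
     u \<in> U \<and> (\<exists>x. sol u x \<and> (\<forall>v\<in>U. \<forall>y. sol v y \<longrightarrow> J u x \<le> J v y))"


section \<open>The control problem with delay\<close>

text \<open>A control on \<open>(t0, T)\<close>, extended to the past by the initial trajectory.\<close>

definition extended_control ::
  "real \<Rightarrow> (real \<Rightarrow> 'b) \<Rightarrow> (real \<Rightarrow> 'w \<Rightarrow> 'b) \<Rightarrow> real \<Rightarrow> 'w \<Rightarrow> 'b" where
  "extended_control t0 \<zeta> u t \<omega> = (if t \<le> t0 then \<zeta> (t - t0) else u t \<omega>)"

definition delayed :: "real \<Rightarrow> (real \<Rightarrow> 'w \<Rightarrow> 'b) \<Rightarrow> real \<Rightarrow> 'w \<Rightarrow> 'b" where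
  "delayed \<delta> v t \<omega> = v (t - \<delta>) \<omega>"

definition memory ::
  "real \<Rightarrow> (real \<Rightarrow> real \<Rightarrow> real^'k^'k) \<Rightarrow> (real \<Rightarrow> 'w \<Rightarrow> real^'k) \<Rightarrow> real \<Rightarrow> 'w \<Rightarrow> real^'k" where
  "memory t0 K v t \<omega> = (LINT s:{t0<..<t}|lborel. K t s *v v s \<omega>)"

definition delay_drift ::
  "real \<Rightarrow> ('w, 'n::finite, 'm::finite) coeffs \<Rightarrow> real \<Rightarrow> (real \<Rightarrow> real^'m)
    \<Rightarrow> (real \<Rightarrow> 'w \<Rightarrow> real^'m) \<Rightarrow> (real \<Rightarrow> 'w \<Rightarrow> real^'n) \<Rightarrow> real \<Rightarrow> 'w \<Rightarrow> real^'n" where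
  "delay_drift \<delta> P t0 \<zeta> u x t \<omega> =
     A1 P t *v x t \<omega> + A2 P t *v delayed \<delta> x t \<omega> + A3 P t *v memory t0 (F_ker P) x t \<omega>
     + B1 P t *v u t \<omega> + B2 P t *v delayed \<delta> (extended_control t0 \<zeta> u) t \<omega>
     + B3 P t *v memory t0 (F'_ker P) u t \<omega> + b_coeff P t \<omega>"

definition delay_diffusion ::
  "real \<Rightarrow> ('w, 'n::finite, 'm::finite) coeffs \<Rightarrow> real
    \<Rightarrow> (real \<Rightarrow> 'w \<Rightarrow> real^'m) \<Rightarrow> (real \<Rightarrow> 'w \<Rightarrow> real^'n) \<Rightarrow> real \<Rightarrow> 'w \<Rightarrow> real^'n" where
  "delay_diffusion \<delta> P t0 u x t \<omega> =
     C1 P t *v x t \<omega> + C2 P t *v delayed \<delta> x t \<omega> + C3 P t *v memory t0 (F_ker P) x t \<omega>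
     + D1 P t *v u t \<omega> + \<sigma>_coeff P t \<omega>"

text \<open>As usual, a solution of the stochastic differential equation is a square integrable adapted
  process with continuous paths that satisfies the integrated equation.\<close>

definition delay_state ::
  "'w measure \<Rightarrow> (real \<Rightarrow> 'w \<Rightarrow> real) \<Rightarrow> real \<Rightarrow> real \<Rightarrow> ('w, 'n::finite, 'm::finite) coeffs
    \<Rightarrow> real \<Rightarrow> (real \<Rightarrow> real^'n) \<Rightarrow> (real \<Rightarrow> real^'m)
    \<Rightarrow> (real \<Rightarrow> 'w \<Rightarrow> real^'m) \<Rightarrow> (real \<Rightarrow> 'w \<Rightarrow> real^'n) \<Rightarrow> bool" where
  "delay_state M W T \<delta> P t0 \<xi> \<zeta> u x \<longleftrightarrow>
     x \<in> L2F M W t0 T \<and>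
     (AE \<omega> in M. continuous_on {t0 - \<delta>..T} (\<lambda>t. x t \<omega>)) \<and>
     (\<forall>\<omega>\<in>space M. \<forall>t\<in>{t0 - \<delta>..t0}. x t \<omega> = \<xi> (t - t0)) \<and>
     (\<forall>t\<in>{t0<..<T}. \<exists>I.
        has_ito_integral M W t0 t (delay_diffusion \<delta> P t0 u x) I \<and>
        (AE \<omega> in M. x t \<omega> =
           \<xi> 0 + (LINT s:{t0<..<t}|lborel. delay_drift \<delta> P t0 \<zeta> u x s \<omega>) + I \<omega>))"

definition delay_cost ::
  "'w measure \<Rightarrow> real \<Rightarrow> real \<Rightarrow> ('w, 'n::finite, 'm::finite) coeffs \<Rightarrow> real
    \<Rightarrow> (real \<Rightarrow> real^'m) \<Rightarrow> (real \<Rightarrow> 'w \<Rightarrow> real^'m) \<Rightarrow> (real \<Rightarrow> 'w \<Rightarrow> real^'n) \<Rightarrow> real" where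
  "delay_cost M T \<delta> P t0 \<zeta> u x =
     (LINT \<omega>|M. (LINT t:{t0<..<T}|lborel.
        quad (Q1 P t) (x t \<omega>) + quad (Q2 P t) (delayed \<delta> x t \<omega>)
        + quad (Q3 P t) (memory t0 (F_ker P) x t \<omega>)
        + quad (R1 P t) (u t \<omega>)
        + quad (R2 P t) (delayed \<delta> (extended_control t0 \<zeta> u) t \<omega>)))"


section \<open>The Volterra control problem\<close>

definition Eker :: "('w, 'n::finite, 'm::finite) coeffs \<Rightarrow> real \<Rightarrow> real \<Rightarrow> real^'n^'n" where
  "Eker P t s = indicator {0..t} s *\<^sub>R (LINT r:{s<..<t}|lborel. F_ker P t r)"

definition B2_zero :: "real \<Rightarrow> ('w, 'n::finite, 'm::finite) coeffs \<Rightarrow> real \<Rightarrow> real^'m^'n" where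
  "B2_zero T P t = (if t > T then 0 else B2 P t)"

definition volterra_phi ::
  "real \<Rightarrow> real \<Rightarrow> ('w, 'n::finite, 'm::finite) coeffs \<Rightarrow> real \<Rightarrow> (real \<Rightarrow> real^'n)
    \<Rightarrow> (real \<Rightarrow> real^'m) \<Rightarrow> real \<Rightarrow> real^('n + 'n + 'n)" where
  "volterra_phi T \<delta> P t0 \<xi> \<zeta> t =
     vstack3
       (\<xi> 0 + (LINT s:{t0<..<t0 + \<delta>}|lborel.
                 indicator {t0..<t} s *\<^sub>R (B2_zero T P s *v \<zeta> (s - t0 - \<delta>))))
       (indicator {t0..t0 + \<delta>} t *\<^sub>R \<xi> (t - t0 - \<delta>)
        + indicator {t0 + \<delta><..} t *\<^sub>R
            (\<xi> 0 + (LINT s:{t0<..<min (t0 + \<delta>) (t - \<delta>)}|lborel.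
                      B2_zero T P s *v \<zeta> (s - t0 - \<delta>))))
       (LINT s:{t0<..<t}|lborel. F_ker P t s *v
          (\<xi> 0 + (LINT r:{t0<..<t0 + \<delta>}|lborel.
                    indicator {t0..<s} r *\<^sub>R (B2_zero T P r *v \<zeta> (r - t0 - \<delta>)))))"

definition Upsilon ::
  "real \<Rightarrow> ('w, 'n::finite, 'm::finite) coeffs \<Rightarrow> real \<Rightarrow> real \<Rightarrow> real^'n^('n + 'n + 'n)" where
  "Upsilon \<delta> P t s =
     vstack3 (mat 1) (indicator {\<delta><..} (t - s) *\<^sub>R mat 1) (Eker P t s)"

definition volterra_A ::
  "real \<Rightarrow> ('w, 'n::finite, 'm::finite) coeffs \<Rightarrow> real \<Rightarrow> real
    \<Rightarrow> real^('n + 'n + 'n)^('n + 'n + 'n)" where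
  "volterra_A \<delta> P t s = Upsilon \<delta> P t s ** hstack3 (A1 P s) (A2 P s) (A3 P s)"

definition volterra_C ::
  "real \<Rightarrow> ('w, 'n::finite, 'm::finite) coeffs \<Rightarrow> real \<Rightarrow> real
    \<Rightarrow> real^('n + 'n + 'n)^('n + 'n + 'n)" where
  "volterra_C \<delta> P t s = Upsilon \<delta> P t s ** hstack3 (C1 P s) (C2 P s) (C3 P s)"

definition volterra_D ::
  "real \<Rightarrow> ('w, 'n::finite, 'm::finite) coeffs \<Rightarrow> real \<Rightarrow> real \<Rightarrow> real^'m^('n + 'n + 'n)" where
  "volterra_D \<delta> P t s = Upsilon \<delta> P t s ** D1 P s"

definition volterra_b ::
  "real \<Rightarrow> ('w, 'n::finite, 'm::finite) coeffs \<Rightarrow> real \<Rightarrow> real \<Rightarrow> 'w \<Rightarrow> real^('n + 'n + 'n)" where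
  "volterra_b \<delta> P t s \<omega> = Upsilon \<delta> P t s *v b_coeff P s \<omega>"

definition volterra_\<sigma> ::
  "real \<Rightarrow> ('w, 'n::finite, 'm::finite) coeffs \<Rightarrow> real \<Rightarrow> real \<Rightarrow> 'w \<Rightarrow> real^('n + 'n + 'n)" where
  "volterra_\<sigma> \<delta> P t s \<omega> = Upsilon \<delta> P t s *v \<sigma>_coeff P s \<omega>"

definition volterra_B ::
  "real \<Rightarrow> real \<Rightarrow> ('w, 'n::finite, 'm::finite) coeffs \<Rightarrow> real \<Rightarrow> real
    \<Rightarrow> real^'m^('n + 'n + 'n)" where
  "volterra_B T \<delta> P t s =
     vstack3
       (B1 P s + indicator {\<delta><..} (t - s) *\<^sub>R B2_zero T P (s + \<delta>)
        + (LINT r:{s<..<t}|lborel. B3 P r ** F'_ker P r s))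
       (indicator {\<delta><..} (t - s) *\<^sub>R
          (B1 P s + indicator {2 * \<delta><..} (t - s) *\<^sub>R B2_zero T P (s + \<delta>)
           + (LINT r:{s<..<t - \<delta>}|lborel. B3 P r ** F'_ker P r s)))
       (Eker P t s ** B1 P s + Eker P t (s + \<delta>) ** B2_zero T P (s + \<delta>)
        + (LINT \<theta>:{s<..<t}|lborel. Eker P t \<theta> ** B3 P \<theta> ** F'_ker P \<theta> s))"

definition volterra_Q ::
  "('w, 'n::finite, 'm::finite) coeffs \<Rightarrow> real \<Rightarrow> real^('n + 'n + 'n)^('n + 'n + 'n)" where
  "volterra_Q P t = diag3 (Q1 P t) (Q2 P t) (Q3 P t)"

definition volterra_R ::
  "real \<Rightarrow> real \<Rightarrow> ('w, 'n::finite, 'm::finite) coeffs \<Rightarrow> real \<Rightarrow> real^'m^'m" where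
  "volterra_R T \<delta> P t = R1 P t + indicator {0..<T - \<delta>} t *\<^sub>R R2 P (t + \<delta>)"

text \<open>The Volterra equation is an identity in \<open>L2F M W t0 T\<close>, hence required for almost every
  \<open>t\<close>. Since the kernel \<open>F_ker P\<close> is only essentially bounded on the triangle,
  its sections, and with them the third block row of the coefficients, are meaningful for
  almost every \<open>t\<close> only.\<close>

definition volterra_state ::
  "'w measure \<Rightarrow> (real \<Rightarrow> 'w \<Rightarrow> real) \<Rightarrow> real \<Rightarrow> real \<Rightarrow> ('w, 'n::finite, 'm::finite) coeffs
    \<Rightarrow> real \<Rightarrow> (real \<Rightarrow> real^'n) \<Rightarrow> (real \<Rightarrow> real^'m)
    \<Rightarrow> (real \<Rightarrow> 'w \<Rightarrow> real^'m) \<Rightarrow> (real \<Rightarrow> 'w \<Rightarrow> real^('n + 'n + 'n)) \<Rightarrow> bool" where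
  "volterra_state M W T \<delta> P t0 \<xi> \<zeta> u X \<longleftrightarrow>
     X \<in> L2F M W t0 T \<and>
     (AE t in lborel. t \<in> {t0<..<T} \<longrightarrow> (\<exists>I.
        has_ito_integral M W t0 t
          (\<lambda>s \<omega>. volterra_C \<delta> P t s *v X s \<omega> + volterra_D \<delta> P t s *v u s \<omega>
                  + volterra_\<sigma> \<delta> P t s \<omega>) I \<and>
        (AE \<omega> in M. X t \<omega> =
           volterra_phi T \<delta> P t0 \<xi> \<zeta> t
           + (LINT s:{t0<..<t}|lborel.
                volterra_A \<delta> P t s *v X s \<omega> + volterra_B T \<delta> P t s *v u s \<omega>
                + volterra_b \<delta> P t s \<omega>)
           + I \<omega>)))"

definition volterra_cost ::
  "'w measure \<Rightarrow> real \<Rightarrow> real \<Rightarrow> ('w, 'n::finite, 'm::finite) coeffs \<Rightarrow> real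
    \<Rightarrow> (real \<Rightarrow> real^'m) \<Rightarrow> (real \<Rightarrow> 'w \<Rightarrow> real^'m) \<Rightarrow> (real \<Rightarrow> 'w \<Rightarrow> real^('n + 'n + 'n))
    \<Rightarrow> real" where
  "volterra_cost M T \<delta> P t0 \<zeta> u X =
     (LINT \<omega>|M. (LINT t:{t0<..<T}|lborel.
        quad (volterra_Q P t) (X t \<omega>) + quad (volterra_R T \<delta> P t) (u t \<omega>)))
     + (LINT \<omega>|M. (LINT t:{t0<..<min (t0 + \<delta>) T}|lborel.
          quad (R2 P t) (\<zeta> (t - t0 - \<delta>))))"

end

theory Submission
  imports Defs
begin

text \<open>
  Both problems have the same controls. It therefore suffices to turn a state of one equation into a
  state of the other with the same control and the same cost; \<open>delay_to_volterra\<close> and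
  \<open>volterra_to_delay\<close> do this, and \<open>is_minimizer_transfer\<close> concludes.

  A delay state is \<open>x(t) = \<xi>(0) + \<integral> d + Y(t)\<close>, where \<open>d\<close> is the drift and
  \<open>Y\<close> is the integral of the diffusion coefficient \<open>f\<close> against \<open>W\<close>. The Volterra state is
  \<open>X = (x, x(\<cdot> - \<delta>), \<integral> F x)\<close>. Each of its blocks arises from the formula for \<open>x\<close> by a linear operation in
  time: the identity, the evaluation at \<open>t - \<delta>\<close>, the integration against \<open>F(t, \<cdot>)\<close>. In the drift,
  Fubini's theorem and the shift \<open>s \<mapsto> s + \<delta>\<close> collect all direct, delayed and accumulated effects of the
  control at its own time \<open>s\<close>. They form the kernel \<open>B(t, s)\<close>, and what comes from the initial trajectory
  forms \<open>\<phi>\<close>: see \<open>drift_transport\<close>, from which \<open>state_row\<close>, \<open>delay_row\<close> and \<open>memory_row\<close> follow.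
  In the stochastic integral, evaluation at \<open>t - \<delta>\<close> cuts the integrand off
  (\<open>has_ito_zero_extend\<close>), and the stochastic Fubini theorem \<open>ito_fubini\<close> turns \<open>\<integral> F(t, r) Y(r) dr\<close> into
  the integral of \<open>\<E>(t, s) f(s)\<close> against \<open>W\<close>. All this is summarized in \<open>volterra_rhs\<close>.

  Conversely, the identity \<open>volterra_rhs\<close> holds for any three processes in the place of
  \<open>x\<close>, its delay and its memory in \<open>d\<close> and \<open>f\<close>. For the blocks of a Volterra state it shows that they are
  the delay triple of the continuous process \<open>x = \<xi>(0) + \<integral> d + Y\<close>, almost surely at almost every time. Then
  \<open>x\<close> solves the delay equation. The two costs differ only in that the cost of the delayed control is
  shifted to the control itself (\<open>costs_equal\<close>).

  For the Ito integral, defined as a mean square limit over simple processes, the isometry yields uniqueness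
  (\<open>has_ito_unique\<close>) and linearity. The martingale property gives a maximal inequality for
  elementary integrals (\<open>el_int_maximal\<close>), and with the Borel-Cantelli lemma a version with continuous
  paths that is almost surely a uniform limit of elementary integrals (\<open>ito_continuous_version\<close>). Uniform
  convergence of the paths is what allows the stochastic Fubini theorem to be proved path by path. The two
  equations assert that the integral of \<open>f\<close> exists up to times arbitrarily close to \<open>T\<close>; from this the one up to
  \<open>T\<close> is obtained by \<open>approximates_extend\<close>.
\<close>


section \<open>The filtration and the increments of Brownian motion\<close>

locale brownian = prob_space M + complete_measure M
  for M :: "'w measure" +
  fixes W :: "real \<Rightarrow> 'w \<Rightarrow> real"
  assumes bm: "brownian_motion M W"
begin

abbreviation Fil :: "real \<Rightarrow> 'w measure" where
  "Fil t \<equiv> bm_filtration M W t"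

lemma W_measurable [measurable]: "0 \<le> t \<Longrightarrow> W t \<in> borel_measurable M"
  using bm by (simp add: brownian_motion_def)

lemma Fil_generator:
  assumes "A \<in> {W s -` E \<inter> space M | s E. 0 \<le> s \<and> s \<le> t \<and> E \<in> sets borel} \<union> null_sets M"
  shows "A \<in> sets M"
  using assms by auto

lemma sets_Fil: "sets (Fil t) = sigma_sets (space M)
       ({W s -` E \<inter> space M | s E. 0 \<le> s \<and> s \<le> t \<and> E \<in> sets borel} \<union> null_sets M)"
  unfolding bm_filtration_def
  by (rule sets_measure_of) (use Fil_generator sets.sets_into_space in blast)

lemma space_Fil [simp]: "space (Fil t) = space M"
  unfolding bm_filtration_def
  by (rule space_measure_of) (use Fil_generator sets.sets_into_space in blast)

lemma Fil_subset: "sets (Fil t) \<subseteq> sets M"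
  unfolding sets_Fil by (rule sets.sigma_sets_subset) (use Fil_generator in blast)

lemma Fil_mono: "s \<le> t \<Longrightarrow> sets (Fil s) \<subseteq> sets (Fil t)"
  unfolding sets_Fil by (intro sigma_sets_mono' Un_mono subset_refl Collect_mono) (blast intro: order_trans)

lemma null_sets_Fil: "N \<in> null_sets M \<Longrightarrow> N \<in> sets (Fil t)"
  unfolding sets_Fil by (rule sigma_sets.Basic) auto

lemma measurable_FilD:
  assumes "f \<in> borel_measurable (Fil t)"
  shows "f \<in> borel_measurable M"
  by (rule measurable_from_subalg[OF _ assms]) (simp add: subalgebra_def Fil_subset)

lemma measurable_Fil_mono:
  assumes "f \<in> borel_measurable (Fil s)" "s \<le> t"
  shows "f \<in> borel_measurable (Fil t)"
  by (rule measurable_from_subalg[OF _ assms(1)]) (simp add: subalgebra_def Fil_mono assms(2))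

lemma W_measurable_Fil:
  assumes "0 \<le> s" "s \<le> t"
  shows "W s \<in> borel_measurable (Fil t)"
proof (rule measurableI)
  fix A :: "real set" assume "A \<in> sets borel"
  then show "W s -` A \<inter> space (Fil t) \<in> sets (Fil t)"
    unfolding space_Fil sets_Fil by (intro sigma_sets.Basic) (use assms in blast)
qed simp

text \<open>By completeness every subset of the null set where \<open>f\<close> and \<open>g\<close> differ is a null set, so preimages
  under \<open>f\<close> and \<open>g\<close> differ by null sets only. With the augmented filtration this makes modifications of
  adapted processes adapted.\<close>

lemma measurable_AE_cong:
  fixes f g :: "'w \<Rightarrow> 'b::topological_space"
  assumes N: "space N = space M" "null_sets M \<subseteq> sets N"
    and f: "f \<in> borel_measurable N" and eq: "AE \<omega> in M. g \<omega> = f \<omega>"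
  shows "g \<in> borel_measurable N"
proof (rule measurableI)
  fix A :: "'b set" assume A: "A \<in> sets borel"
  define D where "D = {\<omega> \<in> space M. g \<omega> \<noteq> f \<omega>}"
  have D: "D \<in> null_sets M"
    using eq unfolding AE_iff_null_sets D_def .
  have "g -` A \<inter> space M = (f -` A \<inter> space M - D) \<union> (g -` A \<inter> D)"
    unfolding D_def by auto
  moreover have "g -` A \<inter> D \<in> null_sets M"
    by (rule complete2[OF _ D]) auto
  ultimately show "g -` A \<inter> space N \<in> sets N"
    using D N measurable_sets[OF f A] by (metis sets.Diff sets.Un subsetD)
qed simp

lemma measurable_Fil_AE_cong:
  fixes f g :: "'w \<Rightarrow> 'b::topological_space"
  assumes "f \<in> borel_measurable (Fil t)" "AE \<omega> in M. g \<omega> = f \<omega>"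
  shows "g \<in> borel_measurable (Fil t)"
  using null_sets_Fil by (intro measurable_AE_cong[OF _ _ assms]) auto

lemma borel_measurable_AE_cong:
  fixes f g :: "'w \<Rightarrow> 'b::topological_space"
  assumes "f \<in> borel_measurable M" "AE \<omega> in M. g \<omega> = f \<omega>"
  shows "g \<in> borel_measurable M"
  by (rule measurable_AE_cong[OF _ _ assms]) auto

subsection \<open>Moments of increments\<close>

lemma increment_distributed:
  "0 \<le> s \<Longrightarrow> s < t \<Longrightarrow> distributed M lborel (\<lambda>\<omega>. W t \<omega> - W s \<omega>) (normal_density 0 (sqrt (t - s)))"
  using bm by (simp add: brownian_motion_def)

lemma increment_moment1:
  assumes "0 \<le> s" "s < t"
  shows "integrable M (\<lambda>\<omega>. W t \<omega> - W s \<omega>)" "(\<integral>\<omega>. W t \<omega> - W s \<omega> \<partial>M) = 0"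
proof -
  note d = increment_distributed[OF assms]
  show "integrable M (\<lambda>\<omega>. W t \<omega> - W s \<omega>)"
    using distributed_integrable[OF d, of "\<lambda>x. x"] integrable_normal_moment_nz_1[of "sqrt (t - s)" 0] assms
    by simp
  show "(\<integral>\<omega>. W t \<omega> - W s \<omega> \<partial>M) = 0"
    using distributed_integral[OF d, of "\<lambda>x. x"] integral_normal_moment_nz_1[of "sqrt (t - s)" 0] assms
    by simp
qed

lemma increment_moment2:
  assumes "0 \<le> s" "s < t"
  shows "integrable M (\<lambda>\<omega>. (W t \<omega> - W s \<omega>)\<^sup>2)" "(\<integral>\<omega>. (W t \<omega> - W s \<omega>)\<^sup>2 \<partial>M) = t - s"
proof -
  note d = increment_distributed[OF assms]
  show "integrable M (\<lambda>\<omega>. (W t \<omega> - W s \<omega>)\<^sup>2)"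
    using distributed_integrable[OF d, of "\<lambda>x. x\<^sup>2"] integrable_normal_moment[of "sqrt (t - s)" 0 2] assms
    by simp
  show "(\<integral>\<omega>. (W t \<omega> - W s \<omega>)\<^sup>2 \<partial>M) = t - s"
    using distributed_integral[OF d, of "\<lambda>x. x\<^sup>2"] integral_normal_moment_even[of "sqrt (t - s)" 0 1] assms
    by simp
qed

lemma indep_increment:
  assumes "0 \<le> s" "s < t" and Z: "Z \<in> borel_measurable (Fil s)"
  shows "indep_var borel (Z :: 'w \<Rightarrow> real) borel (\<lambda>\<omega>. W t \<omega> - W s \<omega>)"
proof -
  let ?D = "\<lambda>\<omega>. W t \<omega> - W s \<omega>"
  have ind: "indep_set (sets (vimage_algebra (space M) ?D borel)) (sets (Fil s))"
    using bm assms by (simp add: brownian_motion_def)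
  have D: "?D \<in> borel_measurable M" using assms by (intro borel_measurable_diff W_measurable) auto
  have 1: "sigma_sets (space M) {Z -` A \<inter> space M |A. A \<in> sets borel} \<subseteq> sets (Fil s)"
  proof -
    have "{Z -` A \<inter> space M |A. A \<in> sets borel} \<subseteq> sets (Fil s)"
      using measurable_sets[OF Z] by auto
    then show ?thesis using sets.sigma_sets_subset[of _ "Fil s"] by simp
  qed
  have 2: "sigma_sets (space M) {?D -` A \<inter> space M |A. A \<in> sets borel} \<subseteq> sets (vimage_algebra (space M) ?D borel)"
    by (simp add: sets_vimage_algebra)
  have "indep_set (sigma_sets (space M) {Z -` A \<inter> space M |A. A \<in> sets borel})
      (sigma_sets (space M) {?D -` A \<inter> space M |A. A \<in> sets borel})"
  proof (rule indep_setI)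
    fix A B
    assume "A \<in> sigma_sets (space M) {Z -` A \<inter> space M |A. A \<in> sets borel}"
      and "B \<in> sigma_sets (space M) {?D -` A \<inter> space M |A. A \<in> sets borel}"
    then show "prob (A \<inter> B) = prob A * prob B"
      using indep_setD[OF ind, of B A] 1 2 by (auto simp: Int_commute mult.commute)
  qed (use 1 2 Fil_subset indep_setD_ev1[OF ind] in blast)+
  then show ?thesis
    unfolding indep_var_eq using measurable_FilD[OF Z] D by blast
qed

lemma increment_orthogonal:
  assumes "0 \<le> s" "s \<le> t" and Z: "Z \<in> borel_measurable (Fil s)" "integrable M Z"
  shows "has_bochner_integral M (\<lambda>\<omega>. Z \<omega> * (W t \<omega> - W s \<omega>)) 0"
proof (cases "s = t")
  case False
  then have st: "s < t" using assms by simp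
  note i = indep_increment[OF \<open>0 \<le> s\<close> st Z(1)] and m = increment_moment1[OF \<open>0 \<le> s\<close> st]
  show ?thesis
    using indep_var_lebesgue_integral[OF i Z(2) m(1)] indep_var_integrable[OF i Z(2) m(1)] m(2)
    by (simp add: has_bochner_integral_iff)
qed (simp add: has_bochner_integral_iff)

lemma increment_variance:
  assumes "0 \<le> s" "s \<le> t" and Z: "Z \<in> borel_measurable (Fil s)" "integrable M Z"
  shows "has_bochner_integral M (\<lambda>\<omega>. Z \<omega> * (W t \<omega> - W s \<omega>)\<^sup>2) ((t - s) * (\<integral>\<omega>. Z \<omega> \<partial>M))"
proof (cases "s = t")
  case False
  then have st: "s < t" using assms by simp
  have i: "indep_var borel Z borel (\<lambda>\<omega>. (W t \<omega> - W s \<omega>)\<^sup>2)"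
    using indep_var_compose[OF indep_increment[OF \<open>0 \<le> s\<close> st Z(1)], of "\<lambda>x. x" borel "\<lambda>x. x\<^sup>2" borel]
    by (simp add: comp_def)
  note m = increment_moment2[OF \<open>0 \<le> s\<close> st]
  show ?thesis
    using indep_var_lebesgue_integral[OF i Z(2) m(1)] indep_var_integrable[OF i Z(2) m(1)] m(2)
    by (simp add: has_bochner_integral_iff mult.commute)
qed (simp add: has_bochner_integral_iff)

lemma integrable_bounded_increment:
  assumes "0 \<le> s" "s \<le> t" and Z: "Z \<in> borel_measurable (Fil r)" "\<And>\<omega>. \<omega> \<in> space M \<Longrightarrow> \<bar>Z \<omega>\<bar> \<le> (K::real)"
  shows "integrable M (\<lambda>\<omega>. Z \<omega> * (W t \<omega> - W s \<omega>))"
proof (cases "s = t")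
  case False
  then have st: "s < t" using assms by simp
  show ?thesis
  proof (rule Bochner_Integration.integrable_bound)
    show "integrable M (\<lambda>\<omega>. K * (W t \<omega> - W s \<omega>))"
      using increment_moment1(1)[OF \<open>0 \<le> s\<close> st] by simp
    show "(\<lambda>\<omega>. Z \<omega> * (W t \<omega> - W s \<omega>)) \<in> borel_measurable M"
      using measurable_FilD[OF Z(1)] assms by (intro borel_measurable_diff borel_measurable_times W_measurable) auto
    show "AE \<omega> in M. norm (Z \<omega> * (W t \<omega> - W s \<omega>)) \<le> norm (K * (W t \<omega> - W s \<omega>))"
    proof (rule AE_I2)
      fix \<omega> assume "\<omega> \<in> space M"
      then have "\<bar>Z \<omega>\<bar> \<le> \<bar>K\<bar>" using Z(2)[of \<omega>] by linarith
      then show "norm (Z \<omega> * (W t \<omega> - W s \<omega>)) \<le> norm (K * (W t \<omega> - W s \<omega>))"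
        by (simp add: abs_mult mult_right_mono)
    qed
  qed
qed simp

lemma integrable_bounded:
  assumes Z: "Z \<in> borel_measurable M" "\<And>\<omega>. \<omega> \<in> space M \<Longrightarrow> \<bar>Z \<omega>\<bar> \<le> (K::real)"
  shows "integrable M Z"
  by (rule integrable_const_bound[where B=K]) (use assms in auto)

text \<open>The polarized Ito isometry for two single steps. The two intervals are cut at each other's
  endpoints. A product of increments over two disjoint pieces has mean zero, since the later increment
  is independent of the earlier one and of the weight \<open>Z\<close>; only the square of the increment over the
  overlap remains, and its mean is the length of the overlap.\<close>

lemma increment_covariance_ordered:
  assumes t: "0 \<le> a" "a \<le> b" "a \<le> c" "c \<le> d"
    and Z: "Z \<in> borel_measurable (Fil c)" "\<And>\<omega>. \<omega> \<in> space M \<Longrightarrow> \<bar>Z \<omega>\<bar> \<le> (K::real)"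
  shows "has_bochner_integral M (\<lambda>\<omega>. Z \<omega> * ((W b \<omega> - W a \<omega>) * (W d \<omega> - W c \<omega>)))
           (max 0 (min b d - c) * (\<integral>\<omega>. Z \<omega> \<partial>M))"
proof -
  have bnd: "integrable M Z" by (rule integrable_bounded[OF measurable_FilD[OF Z(1)] Z(2)])
  have Wm: "0 \<le> s \<Longrightarrow> s \<le> r \<Longrightarrow> W s \<in> borel_measurable (Fil r)" for s r
    by (rule W_measurable_Fil)
  have off: "has_bochner_integral M (\<lambda>\<omega>. (Z \<omega> * (W q \<omega> - W p \<omega>)) * (W s \<omega> - W r \<omega>)) 0"
    if "0 \<le> p" "p \<le> q" "q \<le> r" "r \<le> s" "c \<le> r" for p q r s
  proof (rule increment_orthogonal)
    show "integrable M (\<lambda>\<omega>. Z \<omega> * (W q \<omega> - W p \<omega>))"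
      by (rule integrable_bounded_increment[OF _ _ Z]) (use that in auto)
    have [measurable]: "Z \<in> borel_measurable (Fil r)" "W p \<in> borel_measurable (Fil r)" "W q \<in> borel_measurable (Fil r)"
      using measurable_Fil_mono[OF Z(1)] Wm that by auto
    show "(\<lambda>\<omega>. Z \<omega> * (W q \<omega> - W p \<omega>)) \<in> borel_measurable (Fil r)" by measurable
  qed (use that t in auto)
  have sq: "has_bochner_integral M (\<lambda>\<omega>. Z \<omega> * (W q \<omega> - W c \<omega>)\<^sup>2) ((q - c) * (\<integral>\<omega>. Z \<omega> \<partial>M))"
    if "c \<le> q" for q
    by (rule increment_variance[OF _ that Z(1) bnd]) (use t in auto)
  \<comment> \<open>disjoint intervals, overlapping intervals, and \<open>(c, d]\<close> inside \<open>(a, b]\<close>\<close>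
  consider "b \<le> c" | "c < b" "b \<le> d" | "c < b" "d < b" by linarith
  then show ?thesis
  proof cases
    case 1
    then show ?thesis using off[of a b c d] t by (simp add: mult.assoc)
  next
    case 2
    show ?thesis
      using has_bochner_integral_add[OF has_bochner_integral_add[OF off[of a c c d] sq[of b]] off[of c b b d]] 2 t
      by (simp add: algebra_simps power2_eq_square)
  next
    case 3
    show ?thesis
      using has_bochner_integral_add[OF has_bochner_integral_add[OF off[of a c c d] sq[of d]] off[of c d d b]] 3 t
      by (simp add: algebra_simps power2_eq_square)
  qed
qed

lemma step_covariance:
  fixes \<eta> \<theta> :: "'w \<Rightarrow> 'b::euclidean_space"
  assumes t: "0 \<le> a" "a \<le> b" "0 \<le> c" "c \<le> d"
    and \<eta>: "\<eta> \<in> borel_measurable (Fil a)" "\<And>\<omega>. \<omega> \<in> space M \<Longrightarrow> norm (\<eta> \<omega>) \<le> K"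
    and \<theta>: "\<theta> \<in> borel_measurable (Fil c)" "\<And>\<omega>. \<omega> \<in> space M \<Longrightarrow> norm (\<theta> \<omega>) \<le> L"
  shows "has_bochner_integral M (\<lambda>\<omega>. ((W b \<omega> - W a \<omega>) *\<^sub>R \<eta> \<omega>) \<bullet> ((W d \<omega> - W c \<omega>) *\<^sub>R \<theta> \<omega>))
           (max 0 (min b d - max a c) * (\<integral>\<omega>. \<eta> \<omega> \<bullet> \<theta> \<omega> \<partial>M))"
proof -
  define Z where "Z \<omega> = \<eta> \<omega> \<bullet> \<theta> \<omega>" for \<omega>
  have bnd: "\<bar>Z \<omega>\<bar> \<le> K * L" if "\<omega> \<in> space M" for \<omega>
  proof -
    have "\<bar>Z \<omega>\<bar> \<le> norm (\<eta> \<omega>) * norm (\<theta> \<omega>)" unfolding Z_def by (rule Cauchy_Schwarz_ineq2)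
    also have "\<dots> \<le> K * L" by (rule mult_mono') (use \<eta>(2) \<theta>(2) that in auto)
    finally show ?thesis .
  qed
  have Zm: "Z \<in> borel_measurable (Fil (max a c))"
    unfolding Z_def using measurable_Fil_mono[OF \<eta>(1), of "max a c"] measurable_Fil_mono[OF \<theta>(1), of "max a c"]
    by (intro borel_measurable_inner) auto
  show ?thesis
  proof (cases "a \<le> c")
    case True
    then show ?thesis
      using increment_covariance_ordered[of a b c d Z, OF _ _ _ _ _ bnd] t Zm
      by (simp add: Z_def max_absorb2 algebra_simps)
  next
    case False
    then show ?thesis
      using increment_covariance_ordered[of c d a b Z, OF _ _ _ _ _ bnd] t Zm
      by (simp add: Z_def max_absorb1 algebra_simps min.commute)
  qed
qed

end

section \<open>Elementary integrands\<close>

text \<open>A list of triples \<open>(a, b, \<eta>)\<close> stands for the step process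
  \<open>\<Sum> 1\<^bsub>(a, b]\<^esub>(s) \<eta>\<close>. The intervals may overlap and come in any order, so that sums of
  step processes are just concatenations. Process and integral are both instances of
  \<open>el_sum\<close>: the first with \<open>H x = 1\<^bsub>[s, \<infinity>)\<^esub>(x)\<close>, the second with \<open>H = W\<close>.\<close>

definition el_sum :: "(real \<Rightarrow> real) \<Rightarrow> (real \<times> real \<times> ('w \<Rightarrow> 'b::real_vector)) list \<Rightarrow> 'w \<Rightarrow> 'b" where
  "el_sum H xs \<omega> = (\<Sum>(a, b, \<eta>)\<leftarrow>xs. (H b - H a) *\<^sub>R \<eta> \<omega>)"

definition el_proc :: "(real \<times> real \<times> ('w \<Rightarrow> 'b::real_vector)) list \<Rightarrow> real \<Rightarrow> 'w \<Rightarrow> 'b" where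
  "el_proc xs s \<omega> = el_sum (\<lambda>x. of_bool (s \<le> x)) xs \<omega>"

definition el_int :: "(real \<Rightarrow> 'w \<Rightarrow> real) \<Rightarrow> (real \<times> real \<times> ('w \<Rightarrow> 'b::real_vector)) list \<Rightarrow> 'w \<Rightarrow> 'b" where
  "el_int W xs \<omega> = el_sum (\<lambda>t. W t \<omega>) xs \<omega>"

definition el_map :: "('b \<Rightarrow> 'c) \<Rightarrow> (real \<times> real \<times> ('w \<Rightarrow> 'b)) list \<Rightarrow> (real \<times> real \<times> ('w \<Rightarrow> 'c)) list" where
  "el_map L xs = map (\<lambda>(a, b, \<eta>). (a, b, \<lambda>\<omega>. L (\<eta> \<omega>))) xs"

text \<open>The steps cut off at time \<open>t\<close>. A step that starts after \<open>t\<close> becomes an empty step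
  with value \<open>0\<close> at \<open>t\<close> instead of being dropped: this keeps truncation a \<open>map\<close>, and
  \<open>0\<close> is measurable at every time.\<close>

definition el_trunc :: "real \<Rightarrow> (real \<times> real \<times> ('w \<Rightarrow> 'b::zero)) list \<Rightarrow> (real \<times> real \<times> ('w \<Rightarrow> 'b)) list" where
  "el_trunc t xs = map (\<lambda>(a, b, \<eta>). if a \<le> t then (a, min b t, \<eta>) else (t, t, \<lambda>_. 0)) xs"

definition mean_sq :: "'w measure \<Rightarrow> real \<Rightarrow> real \<Rightarrow> (real \<Rightarrow> 'w \<Rightarrow> 'b::real_normed_vector) \<Rightarrow> ennreal" where
  "mean_sq M a b f = (\<integral>\<^sup>+\<omega>. (\<integral>\<^sup>+s\<in>{a<..<b}. ennreal ((norm (f s \<omega>))\<^sup>2) \<partial>lborel) \<partial>M)"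

lemma el_sum_Nil [simp]: "el_sum H [] \<omega> = 0"
  by (simp add: el_sum_def)

lemma el_sum_Cons: "el_sum H ((a, b, \<eta>) # xs) \<omega> = (H b - H a) *\<^sub>R \<eta> \<omega> + el_sum H xs \<omega>"
  by (simp add: el_sum_def)

lemma el_sum_append: "el_sum H (xs @ ys) \<omega> = el_sum H xs \<omega> + el_sum H ys \<omega>"
  by (simp add: el_sum_def)

lemma el_proc_append: "el_proc (xs @ ys) s \<omega> = el_proc xs s \<omega> + el_proc ys s \<omega>"
  by (simp add: el_proc_def el_sum_append)

lemma el_int_append: "el_int W (xs @ ys) \<omega> = el_int W xs \<omega> + el_int W ys \<omega>"
  by (simp add: el_int_def el_sum_append)

lemma el_sum_map:
  assumes "linear L"
  shows "el_sum H (el_map L xs) \<omega> = L (el_sum H xs \<omega>)"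
  by (induction xs) (auto simp: el_map_def el_sum_def linear_0[OF assms] linear_add[OF assms] linear_scale[OF assms])

lemma el_proc_map: "linear L \<Longrightarrow> el_proc (el_map L xs) s \<omega> = L (el_proc xs s \<omega>)"
  by (simp add: el_proc_def el_sum_map)

lemma el_int_map: "linear L \<Longrightarrow> el_int W (el_map L xs) \<omega> = L (el_int W xs \<omega>)"
  by (simp add: el_int_def el_sum_map)

text \<open>For \<open>H = W\<close> this exhibits the integrals of the truncations as the path of the elementary integral as
  a function of its upper limit, and the path inherits the continuity of \<open>W\<close>.\<close>

lemma el_sum_trunc:
  assumes "\<forall>(a, b, \<eta>)\<in>set xs. a \<le> b"
  shows "el_sum H (el_trunc t xs) \<omega> = el_sum (\<lambda>x. H (min x t)) xs \<omega>"
  using assms by (induction xs) (auto simp: el_trunc_def el_sum_def min_def)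

lemma sum_list_inner:
  fixes f g :: "_ \<Rightarrow> 'b::real_inner"
  shows "(\<Sum>x\<leftarrow>xs. f x) \<bullet> (\<Sum>y\<leftarrow>ys. g y) = (\<Sum>x\<leftarrow>xs. \<Sum>y\<leftarrow>ys. f x \<bullet> g y)"
proof (induction xs)
  case (Cons x xs)
  have "f x \<bullet> (\<Sum>y\<leftarrow>ys. g y) = (\<Sum>y\<leftarrow>ys. f x \<bullet> g y)"
    by (induction ys) (auto simp: inner_add_right)
  with Cons show ?case by (simp add: inner_add_left)
qed simp

lemma has_bochner_integral_sum_list:
  assumes "\<And>x. x \<in> set xs \<Longrightarrow> has_bochner_integral N (f x) (c x)"
  shows "has_bochner_integral N (\<lambda>\<omega>. \<Sum>x\<leftarrow>xs. f x \<omega>) (\<Sum>x\<leftarrow>xs. c x)"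
  using assms by (induction xs) (auto intro!: has_bochner_integral_add)

lemma has_bochner_step_product:
  assumes "a \<le> b" "c \<le> d"
  shows "has_bochner_integral lborel
    (\<lambda>s. (of_bool (s \<le> b) - of_bool (s \<le> a)) * (of_bool (s \<le> d) - of_bool (s \<le> c)) :: real)
    (max 0 (min b d - max a c))"
proof -
  have "has_bochner_integral lborel (indicator {max a c<..max (max a c) (min b d)} :: real \<Rightarrow> real)
     (measure lborel {max a c<..max (max a c) (min b d)})"
    by (rule has_bochner_integral_real_indicator) auto
  moreover have "(indicator {max a c<..max (max a c) (min b d)} :: real \<Rightarrow> real) =
      (\<lambda>s. (of_bool (s \<le> b) - of_bool (s \<le> a)) * (of_bool (s \<le> d) - of_bool (s \<le> c)))"
    using assms by (auto simp: fun_eq_iff indicator_def)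
  ultimately show ?thesis by (simp add: max_def min_def split: if_splits)
qed

context brownian
begin

definition elem :: "real \<Rightarrow> real \<Rightarrow> (real \<times> real \<times> ('w \<Rightarrow> 'b::euclidean_space)) list \<Rightarrow> bool" where
  "elem lo hi xs \<longleftrightarrow> (\<forall>(a, b, \<eta>)\<in>set xs. lo \<le> a \<and> a \<le> b \<and> b \<le> hi \<and>
     \<eta> \<in> borel_measurable (Fil a) \<and> (\<exists>K. \<forall>\<omega>\<in>space M. norm (\<eta> \<omega>) \<le> K))"

lemma elem_Nil [simp]: "elem lo hi []" by (simp add: elem_def)

lemma elem_append [simp]: "elem lo hi (xs @ ys) \<longleftrightarrow> elem lo hi xs \<and> elem lo hi ys"
  unfolding elem_def set_append ball_Un ..

lemma elem_mono: "elem lo hi xs \<Longrightarrow> lo' \<le> lo \<Longrightarrow> hi \<le> hi' \<Longrightarrow> elem lo' hi' xs"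
  by (fastforce simp: elem_def)

lemma elem_map:
  fixes L :: "'b::euclidean_space \<Rightarrow> 'c::euclidean_space"
  assumes L: "bounded_linear L" and xs: "elem lo hi xs"
  shows "elem lo hi (el_map L xs)"
  unfolding elem_def el_map_def
proof (clarsimp, intro conjI)
  fix a b \<eta> assume "(a, b, \<eta>) \<in> set xs"
  then have x: "lo \<le> a" "a \<le> b" "b \<le> hi" "\<eta> \<in> borel_measurable (Fil a)" "\<exists>K. \<forall>\<omega>\<in>space M. norm (\<eta> \<omega>) \<le> K"
    using xs by (auto simp: elem_def)
  then show "lo \<le> a" "a \<le> b" "b \<le> hi" by auto
  have "L \<in> borel_measurable borel"
    by (intro borel_measurable_continuous_onI linear_continuous_on L)
  then show "(\<lambda>\<omega>. L (\<eta> \<omega>)) \<in> borel_measurable (Fil a)" using x(4) by measurable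
  obtain K where K: "\<And>\<omega>. \<omega> \<in> space M \<Longrightarrow> norm (\<eta> \<omega>) \<le> K" using x(5) by auto
  obtain C where C: "\<And>x. norm (L x) \<le> norm x * C" "C > 0" using bounded_linear.pos_bounded[OF L] by blast
  have "norm (L (\<eta> \<omega>)) \<le> K * C" if "\<omega> \<in> space M" for \<omega>
    using C(1)[of "\<eta> \<omega>"] mult_right_mono[OF K[OF that], of C] C(2) by linarith
  then show "\<exists>K. \<forall>\<omega>\<in>space M. norm (L (\<eta> \<omega>)) \<le> K" by blast
qed

lemma elem_trunc:
  assumes "elem lo hi xs" "lo \<le> t"
  shows "elem lo t (el_trunc t xs)"
  using assms unfolding elem_def el_trunc_def by (fastforce split: if_splits)

lemma elemD:
  assumes "elem lo hi xs" "(a, b, \<eta>) \<in> set xs"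
  obtains K where "lo \<le> a" "a \<le> b" "b \<le> hi" "\<eta> \<in> borel_measurable (Fil a)"
    "\<And>\<omega>. \<omega> \<in> space M \<Longrightarrow> norm (\<eta> \<omega>) \<le> K"
  using assms unfolding elem_def by blast

lemma elem_ordered: "elem lo hi xs \<Longrightarrow> \<forall>(a, b, \<eta>)\<in>set xs. a \<le> b"
  by (auto simp: elem_def)

lemma el_int_trunc:
  "elem lo hi xs \<Longrightarrow> el_int W (el_trunc t xs) \<omega> = el_sum (\<lambda>x. W (min x t) \<omega>) xs \<omega>"
  by (simp add: el_int_def el_sum_trunc elem_ordered)

lemma el_proc_trunc:
  assumes "elem lo hi xs"
  shows "el_proc (el_trunc t xs) s \<omega> = (if s \<le> t then el_proc xs s \<omega> else 0)"
  unfolding el_proc_def el_sum_trunc[OF elem_ordered[OF assms]]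
  using assms by (induction xs) (auto simp: el_sum_Cons elem_def)

lemma el_proc_outside:
  assumes "elem lo hi xs" "s \<le> lo \<or> hi < s"
  shows "el_proc xs s \<omega> = 0"
  using assms unfolding el_proc_def by (induction xs) (auto simp: el_sum_Cons elem_def)

lemma el_int_measurable:
  assumes "elem lo hi xs" "0 \<le> lo"
  shows "el_int W xs \<in> borel_measurable (Fil hi)"
  using assms
proof (induction xs)
  case (Cons x xs)
  obtain a b \<eta> where x: "x = (a, b, \<eta>)" by (cases x) auto
  have e: "elem lo hi xs" using Cons.prems by (simp add: elem_def)
  obtain K where K: "lo \<le> a" "a \<le> b" "b \<le> hi" "\<eta> \<in> borel_measurable (Fil a)"
    using elemD[OF Cons.prems(1), of a b \<eta>] x by auto
  have "(\<lambda>\<omega>. (W b \<omega> - W a \<omega>) *\<^sub>R \<eta> \<omega> + el_int W xs \<omega>) \<in> borel_measurable (Fil hi)"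
    using K Cons.IH[OF e] Cons.prems(2) W_measurable_Fil[of a hi] W_measurable_Fil[of b hi]
      measurable_Fil_mono[OF K(4), of hi]
    by (intro borel_measurable_add borel_measurable_scaleR borel_measurable_diff) auto
  then show ?case by (simp add: x el_int_def el_sum_Cons[abs_def])
qed (simp add: el_int_def[abs_def])

lemma el_int_measurable_M:
  "elem lo hi xs \<Longrightarrow> 0 \<le> lo \<Longrightarrow> el_int W xs \<in> borel_measurable M"
  by (rule measurable_FilD[OF el_int_measurable])

lemma el_proc_measurable:
  fixes xs :: "(real \<times> real \<times> ('w \<Rightarrow> 'b::euclidean_space)) list"
  assumes "elem lo hi xs"
  shows "(\<lambda>(s, \<omega>). el_proc xs s \<omega>) \<in> borel_measurable (borel \<Otimes>\<^sub>M M)"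
  using assms
proof (induction xs)
  case (Cons x xs)
  obtain a b \<eta> where x: "x = (a, b, \<eta>)" by (cases x) auto
  have e: "elem lo hi xs" using Cons.prems by (simp add: elem_def)
  obtain K where K: "\<eta> \<in> borel_measurable (Fil a)"
    using elemD[OF Cons.prems(1), of a b \<eta>] x by auto
  have [measurable]: "\<eta> \<in> borel_measurable M" by (rule measurable_FilD[OF K])
  have [measurable]: "(\<lambda>(s, \<omega>). el_proc xs s \<omega>) \<in> borel_measurable (borel \<Otimes>\<^sub>M M)"
    using Cons.IH[OF e] .
  have "(\<lambda>(s, \<omega>). (of_bool (s \<le> b) - of_bool (s \<le> a)) *\<^sub>R \<eta> \<omega> + el_proc xs s \<omega>)
      \<in> borel_measurable (borel \<Otimes>\<^sub>M M)"
    unfolding of_bool_def by measurable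
  then show ?case by (simp add: x el_proc_def el_sum_Cons[abs_def])
next
  case Nil
  show ?case unfolding el_proc_def el_sum_Nil by measurable
qed

subsection \<open>The isometry\<close>

text \<open>Expanding the squares turns the square of the integral and the time integral \<open>q\<close> of the square
  of the process into double sums over pairs of steps. They have the same mean \<open>V\<close> term by term, because
  the covariance of two steps is the length of their overlap times the mean of the product of the values.\<close>

lemma el_isometry_aux:
  fixes xs :: "(real \<times> real \<times> ('w \<Rightarrow> 'b::euclidean_space)) list"
  assumes xs: "elem lo hi xs" and lo: "0 \<le> lo"
  shows "\<exists>q V. has_bochner_integral M (\<lambda>\<omega>. (norm (el_int W xs \<omega>))\<^sup>2) V \<and>
    (\<forall>\<omega>. has_bochner_integral lborel (\<lambda>s. (norm (el_proc xs s \<omega>))\<^sup>2) (q \<omega>)) \<and>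
    has_bochner_integral M q V"
proof -
  define q where "q = (\<lambda>\<omega>. \<Sum>(a, b, \<eta>)\<leftarrow>xs. \<Sum>(c, d, \<theta>)\<leftarrow>xs. max 0 (min b d - max a c) * (\<eta> \<omega> \<bullet> \<theta> \<omega>))"
  define V where "V = (\<Sum>(a, b, \<eta>)\<leftarrow>xs. \<Sum>(c, d, \<theta>)\<leftarrow>xs. max 0 (min b d - max a c) * (\<integral>\<omega>. \<eta> \<omega> \<bullet> \<theta> \<omega> \<partial>M))"
  have pair: "has_bochner_integral M (\<lambda>\<omega>. ((W b \<omega> - W a \<omega>) *\<^sub>R \<eta> \<omega>) \<bullet> ((W d \<omega> - W c \<omega>) *\<^sub>R \<theta> \<omega>))
           (max 0 (min b d - max a c) * (\<integral>\<omega>. \<eta> \<omega> \<bullet> \<theta> \<omega> \<partial>M))"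
    "has_bochner_integral M (\<lambda>\<omega>. max 0 (min b d - max a c) * (\<eta> \<omega> \<bullet> \<theta> \<omega>))
           (max 0 (min b d - max a c) * (\<integral>\<omega>. \<eta> \<omega> \<bullet> \<theta> \<omega> \<partial>M))"
    "has_bochner_integral lborel (\<lambda>s. ((of_bool (s \<le> b) - of_bool (s \<le> a)) *\<^sub>R \<eta> \<omega>) \<bullet>
         ((of_bool (s \<le> d) - of_bool (s \<le> c)) *\<^sub>R \<theta> \<omega>)) (max 0 (min b d - max a c) * (\<eta> \<omega> \<bullet> \<theta> \<omega>))"
    if x: "(a, b, \<eta>) \<in> set xs" and y: "(c, d, \<theta>) \<in> set xs" for a b \<eta> c d \<theta> \<omega>
  proof -
    obtain K where K: "lo \<le> a" "a \<le> b" "b \<le> hi" "\<eta> \<in> borel_measurable (Fil a)"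
      "\<And>\<omega>. \<omega> \<in> space M \<Longrightarrow> norm (\<eta> \<omega>) \<le> K" by (rule elemD[OF xs x]) blast
    obtain L where L: "lo \<le> c" "c \<le> d" "d \<le> hi" "\<theta> \<in> borel_measurable (Fil c)"
      "\<And>\<omega>. \<omega> \<in> space M \<Longrightarrow> norm (\<theta> \<omega>) \<le> L" by (rule elemD[OF xs y]) blast
    show "has_bochner_integral M (\<lambda>\<omega>. ((W b \<omega> - W a \<omega>) *\<^sub>R \<eta> \<omega>) \<bullet> ((W d \<omega> - W c \<omega>) *\<^sub>R \<theta> \<omega>))
           (max 0 (min b d - max a c) * (\<integral>\<omega>. \<eta> \<omega> \<bullet> \<theta> \<omega> \<partial>M))"
      by (rule step_covariance[OF _ K(2) _ L(2) K(4,5) L(4,5)]) (use K(1) L(1) lo in auto)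
    have bnd: "\<bar>\<eta> \<omega> \<bullet> \<theta> \<omega>\<bar> \<le> K * L" if "\<omega> \<in> space M" for \<omega>
    proof -
      have "\<bar>\<eta> \<omega> \<bullet> \<theta> \<omega>\<bar> \<le> norm (\<eta> \<omega>) * norm (\<theta> \<omega>)" by (rule Cauchy_Schwarz_ineq2)
      also have "\<dots> \<le> K * L" by (rule mult_mono') (use K L that in auto)
      finally show ?thesis .
    qed
    have "integrable M (\<lambda>\<omega>. \<eta> \<omega> \<bullet> \<theta> \<omega>)"
      by (rule integrable_bounded[OF _ bnd]) (intro borel_measurable_inner measurable_FilD[OF K(4)] measurable_FilD[OF L(4)])
    then show "has_bochner_integral M (\<lambda>\<omega>. max 0 (min b d - max a c) * (\<eta> \<omega> \<bullet> \<theta> \<omega>))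
           (max 0 (min b d - max a c) * (\<integral>\<omega>. \<eta> \<omega> \<bullet> \<theta> \<omega> \<partial>M))"
      by (intro has_bochner_integral_mult_right has_bochner_integral_integrable)
    show "has_bochner_integral lborel (\<lambda>s. ((of_bool (s \<le> b) - of_bool (s \<le> a)) *\<^sub>R \<eta> \<omega>) \<bullet>
         ((of_bool (s \<le> d) - of_bool (s \<le> c)) *\<^sub>R \<theta> \<omega>)) (max 0 (min b d - max a c) * (\<eta> \<omega> \<bullet> \<theta> \<omega>))"
      using has_bochner_integral_mult_left[OF has_bochner_step_product[OF K(2) L(2)], where c="\<eta> \<omega> \<bullet> \<theta> \<omega>"]
      by (simp add: mult_ac)
  qed
  have eq: "(norm (el_sum H xs \<omega>))\<^sup>2 = (\<Sum>x\<leftarrow>xs. \<Sum>y\<leftarrow>xs. (case x of (a, b, \<eta>) \<Rightarrow> (H b - H a) *\<^sub>R \<eta> \<omega>)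
       \<bullet> (case y of (c, d, \<theta>) \<Rightarrow> (H d - H c) *\<^sub>R \<theta> \<omega>))" for H \<omega>
    unfolding power2_norm_eq_inner el_sum_def by (subst sum_list_inner) (simp add: case_prod_beta)
  have "has_bochner_integral M (\<lambda>\<omega>. (norm (el_int W xs \<omega>))\<^sup>2) V"
    unfolding el_int_def eq V_def case_prod_beta
    by (intro has_bochner_integral_sum_list) (use pair(1) in auto)
  moreover have "has_bochner_integral lborel (\<lambda>s. (norm (el_proc xs s \<omega>))\<^sup>2) (q \<omega>)" for \<omega>
    unfolding el_proc_def eq q_def case_prod_beta
    by (intro has_bochner_integral_sum_list) (use pair(3) in auto)
  moreover have "has_bochner_integral M q V"
    unfolding q_def V_def case_prod_beta
    by (intro has_bochner_integral_sum_list) (use pair(2) in auto)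
  ultimately show ?thesis by blast
qed

lemma el_int_square_integrable:
  assumes "elem lo hi xs" "0 \<le> lo"
  shows "integrable M (\<lambda>\<omega>. (norm (el_int W xs \<omega>))\<^sup>2)"
  using el_isometry_aux[OF assms] by (auto simp: has_bochner_integral_iff)

lemma el_isometry:
  fixes xs :: "(real \<times> real \<times> ('w \<Rightarrow> 'b::euclidean_space)) list"
  assumes xs: "elem lo hi xs" and lo: "0 \<le> lo"
  shows "(\<integral>\<^sup>+\<omega>. ennreal ((norm (el_int W xs \<omega>))\<^sup>2) \<partial>M) = mean_sq M lo hi (el_proc xs)"
proof -
  obtain q V where iso: "has_bochner_integral M (\<lambda>\<omega>. (norm (el_int W xs \<omega>))\<^sup>2) V"
    "\<And>\<omega>. has_bochner_integral lborel (\<lambda>s. (norm (el_proc xs s \<omega>))\<^sup>2) (q \<omega>)"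
    "has_bochner_integral M q V"
    using el_isometry_aux[OF assms] by blast
  have "(\<integral>\<^sup>+s\<in>{lo<..<hi}. ennreal ((norm (el_proc xs s \<omega>))\<^sup>2) \<partial>lborel) = ennreal (q \<omega>)" for \<omega>
  proof -
    have "(\<integral>\<^sup>+s\<in>{lo<..<hi}. ennreal ((norm (el_proc xs s \<omega>))\<^sup>2) \<partial>lborel)
        = (\<integral>\<^sup>+s. ennreal ((norm (el_proc xs s \<omega>))\<^sup>2) \<partial>lborel)"
    proof (rule nn_integral_cong_AE)
      show "AE s in lborel. ennreal ((norm (el_proc xs s \<omega>))\<^sup>2) * indicator {lo<..<hi} s = ennreal ((norm (el_proc xs s \<omega>))\<^sup>2)"
        using AE_lborel_singleton[of hi]
      proof eventually_elim
        case (elim s)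
        then show ?case using el_proc_outside[OF xs, of s \<omega>] by (cases "lo < s \<and> s < hi") auto
      qed
    qed
    also have "\<dots> = ennreal (q \<omega>)"
      using iso(2)[of \<omega>] by (subst nn_integral_eq_integral) (auto simp: has_bochner_integral_iff)
    finally show ?thesis .
  qed
  then have "mean_sq M lo hi (el_proc xs) = (\<integral>\<^sup>+\<omega>. ennreal (q \<omega>) \<partial>M)"
    by (simp add: mean_sq_def)
  also have "\<dots> = ennreal V"
  proof -
    have "0 \<le> q \<omega>" for \<omega>
      using iso(2)[of \<omega>] by (metis (no_types, lifting) Bochner_Integration.integral_nonneg has_bochner_integral_iff zero_le_power2)
    then show ?thesis
      using iso(3) by (subst nn_integral_eq_integral) (auto simp: has_bochner_integral_iff)
  qed
  also have "\<dots> = (\<integral>\<^sup>+\<omega>. ennreal ((norm (el_int W xs \<omega>))\<^sup>2) \<partial>M)"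
    using iso(1) by (subst nn_integral_eq_integral) (auto simp: has_bochner_integral_iff)
  finally show ?thesis by simp
qed

lemma el_isometry_diff:
  fixes xs ys :: "(real \<times> real \<times> ('w \<Rightarrow> 'b::euclidean_space)) list"
  assumes "elem lo hi xs" "elem lo hi ys" "0 \<le> lo"
  shows "(\<integral>\<^sup>+\<omega>. ennreal ((norm (el_int W xs \<omega> - el_int W ys \<omega>))\<^sup>2) \<partial>M)
    = mean_sq M lo hi (\<lambda>s \<omega>. el_proc xs s \<omega> - el_proc ys s \<omega>)"
proof -
  have l: "linear (uminus :: 'b \<Rightarrow> 'b)" "bounded_linear (uminus :: 'b \<Rightarrow> 'b)"
    by (auto intro!: bounded_linear_minus bounded_linear_ident bounded_linear.linear)
  show ?thesis
    using el_isometry[of lo hi "xs @ el_map uminus ys"] assms elem_map[OF l(2) assms(2)]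
    by (simp add: el_int_append el_proc_append[abs_def] el_int_map[OF l(1)] el_proc_map[OF l(1)])
qed

subsection \<open>Kolmogorov's inequality\<close>

text \<open>The integral is a martingale: what it gains after time \<open>t\<close> is a combination of increments
  of \<open>W\<close> after \<open>t\<close>, hence orthogonal to everything that is known at time \<open>t\<close>.\<close>

lemma el_int_orthogonal:
  fixes xs :: "(real \<times> real \<times> ('w \<Rightarrow> 'b::euclidean_space)) list"
  assumes xs: "elem lo hi xs" and lo: "0 \<le> lo" "lo \<le> t"
    and Z: "Z \<in> borel_measurable (Fil t)" "integrable M (\<lambda>\<omega>. (norm (Z \<omega>))\<^sup>2)"
  shows "has_bochner_integral M (\<lambda>\<omega>. Z \<omega> \<bullet> (el_int W xs \<omega> - el_int W (el_trunc t xs) \<omega>)) 0"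
proof -
  have eq: "el_int W xs \<omega> - el_int W (el_trunc t xs) \<omega> =
      (\<Sum>x\<leftarrow>xs. case x of (a, b, \<eta>) \<Rightarrow> (W (max b t) \<omega> - W (max a t) \<omega>) *\<^sub>R \<eta> \<omega>)" for \<omega>
    unfolding el_int_trunc[OF xs] unfolding el_int_def el_sum_def
  proof (induction xs)
    case (Cons x xs)
    obtain a b \<eta> where x: "x = (a, b, \<eta>)" by (cases x) auto
    have "W b \<omega> - W a \<omega> - (W (min b t) \<omega> - W (min a t) \<omega>) = W (max b t) \<omega> - W (max a t) \<omega>"
      by (auto simp: min_def max_def)
    then have "(W b \<omega> - W a \<omega>) *\<^sub>R \<eta> \<omega> - (W (min b t) \<omega> - W (min a t) \<omega>) *\<^sub>R \<eta> \<omega> = (W (max b t) \<omega> - W (max a t) \<omega>) *\<^sub>R \<eta> \<omega>"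
      by (metis scaleR_left_diff_distrib)
    with Cons show ?case by (simp add: x) (metis (no_types, lifting) add_diff_add)
  qed simp
  have "has_bochner_integral M (\<lambda>\<omega>. \<Sum>x\<leftarrow>xs. Z \<omega> \<bullet> (case x of (a, b, \<eta>) \<Rightarrow> (W (max b t) \<omega> - W (max a t) \<omega>) *\<^sub>R \<eta> \<omega>))
     (\<Sum>x\<leftarrow>xs. 0)"
  proof (rule has_bochner_integral_sum_list)
    fix x assume x: "x \<in> set xs"
    obtain a b \<eta> where xe: "x = (a, b, \<eta>)" by (cases x) auto
    obtain K where K: "lo \<le> a" "a \<le> b" "b \<le> hi" "\<eta> \<in> borel_measurable (Fil a)"
      "\<And>\<omega>. \<omega> \<in> space M \<Longrightarrow> norm (\<eta> \<omega>) \<le> K" by (rule elemD[OF xs, of a b \<eta>]) (use x xe in auto)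
    have m: "(\<lambda>\<omega>. Z \<omega> \<bullet> \<eta> \<omega>) \<in> borel_measurable (Fil (max a t))"
      by (intro borel_measurable_inner measurable_Fil_mono[OF Z(1)] measurable_Fil_mono[OF K(4)]) auto
    have i: "integrable M (\<lambda>\<omega>. Z \<omega> \<bullet> \<eta> \<omega>)"
    proof (rule Bochner_Integration.integrable_bound)
      show "integrable M (\<lambda>\<omega>. K * (1 + (norm (Z \<omega>))\<^sup>2))" using Z(2) by auto
      show "AE \<omega> in M. norm (Z \<omega> \<bullet> \<eta> \<omega>) \<le> norm (K * (1 + (norm (Z \<omega>))\<^sup>2))"
      proof (rule AE_I2)
        fix \<omega> assume w: "\<omega> \<in> space M"
        have n: "norm (Z \<omega>) \<le> 1 + (norm (Z \<omega>))\<^sup>2"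
        proof -
          have "0 \<le> (norm (Z \<omega>) - 1/2)\<^sup>2" by simp
          also have "\<dots> = (norm (Z \<omega>))\<^sup>2 - norm (Z \<omega>) + 1/4" by (simp add: power2_eq_square algebra_simps)
          finally show ?thesis by linarith
        qed
        have "norm (Z \<omega> \<bullet> \<eta> \<omega>) \<le> norm (Z \<omega>) * norm (\<eta> \<omega>)" by (simp add: Cauchy_Schwarz_ineq2)
        also have "\<dots> \<le> (1 + (norm (Z \<omega>))\<^sup>2) * K"
          by (rule mult_mono') (use n K(5)[OF w] in auto)
        finally show "norm (Z \<omega> \<bullet> \<eta> \<omega>) \<le> norm (K * (1 + (norm (Z \<omega>))\<^sup>2))" by (simp add: mult.commute)
      qed
    qed (rule measurable_FilD[OF m])
    have "has_bochner_integral M (\<lambda>\<omega>. (Z \<omega> \<bullet> \<eta> \<omega>) * (W (max b t) \<omega> - W (max a t) \<omega>)) 0"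
      by (rule increment_orthogonal[OF _ _ m i]) (use K lo in auto)
    then show "has_bochner_integral M (\<lambda>\<omega>. Z \<omega> \<bullet> (case x of (a, b, \<eta>) \<Rightarrow> (W (max b t) \<omega> - W (max a t) \<omega>) *\<^sub>R \<eta> \<omega>)) 0"
      by (simp add: xe mult.commute)
  qed
  moreover have "(\<Sum>x\<leftarrow>xs. 0) = (0::real)" by (induction xs) auto
  moreover have "v \<bullet> (\<Sum>x\<leftarrow>zs. g x) = (\<Sum>x\<leftarrow>zs. v \<bullet> g x)" for v :: 'b and g :: "real \<times> real \<times> ('w \<Rightarrow> 'b) \<Rightarrow> 'b" and zs
    by (induction zs) (auto simp: inner_add_right)
  ultimately show ?thesis unfolding eq by simp
qed

text \<open>Kolmogorov's argument. \<open>A i\<close> is the event that the bound \<open>e\<close> is exceeded for the first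
  time at \<open>q i\<close>. On \<open>A i\<close> the square of the final value has mean at least \<open>e\<^sup>2\<close> times the
  probability of \<open>A i\<close>, since the gain after \<open>q i\<close> is orthogonal to the value at \<open>q i\<close>. The events
  \<open>A i\<close> are disjoint, so these lower bounds add up.\<close>

lemma el_int_maximal_finite:
  fixes xs :: "(real \<times> real \<times> ('w \<Rightarrow> 'b::euclidean_space)) list"
  assumes xs: "elem lo hi xs" and lo: "0 \<le> lo" and e: "0 < e"
    and q: "\<And>i j. i \<le> j \<Longrightarrow> q i \<le> q j" "\<And>i. lo \<le> q i" "\<And>i. q i \<le> hi"
  shows "e\<^sup>2 * prob {\<omega> \<in> space M. \<exists>i\<le>n::nat. norm (el_int W (el_trunc (q i) xs) \<omega>) > e}
     \<le> (\<integral>\<omega>. (norm (el_int W xs \<omega>))\<^sup>2 \<partial>M)"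
proof -
  define D where "D i = el_int W (el_trunc (q i) xs)" for i
  define A where "A i = {\<omega> \<in> space M. norm (D i \<omega>) > e \<and> (\<forall>j<i. norm (D j \<omega>) \<le> e)}" for i
  have Dm: "D j \<in> borel_measurable (Fil (q i))" if "j \<le> i" for i j
    unfolding D_def
    by (rule measurable_Fil_mono[OF el_int_measurable[OF elem_trunc[OF xs]] ]) (use q that lo in auto)
  have AF: "A i \<in> sets (Fil (q i))" for i
  proof -
    have "A i = {\<omega> \<in> space (Fil (q i)). norm (D i \<omega>) > e} \<inter> {\<omega> \<in> space (Fil (q i)). \<forall>j\<in>{..<i}. norm (D j \<omega>) \<le> e}"
      by (auto simp: A_def)
    moreover have "{\<omega> \<in> space (Fil (q i)). norm (D i \<omega>) > e} \<in> sets (Fil (q i))"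
      using Dm[of i i] by measurable
    moreover have "{\<omega> \<in> space (Fil (q i)). \<forall>j\<in>{..<i}. norm (D j \<omega>) \<le> e} \<in> sets (Fil (q i))"
    proof (rule sets.sets_Collect_finite_All)
      fix j assume "j \<in> {..<i}"
      then have [measurable]: "D j \<in> borel_measurable (Fil (q i))" using Dm[of j i] by simp
      show "{\<omega> \<in> space (Fil (q i)). norm (D j \<omega>) \<le> e} \<in> sets (Fil (q i))" by measurable
    qed simp
    ultimately show ?thesis by auto
  qed
  have AM [measurable]: "A i \<in> sets M" for i using AF Fil_subset by blast
  have Ai: "integrable M (indicator (A i) :: 'w \<Rightarrow> real)" for i
    by (rule integrable_real_indicator) (auto simp: less_top[symmetric])
  have sq: "integrable M (\<lambda>\<omega>. (norm (el_int W xs \<omega>))\<^sup>2)" by (rule el_int_square_integrable[OF xs lo])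
  have sqi: "integrable M (\<lambda>\<omega>. (norm (D i \<omega>))\<^sup>2)" for i
    unfolding D_def by (rule el_int_square_integrable[OF elem_trunc[OF xs q(2)] lo])
  have step: "e\<^sup>2 * prob (A i) \<le> (\<integral>\<omega>. indicator (A i) \<omega> * (norm (el_int W xs \<omega>))\<^sup>2 \<partial>M)" for i
  proof -
    define Z where "Z \<omega> = indicator (A i) \<omega> *\<^sub>R D i \<omega>" for \<omega>
    have Zm: "Z \<in> borel_measurable (Fil (q i))"
      unfolding Z_def using AF[of i] Dm[of i i] by (intro borel_measurable_scaleR) auto
    have Zi: "integrable M (\<lambda>\<omega>. (norm (Z \<omega>))\<^sup>2)"
      by (rule Bochner_Integration.integrable_bound[OF sqi[of i]])
         (use borel_measurable_power[OF measurable_compose[OF measurable_FilD[OF Zm] borel_measurable_norm]] in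
           \<open>auto simp: Z_def[abs_def] indicator_def\<close>)
    have o: "has_bochner_integral M (\<lambda>\<omega>. Z \<omega> \<bullet> (el_int W xs \<omega> - D i \<omega>)) 0"
      unfolding D_def by (rule el_int_orthogonal[OF xs lo q(2) Zm Zi])
    have "e\<^sup>2 * prob (A i) = (\<integral>\<omega>. e\<^sup>2 * indicator (A i) \<omega> + 2 * (Z \<omega> \<bullet> (el_int W xs \<omega> - D i \<omega>)) \<partial>M)"
      using o Ai by (subst Bochner_Integration.integral_add) (auto simp: has_bochner_integral_iff)
    also have "\<dots> \<le> (\<integral>\<omega>. indicator (A i) \<omega> * (norm (el_int W xs \<omega>))\<^sup>2 \<partial>M)"
    proof (rule integral_mono)
      show "integrable M (\<lambda>\<omega>. e\<^sup>2 * indicator (A i) \<omega> + 2 * (Z \<omega> \<bullet> (el_int W xs \<omega> - D i \<omega>)))"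
        using o by (intro Bochner_Integration.integrable_add integrable_mult_right Ai) (auto simp: has_bochner_integral_iff)
      show "integrable M (\<lambda>\<omega>. indicator (A i) \<omega> * (norm (el_int W xs \<omega>))\<^sup>2)"
        using integrable_real_mult_indicator[OF AM sq, of i] by (simp add: mult.commute)
      fix \<omega> assume "\<omega> \<in> space M"
      have "e\<^sup>2 + 2 * (D i \<omega> \<bullet> (el_int W xs \<omega> - D i \<omega>)) \<le> (norm (el_int W xs \<omega>))\<^sup>2" if "\<omega> \<in> A i"
      proof -
        have "e\<^sup>2 \<le> (norm (D i \<omega>))\<^sup>2" using that e by (intro power_mono) (auto simp: A_def)
        moreover have "(norm (el_int W xs \<omega>))\<^sup>2 = (norm (D i \<omega>))\<^sup>2 + 2 * (D i \<omega> \<bullet> (el_int W xs \<omega> - D i \<omega>))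
           + (norm (el_int W xs \<omega> - D i \<omega>))\<^sup>2"
          unfolding power2_norm_eq_inner by (simp add: inner_diff inner_commute algebra_simps)
        ultimately show ?thesis by (smt (verit) zero_le_power2)
      qed
      then show "e\<^sup>2 * indicator (A i) \<omega> + 2 * (Z \<omega> \<bullet> (el_int W xs \<omega> - D i \<omega>)) \<le> indicator (A i) \<omega> * (norm (el_int W xs \<omega>))\<^sup>2"
        by (auto simp: Z_def indicator_def)
    qed
    finally show ?thesis .
  qed
  have disj: "disjoint_family_on A {..n}"
    unfolding disjoint_family_on_def
  proof (intro ballI impI)
    fix i j :: nat assume "i \<noteq> j"
    have *: "A i \<inter> A j = {}" if "i < j" for i j
      using that by (force simp: A_def)
    show "A i \<inter> A j = {}" using *[of i j] *[of j i] \<open>i \<noteq> j\<close> by (cases "i < j") auto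
  qed
  have U: "{\<omega> \<in> space M. \<exists>i\<le>n. norm (el_int W (el_trunc (q i) xs) \<omega>) > e} = (\<Union>i\<in>{..n}. A i)"
  proof (intro equalityI subsetI)
    fix \<omega> assume "\<omega> \<in> {\<omega> \<in> space M. \<exists>i\<le>n. norm (el_int W (el_trunc (q i) xs) \<omega>) > e}"
    then have w: "\<omega> \<in> space M" and ex: "\<exists>i. i \<le> n \<and> norm (D i \<omega>) > e" by (auto simp: D_def)
    define i where "i = (LEAST i. i \<le> n \<and> norm (D i \<omega>) > e)"
    have i: "i \<le> n \<and> norm (D i \<omega>) > e" unfolding i_def by (rule LeastI_ex[OF ex])
    have "norm (D j \<omega>) \<le> e" if "j < i" for j
      using not_less_Least[of j "\<lambda>i. i \<le> n \<and> norm (D i \<omega>) > e"] that i unfolding i_def[symmetric] by force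
    then show "\<omega> \<in> (\<Union>i\<in>{..n}. A i)" using w i by (auto simp: A_def)
  qed (auto simp: A_def D_def)
  have "e\<^sup>2 * prob {\<omega> \<in> space M. \<exists>i\<le>n. norm (el_int W (el_trunc (q i) xs) \<omega>) > e} = (\<Sum>i\<le>n. e\<^sup>2 * prob (A i))"
    unfolding U using disj by (subst finite_measure_finite_Union) (auto simp: sum_distrib_left)
  also have "\<dots> \<le> (\<Sum>i\<le>n. \<integral>\<omega>. indicator (A i) \<omega> * (norm (el_int W xs \<omega>))\<^sup>2 \<partial>M)"
    by (intro sum_mono step)
  also have "\<dots> = (\<integral>\<omega>. (\<Sum>i\<le>n. indicator (A i) \<omega> * (norm (el_int W xs \<omega>))\<^sup>2) \<partial>M)"
    using integrable_real_mult_indicator[OF AM sq]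
    by (subst Bochner_Integration.integral_sum) (auto simp: mult.commute)
  also have "\<dots> \<le> (\<integral>\<omega>. (norm (el_int W xs \<omega>))\<^sup>2 \<partial>M)"
  proof (rule integral_mono[OF _ sq])
    show "integrable M (\<lambda>\<omega>. \<Sum>i\<le>n. indicator (A i) \<omega> * (norm (el_int W xs \<omega>))\<^sup>2)"
      using integrable_real_mult_indicator[OF AM sq] by (intro Bochner_Integration.integrable_sum) (auto simp: mult.commute)
    fix \<omega>
    have "(\<Sum>i\<le>n. indicator (A i) \<omega> :: real) = indicator (\<Union>i\<in>{..n}. A i) \<omega>"
      by (rule indicator_UN_disjoint[symmetric]) (use disj in auto)
    also have "\<dots> \<le> 1" by (simp add: indicator_def)
    finally show "(\<Sum>i\<le>n. indicator (A i) \<omega> * (norm (el_int W xs \<omega>))\<^sup>2) \<le> (norm (el_int W xs \<omega>))\<^sup>2"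
      unfolding sum_distrib_right[symmetric] using mult_right_mono[OF _ zero_le_power2[of "norm (el_int W xs \<omega>)"]] by fastforce
  qed
  finally show ?thesis .
qed

end

section \<open>Jointly measurable processes and the mean square norm\<close>

definition jmeas :: "'w measure \<Rightarrow> real \<Rightarrow> real \<Rightarrow> (real \<Rightarrow> 'w \<Rightarrow> 'b::topological_space) \<Rightarrow> bool" where
  "jmeas M a b f \<longleftrightarrow> (\<lambda>(t, \<omega>). f t \<omega>) \<in> borel_measurable (restrict_space borel {a<..<b} \<Otimes>\<^sub>M M)"

text \<open>Connects joint measurability on a strip with functions on the whole product space.\<close>

lemma restrict_pair_eq:
  "S \<in> sets N \<Longrightarrow> sets (restrict_space N S \<Otimes>\<^sub>M M) = sets (restrict_space (N \<Otimes>\<^sub>M M) (S \<times> space M))"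
proof -
  assume S: "S \<in> sets N"
  have "restrict_space N S \<Otimes>\<^sub>M M = restrict_space N S \<Otimes>\<^sub>M M" ..
  have sub: "sets (restrict_space N S \<Otimes>\<^sub>M M) \<subseteq> sets (restrict_space (N \<Otimes>\<^sub>M M) (S \<times> space M))"
    unfolding sets_pair_measure[of "restrict_space N S" M]
  proof (rule sets.sigma_sets_subset'[of _ "restrict_space (N \<Otimes>\<^sub>M M) (S \<times> space M)", unfolded space_restrict_space])
    show "{A \<times> B |A B. A \<in> sets (restrict_space N S) \<and> B \<in> sets M} \<subseteq> sets (restrict_space (N \<Otimes>\<^sub>M M) (S \<times> space M))"
      using S sets.sets_into_space[OF S] by (fastforce simp: sets_restrict_space_iff dest: sets.sets_into_space)
    show "space (restrict_space N S) \<times> space M \<in> sets (restrict_space (N \<Otimes>\<^sub>M M) (S \<times> space M))"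
      using S sets.sets_into_space[OF S] by (auto simp: sets_restrict_space_iff space_restrict_space space_pair_measure Int_absorb2)
  qed
  have "A \<inter> (S \<times> space M) \<in> sets (restrict_space N S \<Otimes>\<^sub>M M)" if "A \<in> sets (N \<Otimes>\<^sub>M M)" for A
  proof -
    have "(\<lambda>x. x) \<in> restrict_space N S \<Otimes>\<^sub>M M \<rightarrow>\<^sub>M N \<Otimes>\<^sub>M M"
    proof -
      have "(\<lambda>x. (fst x, snd x)) \<in> restrict_space N S \<Otimes>\<^sub>M M \<rightarrow>\<^sub>M N \<Otimes>\<^sub>M M"
        by (intro measurable_Pair measurable_compose[OF measurable_fst] measurable_snd measurable_restrict_space1 measurable_ident_sets refl)
      then show ?thesis by simp
    qed
    from measurable_sets[OF this that] show ?thesis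
      using S sets.sets_into_space[OF S] by (simp add: space_pair_measure space_restrict_space Int_absorb2)
  qed
  then have "sets (restrict_space (N \<Otimes>\<^sub>M M) (S \<times> space M)) \<subseteq> sets (restrict_space N S \<Otimes>\<^sub>M M)"
    by (auto simp: sets_restrict_space Int_commute)
  with sub show ?thesis by blast
qed

lemma jmeas_iff:
  fixes f :: "real \<Rightarrow> 'w \<Rightarrow> 'b::real_normed_vector"
  shows "jmeas M a b f \<longleftrightarrow> (\<lambda>(t, \<omega>). indicator {a<..<b} t *\<^sub>R f t \<omega>) \<in> borel_measurable (borel \<Otimes>\<^sub>M M)"
proof -
  have "jmeas M a b f \<longleftrightarrow> (\<lambda>(t, \<omega>). f t \<omega>) \<in> borel_measurable (restrict_space (borel \<Otimes>\<^sub>M M) ({a<..<b} \<times> space M))"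
    unfolding jmeas_def by (intro arg_cong2[where f="(\<in>)"] refl measurable_cong_sets restrict_pair_eq) auto
  also have "\<dots> \<longleftrightarrow> (\<lambda>x. indicator ({a<..<b} \<times> space M) x *\<^sub>R (\<lambda>(t, \<omega>). f t \<omega>) x) \<in> borel_measurable (borel \<Otimes>\<^sub>M M)"
    by (rule borel_measurable_restrict_space_iff) (simp add: space_pair_measure Sigma_Int_distrib1 sets.Int_space_eq2)
  also have "\<dots> \<longleftrightarrow> (\<lambda>(t, \<omega>). indicator {a<..<b} t *\<^sub>R f t \<omega>) \<in> borel_measurable (borel \<Otimes>\<^sub>M M)"
    by (rule measurable_cong) (auto simp: space_pair_measure indicator_def)
  finally show ?thesis .
qed

lemma jmeas_cong:
  "(\<And>t \<omega>. a < t \<Longrightarrow> t < b \<Longrightarrow> \<omega> \<in> space M \<Longrightarrow> f t \<omega> = g t \<omega>) \<Longrightarrow> jmeas M a b f \<longleftrightarrow> jmeas M a b g"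
  unfolding jmeas_def by (rule measurable_cong) (auto simp: space_pair_measure space_restrict_space)

lemma jmeas_subinterval:
  fixes f :: "real \<Rightarrow> 'w \<Rightarrow> 'b::euclidean_space"
  assumes "jmeas M a b f" "a \<le> a'" "b' \<le> b"
  shows "jmeas M a' b' f"
proof -
  have [measurable]: "(\<lambda>(t, \<omega>). indicator {a<..<b} t *\<^sub>R f t \<omega>) \<in> borel_measurable (borel \<Otimes>\<^sub>M M)"
    using assms by (simp add: jmeas_iff)
  have "(\<lambda>x. indicator {a'<..<b'} (fst x) *\<^sub>R (\<lambda>(t, \<omega>). indicator {a<..<b} t *\<^sub>R f t \<omega>) x) \<in> borel_measurable (borel \<Otimes>\<^sub>M M)"
    by measurable
  also have "(\<lambda>x. indicator {a'<..<b'} (fst x) *\<^sub>R (\<lambda>(t, \<omega>). indicator {a<..<b} t *\<^sub>R f t \<omega>) x)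
      = (\<lambda>(t, \<omega>). indicator {a'<..<b'} t *\<^sub>R f t \<omega>)"
    using assms(2,3) by (auto simp: fun_eq_iff indicator_def)
  finally show ?thesis by (simp add: jmeas_iff)
qed

lemma jmeas_compose:
  assumes "jmeas M a b f" "g \<in> borel_measurable borel"
  shows "jmeas M a b (\<lambda>t \<omega>. g (f t \<omega>))"
  using measurable_compose[OF assms[unfolded jmeas_def]] by (simp add: jmeas_def case_prod_beta')

lemma jmeas_add:
  fixes f g :: "real \<Rightarrow> 'w \<Rightarrow> 'b::euclidean_space"
  assumes "jmeas M a b f" "jmeas M a b g"
  shows "jmeas M a b (\<lambda>t \<omega>. f t \<omega> + g t \<omega>)"
  using borel_measurable_add[OF assms[unfolded jmeas_def]] by (simp add: jmeas_def case_prod_beta')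

lemma jmeas_diff:
  fixes f g :: "real \<Rightarrow> 'w \<Rightarrow> 'b::euclidean_space"
  assumes "jmeas M a b f" "jmeas M a b g"
  shows "jmeas M a b (\<lambda>t \<omega>. f t \<omega> - g t \<omega>)"
  using borel_measurable_diff[OF assms[unfolded jmeas_def]] by (simp add: jmeas_def case_prod_beta')

lemma jmeas_det:
  assumes "g \<in> borel_measurable (restrict_space borel {a<..<b})"
  shows "jmeas M a b (\<lambda>t \<omega>. g t)"
  using measurable_compose[OF measurable_fst assms] by (simp add: jmeas_def case_prod_beta')

lemma jmeas_section:
  fixes f :: "real \<Rightarrow> 'w \<Rightarrow> 'b::real_normed_vector"
  assumes "jmeas M a b f" "\<omega> \<in> space M"
  shows "(\<lambda>t. indicator {a<..<b} t *\<^sub>R f t \<omega>) \<in> borel_measurable borel"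
proof -
  have "(\<lambda>t. (\<lambda>(t, \<omega>). indicator {a<..<b} t *\<^sub>R f t \<omega>) (t, \<omega>)) \<in> borel_measurable borel"
    by (rule measurable_compose[OF measurable_Pair2'[OF assms(2)]]) (use assms in \<open>simp add: jmeas_iff\<close>)
  then show ?thesis by simp
qed

lemma jmeas_section_set:
  fixes f :: "real \<Rightarrow> 'w \<Rightarrow> 'b::real_normed_vector"
  assumes "jmeas M a b f" "\<omega> \<in> space M"
  shows "set_borel_measurable lborel {a<..<b} (\<lambda>t. f t \<omega>)"
  using jmeas_section[OF assms] by (simp add: set_borel_measurable_def)

text \<open>All estimates in mean square reduce to a pointwise estimate of this form.\<close>

lemma ennreal_sq_bound:
  assumes "norm z \<le> A * norm x + B * norm y"
  shows "ennreal ((norm z)\<^sup>2) \<le> ennreal (2 * A\<^sup>2) * ennreal ((norm x)\<^sup>2) + ennreal (2 * B\<^sup>2) * ennreal ((norm y)\<^sup>2)"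
proof -
  have "(norm z)\<^sup>2 \<le> (A * norm x + B * norm y)\<^sup>2" by (intro power_mono assms) auto
  also have "\<dots> \<le> 2 * A\<^sup>2 * (norm x)\<^sup>2 + 2 * B\<^sup>2 * (norm y)\<^sup>2"
    using zero_le_power2[of "A * norm x - B * norm y"] by (simp add: power2_eq_square algebra_simps)
  finally have "ennreal ((norm z)\<^sup>2) \<le> ennreal (2 * A\<^sup>2 * (norm x)\<^sup>2 + 2 * B\<^sup>2 * (norm y)\<^sup>2)"
    by (rule ennreal_leI)
  also have "\<dots> = ennreal (2 * A\<^sup>2) * ennreal ((norm x)\<^sup>2) + ennreal (2 * B\<^sup>2) * ennreal ((norm y)\<^sup>2)"
    by (simp only: ennreal_plus ennreal_mult zero_le_power2 mult_nonneg_nonneg zero_le_numeral)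
  finally show ?thesis .
qed

context prob_space
begin

lemma jmeas_nn_integral:
  fixes f :: "real \<Rightarrow> 'a \<Rightarrow> 'b::real_normed_vector"
  assumes "jmeas M a b f" "h \<in> borel_measurable borel"
  shows "(\<lambda>\<omega>. \<integral>\<^sup>+s\<in>{a<..<b}. h (f s \<omega>) \<partial>lborel) \<in> borel_measurable M"
proof -
  have [measurable]: "(\<lambda>(t, \<omega>). indicator {a<..<b} t *\<^sub>R f t \<omega>) \<in> borel_measurable (borel \<Otimes>\<^sub>M M)"
    using assms by (simp add: jmeas_iff)
  note assms(2)[measurable]
  have [measurable]: "(\<lambda>(\<omega>, t). indicator {a<..<b} t *\<^sub>R f t \<omega>) \<in> borel_measurable (M \<Otimes>\<^sub>M lborel)"
    by (subst measurable_pair_swap_iff) (simp add: case_prod_beta' measurable_cong_sets[OF sets_pair_measure_cong[OF sets_lborel refl] refl])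
  have "(\<lambda>(\<omega>, s). h (indicator {a<..<b} s *\<^sub>R f s \<omega>) * indicator {a<..<b} s :: ennreal) \<in> borel_measurable (M \<Otimes>\<^sub>M lborel)"
    by measurable
  then have "(\<lambda>\<omega>. \<integral>\<^sup>+s. h (indicator {a<..<b} s *\<^sub>R f s \<omega>) * indicator {a<..<b} s \<partial>lborel) \<in> borel_measurable M"
    by (rule lborel.borel_measurable_nn_integral)
  also have "(\<lambda>\<omega>. \<integral>\<^sup>+s. h (indicator {a<..<b} s *\<^sub>R f s \<omega>) * indicator {a<..<b} s \<partial>lborel)
     = (\<lambda>\<omega>. \<integral>\<^sup>+s\<in>{a<..<b}. h (f s \<omega>) \<partial>lborel)"
    by (intro ext nn_integral_cong) (auto simp: indicator_def)
  finally show ?thesis .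
qed

lemma mean_sq_inner_measurable:
  fixes f :: "real \<Rightarrow> 'a \<Rightarrow> 'b::real_normed_vector"
  assumes "jmeas M a b f"
  shows "(\<lambda>\<omega>. \<integral>\<^sup>+s\<in>{a<..<b}. ennreal ((norm (f s \<omega>))\<^sup>2) \<partial>lborel) \<in> borel_measurable M"
  by (rule jmeas_nn_integral[OF assms]) measurable

lemma jmeas_inner_measurable:
  fixes f :: "real \<Rightarrow> 'a \<Rightarrow> 'b::real_normed_vector"
  assumes "jmeas M a b f" "\<omega> \<in> space M"
  shows "(\<lambda>s. ennreal ((norm (f s \<omega>))\<^sup>2) * indicator {a<..<b} s) \<in> borel_measurable lborel"
proof -
  note jmeas_section[OF assms, measurable]
  have "(\<lambda>s. ennreal ((norm (indicator {a<..<b} s *\<^sub>R f s \<omega>))\<^sup>2)) \<in> borel_measurable lborel" by measurable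
  also have "(\<lambda>s. ennreal ((norm (indicator {a<..<b} s *\<^sub>R f s \<omega>))\<^sup>2)) = (\<lambda>s. ennreal ((norm (f s \<omega>))\<^sup>2) * indicator {a<..<b} s)"
    by (auto simp: indicator_def)
  finally show ?thesis .
qed

lemma mean_sq_bound:
  fixes G :: "real \<Rightarrow> 'a \<Rightarrow> 'b::real_normed_vector" and H :: "real \<Rightarrow> 'a \<Rightarrow> 'c::real_normed_vector"
    and F :: "real \<Rightarrow> 'a \<Rightarrow> 'd::real_normed_vector"
  assumes le: "AE s in lborel. s \<in> {a<..<b} \<longrightarrow> (\<forall>\<omega>\<in>space M. norm (F s \<omega>) \<le> A * norm (G s \<omega>) + B * norm (H s \<omega>))"
    and jm: "jmeas M a b G" "jmeas M a b H"
  shows "mean_sq M a b F \<le> ennreal (2 * A\<^sup>2) * mean_sq M a b G + ennreal (2 * B\<^sup>2) * mean_sq M a b H"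
proof -
  let ?g = "\<lambda>\<omega> s. ennreal ((norm (G s \<omega>))\<^sup>2) * indicator {a<..<b} s"
  let ?h = "\<lambda>\<omega> s. ennreal ((norm (H s \<omega>))\<^sup>2) * indicator {a<..<b} s"
  have "mean_sq M a b F \<le> (\<integral>\<^sup>+\<omega>. (\<integral>\<^sup>+s. ennreal (2 * A\<^sup>2) * ?g \<omega> s + ennreal (2 * B\<^sup>2) * ?h \<omega> s \<partial>lborel) \<partial>M)"
    unfolding mean_sq_def
  proof (rule nn_integral_mono, rule nn_integral_mono_AE)
    fix \<omega> assume w: "\<omega> \<in> space M"
    show "AE s in lborel. ennreal ((norm (F s \<omega>))\<^sup>2) * indicator {a<..<b} s \<le> ennreal (2 * A\<^sup>2) * ?g \<omega> s + ennreal (2 * B\<^sup>2) * ?h \<omega> s"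
      using le
    proof eventually_elim
      case (elim s)
      show ?case
      proof (cases "s \<in> {a<..<b}")
        case True
        then have n: "norm (F s \<omega>) \<le> A * norm (G s \<omega>) + B * norm (H s \<omega>)" using elim w by auto
        from ennreal_sq_bound[OF n] show ?thesis using True by simp
      qed simp
    qed
  qed
  also have "\<dots> = (\<integral>\<^sup>+\<omega>. ennreal (2 * A\<^sup>2) * (\<integral>\<^sup>+s. ?g \<omega> s \<partial>lborel) + ennreal (2 * B\<^sup>2) * (\<integral>\<^sup>+s. ?h \<omega> s \<partial>lborel) \<partial>M)"
    using jmeas_inner_measurable[OF jm(1)] jmeas_inner_measurable[OF jm(2)]
    by (intro nn_integral_cong) (simp add: nn_integral_add nn_integral_cmult)
  also have "\<dots> = ennreal (2 * A\<^sup>2) * mean_sq M a b G + ennreal (2 * B\<^sup>2) * mean_sq M a b H"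
    unfolding mean_sq_def using mean_sq_inner_measurable[OF jm(1)] mean_sq_inner_measurable[OF jm(2)]
    by (simp add: nn_integral_add nn_integral_cmult)
  finally show ?thesis .
qed

lemma mean_sq_add:
  fixes f g :: "real \<Rightarrow> 'a \<Rightarrow> 'b::real_normed_vector"
  assumes "jmeas M a b f" "jmeas M a b g"
  shows "mean_sq M a b (\<lambda>s \<omega>. f s \<omega> + g s \<omega>) \<le> 2 * mean_sq M a b f + 2 * mean_sq M a b g"
  using mean_sq_bound[of a b "\<lambda>s \<omega>. f s \<omega> + g s \<omega>" 1 f 1 g] assms by (simp add: norm_triangle_ineq)

lemma mean_sq_minus: "mean_sq M a b (\<lambda>s \<omega>. f s \<omega> - g s \<omega>) = mean_sq M a b (\<lambda>s \<omega>. g s \<omega> - f s \<omega>)"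
  by (simp add: mean_sq_def norm_minus_commute)

lemma mean_sq_diff:
  fixes f g h :: "real \<Rightarrow> 'a \<Rightarrow> 'b::euclidean_space"
  assumes "jmeas M a b f" "jmeas M a b g" "jmeas M a b h"
  shows "mean_sq M a b (\<lambda>s \<omega>. f s \<omega> - g s \<omega>)
     \<le> 2 * mean_sq M a b (\<lambda>s \<omega>. f s \<omega> - h s \<omega>) + 2 * mean_sq M a b (\<lambda>s \<omega>. g s \<omega> - h s \<omega>)"
  using mean_sq_add[OF jmeas_diff[OF assms(1,3)] jmeas_diff[OF assms(3,2)]] mean_sq_minus[of a b g h]
  by simp

lemma mean_sq_mono_interval:
  assumes "a \<le> a'" "b' \<le> b"
  shows "mean_sq M a' b' f \<le> mean_sq M a b f"
  unfolding mean_sq_def using assms by (intro nn_integral_mono) (auto simp: indicator_def)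

lemma AE_swap:
  fixes Q :: "real \<Rightarrow> 'a \<Rightarrow> bool"
  assumes [measurable]: "(\<lambda>(t, \<omega>). Q t \<omega>) \<in> measurable (borel \<Otimes>\<^sub>M M) (count_space UNIV)"
  shows "(AE t in lborel. AE \<omega> in M. Q t \<omega>) \<longleftrightarrow> (AE \<omega> in M. AE t in lborel. Q t \<omega>)"
proof -
  interpret P: pair_sigma_finite lborel M by unfold_locales
  have s: "sets (borel \<Otimes>\<^sub>M M) = sets (lborel \<Otimes>\<^sub>M M)" by (intro sets_pair_measure_cong) auto
  have "{x\<in>space (lborel \<Otimes>\<^sub>M M). Q (fst x) (snd x)} \<in> sets (lborel \<Otimes>\<^sub>M M)"
    unfolding s[symmetric] sets_eq_imp_space_eq[OF s, symmetric] by measurable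
  then show ?thesis by (rule P.AE_commute)
qed

text \<open>Both sides say that the pairs \<open>(t, \<omega>)\<close> at which the processes differ form a null set.\<close>

lemma jmeas_AE_swap:
  fixes f g :: "real \<Rightarrow> 'a \<Rightarrow> 'b::euclidean_space"
  assumes f: "jmeas M a b f" and g: "jmeas M a b g"
  shows "(AE t in lborel. t \<in> {a<..<b} \<longrightarrow> (AE \<omega> in M. f t \<omega> = g t \<omega>))
    \<longleftrightarrow> (AE \<omega> in M. AE t in lborel. t \<in> {a<..<b} \<longrightarrow> f t \<omega> = g t \<omega>)"
proof -
  have [measurable]: "(\<lambda>(t, \<omega>). indicator {a<..<b} t *\<^sub>R f t \<omega>) \<in> borel_measurable (borel \<Otimes>\<^sub>M M)"
      "(\<lambda>(t, \<omega>). indicator {a<..<b} t *\<^sub>R g t \<omega>) \<in> borel_measurable (borel \<Otimes>\<^sub>M M)"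
    using assms by (simp_all add: jmeas_iff)
  have "(\<lambda>(t, \<omega>). indicator {a<..<b} t *\<^sub>R f t \<omega> = indicator {a<..<b} t *\<^sub>R g t \<omega>)
      \<in> measurable (borel \<Otimes>\<^sub>M M) (count_space UNIV)" by measurable
  also have "(\<lambda>(t, \<omega>). indicator {a<..<b} t *\<^sub>R f t \<omega> = indicator {a<..<b} t *\<^sub>R g t \<omega>)
     = (\<lambda>(t, \<omega>). t \<in> {a<..<b} \<longrightarrow> f t \<omega> = g t \<omega>)"
    by (auto simp: fun_eq_iff indicator_def)
  finally have "(AE t in lborel. AE \<omega> in M. t \<in> {a<..<b} \<longrightarrow> f t \<omega> = g t \<omega>)
    \<longleftrightarrow> (AE \<omega> in M. AE t in lborel. t \<in> {a<..<b} \<longrightarrow> f t \<omega> = g t \<omega>)"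
    by (rule AE_swap)
  moreover have "(AE \<omega> in M. t \<in> {a<..<b} \<longrightarrow> f t \<omega> = g t \<omega>) \<longleftrightarrow> (t \<in> {a<..<b} \<longrightarrow> (AE \<omega> in M. f t \<omega> = g t \<omega>))" for t
    by (cases "t \<in> {a<..<b}") simp_all
  ultimately show ?thesis by simp
qed

lemma mean_sq_cong_AE:
  fixes f g :: "real \<Rightarrow> 'a \<Rightarrow> 'b::euclidean_space"
  assumes "AE \<omega> in M. AE t in lborel. t \<in> {a<..<b} \<longrightarrow> f t \<omega> = g t \<omega>"
  shows "mean_sq M a b f = mean_sq M a b g"
  unfolding mean_sq_def
proof (rule nn_integral_cong_AE)
  show "AE \<omega> in M. (\<integral>\<^sup>+s\<in>{a<..<b}. ennreal ((norm (f s \<omega>))\<^sup>2) \<partial>lborel) = (\<integral>\<^sup>+s\<in>{a<..<b}. ennreal ((norm (g s \<omega>))\<^sup>2) \<partial>lborel)"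
    using assms by eventually_elim (rule nn_integral_cong_AE, erule eventually_mono, auto simp: indicator_def)
qed

end

lemma L2F_iff: "f \<in> L2F M W a b \<longleftrightarrow> jmeas M a b f \<and>
    (\<forall>t\<in>{a<..<b}. f t \<in> borel_measurable (bm_filtration M W t)) \<and> mean_sq M a b f < \<infinity>"
  by (simp add: L2F_def adapted_processes_def jmeas_def mean_sq_def)

lemma tendsto_zero_two_sum:
  fixes u v :: "nat \<Rightarrow> ennreal"
  assumes "u \<longlonglongrightarrow> 0" "v \<longlonglongrightarrow> 0" "c < \<infinity>" "d < \<infinity>"
  shows "(\<lambda>j. c * u j + d * v j) \<longlonglongrightarrow> 0"
proof -
  have "(\<lambda>j. c * u j + d * v j) \<longlonglongrightarrow> c * 0 + d * 0"
    by (intro tendsto_add ennreal_tendsto_cmult assms) (use assms in auto)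
  then show ?thesis by simp
qed

lemma tendsto_zero_le:
  fixes u v :: "nat \<Rightarrow> ennreal"
  assumes "\<And>j. u j \<le> v j" "v \<longlonglongrightarrow> 0"
  shows "u \<longlonglongrightarrow> 0"
  by (rule tendsto_sandwich[OF _ _ tendsto_const assms(2)]) (use assms in auto)

context brownian
begin

lemma el_proc_jmeas: "elem lo hi xs \<Longrightarrow> jmeas M a b (el_proc xs)"
proof -
  assume "elem lo hi xs"
  note el_proc_measurable[OF this, measurable]
  show ?thesis unfolding jmeas_iff by measurable
qed

lemma L2F_subinterval:
  fixes f :: "real \<Rightarrow> 'w \<Rightarrow> 'b::euclidean_space"
  assumes "f \<in> L2F M W a b" "a \<le> a'" "b' \<le> b"
  shows "f \<in> L2F M W a' b'"
  using assms jmeas_subinterval[of M a b f a' b'] mean_sq_mono_interval[of a a' b' b f]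
  by (auto simp: L2F_iff intro: le_less_trans)

lemma L2F_add:
  fixes f g :: "real \<Rightarrow> 'w \<Rightarrow> 'b::euclidean_space"
  assumes "f \<in> L2F M W a b" "g \<in> L2F M W a b"
  shows "(\<lambda>t \<omega>. f t \<omega> + g t \<omega>) \<in> L2F M W a b"
  using assms jmeas_add[of M a b f g] le_less_trans[OF mean_sq_add[of a b f g]]
  by (auto simp: L2F_iff ennreal_mult_less_top intro!: borel_measurable_add)

lemma L2F_linear:
  fixes f :: "real \<Rightarrow> 'w \<Rightarrow> 'b::euclidean_space" and L :: "'b \<Rightarrow> 'c::euclidean_space"
  assumes f: "f \<in> L2F M W a b" and L: "bounded_linear L"
  shows "(\<lambda>t \<omega>. L (f t \<omega>)) \<in> L2F M W a b"
proof -
  have Lm: "L \<in> borel_measurable borel"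
    by (intro borel_measurable_continuous_onI linear_continuous_on L)
  obtain C where C: "\<And>x. norm (L x) \<le> norm x * C" "C > 0" using bounded_linear.pos_bounded[OF L] by blast
  have jm: "jmeas M a b f" using f by (simp add: L2F_iff)
  have "mean_sq M a b (\<lambda>t \<omega>. L (f t \<omega>)) \<le> ennreal (2 * C\<^sup>2) * mean_sq M a b f + ennreal (2 * 0\<^sup>2) * mean_sq M a b f"
    by (rule mean_sq_bound[OF _ jm jm]) (use C(1) in \<open>simp add: mult.commute\<close>)
  also have "\<dots> < \<infinity>" using f by (auto simp: L2F_iff ennreal_mult_less_top)
  finally have "mean_sq M a b (\<lambda>t \<omega>. L (f t \<omega>)) < \<infinity>" .
  moreover have "(\<lambda>\<omega>. L (f t \<omega>)) \<in> borel_measurable (Fil t)" if "t \<in> {a<..<b}" for t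
    by (rule measurable_compose[OF _ Lm]) (use f that in \<open>auto simp: L2F_iff\<close>)
  ultimately show ?thesis using f jmeas_compose[OF _ Lm, of M a b f] by (auto simp: L2F_iff)
qed

end

section \<open>The Ito integral\<close>

context brownian
begin

subsection \<open>Elementary integrands as simple processes\<close>

text \<open>The endpoints of all steps form a common partition. On a cell of it, the values of
  the steps that contain the cell add up. The sum over the cells that make up one step
  telescopes.\<close>

lemma el_normal_form:
  fixes xs :: "(real \<times> real \<times> ('w \<Rightarrow> 'b::euclidean_space)) list"
  assumes xs: "elem a b xs" and ab: "a < b"
  shows "\<exists>k p \<eta>. simple_data M W a b k p \<eta> \<and>
     (\<forall>s \<omega>. simple_process k p \<eta> s \<omega> = el_proc xs s \<omega>) \<and> (\<forall>\<omega>. simple_ito W k p \<eta> \<omega> = el_int W xs \<omega>)"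
proof -
  define S where "S = {a, b} \<union> (\<Union>(c, d, \<theta>)\<in>set xs. {c, d})"
  have S: "finite S" "a \<in> S" "b \<in> S" "\<And>x. x \<in> S \<Longrightarrow> a \<le> x \<and> x \<le> b"
    using xs ab unfolding S_def by (auto simp: elem_def)
  define L where "L = sorted_list_of_set S"
  have L: "set L = S" "sorted_wrt (<) L" "length L = card S"
    using S(1) by (auto simp: L_def)
  define k where "k = card S - 1"
  define p where "p i = L ! i" for i
  have cS: "card S = Suc k" using S by (simp add: k_def card_gt_0_iff) (metis Suc_pred card_gt_0_iff empty_iff)
  have p_strict: "p i < p j" if "i < j" "j \<le> k" for i j
    using sorted_wrt_nth_less[OF L(2), of i j] that cS L(3) by (simp add: p_def)
  have p_less_iff: "p i < p j \<longleftrightarrow> i < j" if "i \<le> k" "j \<le> k" for i j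
    using p_strict[of i j] p_strict[of j i] that by (metis less_asym linorder_neqE_nat order_less_irrefl)
  have p_le_iff: "p i \<le> p j \<longleftrightarrow> i \<le> j" if "i \<le> k" "j \<le> k" for i j
    using p_less_iff[OF that(2,1)] by (metis linorder_not_less)
  have pS: "p i \<in> S" if "i \<le> k" for i using that L(1,3) cS by (metis p_def le_imp_less_Suc nth_mem)
  have surj: "\<exists>i\<le>k. p i = x" if "x \<in> S" for x
    using that L(1,3) cS by (metis in_set_conv_nth p_def less_Suc_eq_le)
  have p0: "p 0 = a"
  proof -
    obtain i where i: "i \<le> k" "p i = a" using surj[OF S(2)] by blast
    then have "p 0 \<le> a" using p_le_iff[of 0 i] by simp
    then show ?thesis using S(4)[OF pS[of 0]] by simp
  qed
  have pk: "p k = b"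
  proof -
    obtain i where i: "i \<le> k" "p i = b" using surj[OF S(3)] by blast
    then have "b \<le> p k" using p_le_iff[of i k] by simp
    then show ?thesis using S(4)[OF pS[of k]] by simp
  qed
  define \<eta> where "\<eta> i \<omega> = (\<Sum>(c, d, \<theta>)\<leftarrow>xs. if c \<le> p i \<and> p (Suc i) \<le> d then \<theta> \<omega> else 0)" for i \<omega>
  have sum_eq: "(\<Sum>i<k. (H (p (Suc i)) - H (p i)) *\<^sub>R \<eta> i \<omega>) = el_sum H xs \<omega>" for H :: "real \<Rightarrow> real" and \<omega>
  proof -
    have "(\<Sum>i<k. (H (p (Suc i)) - H (p i)) *\<^sub>R \<eta> i \<omega>) =
       (\<Sum>(c, d, \<theta>)\<leftarrow>xs. \<Sum>i<k. if c \<le> p i \<and> p (Suc i) \<le> d then (H (p (Suc i)) - H (p i)) *\<^sub>R \<theta> \<omega> else 0)"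
      unfolding \<eta>_def
      by (induction xs) (auto simp: scaleR_add_right sum.distrib intro!: arg_cong2[where f="(+)"] sum.cong)
    also have "\<dots> = (\<Sum>(c, d, \<theta>)\<leftarrow>xs. (H d - H c) *\<^sub>R \<theta> \<omega>)"
    proof (intro arg_cong[where f=sum_list] map_cong refl, clarify)
      fix c d \<theta> assume x: "(c, d, \<theta>) \<in> set xs"
      then have "c \<in> S" "d \<in> S" "c \<le> d" using xs by (force simp: S_def elem_def)+
      then obtain i0 i1 where i: "i0 \<le> k" "p i0 = c" "i1 \<le> k" "p i1 = d" using surj by meson
      then have le: "i0 \<le> i1" using \<open>c \<le> d\<close> p_le_iff by auto
      have "(\<Sum>i<k. if c \<le> p i \<and> p (Suc i) \<le> d then (H (p (Suc i)) - H (p i)) *\<^sub>R \<theta> \<omega> else 0)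
         = (\<Sum>i\<in>{i0..<i1}. (H (p (Suc i)) - H (p i)) *\<^sub>R \<theta> \<omega>)"
      proof -
        have "i < k \<Longrightarrow> (c \<le> p i \<and> p (Suc i) \<le> d) \<longleftrightarrow> i \<in> {i0..<i1}" for i
          using p_le_iff[of i0 i] p_le_iff[of "Suc i" i1] i by auto
        then have "(\<Sum>i<k. if c \<le> p i \<and> p (Suc i) \<le> d then (H (p (Suc i)) - H (p i)) *\<^sub>R \<theta> \<omega> else 0)
         = (\<Sum>i<k. if i \<in> {i0..<i1} then (H (p (Suc i)) - H (p i)) *\<^sub>R \<theta> \<omega> else 0)"
          by (intro sum.cong) auto
        also have "\<dots> = (\<Sum>i\<in>{..<k} \<inter> {i0..<i1}. (H (p (Suc i)) - H (p i)) *\<^sub>R \<theta> \<omega>)"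
          by (simp only: sum.inter_restrict finite_lessThan)
        also have "{..<k} \<inter> {i0..<i1} = {i0..<i1}" using i by auto
        finally show ?thesis .
      qed
      also have "\<dots> = (H d - H c) *\<^sub>R \<theta> \<omega>"
        using sum_Suc_diff'[OF le, of "\<lambda>i. H (p i)"] i by (simp add: scaleR_left.sum[symmetric])
      finally show "(\<Sum>i<k. if c \<le> p i \<and> p (Suc i) \<le> d then (H (p (Suc i)) - H (p i)) *\<^sub>R \<theta> \<omega> else 0)
        = (H d - H c) *\<^sub>R \<theta> \<omega>" .
    qed
    finally show ?thesis by (simp add: el_sum_def)
  qed
  have \<eta>_prop: "\<eta> i \<in> borel_measurable (Fil (p i)) \<and> (\<exists>K. \<forall>\<omega>\<in>space M. norm (\<eta> i \<omega>) \<le> K)" for i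
    unfolding \<eta>_def using xs
  proof (induction xs)
    case (Cons x xs)
    obtain c d \<theta> where x: "x = (c, d, \<theta>)" by (cases x) auto
    have e: "elem a b xs" using Cons.prems by (simp add: elem_def)
    obtain K where K: "\<theta> \<in> borel_measurable (Fil c)" "\<And>\<omega>. \<omega> \<in> space M \<Longrightarrow> norm (\<theta> \<omega>) \<le> K"
      by (rule elemD[OF Cons.prems, of c d \<theta>]) (auto simp: x)
    obtain K' where K': "\<And>\<omega>. \<omega> \<in> space M \<Longrightarrow> norm (\<Sum>(c, d, \<theta>)\<leftarrow>xs. if c \<le> p i \<and> p (Suc i) \<le> d then \<theta> \<omega> else 0) \<le> K'"
      using Cons.IH[OF e] by blast
    define \<theta>' where "\<theta>' \<omega> = (if c \<le> p i \<and> p (Suc i) \<le> d then \<theta> \<omega> else 0)" for \<omega>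
    have \<theta>'m: "\<theta>' \<in> borel_measurable (Fil (p i))"
      using measurable_Fil_mono[OF K(1), of "p i"] by (cases "c \<le> p i") (simp_all add: \<theta>'_def[abs_def])
    have bd: "norm (\<theta>' \<omega>) \<le> \<bar>K\<bar>" if "\<omega> \<in> space M" for \<omega>
      using K(2)[OF that] by (auto simp: \<theta>'_def)
    have eq: "(\<Sum>(c, d, \<theta>)\<leftarrow>x # xs. if c \<le> p i \<and> p (Suc i) \<le> d then \<theta> \<omega> else 0) =
      \<theta>' \<omega> + (\<Sum>(c, d, \<theta>)\<leftarrow>xs. if c \<le> p i \<and> p (Suc i) \<le> d then \<theta> \<omega> else 0)" for \<omega>
      by (simp add: x \<theta>'_def)
    have "(\<lambda>\<omega>. \<theta>' \<omega> + (\<Sum>(c, d, \<theta>)\<leftarrow>xs. if c \<le> p i \<and> p (Suc i) \<le> d then \<theta> \<omega> else 0)) \<in> borel_measurable (Fil (p i))"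
      using \<theta>'m Cons.IH[OF e] by (intro borel_measurable_add) auto
    moreover have "\<forall>\<omega>\<in>space M. norm (\<theta>' \<omega> + (\<Sum>(c, d, \<theta>)\<leftarrow>xs. if c \<le> p i \<and> p (Suc i) \<le> d then \<theta> \<omega> else 0)) \<le> \<bar>K\<bar> + K'"
      using bd K' by (auto intro!: norm_triangle_le add_mono)
    ultimately show ?case unfolding eq by blast
  qed (auto intro: exI[of _ 0])
  have "simple_data M W a b k p \<eta>"
    unfolding simple_data_def using p0 pk \<eta>_prop p_strict by simp
  moreover have "simple_process k p \<eta> s \<omega> = el_proc xs s \<omega>" for s \<omega>
  proof -
    have "indicator {p i<..p (Suc i)} s = (of_bool (s \<le> p (Suc i)) - of_bool (s \<le> p i) :: real)" if "i < k" for i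
      using p_strict[of i "Suc i"] that by (auto simp: indicator_def)
    then show ?thesis
      unfolding simple_process_def el_proc_def sum_eq[symmetric] by (intro sum.cong) auto
  qed
  moreover have "simple_ito W k p \<eta> \<omega> = el_int W xs \<omega>" for \<omega>
    unfolding simple_ito_def el_int_def sum_eq[symmetric] ..
  ultimately show ?thesis by blast
qed

lemma simple_data_elem:
  fixes \<eta> :: "nat \<Rightarrow> 'w \<Rightarrow> 'b::euclidean_space"
  assumes "simple_data M W a b k p \<eta>"
  shows "\<exists>xs. elem a b xs \<and> (\<forall>s \<omega>. simple_process k p \<eta> s \<omega> = el_proc xs s \<omega>) \<and> (\<forall>\<omega>. simple_ito W k p \<eta> \<omega> = el_int W xs \<omega>)"
proof -
  define xs where "xs = map (\<lambda>i. (p i, p (Suc i), \<eta> i)) [0..<k]"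
  have d: "p 0 = a" "p k = b" "\<And>i. i < k \<Longrightarrow> p i < p (Suc i)"
    "\<And>i. i < k \<Longrightarrow> \<eta> i \<in> borel_measurable (Fil (p i))" "\<And>i. i < k \<Longrightarrow> \<exists>K. \<forall>\<omega>\<in>space M. norm (\<eta> i \<omega>) \<le> K"
    using assms by (auto simp: simple_data_def)
  have mono: "p i \<le> p j" if "i \<le> j" "j \<le> k" for i j
    using that
  proof (induction j)
    case (Suc j)
    then show ?case using d(3)[of j] by (auto simp: le_Suc_eq)
  qed simp
  have "elem a b xs"
    unfolding elem_def xs_def using d mono[of 0] mono[of _ k] by (auto intro: less_imp_le)
  moreover have el: "el_sum H xs \<omega> = (\<Sum>i<k. (H (p (Suc i)) - H (p i)) *\<^sub>R \<eta> i \<omega>)" for H \<omega>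
    by (simp add: el_sum_def xs_def comp_def sum_list_distinct_conv_sum_set atLeast0LessThan)
  moreover have "simple_process k p \<eta> s \<omega> = el_proc xs s \<omega>" for s \<omega>
  proof -
    have "indicator {p i<..p (Suc i)} s = (of_bool (s \<le> p (Suc i)) - of_bool (s \<le> p i) :: real)" if "i < k" for i
      using d(3)[OF that] by (auto simp: indicator_def)
    then show ?thesis
      unfolding simple_process_def el_proc_def el by (intro sum.cong) auto
  qed
  ultimately show ?thesis by (auto simp: simple_ito_def el_int_def)
qed

definition approximates :: "real \<Rightarrow> real \<Rightarrow> (nat \<Rightarrow> (real \<times> real \<times> ('w \<Rightarrow> 'b::euclidean_space)) list) \<Rightarrow> (real \<Rightarrow> 'w \<Rightarrow> 'b) \<Rightarrow> bool" where
  "approximates a b xs f \<longleftrightarrow> (\<forall>j. elem a b (xs j)) \<and>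
     (\<lambda>j. mean_sq M a b (\<lambda>s \<omega>. el_proc (xs j) s \<omega> - f s \<omega>)) \<longlonglongrightarrow> 0"

text \<open>Working with elementary integrands instead of simple processes on a partition makes sums and
  truncations of approximations available without common refinements.\<close>

lemma has_ito_iff:
  fixes f :: "real \<Rightarrow> 'w \<Rightarrow> 'b::euclidean_space"
  assumes ab: "a < b"
  shows "has_ito_integral M W a b f I \<longleftrightarrow> f \<in> L2F M W a b \<and> I \<in> borel_measurable M \<and>
    (\<exists>xs. approximates a b xs f \<and> (\<lambda>j. \<integral>\<^sup>+\<omega>. ennreal ((norm (el_int W (xs j) \<omega> - I \<omega>))\<^sup>2) \<partial>M) \<longlonglongrightarrow> 0)"
  (is "?L \<longleftrightarrow> ?R")
proof
  assume ?L
  then obtain k p \<eta> where d: "f \<in> L2F M W a b" "I \<in> borel_measurable M" "\<And>j. simple_data M W a b (k j) (p j) (\<eta> j)"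
    "(\<lambda>j. mean_sq M a b (\<lambda>s \<omega>. simple_process (k j) (p j) (\<eta> j) s \<omega> - f s \<omega>)) \<longlonglongrightarrow> 0"
    "(\<lambda>j. \<integral>\<^sup>+\<omega>. ennreal ((norm (simple_ito W (k j) (p j) (\<eta> j) \<omega> - I \<omega>))\<^sup>2) \<partial>M) \<longlonglongrightarrow> 0"
    unfolding has_ito_integral_def mean_sq_def by blast
  obtain xs where xs: "\<And>j. elem a b (xs j)" "\<And>j s \<omega>. simple_process (k j) (p j) (\<eta> j) s \<omega> = el_proc (xs j) s \<omega>"
    "\<And>j \<omega>. simple_ito W (k j) (p j) (\<eta> j) \<omega> = el_int W (xs j) \<omega>"
    using simple_data_elem[OF d(3)] by metis
  show ?R using d xs(1) unfolding xs(2,3) approximates_def by blast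
next
  assume ?R
  then obtain xs where d: "f \<in> L2F M W a b" "I \<in> borel_measurable M" "\<And>j. elem a b (xs j)"
    "(\<lambda>j. mean_sq M a b (\<lambda>s \<omega>. el_proc (xs j) s \<omega> - f s \<omega>)) \<longlonglongrightarrow> 0"
    "(\<lambda>j. \<integral>\<^sup>+\<omega>. ennreal ((norm (el_int W (xs j) \<omega> - I \<omega>))\<^sup>2) \<partial>M) \<longlonglongrightarrow> 0"
    unfolding approximates_def by blast
  obtain k p \<eta> where "\<And>j. simple_data M W a b (k j) (p j) (\<eta> j)"
    and xs: "\<And>j s \<omega>. simple_process (k j) (p j) (\<eta> j) s \<omega> = el_proc (xs j) s \<omega>"
    "\<And>j \<omega>. simple_ito W (k j) (p j) (\<eta> j) \<omega> = el_int W (xs j) \<omega>"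
    using el_normal_form[OF d(3) ab] by metis
  then show ?L
    using d unfolding has_ito_integral_def mean_sq_def xs[symmetric] by blast
qed

subsection \<open>Uniqueness, linearity and limits\<close>

lemma approximates_Cauchy:
  fixes f :: "real \<Rightarrow> 'w \<Rightarrow> 'b::euclidean_space"
  assumes "elem a b xs" "elem a b ys" "0 \<le> a" "jmeas M a b f"
  shows "(\<integral>\<^sup>+\<omega>. ennreal ((norm (el_int W xs \<omega> - el_int W ys \<omega>))\<^sup>2) \<partial>M)
    \<le> 2 * mean_sq M a b (\<lambda>s \<omega>. el_proc xs s \<omega> - f s \<omega>) + 2 * mean_sq M a b (\<lambda>s \<omega>. el_proc ys s \<omega> - f s \<omega>)"
  unfolding el_isometry_diff[OF assms(1,2,3)]
  by (intro mean_sq_diff el_proc_jmeas[OF assms(1)] el_proc_jmeas[OF assms(2)] assms(4))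

lemma second_moment_bound:
  fixes f :: "'w \<Rightarrow> 'b::euclidean_space" and g :: "'w \<Rightarrow> 'c::euclidean_space"
    and h :: "'w \<Rightarrow> 'd::real_normed_vector"
  assumes le: "\<And>\<omega>. norm (h \<omega>) \<le> A * norm (f \<omega>) + B * norm (g \<omega>)"
    and [measurable]: "f \<in> borel_measurable M" "g \<in> borel_measurable M"
  shows "(\<integral>\<^sup>+\<omega>. ennreal ((norm (h \<omega>))\<^sup>2) \<partial>M) \<le>
    ennreal (2 * A\<^sup>2) * (\<integral>\<^sup>+\<omega>. ennreal ((norm (f \<omega>))\<^sup>2) \<partial>M) + ennreal (2 * B\<^sup>2) * (\<integral>\<^sup>+\<omega>. ennreal ((norm (g \<omega>))\<^sup>2) \<partial>M)"
proof -
  have "(\<integral>\<^sup>+\<omega>. ennreal ((norm (h \<omega>))\<^sup>2) \<partial>M) \<le>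
    (\<integral>\<^sup>+\<omega>. ennreal (2 * A\<^sup>2) * ennreal ((norm (f \<omega>))\<^sup>2) + ennreal (2 * B\<^sup>2) * ennreal ((norm (g \<omega>))\<^sup>2) \<partial>M)"
    by (intro nn_integral_mono ennreal_sq_bound le)
  also have "\<dots> = ennreal (2 * A\<^sup>2) * (\<integral>\<^sup>+\<omega>. ennreal ((norm (f \<omega>))\<^sup>2) \<partial>M)
      + ennreal (2 * B\<^sup>2) * (\<integral>\<^sup>+\<omega>. ennreal ((norm (g \<omega>))\<^sup>2) \<partial>M)"
    by (simp add: nn_integral_add nn_integral_cmult)
  finally show ?thesis .
qed

lemma second_moment_diff_le:
  fixes f g h :: "'w \<Rightarrow> 'b::euclidean_space"
  assumes [measurable]: "f \<in> borel_measurable M" "g \<in> borel_measurable M" "h \<in> borel_measurable M"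
  shows "(\<integral>\<^sup>+\<omega>. ennreal ((norm (f \<omega> - g \<omega>))\<^sup>2) \<partial>M) \<le>
    2 * (\<integral>\<^sup>+\<omega>. ennreal ((norm (f \<omega> - h \<omega>))\<^sup>2) \<partial>M) + 2 * (\<integral>\<^sup>+\<omega>. ennreal ((norm (h \<omega> - g \<omega>))\<^sup>2) \<partial>M)"
proof -
  have "norm (f \<omega> - g \<omega>) \<le> 1 * norm (f \<omega> - h \<omega>) + 1 * norm (h \<omega> - g \<omega>)" for \<omega>
    using norm_triangle_ineq[of "f \<omega> - h \<omega>" "h \<omega> - g \<omega>"] by simp
  from second_moment_bound[OF this] show ?thesis by simp
qed

lemma second_moment_commute: "(\<integral>\<^sup>+\<omega>. ennreal ((norm (f \<omega> - g \<omega>))\<^sup>2) \<partial>M) = (\<integral>\<^sup>+\<omega>. ennreal ((norm (g \<omega> - f \<omega> :: 'b::real_normed_vector))\<^sup>2) \<partial>M)"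
  by (simp add: norm_minus_commute)

text \<open>By the isometry the elementary integrals of two approximations of \<open>f\<close> come close to each
  other in mean square, and so do their limits \<open>I\<close> and \<open>J\<close>.\<close>

lemma has_ito_unique:
  fixes f :: "real \<Rightarrow> 'w \<Rightarrow> 'b::euclidean_space"
  assumes ab: "0 \<le> a" "a < b" and I: "has_ito_integral M W a b f I" and J: "has_ito_integral M W a b f J"
  shows "AE \<omega> in M. I \<omega> = J \<omega>"
proof -
  obtain xs where x: "approximates a b xs f" "I \<in> borel_measurable M" "f \<in> L2F M W a b"
      "(\<lambda>j. \<integral>\<^sup>+\<omega>. ennreal ((norm (el_int W (xs j) \<omega> - I \<omega>))\<^sup>2) \<partial>M) \<longlonglongrightarrow> 0"
    using I unfolding has_ito_iff[OF ab(2)] by blast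
  obtain ys where y: "approximates a b ys f" "J \<in> borel_measurable M"
      "(\<lambda>j. \<integral>\<^sup>+\<omega>. ennreal ((norm (el_int W (ys j) \<omega> - J \<omega>))\<^sup>2) \<partial>M) \<longlonglongrightarrow> 0"
    using J unfolding has_ito_iff[OF ab(2)] by blast
  have el: "elem a b (xs j)" "elem a b (ys j)" for j using x(1) y(1) by (auto simp: approximates_def)
  note m = el_int_measurable_M[OF el(1) ab(1)] el_int_measurable_M[OF el(2) ab(1)]
  let ?d = "\<lambda>f g. \<integral>\<^sup>+\<omega>. ennreal ((norm (f \<omega> - g \<omega> :: 'b))\<^sup>2) \<partial>M"
  have "?d I J \<le> 2 * ?d (el_int W (xs j)) I + 2 * (2 * (2 * mean_sq M a b (\<lambda>s \<omega>. el_proc (xs j) s \<omega> - f s \<omega>) +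
     2 * mean_sq M a b (\<lambda>s \<omega>. el_proc (ys j) s \<omega> - f s \<omega>)) + 2 * ?d (el_int W (ys j)) J)" for j
  proof -
    have "?d I J \<le> 2 * ?d I (el_int W (xs j)) + 2 * ?d (el_int W (xs j)) J"
      by (intro second_moment_diff_le x y m)
    also have "\<dots> \<le> 2 * ?d I (el_int W (xs j)) + 2 * (2 * ?d (el_int W (xs j)) (el_int W (ys j)) + 2 * ?d (el_int W (ys j)) J)"
      by (intro add_left_mono mult_left_mono second_moment_diff_le x y m) auto
    also have "\<dots> \<le> 2 * ?d I (el_int W (xs j)) + 2 * (2 * (2 * mean_sq M a b (\<lambda>s \<omega>. el_proc (xs j) s \<omega> - f s \<omega>) +
     2 * mean_sq M a b (\<lambda>s \<omega>. el_proc (ys j) s \<omega> - f s \<omega>)) + 2 * ?d (el_int W (ys j)) J)"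
      using x(3) by (intro add_left_mono mult_left_mono add_right_mono approximates_Cauchy el ab) (auto simp: L2F_iff)
    finally show ?thesis by (simp add: second_moment_commute[of I])
  qed
  moreover have "(\<lambda>j. 2 * ?d (el_int W (xs j)) I + 2 * (2 * (2 * mean_sq M a b (\<lambda>s \<omega>. el_proc (xs j) s \<omega> - f s \<omega>) +
     2 * mean_sq M a b (\<lambda>s \<omega>. el_proc (ys j) s \<omega> - f s \<omega>)) + 2 * ?d (el_int W (ys j)) J)) \<longlonglongrightarrow> 0"
    using x y by (intro tendsto_zero_two_sum) (auto simp: approximates_def)
  ultimately have "?d I J \<le> 0"
    by (intro LIMSEQ_le_const) auto
  then have "AE \<omega> in M. ennreal ((norm (I \<omega> - J \<omega>))\<^sup>2) = 0"
    using x(2) y(2) by (subst nn_integral_0_iff_AE[symmetric]) auto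
  then show ?thesis by eventually_elim auto
qed

lemma has_ito_add:
  fixes f :: "real \<Rightarrow> 'w \<Rightarrow> 'b::euclidean_space"
  assumes ab: "0 \<le> a" "a < b" and I: "has_ito_integral M W a b f I" and J: "has_ito_integral M W a b g J"
  shows "has_ito_integral M W a b (\<lambda>s \<omega>. f s \<omega> + g s \<omega>) (\<lambda>\<omega>. I \<omega> + J \<omega>)"
proof -
  obtain xs where x: "approximates a b xs f" "I \<in> borel_measurable M" "f \<in> L2F M W a b"
      "(\<lambda>j. \<integral>\<^sup>+\<omega>. ennreal ((norm (el_int W (xs j) \<omega> - I \<omega>))\<^sup>2) \<partial>M) \<longlonglongrightarrow> 0"
    using I unfolding has_ito_iff[OF ab(2)] by blast
  obtain ys where y: "approximates a b ys g" "J \<in> borel_measurable M" "g \<in> L2F M W a b"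
      "(\<lambda>j. \<integral>\<^sup>+\<omega>. ennreal ((norm (el_int W (ys j) \<omega> - J \<omega>))\<^sup>2) \<partial>M) \<longlonglongrightarrow> 0"
    using J unfolding has_ito_iff[OF ab(2)] by blast
  have el: "elem a b (xs j)" "elem a b (ys j)" for j using x(1) y(1) by (auto simp: approximates_def)
  note m = el_int_measurable_M[OF el(1) ab(1)] el_int_measurable_M[OF el(2) ab(1)]
  have jm: "jmeas M a b f" "jmeas M a b g" using x y by (auto simp: L2F_iff)
  have "approximates a b (\<lambda>j. xs j @ ys j) (\<lambda>s \<omega>. f s \<omega> + g s \<omega>)"
    unfolding approximates_def
  proof (intro conjI allI)
    show "elem a b (xs j @ ys j)" for j using el by simp
    show "(\<lambda>j. mean_sq M a b (\<lambda>s \<omega>. el_proc (xs j @ ys j) s \<omega> - (f s \<omega> + g s \<omega>))) \<longlonglongrightarrow> 0"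
    proof (rule tendsto_zero_le)
      fix j
      have "mean_sq M a b (\<lambda>s \<omega>. (el_proc (xs j) s \<omega> - f s \<omega>) + (el_proc (ys j) s \<omega> - g s \<omega>))
         \<le> 2 * mean_sq M a b (\<lambda>s \<omega>. el_proc (xs j) s \<omega> - f s \<omega>) + 2 * mean_sq M a b (\<lambda>s \<omega>. el_proc (ys j) s \<omega> - g s \<omega>)"
        by (intro mean_sq_add jmeas_diff el_proc_jmeas[OF el(1)] el_proc_jmeas[OF el(2)] jm)
      then show "mean_sq M a b (\<lambda>s \<omega>. el_proc (xs j @ ys j) s \<omega> - (f s \<omega> + g s \<omega>))
         \<le> 2 * mean_sq M a b (\<lambda>s \<omega>. el_proc (xs j) s \<omega> - f s \<omega>) + 2 * mean_sq M a b (\<lambda>s \<omega>. el_proc (ys j) s \<omega> - g s \<omega>)"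
        by (simp add: el_proc_append algebra_simps)
    qed (use x y in \<open>auto intro!: tendsto_zero_two_sum simp: approximates_def\<close>)
  qed
  moreover have "(\<lambda>j. \<integral>\<^sup>+\<omega>. ennreal ((norm (el_int W (xs j @ ys j) \<omega> - (I \<omega> + J \<omega>)))\<^sup>2) \<partial>M) \<longlonglongrightarrow> 0"
  proof (rule tendsto_zero_le[OF second_moment_bound])
    show "norm (el_int W (xs j @ ys j) \<omega> - (I \<omega> + J \<omega>)) \<le> 1 * norm (el_int W (xs j) \<omega> - I \<omega>) + 1 * norm (el_int W (ys j) \<omega> - J \<omega>)" for j \<omega>
      using norm_triangle_ineq[of "el_int W (xs j) \<omega> - I \<omega>" "el_int W (ys j) \<omega> - J \<omega>"] by (simp add: el_int_append algebra_simps)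
  qed (use x y m in \<open>auto intro!: tendsto_zero_two_sum\<close>)
  ultimately show ?thesis
    unfolding has_ito_iff[OF ab(2)] using x y L2F_add[OF x(3) y(3)] by auto
qed

lemma has_ito_linear:
  fixes f :: "real \<Rightarrow> 'w \<Rightarrow> 'b::euclidean_space" and L :: "'b \<Rightarrow> 'c::euclidean_space"
  assumes ab: "0 \<le> a" "a < b" and I: "has_ito_integral M W a b f I" and L: "bounded_linear L"
  shows "has_ito_integral M W a b (\<lambda>s \<omega>. L (f s \<omega>)) (\<lambda>\<omega>. L (I \<omega>))"
proof -
  obtain xs where x: "approximates a b xs f" "I \<in> borel_measurable M" "f \<in> L2F M W a b"
      "(\<lambda>j. \<integral>\<^sup>+\<omega>. ennreal ((norm (el_int W (xs j) \<omega> - I \<omega>))\<^sup>2) \<partial>M) \<longlonglongrightarrow> 0"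
    using I unfolding has_ito_iff[OF ab(2)] by blast
  have el: "elem a b (xs j)" for j using x(1) by (auto simp: approximates_def)
  have jm: "jmeas M a b f" using x by (auto simp: L2F_iff)
  have Lm: "L \<in> borel_measurable borel"
    by (intro borel_measurable_continuous_onI linear_continuous_on L)
  have lin: "linear L" using L by (rule bounded_linear.linear)
  obtain C where C: "\<And>x. norm (L x) \<le> norm x * C" "C > 0" using bounded_linear.pos_bounded[OF L] by blast
  have scale: "(\<lambda>j. ennreal c * e j) \<longlonglongrightarrow> 0" if "e \<longlonglongrightarrow> 0" for c and e :: "nat \<Rightarrow> ennreal"
    using tendsto_zero_two_sum[OF that that, of "ennreal c" 0] by simp
  have bd: "norm (L x - L y) \<le> C * norm (x - y) + 0 * norm (x - y)" for x y
    using C(1)[of "x - y"] by (simp add: linear_diff[OF lin] mult.commute)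
  have "approximates a b (\<lambda>j. el_map L (xs j)) (\<lambda>s \<omega>. L (f s \<omega>))"
    unfolding approximates_def el_proc_map[OF lin]
  proof (intro conjI allI)
    show "elem a b (el_map L (xs j))" for j by (intro elem_map el L)
    show "(\<lambda>j. mean_sq M a b (\<lambda>s \<omega>. L (el_proc (xs j) s \<omega>) - L (f s \<omega>))) \<longlonglongrightarrow> 0"
    proof (rule tendsto_zero_le[OF mean_sq_bound])
      show "AE s in lborel. s \<in> {a<..<b} \<longrightarrow> (\<forall>\<omega>\<in>space M. norm (L (el_proc (xs j) s \<omega>) - L (f s \<omega>))
          \<le> C * norm (el_proc (xs j) s \<omega> - f s \<omega>) + 0 * norm (el_proc (xs j) s \<omega> - f s \<omega>))" for j
        using bd by blast
    qed (use x(1) in \<open>auto simp: approximates_def intro!: scale jmeas_diff el_proc_jmeas[OF el] jm\<close>)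
  qed
  moreover have "(\<lambda>j. \<integral>\<^sup>+\<omega>. ennreal ((norm (el_int W (el_map L (xs j)) \<omega> - L (I \<omega>)))\<^sup>2) \<partial>M) \<longlonglongrightarrow> 0"
    unfolding el_int_map[OF lin]
    by (rule tendsto_zero_le[OF second_moment_bound[OF bd]])
      (use x el_int_measurable_M[OF el ab(1)] in \<open>auto intro!: scale\<close>)
  ultimately show ?thesis
    unfolding has_ito_iff[OF ab(2)] using L2F_linear[OF x(3) L] measurable_compose[OF x(2) Lm] by blast
qed

lemma has_ito_cong:
  fixes f g :: "real \<Rightarrow> 'w \<Rightarrow> 'b::euclidean_space"
  assumes ab: "a < b" and I: "has_ito_integral M W a b f I" and g: "g \<in> L2F M W a b"
    and eq: "AE \<omega> in M. AE t in lborel. t \<in> {a<..<b} \<longrightarrow> f t \<omega> = g t \<omega>"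
    and IJ: "AE \<omega> in M. I \<omega> = J \<omega>"
  shows "has_ito_integral M W a b g J"
proof -
  obtain xs where x: "\<And>j. elem a b (xs j)" "I \<in> borel_measurable M" "(\<lambda>j. mean_sq M a b (\<lambda>s \<omega>. el_proc (xs j) s \<omega> - f s \<omega>)) \<longlonglongrightarrow> 0"
      "(\<lambda>j. \<integral>\<^sup>+\<omega>. ennreal ((norm (el_int W (xs j) \<omega> - I \<omega>))\<^sup>2) \<partial>M) \<longlonglongrightarrow> 0"
    using I unfolding has_ito_iff[OF ab] approximates_def by blast
  have "mean_sq M a b (\<lambda>s \<omega>. el_proc (xs j) s \<omega> - f s \<omega>) = mean_sq M a b (\<lambda>s \<omega>. el_proc (xs j) s \<omega> - g s \<omega>)" for j
    by (rule mean_sq_cong_AE, use eq in eventually_elim) (auto elim: eventually_mono)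
  moreover have "(\<integral>\<^sup>+\<omega>. ennreal ((norm (el_int W (xs j) \<omega> - I \<omega>))\<^sup>2) \<partial>M) = (\<integral>\<^sup>+\<omega>. ennreal ((norm (el_int W (xs j) \<omega> - J \<omega>))\<^sup>2) \<partial>M)" for j
    by (rule nn_integral_cong_AE, use IJ in eventually_elim) auto
  moreover have "J \<in> borel_measurable M"
    by (rule borel_measurable_AE_cong[OF x(2)], use IJ in eventually_elim) simp
  ultimately show ?thesis
    unfolding has_ito_iff[OF ab] approximates_def using x g by auto
qed

text \<open>An almost sure limit of elementary integrals is also their limit in mean square: by the isometry
  they are a Cauchy sequence, and Fatou's lemma passes to the limit in one of the two indices. This
  lets Ito integrals be identified path by path.\<close>

lemma has_ito_of_AE_limit:
  fixes f :: "real \<Rightarrow> 'w \<Rightarrow> 'b::euclidean_space"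
  assumes ab: "0 \<le> a" "a < b" and f: "f \<in> L2F M W a b" and xs: "approximates a b xs f"
    and I: "I \<in> borel_measurable M" "AE \<omega> in M. (\<lambda>j. el_int W (xs j) \<omega>) \<longlonglongrightarrow> I \<omega>"
  shows "has_ito_integral M W a b f I"
proof -
  have el: "elem a b (xs j)" for j using xs by (auto simp: approximates_def)
  note m [measurable] = el_int_measurable_M[OF el ab(1)] and I(1) [measurable]
  define e where "e j = mean_sq M a b (\<lambda>s \<omega>. el_proc (xs j) s \<omega> - f s \<omega>)" for j
  have e: "e \<longlonglongrightarrow> 0" using xs by (simp add: approximates_def e_def[abs_def])
  have le: "(\<integral>\<^sup>+\<omega>. ennreal ((norm (el_int W (xs j) \<omega> - I \<omega>))\<^sup>2) \<partial>M) \<le> 2 * e j" for j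
  proof -
    have "(\<integral>\<^sup>+\<omega>. ennreal ((norm (el_int W (xs j) \<omega> - I \<omega>))\<^sup>2) \<partial>M)
      = (\<integral>\<^sup>+\<omega>. liminf (\<lambda>l. ennreal ((norm (el_int W (xs j) \<omega> - el_int W (xs l) \<omega>))\<^sup>2)) \<partial>M)"
    proof (rule nn_integral_cong_AE, use I(2) in eventually_elim)
      case (elim \<omega>)
      then have l: "(\<lambda>l. ennreal ((norm (el_int W (xs j) \<omega> - el_int W (xs l) \<omega>))\<^sup>2)) \<longlonglongrightarrow> ennreal ((norm (el_int W (xs j) \<omega> - I \<omega>))\<^sup>2)"
        by (intro tendsto_intros)
      show ?case by (rule lim_imp_Liminf[OF trivial_limit_sequentially l, symmetric])
    qed
    also have "\<dots> \<le> liminf (\<lambda>l. \<integral>\<^sup>+\<omega>. ennreal ((norm (el_int W (xs j) \<omega> - el_int W (xs l) \<omega>))\<^sup>2) \<partial>M)"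
      by (rule nn_integral_liminf) measurable
    also have "\<dots> \<le> liminf (\<lambda>l. 2 * e j + 2 * e l)"
      unfolding e_def using f by (intro Liminf_mono always_eventually allI approximates_Cauchy el ab) (auto simp: L2F_iff)
    also have "\<dots> = 2 * e j"
    proof -
      have "(\<lambda>l. 2 * e j + 2 * e l) \<longlonglongrightarrow> 2 * e j + 2 * 0"
        by (intro tendsto_intros ennreal_tendsto_cmult e) auto
      then show ?thesis by (simp add: lim_imp_Liminf)
    qed
    finally show ?thesis .
  qed
  have "(\<lambda>j. \<integral>\<^sup>+\<omega>. ennreal ((norm (el_int W (xs j) \<omega> - I \<omega>))\<^sup>2) \<partial>M) \<longlonglongrightarrow> 0"
    by (rule tendsto_zero_le[OF le]) (use tendsto_zero_two_sum[OF e tendsto_const[of 0], of 2 0] in simp)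
  then show ?thesis unfolding has_ito_iff[OF ab(2)] using f xs I by blast
qed

end

subsection \<open>Continuous versions\<close>

lemma floor_dyadic:
  fixes r :: real
  shows "of_int \<lfloor>r * 2 ^ m\<rfloor> / 2 ^ m \<le> r" "(\<lambda>m. of_int \<lfloor>r * 2 ^ m\<rfloor> / 2 ^ m) \<longlonglongrightarrow> r"
proof -
  have up: "of_int \<lfloor>r * 2 ^ m\<rfloor> / 2 ^ m \<le> r" for m
    using of_int_floor_le[of "r * 2 ^ m"] by (simp add: divide_le_eq)
  then show "of_int \<lfloor>r * 2 ^ m\<rfloor> / 2 ^ m \<le> r" .
  have lo: "r - (1 / 2) ^ m \<le> of_int \<lfloor>r * 2 ^ m\<rfloor> / 2 ^ m" for m
  proof -
    have "(r * 2 ^ m - 1) / 2 ^ m \<le> of_int \<lfloor>r * 2 ^ m\<rfloor> / 2 ^ m" by (intro divide_right_mono) (linarith, simp)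
    then show ?thesis by (simp add: diff_divide_distrib power_divide)
  qed
  have "(\<lambda>m. r - (1 / 2) ^ m) \<longlonglongrightarrow> r - 0" by (intro tendsto_diff tendsto_const LIMSEQ_realpow_zero) auto
  then have "(\<lambda>m. r - (1 / 2) ^ m) \<longlonglongrightarrow> r" by (simp only: diff_0_right)
  then show "(\<lambda>m. of_int \<lfloor>r * 2 ^ m\<rfloor> / 2 ^ m) \<longlonglongrightarrow> r"
    by (rule tendsto_sandwich[OF always_eventually always_eventually _ tendsto_const, rotated 2]) (use up lo in auto)
qed

context brownian
begin

lemma el_int_path_continuous:
  assumes xs: "elem lo hi xs" and lo: "0 \<le> lo" and c: "continuous_on {0..} (\<lambda>t. W t \<omega>)"
  shows "continuous_on {lo..hi} (\<lambda>t. el_int W (el_trunc t xs) \<omega>)"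
  unfolding el_int_trunc[OF xs] using xs
proof (induction xs)
  case (Cons x xs)
  obtain p q \<eta> where x: "x = (p, q, \<eta>)" by (cases x) auto
  have e: "elem lo hi xs" and pq: "lo \<le> p" "p \<le> q" using Cons.prems by (auto simp: elem_def x)
  have "continuous_on {lo..hi} (\<lambda>t. W (min r t) \<omega>)" if "lo \<le> r" for r
    by (rule continuous_on_compose2[OF c]) (use that lo in \<open>auto intro!: continuous_intros\<close>)
  then show ?case
    unfolding x el_sum_Cons using pq Cons.IH[OF e] by (intro continuous_intros) auto
qed simp

lemma el_int_trunc_start:
  assumes "elem a b xs"
  shows "el_int W (el_trunc a xs) \<omega> = 0"
  unfolding el_int_trunc[OF assms] using assms
  by (induction xs) (auto simp: el_sum_Cons elem_def min.absorb2)

lemma dyadic_approx: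
  assumes r: "0 \<le> r" "r \<le> (1::real)"
  shows "(\<lambda>m. real (nat \<lfloor>r * 2 ^ m\<rfloor>) / 2 ^ m) \<longlonglongrightarrow> r" "nat \<lfloor>r * 2 ^ m\<rfloor> \<le> 2 ^ m" "real (nat \<lfloor>r * 2 ^ m\<rfloor>) / 2 ^ m \<le> 1"
proof -
  have fl: "real (nat \<lfloor>r * 2 ^ m\<rfloor>) = of_int \<lfloor>r * 2 ^ m\<rfloor>" for m using r by simp
  show "(\<lambda>m. real (nat \<lfloor>r * 2 ^ m\<rfloor>) / 2 ^ m) \<longlonglongrightarrow> r" unfolding fl by (rule floor_dyadic)
  show "real (nat \<lfloor>r * 2 ^ m\<rfloor>) / 2 ^ m \<le> 1" unfolding fl using floor_dyadic(1)[of r m] r by linarith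
  then have "real (nat \<lfloor>r * 2 ^ m\<rfloor>) \<le> real (2 ^ m)" by (simp add: divide_le_eq)
  then show "nat \<lfloor>r * 2 ^ m\<rfloor> \<le> 2 ^ m" by (simp only: of_nat_le_iff)
qed

text \<open>The maximal inequality for the whole path. The exceptional events of the dyadic grids increase to
  the event \<open>E\<close>, so that its probability obeys the same bound. Off \<open>E\<close> the path is bounded at all
  dyadic times, and by continuity of \<open>W\<close> everywhere.\<close>

lemma el_int_maximal:
  fixes xs :: "(real \<times> real \<times> ('w \<Rightarrow> 'b::euclidean_space)) list"
  assumes xs: "elem lo hi xs" and lo: "0 \<le> lo" "lo < hi" and e: "0 < e"
  shows "\<exists>E\<in>sets M. e\<^sup>2 * prob E \<le> (\<integral>\<omega>. (norm (el_int W xs \<omega>))\<^sup>2 \<partial>M) \<and>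
    (\<forall>\<omega>\<in>space M - E. continuous_on {0..} (\<lambda>t. W t \<omega>) \<longrightarrow> (\<forall>t\<in>{lo..hi}. norm (el_int W (el_trunc t xs) \<omega>) \<le> e))"
proof -
  define q where "q m i = lo + (hi - lo) * min 1 (real i / 2 ^ m)" for m i :: nat
  have q: "lo \<le> q m i" "q m i \<le> hi" "i \<le> j \<Longrightarrow> q m i \<le> q m j" for m i j
  proof -
    show "lo \<le> q m i" unfolding q_def using lo by simp
    have "(hi - lo) * min 1 (real i / 2 ^ m) \<le> (hi - lo) * 1" using lo by (intro mult_left_mono) auto
    then show "q m i \<le> hi" unfolding q_def by simp
    assume "i \<le> j"
    then have "real i / 2 ^ m \<le> real j / 2 ^ m" by (simp add: divide_right_mono)
    then show "q m i \<le> q m j" unfolding q_def using lo by (intro add_left_mono mult_left_mono min.mono) auto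
  qed
  have q_double: "q (Suc m) (2 * i) = q m i" for m i by (simp add: q_def)
  define E where "E m = {\<omega> \<in> space M. \<exists>i\<le>2^m. norm (el_int W (el_trunc (q m i) xs) \<omega>) > e}" for m
  have meas [measurable]: "el_int W (el_trunc (q m i) xs) \<in> borel_measurable M" for m i
    by (intro el_int_measurable_M[OF elem_trunc[OF xs]] q lo)
  have EM: "E m \<in> sets M" for m
    unfolding E_def by measurable
  have inc: "incseq E"
  proof (rule incseq_SucI, rule subsetI)
    fix m \<omega> assume "\<omega> \<in> E m"
    then obtain i where "\<omega> \<in> space M" "i \<le> 2 ^ m" "norm (el_int W (el_trunc (q m i) xs) \<omega>) > e" by (auto simp: E_def)
    then show "\<omega> \<in> E (Suc m)" unfolding E_def by (auto intro!: exI[of _ "2 * i"] simp: q_double)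
  qed
  have "e\<^sup>2 * prob (\<Union>m. E m) \<le> (\<integral>\<omega>. (norm (el_int W xs \<omega>))\<^sup>2 \<partial>M)"
  proof (rule LIMSEQ_le_const2)
    show "(\<lambda>m. e\<^sup>2 * prob (E m)) \<longlonglongrightarrow> e\<^sup>2 * prob (\<Union>m. E m)"
      by (intro tendsto_mult tendsto_const finite_Lim_measure_incseq inc) (use EM in auto)
    show "\<exists>N. \<forall>n\<ge>N. e\<^sup>2 * prob (E n) \<le> (\<integral>\<omega>. (norm (el_int W xs \<omega>))\<^sup>2 \<partial>M)"
      unfolding E_def by (intro exI[of _ 0] allI impI el_int_maximal_finite[OF xs lo(1) e] q)
  qed
  moreover have "norm (el_int W (el_trunc t xs) \<omega>) \<le> e"
    if w: "\<omega> \<in> space M - (\<Union>m. E m)" and c: "continuous_on {0..} (\<lambda>t. W t \<omega>)" and t: "t \<in> {lo..hi}" for t \<omega>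
  proof -
    define r where "r = (t - lo) / (hi - lo)"
    have r: "0 \<le> r" "r \<le> 1" using t lo by (auto simp: r_def divide_le_eq)
    define i where "i m = nat \<lfloor>r * 2 ^ m\<rfloor>" for m :: nat
    have qi: "(\<lambda>m. q m (i m)) \<longlonglongrightarrow> t"
    proof -
      have "(\<lambda>m. lo + (hi - lo) * (real (i m) / 2 ^ m)) \<longlonglongrightarrow> lo + (hi - lo) * r"
        unfolding i_def by (intro tendsto_intros dyadic_approx r)
      moreover have "lo + (hi - lo) * r = t" using lo by (simp add: r_def)
      moreover have "q m (i m) = lo + (hi - lo) * (real (i m) / 2 ^ m)" for m
        unfolding q_def i_def using min_absorb2[OF dyadic_approx(3)[OF r, of m]] by (simp only:)
      ultimately show ?thesis by simp
    qed
    have "(\<lambda>m. norm (el_int W (el_trunc (q m (i m)) xs) \<omega>)) \<longlonglongrightarrow> norm (el_int W (el_trunc t xs) \<omega>)"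
      by (intro tendsto_norm continuous_on_tendsto_compose[OF el_int_path_continuous[OF xs lo(1) c] qi t])
         (use q in auto)
    moreover have "norm (el_int W (el_trunc (q m (i m)) xs) \<omega>) \<le> e" for m
    proof (rule ccontr)
      assume "\<not> ?thesis"
      then have "\<omega> \<in> E m" using w dyadic_approx(2)[OF r, of m] unfolding E_def i_def by (auto simp only: mem_Collect_eq not_le DiffE)
      then show False using w by blast
    qed
    ultimately show ?thesis by (intro LIMSEQ_le_const2) auto
  qed
  ultimately show ?thesis using EM by (intro bexI[of _ "\<Union>m. E m"]) auto
qed

text \<open>The approximating sequence is part of the notion, since the uniform convergence of its paths
  is used again when path integrals of \<open>Y\<close> are computed.\<close>

definition continuous_version ::
  "real \<Rightarrow> real \<Rightarrow> (real \<Rightarrow> 'w \<Rightarrow> 'b::euclidean_space) \<Rightarrow> (nat \<Rightarrow> (real \<times> real \<times> ('w \<Rightarrow> 'b)) list) \<Rightarrow> (real \<Rightarrow> 'w \<Rightarrow> 'b) \<Rightarrow> bool" where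
  "continuous_version a b f ys Y \<longleftrightarrow> approximates a b ys f \<and>
     (\<forall>t\<in>{a..b}. Y t \<in> borel_measurable M) \<and> (\<forall>\<omega>. Y a \<omega> = 0) \<and>
     (AE \<omega> in M. continuous_on {a..b} (\<lambda>t. Y t \<omega>) \<and>
        uniform_limit {a..b} (\<lambda>j t. el_int W (el_trunc t (ys j)) \<omega>) (\<lambda>t. Y t \<omega>) sequentially)"

text \<open>Along a subsequence \<open>ys\<close> whose errors decrease like \<open>8\<^sup>-\<^sup>n\<close>, the maximal inequality
  bounds the probability that two successive paths differ by more than \<open>2\<^sup>-\<^sup>n\<close> by a multiple of
  \<open>4\<^sup>n 8\<^sup>-\<^sup>n = 2\<^sup>-\<^sup>n\<close>. These probabilities are summable, so by Borel-Cantelli the paths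
  converge uniformly almost surely.\<close>

lemma ito_continuous_version:
  fixes f :: "real \<Rightarrow> 'w \<Rightarrow> 'b::euclidean_space"
  assumes ab: "0 \<le> a" "a < b" and f: "f \<in> L2F M W a b" and xs: "approximates a b xs f"
  shows "\<exists>ys Y. continuous_version a b f ys Y"
proof -
  let ?e = "\<lambda>zs. mean_sq M a b (\<lambda>s \<omega>. el_proc zs s \<omega> - f s \<omega>)"
  have jm: "jmeas M a b f" using f by (simp add: L2F_iff)
  have "\<exists>j. ?e (xs j) < ennreal ((1/8)^n)" for n :: nat
  proof -
    have "\<forall>\<^sub>F j in sequentially. ?e (xs j) < ennreal ((1/8)^n)"
      using xs by (intro order_tendstoD(2)[of _ 0]) (auto simp: approximates_def)
    then show ?thesis by (auto simp: eventually_sequentially)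
  qed
  then have "\<exists>J. \<forall>n. ?e (xs (J n)) < ennreal ((1/8)^n)" by (intro choice allI)
  then obtain J where J: "\<And>n. ?e (xs (J n)) < ennreal ((1/8)^n)" by blast
  define ys where "ys n = xs (J n)" for n
  have el: "elem a b (ys n)" for n using xs by (simp add: ys_def approximates_def)
  have ye: "?e (ys n) \<le> ennreal ((1/8)^n)" for n using J[of n] by (simp add: ys_def less_imp_le)
  have yap: "approximates a b ys f"
    unfolding approximates_def
  proof (intro conjI allI el)
    show "(\<lambda>j. ?e (ys j)) \<longlonglongrightarrow> 0"
    proof (rule tendsto_zero_le[OF ye])
      have "(\<lambda>n. ennreal ((1/8)^n)) \<longlonglongrightarrow> ennreal 0" by (intro tendsto_ennrealI LIMSEQ_realpow_zero) auto
      then show "(\<lambda>n. ennreal ((1/8)^n)) \<longlonglongrightarrow> 0" by simp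
    qed
  qed
  \<comment> \<open>the difference of two successive approximations is again an elementary integrand\<close>
  define D where "D n = ys (Suc n) @ el_map uminus (ys n)" for n
  have l: "linear (uminus :: 'b \<Rightarrow> 'b)" "bounded_linear (uminus :: 'b \<Rightarrow> 'b)"
    by (auto intro!: bounded_linear_minus bounded_linear_ident bounded_linear.linear)
  have elD: "elem a b (D n)" for n unfolding D_def using el elem_map[OF l(2) el] by simp
  have D_diff: "el_int W (D n) \<omega> = el_int W (ys (Suc n)) \<omega> - el_int W (ys n) \<omega>" for n \<omega>
    by (simp add: D_def el_int_append el_int_map[OF l(1)])
  have DT_diff: "el_int W (el_trunc t (D n)) \<omega> = el_int W (el_trunc t (ys (Suc n))) \<omega> - el_int W (el_trunc t (ys n)) \<omega>" for n t \<omega>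
    unfolding el_int_trunc[OF elD] el_int_trunc[OF el] by (simp add: D_def el_sum_append el_sum_map[OF l(1)])
  have D_sq: "(\<integral>\<omega>. (norm (el_int W (D n) \<omega>))\<^sup>2 \<partial>M) \<le> 4 * (1/8)^n" for n
  proof -
    have "ennreal (\<integral>\<omega>. (norm (el_int W (D n) \<omega>))\<^sup>2 \<partial>M) = (\<integral>\<^sup>+\<omega>. ennreal ((norm (el_int W (D n) \<omega>))\<^sup>2) \<partial>M)"
      using el_int_square_integrable[OF elD ab(1)] by (intro nn_integral_eq_integral[symmetric]) auto
    also have "\<dots> \<le> 2 * ?e (ys (Suc n)) + 2 * ?e (ys n)"
      unfolding D_diff by (intro approximates_Cauchy el ab jm)
    also have "\<dots> \<le> 2 * ennreal ((1/8)^Suc n) + 2 * ennreal ((1/8)^n)"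
      by (intro add_mono mult_left_mono ye) auto
    also have "\<dots> = ennreal (2 * (1/8)^Suc n + 2 * (1/8)^n)"
      by (subst ennreal_plus) (auto simp: ennreal_mult simp del: power_Suc)
    also have "\<dots> \<le> ennreal (4 * (1/8)^n)" by (intro ennreal_leI) simp
    finally show ?thesis by (simp add: ennreal_le_iff)
  qed
  have "\<forall>n. \<exists>E\<in>sets M. ((1/2)^n)\<^sup>2 * prob E \<le> 4 * (1/8)^n \<and>
    (\<forall>\<omega>\<in>space M - E. continuous_on {0..} (\<lambda>t. W t \<omega>) \<longrightarrow> (\<forall>t\<in>{a..b}. norm (el_int W (el_trunc t (D n)) \<omega>) \<le> (1/2)^n))"
  proof
    fix n
    have "0 < (1/2 :: real)^n" by simp
    from el_int_maximal[OF elD[of n] ab this] obtain E where "E \<in> sets M"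
      "((1/2)^n)\<^sup>2 * prob E \<le> (\<integral>\<omega>. (norm (el_int W (D n) \<omega>))\<^sup>2 \<partial>M)"
      "\<forall>\<omega>\<in>space M - E. continuous_on {0..} (\<lambda>t. W t \<omega>) \<longrightarrow> (\<forall>t\<in>{a..b}. norm (el_int W (el_trunc t (D n)) \<omega>) \<le> (1/2)^n)"
      by blast
    then show "\<exists>E\<in>sets M. ((1/2)^n)\<^sup>2 * prob E \<le> 4 * (1/8)^n \<and>
      (\<forall>\<omega>\<in>space M - E. continuous_on {0..} (\<lambda>t. W t \<omega>) \<longrightarrow> (\<forall>t\<in>{a..b}. norm (el_int W (el_trunc t (D n)) \<omega>) \<le> (1/2)^n))"
      using D_sq[of n] by (intro bexI[of _ E] conjI) (auto intro: order_trans)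
  qed
  then obtain E where E: "\<And>n. E n \<in> sets M" "\<And>n. ((1/2)^n)\<^sup>2 * prob (E n) \<le> 4 * (1/8)^n"
    "\<And>n \<omega> t. \<omega> \<in> space M - E n \<Longrightarrow> continuous_on {0..} (\<lambda>t. W t \<omega>) \<Longrightarrow> t \<in> {a..b} \<Longrightarrow> norm (el_int W (el_trunc t (D n)) \<omega>) \<le> (1/2)^n"
    by metis
  have pE: "prob (E n) \<le> 4 * (1/2)^n" for n
  proof -
    have "((1/2)^n)\<^sup>2 * prob (E n) \<le> ((1/2)^n)\<^sup>2 * (4 * (1/2)^n)"
    proof -
      have "((1/2)^n)\<^sup>2 * (1/2)^n = ((1/2::real)^3)^n" by (simp flip: power_mult power_add add: algebra_simps)
      also have "(1/2::real)^3 = 1/8" by (simp add: power3_eq_cube)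
      finally show ?thesis using E(2)[of n] by (simp add: algebra_simps)
    qed
    then show ?thesis by (rule mult_left_le_imp_le) simp
  qed
  have ev: "AE \<omega> in M. eventually (\<lambda>n. \<omega> \<in> space M - E n) sequentially"
  proof (rule borel_cantelli_AE1[OF E(1)])
    show "summable (\<lambda>n. prob (E n))"
      by (rule summable_comparison_test'[of "\<lambda>n. 4 * (1/2)^n" 0])
         (use pE in \<open>auto intro!: summable_mult summable_geometric\<close>)
  qed (simp add: less_top[symmetric])
  define Y where "Y t \<omega> = lim (\<lambda>n. el_int W (el_trunc t (ys n)) \<omega>)" for t \<omega>
  have "AE \<omega> in M. continuous_on {0..} (\<lambda>t. W t \<omega>)" using bm by (simp add: brownian_motion_def)
  with ev have good: "AE \<omega> in M. continuous_on {a..b} (\<lambda>t. Y t \<omega>) \<and>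
        uniform_limit {a..b} (\<lambda>j t. el_int W (el_trunc t (ys j)) \<omega>) (\<lambda>t. Y t \<omega>) sequentially"
  proof eventually_elim
    case (elim \<omega>)
    let ?y = "\<lambda>n t. el_int W (el_trunc t (ys n)) \<omega>"
    have "\<forall>\<^sub>F n in sequentially. \<forall>t\<in>{a..b}. norm (?y (Suc n) t - ?y n t) \<le> (1/2)^n"
      using elim(1)
    proof eventually_elim
      case (elim n)
      then show ?case using E(3)[OF elim \<open>continuous_on {0..} (\<lambda>t. W t \<omega>)\<close>] by (simp add: DT_diff)
    qed
    then have "uniform_limit {a..b} (\<lambda>n t. \<Sum>i<n. ?y (Suc i) t - ?y i t) (\<lambda>t. \<Sum>i. ?y (Suc i) t - ?y i t) sequentially"
      by (rule Weierstrass_m_test_ev) (auto intro!: summable_geometric)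
    then have "uniform_limit {a..b} (\<lambda>n t. ?y n t - ?y 0 t) (\<lambda>t. \<Sum>i. ?y (Suc i) t - ?y i t) sequentially"
      by (simp only: sum_lessThan_telescope[of "\<lambda>n. ?y n t" for t])
    then have "uniform_limit {a..b} (\<lambda>n t. (?y n t - ?y 0 t) + ?y 0 t) (\<lambda>t. (\<Sum>i. ?y (Suc i) t - ?y i t) + ?y 0 t) sequentially"
      by (intro uniform_limit_add uniform_limit_const)
    then have u: "uniform_limit {a..b} ?y (\<lambda>t. (\<Sum>i. ?y (Suc i) t - ?y i t) + ?y 0 t) sequentially"
      by simp
    have Yeq: "Y t \<omega> = (\<Sum>i. ?y (Suc i) t - ?y i t) + ?y 0 t" if "t \<in> {a..b}" for t
      unfolding Y_def by (rule limI[OF tendsto_uniform_limitI[OF u that]])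
    have u': "uniform_limit {a..b} ?y (\<lambda>t. Y t \<omega>) sequentially"
      by (rule uniform_limit_cong'[THEN iffD1, OF _ _ u]) (use Yeq in auto)
    have "continuous_on {a..b} (\<lambda>t. Y t \<omega>)"
      by (rule uniform_limit_theorem[OF _ u'])
         (use el_int_path_continuous[OF el ab(1) elim(2)] in auto)
    with u' show ?case by simp
  qed
  moreover have "Y t \<in> borel_measurable M" if "t \<in> {a..b}" for t
    unfolding Y_def by (intro borel_measurable_lim_metric el_int_measurable_M[OF elem_trunc[OF el]]) (use that ab in auto)
  moreover have "Y a \<omega> = 0" for \<omega>
  proof -
    have "el_int W (el_trunc a (ys n)) \<omega> = 0" for n by (rule el_int_trunc_start[OF el])
    then show ?thesis by (simp only: Y_def limI[OF tendsto_const])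
  qed
  ultimately show ?thesis unfolding continuous_version_def using yap by blast
qed

lemma approximates_trunc:
  assumes "approximates a b ys f" "a \<le> t" "t \<le> b"
  shows "approximates a t (\<lambda>j. el_trunc t (ys j)) f"
  unfolding approximates_def
proof (intro conjI allI)
  have el: "elem a b (ys j)" for j using assms by (simp add: approximates_def)
  show "elem a t (el_trunc t (ys j))" for j by (rule elem_trunc[OF el assms(2)])
  have eq: "mean_sq M a t (\<lambda>s \<omega>. el_proc (el_trunc t (ys j)) s \<omega> - f s \<omega>) = mean_sq M a t (\<lambda>s \<omega>. el_proc (ys j) s \<omega> - f s \<omega>)" for j
    unfolding mean_sq_def el_proc_trunc[OF el] by (intro nn_integral_cong) (auto simp: indicator_def)
  show "(\<lambda>j. mean_sq M a t (\<lambda>s \<omega>. el_proc (el_trunc t (ys j)) s \<omega> - f s \<omega>)) \<longlonglongrightarrow> 0"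
    unfolding eq
    by (rule tendsto_zero_le[OF mean_sq_mono_interval[of a a t b]]) (use assms in \<open>auto simp: approximates_def\<close>)
qed

lemma continuous_version_has_ito:
  assumes ab: "0 \<le> a" and f: "f \<in> L2F M W a b" and Y: "continuous_version a b f ys Y" and t: "a < t" "t \<le> b"
  shows "has_ito_integral M W a t f (Y t)"
proof (rule has_ito_of_AE_limit[OF ab t(1) L2F_subinterval[OF f order_refl t(2)]])
  show "approximates a t (\<lambda>j. el_trunc t (ys j)) f"
    using Y t by (intro approximates_trunc) (auto simp: continuous_version_def)
  show "Y t \<in> borel_measurable M" using Y t by (auto simp: continuous_version_def)
  have "AE \<omega> in M. uniform_limit {a..b} (\<lambda>j t. el_int W (el_trunc t (ys j)) \<omega>) (\<lambda>t. Y t \<omega>) sequentially"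
    using Y by (auto simp: continuous_version_def)
  then show "AE \<omega> in M. (\<lambda>j. el_int W (el_trunc t (ys j)) \<omega>) \<longlonglongrightarrow> Y t \<omega>"
    by eventually_elim (rule tendsto_uniform_limitI, use t in auto)
qed

end

section \<open>Matrix factors and extension in time\<close>

lemma norm_matrix_vector_le: "norm (A *v x) \<le> norm A * norm (x :: real^'n)" for A :: "real^'n^'k"
proof -
  have "norm (A *v x) = L2_set (\<lambda>i. \<bar>A $ i \<bullet> x\<bar>) UNIV"
    by (simp add: norm_vec_def matrix_vector_mul_component)
  also have "\<dots> \<le> L2_set (\<lambda>i. norm x * norm (A $ i)) UNIV"
    by (intro L2_set_mono) (subst mult.commute, rule Cauchy_Schwarz_ineq2, simp)
  also have "\<dots> = norm A * norm x"
    by (simp add: L2_set_right_distrib[symmetric] norm_vec_def mult.commute)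
  finally show ?thesis .
qed

lemma bounded_bilinear_matrix_vector: "bounded_bilinear ((*v) :: real^'n^'k \<Rightarrow> real^'n \<Rightarrow> real^'k)"
proof
  show "\<exists>K. \<forall>A x. norm (A *v x :: real^'k) \<le> norm A * norm (x::real^'n) * K"
    by (intro exI[of _ 1]) (simp add: norm_matrix_vector_le)
qed (simp_all add: matrix_vector_mult_add_rdistrib matrix_vector_right_distrib scaleR_matrix_vector_assoc
      matrix_vector_mult_scaleR)

lemma bounded_bilinear_matrix_mult:
  "bounded_bilinear ((**) :: real^'n^'k \<Rightarrow> real^'m^'n \<Rightarrow> real^'m^'k)"
  unfolding bilinear_conv_bounded_bilinear[symmetric] bilinear_def
  by (auto intro!: linearI simp: vec_eq_iff matrix_matrix_mult_def sum.distrib algebra_simps sum_distrib_left)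

lemma borel_measurable_matrix_vector [measurable]:
  assumes "f \<in> borel_measurable N" "g \<in> borel_measurable N"
  shows "(\<lambda>x. (f x :: real^'n^'k) *v g x) \<in> borel_measurable N"
  by (rule borel_measurable_continuous_Pair[OF assms])
     (intro bounded_bilinear.continuous_on[OF bounded_bilinear_matrix_vector] continuous_intros)

lemma borel_measurable_matrix_mult [measurable]:
  assumes "f \<in> borel_measurable N" "g \<in> borel_measurable N"
  shows "(\<lambda>x. (f x :: real^'n^'k) ** (g x :: real^'m^'n)) \<in> borel_measurable N"
  by (rule borel_measurable_continuous_Pair[OF assms])
     (intro bounded_bilinear.continuous_on[OF bounded_bilinear_matrix_mult] continuous_intros)

lemma jmeas_matrix:
  fixes G :: "real \<Rightarrow> real^'n^'k"
  assumes G: "G \<in> borel_measurable (restrict_space borel {a<..<b})" and f: "jmeas M a b f"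
  shows "jmeas M a b (\<lambda>s \<omega>. G s *v f s \<omega>)"
  using borel_measurable_matrix_vector[OF jmeas_det[OF G, unfolded jmeas_def] f[unfolded jmeas_def]]
  by (simp add: jmeas_def case_prod_beta')

lemma integrable_bounded_on_interval:
  fixes k :: "real \<Rightarrow> 'b::euclidean_space"
  assumes k: "set_borel_measurable lborel {a<..<b} k" and K: "AE r in lborel. r \<in> {a<..<b} \<longrightarrow> norm (k r) \<le> K"
  shows "set_integrable lborel {a<..<b} k"
  unfolding set_integrable_def
proof (rule Bochner_Integration.integrable_bound)
  show "integrable lborel (\<lambda>r. indicator {a<..<b} r *\<^sub>R K)"
    by (cases "a \<le> b") (auto simp: less_top[symmetric])
  show "(\<lambda>r. indicator {a<..<b} r *\<^sub>R k r) \<in> borel_measurable lborel" using k by (simp add: set_borel_measurable_def)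
  show "AE r in lborel. norm (indicator {a<..<b} r *\<^sub>R k r) \<le> norm (indicator {a<..<b} r *\<^sub>R K)"
    using K by eventually_elim (auto simp: indicator_def)
qed

context brownian
begin

lemma L2F_matrix:
  fixes G :: "real \<Rightarrow> real^'n^'k" and f :: "real \<Rightarrow> 'w \<Rightarrow> real^'n"
  assumes G: "G \<in> borel_measurable (restrict_space borel {a<..<b})"
    and C: "AE s in lborel. s \<in> {a<..<b} \<longrightarrow> norm (G s) \<le> C" and f: "f \<in> L2F M W a b"
  shows "(\<lambda>s \<omega>. G s *v f s \<omega>) \<in> L2F M W a b"
  unfolding L2F_iff
proof (intro conjI ballI)
  have jm: "jmeas M a b f" using f by (simp add: L2F_iff)
  show "jmeas M a b (\<lambda>s \<omega>. G s *v f s \<omega>)" by (rule jmeas_matrix[OF G jm])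
  show "(\<lambda>\<omega>. G t *v f t \<omega>) \<in> borel_measurable (Fil t)" if "t \<in> {a<..<b}" for t
    using f that by (intro borel_measurable_matrix_vector) (auto simp: L2F_iff)
  have "mean_sq M a b (\<lambda>s \<omega>. G s *v f s \<omega>) \<le> ennreal (2 * C\<^sup>2) * mean_sq M a b f + ennreal (2 * 0\<^sup>2) * mean_sq M a b f"
  proof (rule mean_sq_bound[OF _ jm jm], use C in eventually_elim, intro impI ballI)
    fix s \<omega> assume "s \<in> {a<..<b} \<longrightarrow> norm (G s) \<le> C" "s \<in> {a<..<b}"
    then have "norm (G s) * norm (f s \<omega>) \<le> C * norm (f s \<omega>)" by (intro mult_right_mono) auto
    then show "norm (G s *v f s \<omega>) \<le> C * norm (f s \<omega>) + 0 * norm (f s \<omega>)"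
      using norm_matrix_vector_le[of "G s" "f s \<omega>"] by simp
  qed
  then show "mean_sq M a b (\<lambda>s \<omega>. G s *v f s \<omega>) < \<infinity>"
    using f by (auto simp: L2F_iff ennreal_mult_less_top intro: le_less_trans)
qed

end

subsection \<open>Extension of integrands in time\<close>

lemma AE_interval_obtains:
  assumes "AE t in lborel. t \<in> {a<..<b} \<longrightarrow> Q t" "a \<le> c" "c < (b::real)"
  shows "\<exists>t. c < t \<and> t < b \<and> Q t"
proof (rule ccontr)
  assume n: "\<not> ?thesis"
  have "AE t in lborel. t \<notin> {c<..<b}"
    using assms(1) by eventually_elim (use n assms in auto)
  then have "emeasure lborel {c<..<b} = 0" by (intro null_setsD1) (simp add: AE_iff_null_sets)
  then show False using assms by simp
qed

lemma dense_left_sequence: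
  assumes ab: "a < (b::real)" and dense: "\<And>c. a \<le> c \<Longrightarrow> c < b \<Longrightarrow> \<exists>t. c < t \<and> t < b \<and> Q t"
  obtains t where "\<And>n. a < t n" "\<And>n. t n < b" "\<And>n. Q (t n)" "t \<longlonglongrightarrow> b"
proof -
  have "\<exists>t. max a (b - 1 / real (Suc n)) < t \<and> t < b \<and> Q t" for n
    using ab by (intro dense) auto
  then obtain t where t: "\<And>n. max a (b - 1 / real (Suc n)) < t n" "\<And>n. t n < b" "\<And>n. Q (t n)" by metis
  have "t \<longlonglongrightarrow> b"
  proof (rule tendsto_sandwich[OF _ _ _ tendsto_const])
    show "\<forall>\<^sub>F n in sequentially. b - 1 / real (Suc n) \<le> t n" using t(1) by (auto intro!: always_eventually less_imp_le)
    show "\<forall>\<^sub>F n in sequentially. t n \<le> b" using t(2) by (auto intro!: always_eventually less_imp_le)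
    have "(\<lambda>n. b - 1 / real (Suc n)) \<longlonglongrightarrow> b - 0" by (intro tendsto_diff tendsto_const LIMSEQ_Suc[OF lim_1_over_n])
    then show "(\<lambda>n. b - 1 / real (Suc n)) \<longlonglongrightarrow> b" by simp
  qed
  with t that show thesis by (meson max_less_iff_conj)
qed

context prob_space
begin

lemma mean_sq_split:
  fixes f :: "real \<Rightarrow> 'a \<Rightarrow> 'b::euclidean_space"
  assumes "a \<le> c" "c \<le> b" and f: "jmeas M a b f"
  shows "mean_sq M a b f = mean_sq M a c f + mean_sq M c b f"
proof -
  have f1: "jmeas M a c f" and f2: "jmeas M c b f"
    using jmeas_subinterval[OF f] assms by auto
  have "(\<integral>\<^sup>+s\<in>{a<..<b}. ennreal ((norm (f s \<omega>))\<^sup>2) \<partial>lborel) =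
     (\<integral>\<^sup>+s\<in>{a<..<c}. ennreal ((norm (f s \<omega>))\<^sup>2) \<partial>lborel) + (\<integral>\<^sup>+s\<in>{c<..<b}. ennreal ((norm (f s \<omega>))\<^sup>2) \<partial>lborel)"
    if "\<omega> \<in> space M" for \<omega>
  proof -
    have "(\<integral>\<^sup>+s\<in>{a<..<b}. ennreal ((norm (f s \<omega>))\<^sup>2) \<partial>lborel) =
      (\<integral>\<^sup>+s. ennreal ((norm (f s \<omega>))\<^sup>2) * indicator {a<..<c} s + ennreal ((norm (f s \<omega>))\<^sup>2) * indicator {c<..<b} s \<partial>lborel)"
      using AE_lborel_singleton[of c] assms
      by (intro nn_integral_cong_AE) (auto simp: indicator_def elim!: eventually_mono)
    then show ?thesis
      using jmeas_inner_measurable[OF f1 that] jmeas_inner_measurable[OF f2 that] by (simp add: nn_integral_add)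
  qed
  then have "mean_sq M a b f = (\<integral>\<^sup>+\<omega>. (\<integral>\<^sup>+s\<in>{a<..<c}. ennreal ((norm (f s \<omega>))\<^sup>2) \<partial>lborel) + (\<integral>\<^sup>+s\<in>{c<..<b}. ennreal ((norm (f s \<omega>))\<^sup>2) \<partial>lborel) \<partial>M)"
    unfolding mean_sq_def by (intro nn_integral_cong)
  then show ?thesis
    unfolding mean_sq_def using mean_sq_inner_measurable[OF f1] mean_sq_inner_measurable[OF f2] by (simp add: nn_integral_add)
qed

lemma mean_sq_tail:
  fixes f :: "real \<Rightarrow> 'a \<Rightarrow> 'b::euclidean_space"
  assumes f: "jmeas M a b f" "mean_sq M a b f < \<infinity>" and t: "\<And>n. a \<le> t n" "t \<longlonglongrightarrow> b"
  shows "(\<lambda>n. mean_sq M (t n) b f) \<longlonglongrightarrow> 0"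
proof -
  let ?u = "\<lambda>\<omega>. \<integral>\<^sup>+s\<in>{a<..<b}. ennreal ((norm (f s \<omega>))\<^sup>2) \<partial>lborel"
  let ?v = "\<lambda>n \<omega>. \<integral>\<^sup>+s\<in>{t n<..<b}. ennreal ((norm (f s \<omega>))\<^sup>2) \<partial>lborel"
  have jn: "jmeas M (t n) b f" for n using jmeas_subinterval[OF f(1) t(1)] by simp
  have fin: "AE \<omega> in M. ?u \<omega> \<noteq> \<infinity>"
    by (rule nn_integral_PInf_AE[OF mean_sq_inner_measurable[OF f(1)]]) (use f(2) in \<open>simp add: mean_sq_def\<close>)
  have "(\<lambda>n. \<integral>\<^sup>+\<omega>. ?v n \<omega> \<partial>M) \<longlonglongrightarrow> (\<integral>\<^sup>+\<omega>. 0 \<partial>M)"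
  proof (rule nn_integral_dominated_convergence[where w="?u"])
    show "AE \<omega> in M. (\<lambda>n. ?v n \<omega>) \<longlonglongrightarrow> 0"
      using fin AE_space
    proof eventually_elim
      case (elim \<omega>)
      have "(\<lambda>n. ?v n \<omega>) \<longlonglongrightarrow> (\<integral>\<^sup>+s. 0 \<partial>(lborel :: real measure))"
      proof (rule nn_integral_dominated_convergence[where w="\<lambda>s. ennreal ((norm (f s \<omega>))\<^sup>2) * indicator {a<..<b} s"])
        show "AE s in lborel. (\<lambda>n. ennreal ((norm (f s \<omega>))\<^sup>2) * indicator {t n<..<b} s) \<longlonglongrightarrow> 0"
        proof (rule AE_I2)
          fix s
          show "(\<lambda>n. ennreal ((norm (f s \<omega>))\<^sup>2) * indicator {t n<..<b} s) \<longlonglongrightarrow> 0"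
          proof (cases "s < b")
            case True
            have "\<forall>\<^sub>F n in sequentially. ennreal ((norm (f s \<omega>))\<^sup>2) * indicator {t n<..<b} s = 0"
              using order_tendstoD(1)[OF t(2) True] by eventually_elim auto
            then show ?thesis by (rule tendsto_eventually)
          qed auto
        qed
        show "(\<lambda>s. ennreal ((norm (f s \<omega>))\<^sup>2) * indicator {t n<..<b} s) \<in> borel_measurable lborel" for n
          by (rule jmeas_inner_measurable[OF jn elim(2)])
        show "AE s in lborel. ennreal ((norm (f s \<omega>))\<^sup>2) * indicator {t n<..<b} s \<le> ennreal ((norm (f s \<omega>))\<^sup>2) * indicator {a<..<b} s" for n
          using t(1)[of n] by (intro AE_I2) (auto simp: indicator_def)
      qed (use jmeas_inner_measurable[OF f(1) elim(2)] elim(1) in \<open>auto simp: less_top\<close>)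
      then show ?case by simp
    qed
    show "?v n \<in> borel_measurable M" for n by (rule mean_sq_inner_measurable[OF jn])
    show "AE \<omega> in M. ?v n \<omega> \<le> ?u \<omega>" for n
      using t(1)[of n] by (intro AE_I2 nn_integral_mono) (auto simp: indicator_def)
  qed (use mean_sq_inner_measurable[OF f(1)] f(2) in \<open>auto simp: mean_sq_def\<close>)
  then show ?thesis by (simp add: mean_sq_def)
qed

end

context brownian
begin

text \<open>An approximation on \<open>(a, c)\<close> vanishes after \<open>c\<close>, so it also approximates, on all of \<open>(a, b)\<close>, the
  integrand cut off at \<open>c\<close>.\<close>

lemma has_ito_zero_extend:
  fixes f :: "real \<Rightarrow> 'w \<Rightarrow> 'b::euclidean_space"
  assumes I: "has_ito_integral M W a c f I" and ac: "a < c" "c \<le> b"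
  shows "has_ito_integral M W a b (\<lambda>s \<omega>. if s < c then f s \<omega> else 0) I"
proof -
  obtain xs where x: "\<And>j. elem a c (xs j)" "I \<in> borel_measurable M" "(\<lambda>j. mean_sq M a c (\<lambda>s \<omega>. el_proc (xs j) s \<omega> - f s \<omega>)) \<longlonglongrightarrow> 0"
      "(\<lambda>j. \<integral>\<^sup>+\<omega>. ennreal ((norm (el_int W (xs j) \<omega> - I \<omega>))\<^sup>2) \<partial>M) \<longlonglongrightarrow> 0" and f: "f \<in> L2F M W a c"
    using I unfolding has_ito_iff[OF ac(1)] approximates_def by blast
  let ?g = "\<lambda>s \<omega>. if s < c then f s \<omega> else 0"
  have jg: "jmeas M a b ?g"
  proof -
    have "(\<lambda>(t, \<omega>). indicator {a<..<b} t *\<^sub>R ?g t \<omega>) = (\<lambda>(t, \<omega>). indicator {a<..<c} t *\<^sub>R f t \<omega>)"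
      using ac by (auto simp: fun_eq_iff indicator_def)
    then show ?thesis using f unfolding L2F_iff jmeas_iff by (simp only:)
  qed
  have ms: "mean_sq M a b h = mean_sq M a c h" if "\<And>s \<omega>. c < s \<Longrightarrow> h s \<omega> = 0" for h :: "real \<Rightarrow> 'w \<Rightarrow> 'b"
    unfolding mean_sq_def
  proof (rule nn_integral_cong, rule nn_integral_cong_AE)
    fix \<omega>
    show "AE s in lborel. ennreal ((norm (h s \<omega>))\<^sup>2) * indicator {a<..<b} s = ennreal ((norm (h s \<omega>))\<^sup>2) * indicator {a<..<c} s"
      using AE_lborel_singleton[of c]
    proof eventually_elim
      case (elim s)
      then show ?case using that[of s \<omega>] ac by (cases "s < c") (auto simp: indicator_def)
    qed
  qed
  have mc: "mean_sq M a c (\<lambda>s \<omega>. h s \<omega> - ?g s \<omega>) = mean_sq M a c (\<lambda>s \<omega>. h s \<omega> - f s \<omega>)" for h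
    unfolding mean_sq_def by (intro nn_integral_cong) (auto simp: indicator_def)
  have "mean_sq M a b ?g = mean_sq M a c ?g" by (rule ms) auto
  also have "\<dots> = mean_sq M a c f"
    unfolding mean_sq_def by (intro nn_integral_cong) (auto simp: indicator_def)
  moreover have "(\<lambda>\<omega>. if t < c then f t \<omega> else 0) \<in> borel_measurable (Fil t)" if "t \<in> {a<..<b}" for t
    using f that by (cases "t < c") (auto simp: L2F_iff)
  ultimately have "?g \<in> L2F M W a b"
    using f jg unfolding L2F_iff by auto
  moreover have "approximates a b xs ?g"
    unfolding approximates_def
  proof (intro conjI allI)
    show "elem a b (xs j)" for j by (rule elem_mono[OF x(1)]) (use ac in auto)
    have "mean_sq M a b (\<lambda>s \<omega>. el_proc (xs j) s \<omega> - ?g s \<omega>) = mean_sq M a c (\<lambda>s \<omega>. el_proc (xs j) s \<omega> - f s \<omega>)" for j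
      unfolding mc[symmetric] by (rule ms) (use el_proc_outside[OF x(1)] in auto)
    then show "(\<lambda>j. mean_sq M a b (\<lambda>s \<omega>. el_proc (xs j) s \<omega> - ?g s \<omega>)) \<longlonglongrightarrow> 0" using x(3) by simp
  qed
  ultimately show ?thesis
    unfolding has_ito_iff[OF less_le_trans[OF ac]] using x by blast
qed

text \<open>The equations provide the integral of \<open>f\<close> only up to times before the endpoint, and possibly
  only up to almost every such time. This suffices for an approximation on the whole interval:
  approximate \<open>f\<close> up to \<open>t n\<close> and continue by \<open>0\<close>; the error after \<open>t n\<close> is the tail of the mean
  square norm of \<open>f\<close>, which vanishes as \<open>t n\<close> tends to \<open>b\<close>.\<close>

lemma approximates_extend:
  fixes f :: "real \<Rightarrow> 'w \<Rightarrow> 'b::euclidean_space"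
  assumes f: "f \<in> L2F M W a b" and ab: "a < b"
    and ex: "AE t in lborel. t \<in> {a<..<b} \<longrightarrow> (\<exists>I. has_ito_integral M W a t f I)"
  shows "\<exists>xs. approximates a b xs f"
proof -
  have jm: "jmeas M a b f" using f by (simp add: L2F_iff)
  obtain t where t: "\<And>n. a < t n" "\<And>n. t n < b" "\<And>n. \<exists>I. has_ito_integral M W a (t n) f I" "t \<longlonglongrightarrow> b"
    using dense_left_sequence[OF ab AE_interval_obtains[OF ex]] by auto
  note I = t(3)
  let ?e = "\<lambda>c zs. mean_sq M a c (\<lambda>s \<omega>. el_proc zs s \<omega> - f s \<omega>)"
  have "\<exists>zs. elem a (t n) zs \<and> ?e (t n) zs < ennreal ((1/2)^n)" for n :: nat
  proof -
    obtain xs where xs: "approximates a (t n) xs f" using I[of n] unfolding has_ito_iff[OF t(1)] by blast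
    then have "\<forall>\<^sub>F j in sequentially. ?e (t n) (xs j) < ennreal ((1/2)^n)"
      by (intro order_tendstoD(2)[of _ 0]) (auto simp: approximates_def)
    then show ?thesis using xs by (auto simp: eventually_sequentially approximates_def)
  qed
  then have "\<exists>zs. \<forall>n. elem a (t n) (zs n) \<and> ?e (t n) (zs n) < ennreal ((1/2)^n)" by (intro choice allI)
  then obtain zs where zs: "\<And>n. elem a (t n) (zs n)" "\<And>n. ?e (t n) (zs n) < ennreal ((1/2)^n)" by blast
  have "approximates a b zs f"
    unfolding approximates_def
  proof (intro conjI allI)
    show "elem a b (zs n)" for n by (rule elem_mono[OF zs(1)]) (use t(2)[of n] in auto)
    have le: "?e b (zs n) \<le> ennreal ((1/2)^n) + mean_sq M (t n) b f" for n
    proof -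
      have "?e b (zs n) = ?e (t n) (zs n) + mean_sq M (t n) b (\<lambda>s \<omega>. el_proc (zs n) s \<omega> - f s \<omega>)"
        using t(1,2)[of n] by (intro mean_sq_split jmeas_diff el_proc_jmeas[OF zs(1)] jm) auto
      also have "mean_sq M (t n) b (\<lambda>s \<omega>. el_proc (zs n) s \<omega> - f s \<omega>) = mean_sq M (t n) b f"
        unfolding mean_sq_def using el_proc_outside[OF zs(1)] by (intro nn_integral_cong) (auto simp: indicator_def)
      finally show ?thesis using zs(2)[of n] by (auto intro: add_right_mono less_imp_le)
    qed
    have "(\<lambda>n. ennreal ((1/2)^n) + mean_sq M (t n) b f) \<longlonglongrightarrow> ennreal 0 + 0"
      using f t(1) by (intro tendsto_add tendsto_ennrealI LIMSEQ_realpow_zero mean_sq_tail[OF jm _ _ t(4)])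
         (auto simp: L2F_iff less_imp_le)
    then have "(\<lambda>n. ennreal ((1/2)^n) + mean_sq M (t n) b f) \<longlonglongrightarrow> 0" by (simp only: ennreal_0 add_0)
    then show "(\<lambda>n. ?e b (zs n)) \<longlonglongrightarrow> 0" by (rule tendsto_zero_le[OF le])
  qed
  then show ?thesis by blast
qed

end

section \<open>A stochastic Fubini theorem\<close>

lemma el_sum_concat:
  "el_sum H (concat (map g [0..<m])) \<omega> = (\<Sum>i<m. el_sum H (g i) \<omega>)"
  by (induction m) (auto simp: el_sum_append)

lemma grid_cell:
  assumes h: "0 < h" and r: "a < r" "r \<le> a + real N * h"
  shows "\<exists>i<N. a + real i * h < r \<and> r \<le> a + real (Suc i) * h"
proof -
  define i where "i = (LEAST i. r \<le> a + real i * h)"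
  have ri: "r \<le> a + real i * h" unfolding i_def by (rule LeastI[of _ N]) (rule r(2))
  have iN: "i \<le> N" unfolding i_def by (rule Least_le) (rule r(2))
  have "i \<noteq> 0" using ri r by (cases "i = 0") auto
  then obtain j where j: "i = Suc j" by (cases i) auto
  have "\<not> r \<le> a + real j * h" using not_less_Least[of j "\<lambda>i. r \<le> a + real i * h"] j unfolding i_def by simp
  then show ?thesis using ri iN j by (intro exI[of _ j]) auto
qed

lemma grid_sum:
  fixes y :: "nat \<Rightarrow> 'b::real_vector"
  assumes h: "0 < h" and i: "i < N" "a + real i * h < r" "r \<le> a + real (Suc i) * h"
  shows "(\<Sum>j<N. indicator {a + real j * h<..a + real (Suc j) * h} r *\<^sub>R y j) = y i"
proof -
  have "indicator {a + real j * h<..a + real (Suc j) * h} r = (if i = j then 1 else 0 :: real)" for j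
  proof (cases "i = j")
    case False
    have "real (Suc j) * h \<le> real i * h" if "j < i" using that h by (intro mult_right_mono) auto
    moreover have "real (Suc i) * h \<le> real j * h" if "i < j" using that h by (intro mult_right_mono) auto
    ultimately show ?thesis using False i by (cases "i < j") auto
  qed (use i in auto)
  then show ?thesis using i(1) by (simp add: if_distrib[of "\<lambda>c. c *\<^sub>R _"] sum.delta cong: if_cong)
qed

lemma norm_integral_interval_le:
  fixes g :: "real \<Rightarrow> 'b::{banach, second_countable_topology}"
  assumes g: "AE r in lborel. norm (g r) \<le> K * indicator {p<..q} r" and pq: "p \<le> q" and K: "0 \<le> K"
  shows "norm (\<integral>r. g r \<partial>lborel) \<le> K * (q - p)"
proof (cases "integrable lborel g")
  case True
  have "norm (\<integral>r. g r \<partial>lborel) \<le> (\<integral>r. norm (g r) \<partial>lborel)" by (rule integral_norm_bound)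
  also have "\<dots> \<le> (\<integral>r. K * indicator {p<..q} r \<partial>lborel)"
    by (rule integral_mono_AE[OF integrable_norm[OF True] _ g]) (use pq in auto)
  also have "\<dots> = K * (q - p)" using pq by simp
  finally show ?thesis .
qed (use pq K in \<open>simp add: not_integrable_integral_eq\<close>)

text \<open>One section of a Volterra kernel. It is bounded almost everywhere only, but its primitive, taken
  backwards from \<open>t\<close>, is Lipschitz continuous and vanishes at \<open>t\<close>.\<close>

locale bounded_kernel =
  fixes a t K :: real and k :: "real \<Rightarrow> real^'n^'k"
  assumes at: "a < t" and k_meas: "set_borel_measurable lborel {a<..<t} k"
    and K: "AE r in lborel. r \<in> {a<..<t} \<longrightarrow> norm (k r) \<le> K" and K_nonneg: "0 \<le> K"
begin

definition kh :: "real \<Rightarrow> real^'n^'k" where "kh r = indicator {a<..<t} r *\<^sub>R k r"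

definition prim :: "real \<Rightarrow> real^'n^'k" where "prim s = (LINT r:{s<..<t}|lborel. k r)"

lemma kh_meas [measurable]: "kh \<in> borel_measurable borel"
  using k_meas by (simp add: kh_def[abs_def] set_borel_measurable_def)

lemma kh_bound: "AE r in lborel. norm (kh r) \<le> K * indicator {a<..<t} r"
  using K by eventually_elim (auto simp: kh_def indicator_def)

lemma kh_integrable: "integrable lborel kh"
  using integrable_bounded_on_interval[OF k_meas K] by (simp add: kh_def[abs_def] set_integrable_def)

lemma kh_ind_integrable: "A \<in> sets borel \<Longrightarrow> integrable lborel (\<lambda>r. indicator A r *\<^sub>R kh r)"
  by (intro integrable_mult_indicator kh_integrable) simp

lemma prim_eq: "a \<le> s \<Longrightarrow> prim s = (\<integral>r. indicator {s<..} r *\<^sub>R kh r \<partial>lborel)"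
  unfolding prim_def set_lebesgue_integral_def kh_def
  by (intro Bochner_Integration.integral_cong) (auto simp: indicator_def)

lemma prim_diff:
  assumes "a \<le> s" "s \<le> s'"
  shows "prim s - prim s' = (\<integral>r. indicator {s<..s'} r *\<^sub>R kh r \<partial>lborel)"
proof -
  have "prim s - prim s' = (\<integral>r. indicator {s<..} r *\<^sub>R kh r - indicator {s'<..} r *\<^sub>R kh r \<partial>lborel)"
    using assms by (simp add: prim_eq kh_ind_integrable)
  also have "\<dots> = (\<integral>r. indicator {s<..s'} r *\<^sub>R kh r \<partial>lborel)"
    using assms by (intro Bochner_Integration.integral_cong) (auto simp: indicator_def)
  finally show ?thesis .
qed

lemma prim_t [simp]: "prim t = 0"
  by (simp add: prim_def set_lebesgue_integral_def)

lemma prim_lipschitz: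
  assumes "a \<le> s" "s \<le> s'"
  shows "norm (prim s - prim s') \<le> K * (s' - s)"
  unfolding prim_diff[OF assms]
  by (rule norm_integral_interval_le, use kh_bound in eventually_elim)
     (use assms K_nonneg in \<open>auto simp: indicator_def of_bool_def split: if_splits\<close>)

lemma prim_bound: "a \<le> s \<Longrightarrow> s \<le> t \<Longrightarrow> norm (prim s) \<le> K * (t - a)"
  using prim_lipschitz[of s t] mult_left_mono[of "t - s" "t - a" K] K_nonneg by simp

lemma prim_continuous: "continuous_on {a..t} prim"
proof (rule continuous_onI)
  fix x e :: real assume x: "x \<in> {a..t}" and e: "0 < e"
  have "dist (prim y) (prim x) \<le> e" if "y \<in> {a..t}" "dist y x < e / (K + 1)" for y
  proof -
    have "norm (prim y - prim x) \<le> K * \<bar>y - x\<bar>"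
    proof (cases "y \<le> x")
      case True then show ?thesis using prim_lipschitz[of y x] that by simp
    next
      case False then show ?thesis using prim_lipschitz[of x y] x by (simp add: norm_minus_commute)
    qed
    also have "\<dots> \<le> (K + 1) * (e / (K + 1))"
      using that K_nonneg by (intro mult_mono) (auto simp: dist_real_def)
    also have "\<dots> = e" using K_nonneg by simp
    finally show ?thesis by (simp add: dist_norm)
  qed
  then show "\<exists>d>0. \<forall>y\<in>{a..t}. dist y x < d \<longrightarrow> dist (prim y) (prim x) \<le> e"
    using e K_nonneg by (intro exI[of _ "e / (K + 1)"]) auto
qed

lemma prim_measurable: "prim \<in> borel_measurable (restrict_space borel {a<..<t})"
  by (rule borel_measurable_continuous_on_restrict[OF continuous_on_subset[OF prim_continuous]]) auto

lemma abel_sum: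
  "(\<Sum>i<m. E (Suc i) *v (y (Suc i) - y i)) = E m *v y m - E 0 *v y 0 + (\<Sum>i<m. (E i - E (Suc i)) *v (y i :: real^'q))"
  for E :: "nat \<Rightarrow> real^'q^'p"
  by (induction m) (auto simp: matrix_vector_mult_diff_distrib matrix_vector_mult_diff_rdistrib)

lemma kernel_integral_limit:
  fixes V :: "nat \<Rightarrow> real \<Rightarrow> real^'n" and Y :: "real \<Rightarrow> real^'n"
  assumes u: "uniform_limit {a<..<t} V Y sequentially"
    and i: "\<And>n. integrable lborel (\<lambda>r. kh r *v V n r)" "integrable lborel (\<lambda>r. kh r *v Y r)"
  shows "(\<lambda>n. \<integral>r. kh r *v V n r \<partial>lborel) \<longlonglongrightarrow> (\<integral>r. kh r *v Y r \<partial>lborel)"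
proof (rule tendstoI)
  fix e :: real assume e: "0 < e"
  define d where "d = e / (K * (t - a) + 1)"
  have p: "0 < K * (t - a) + 1" using K_nonneg at by (smt (verit) mult_nonneg_nonneg)
  then have d: "0 < d" using e by (simp add: d_def)
  from uniform_limitD[OF u d]
  show "\<forall>\<^sub>F n in sequentially. dist (\<integral>r. kh r *v V n r \<partial>lborel) (\<integral>r. kh r *v Y r \<partial>lborel) < e"
  proof eventually_elim
    case (elim n)
    have "dist (\<integral>r. kh r *v V n r \<partial>lborel) (\<integral>r. kh r *v Y r \<partial>lborel) = norm (\<integral>r. kh r *v (V n r - Y r) \<partial>lborel)"
      using i by (simp add: dist_norm matrix_vector_mult_diff_distrib)
    also have "\<dots> \<le> (K * d) * (t - a)"
    proof (rule norm_integral_interval_le, use kh_bound in eventually_elim)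
      fix r assume b: "norm (kh r) \<le> K * indicator {a<..<t} r"
      have "norm (kh r *v (V n r - Y r)) \<le> norm (kh r) * norm (V n r - Y r)" by (rule norm_matrix_vector_le)
      also have "\<dots> \<le> K * d * indicator {a<..t} r"
      proof (cases "r \<in> {a<..<t}")
        case True
        have "norm (kh r) * norm (V n r - Y r) \<le> K * d"
          using b True elim K_nonneg by (intro mult_mono) (auto simp: dist_norm less_imp_le)
        then show ?thesis using True by simp
      next
        case False
        then have "norm (kh r) \<le> 0" using b by simp
        then show ?thesis using K_nonneg d by simp
      qed
      finally show "norm (kh r *v (V n r - Y r)) \<le> K * d * indicator {a<..t} r" .
    qed (use at d K_nonneg in auto)
    also have "\<dots> < (K * (t - a) + 1) * d" using d by (simp add: algebra_simps)
    also have "\<dots> = e" using p by (simp add: d_def)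
    finally show ?case .
  qed
qed

end

context brownian
begin

lemma elem_concat: "(\<And>i. i < m \<Longrightarrow> elem lo hi (g i)) \<Longrightarrow> elem lo hi (concat (map g [0..<m]))"
  by (induction m) auto

text \<open>Stochastic Fubini: with \<open>Y s = \<integral>\<^sub>a\<^sup>s f dW\<close> and \<open>E s = \<integral>\<^sub>s\<^sup>t k(r) dr\<close>,
  the Ito integral of \<open>E f\<close> over \<open>(a, t)\<close> is \<open>\<integral>\<^sub>a\<^sup>t k(r) Y(r) dr\<close>. Replace \<open>f\<close> by an elementary
  integrand and \<open>E\<close> by its values at the right ends of the cells of a uniform grid. The integral of the
  product is then \<open>\<Sum> E(s\<^bsub>i+1\<^esub>) (y(s\<^bsub>i+1\<^esub>) - y(s\<^bsub>i\<^esub>))\<close>, where \<open>y\<close> is the path of the elementary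
  integral, and summation by parts makes it \<open>\<integral> k(r) V(r) dr\<close>, where \<open>V\<close> is the step function with the
  values of \<open>y\<close> at the left ends; the boundary terms vanish because \<open>y(a) = 0\<close> and \<open>E(t) = 0\<close>.
  The products converge to \<open>E f\<close> in mean square, and the functions \<open>V\<close> converge to \<open>Y\<close> uniformly on
  almost every path.\<close>

lemma ito_fubini:
  fixes k :: "real \<Rightarrow> real^'n^'k" and f :: "real \<Rightarrow> 'w \<Rightarrow> real^'n"
  assumes a0: "0 \<le> a" and tb: "t \<le> b" and f: "f \<in> L2F M W a b" and Y: "continuous_version a b f ys Y"
    and k: "bounded_kernel a t K k"
  shows "has_ito_integral M W a t (\<lambda>s \<omega>. (LINT r:{s<..<t}|lborel. k r) *v f s \<omega>)
    (\<lambda>\<omega>. LINT r:{a<..<t}|lborel. k r *v Y r \<omega>)"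
proof -
  interpret bk: bounded_kernel a t K k by (rule k)
  note at = bk.at
  have f't: "f \<in> L2F M W a t" by (rule L2F_subinterval[OF f order_refl tb])
  then have jm: "jmeas M a t f" by (simp add: L2F_iff)
  have el: "elem a b (ys n)" for n using Y by (simp add: continuous_version_def approximates_def)
  define h where "h n = (t - a) / real (Suc n)" for n
  have h: "0 < h n" for n using at by (simp add: h_def)
  have hN: "a + real (Suc n) * h n = t" for n by (simp add: h_def)
  define s where "s n i = a + real i * h n" for n i
  have s0: "s n 0 = a" and sN: "s n (Suc n) = t" for n using hN by (simp_all add: s_def)
  have s_mono: "i \<le> j \<Longrightarrow> s n i \<le> s n j" for n i j
    unfolding s_def using h[of n] by (intro add_left_mono mult_right_mono) auto
  have s_a: "a \<le> s n i" for n i using s_mono[of 0 i n] by (simp add: s0)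
  have s_t: "i \<le> Suc n \<Longrightarrow> s n i \<le> t" for n i using s_mono[of i "Suc n" n] by (simp add: sN)
  have s_Suc: "s n (Suc i) = s n i + h n" for n i by (simp add: s_def algebra_simps)
  let ?E = "bk.prim"
  \<comment> \<open>\<open>cell n i\<close> is \<open>ys n\<close> restricted to one cell of the grid; \<open>Z n\<close> is the product described above\<close>
  define cell where "cell n i = el_trunc (s n (Suc i)) (ys n) @ el_map uminus (el_trunc (s n i) (ys n))" for n i
  define Z where "Z n = concat (map (\<lambda>i. el_map (\<lambda>v. ?E (s n (Suc i)) *v v) (cell n i)) [0..<Suc n])" for n
  have l: "linear (uminus :: real^'n \<Rightarrow> real^'n)" "bounded_linear (uminus :: real^'n \<Rightarrow> real^'n)"
    by (auto intro!: bounded_linear_minus bounded_linear_ident bounded_linear.linear)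
  have elt: "elem a t (el_trunc (s n i) (ys n))" if "i \<le> Suc n" for n i
    by (rule elem_mono[OF elem_trunc[OF el s_a]]) (use s_t that in auto)
  have elc: "elem a t (cell n i)" if "i < Suc n" for n i
    unfolding cell_def using that by (simp add: elt elem_map[OF l(2)])
  have elZ: "elem a t (Z n)" for n
    unfolding Z_def by (intro elem_concat elem_map[OF matrix_vector_mul_bounded_linear] elc)
  have lin: "linear ((*v) A)" for A :: "real^'n^'k" by simp
  have procZ: "el_proc (Z n) r \<omega> = ?E (s n (Suc i)) *v el_proc (ys n) r \<omega>"
    if i: "i < Suc n" "s n i < r" "r \<le> s n (Suc i)" for n i r \<omega>
  proof -
    have "el_proc (Z n) r \<omega> = (\<Sum>j<Suc n. ?E (s n (Suc j)) *v el_proc (cell n j) r \<omega>)"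
      unfolding el_proc_def Z_def el_sum_concat el_sum_map[OF lin] ..
    also have "\<dots> = (\<Sum>j<Suc n. indicator {s n j<..s n (Suc j)} r *\<^sub>R (?E (s n (Suc j)) *v el_proc (ys n) r \<omega>))"
    proof (rule sum.cong[OF refl])
      fix j
      have "s n j \<le> s n (Suc j)" by (rule s_mono) simp
      then have "el_proc (cell n j) r \<omega> = indicator {s n j<..s n (Suc j)} r *\<^sub>R el_proc (ys n) r \<omega>"
        unfolding cell_def el_proc_append el_proc_map[OF l(1)] el_proc_trunc[OF el] by (auto simp: indicator_def)
      then show "?E (s n (Suc j)) *v el_proc (cell n j) r \<omega> = indicator {s n j<..s n (Suc j)} r *\<^sub>R (?E (s n (Suc j)) *v el_proc (ys n) r \<omega>)"
        by (simp add: matrix_vector_mult_scaleR)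
    qed
    also have "\<dots> = ?E (s n (Suc i)) *v el_proc (ys n) r \<omega>"
      using grid_sum[OF h[of n], of i "Suc n" a r "\<lambda>j. ?E (s n (Suc j)) *v el_proc (ys n) r \<omega>"] i
      by (simp only: s_def)
    finally show ?thesis .
  qed
  let ?e = "\<lambda>n. mean_sq M a t (\<lambda>r \<omega>. el_proc (ys n) r \<omega> - f r \<omega>)"
  define C where "C = K * (t - a)"
  have approx: "approximates a t Z (\<lambda>r \<omega>. ?E r *v f r \<omega>)"
    unfolding approximates_def
  proof (intro conjI allI elZ)
    have bound: "mean_sq M a t (\<lambda>r \<omega>. el_proc (Z n) r \<omega> - ?E r *v f r \<omega>)
       \<le> ennreal (2 * C\<^sup>2) * ?e n + ennreal (2 * (K * h n)\<^sup>2) * mean_sq M a t f" for n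
    proof (rule mean_sq_bound[OF AE_I2 jmeas_diff[OF el_proc_jmeas[OF el] jm] jm], intro impI ballI)
      fix r \<omega> assume r: "r \<in> {a<..<t}"
      obtain i where i: "i < Suc n" "s n i < r" "r \<le> s n (Suc i)"
        using grid_cell[OF h[of n], of a r "Suc n"] hN[of n] r unfolding s_def by auto
      have "el_proc (Z n) r \<omega> - ?E r *v f r \<omega> =
        ?E (s n (Suc i)) *v (el_proc (ys n) r \<omega> - f r \<omega>) - (?E r - ?E (s n (Suc i))) *v f r \<omega>"
        unfolding procZ[OF i] by (simp add: matrix_vector_mult_diff_distrib matrix_vector_mult_diff_rdistrib)
      also have "norm \<dots> \<le> norm (?E (s n (Suc i))) * norm (el_proc (ys n) r \<omega> - f r \<omega>) + norm (?E r - ?E (s n (Suc i))) * norm (f r \<omega>)"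
        by (intro order_trans[OF norm_triangle_ineq4] add_mono norm_matrix_vector_le)
      also have "\<dots> \<le> C * norm (el_proc (ys n) r \<omega> - f r \<omega>) + (K * h n) * norm (f r \<omega>)"
      proof (intro add_mono mult_right_mono norm_ge_zero)
        show "norm (?E (s n (Suc i))) \<le> C" unfolding C_def by (rule bk.prim_bound) (use s_a s_t i in auto)
        have "norm (?E r - ?E (s n (Suc i))) \<le> K * (s n (Suc i) - r)" by (rule bk.prim_lipschitz) (use r i in auto)
        also have "\<dots> \<le> K * h n" using i s_Suc[of n i] bk.K_nonneg by (intro mult_left_mono) auto
        finally show "norm (?E r - ?E (s n (Suc i))) \<le> K * h n" .
      qed
      finally show "norm (el_proc (Z n) r \<omega> - ?E r *v f r \<omega>) \<le> C * norm (el_proc (ys n) r \<omega> - f r \<omega>) + (K * h n) * norm (f r \<omega>)" .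
    qed
    have e0: "?e \<longlonglongrightarrow> 0"
      by (rule tendsto_zero_le[OF mean_sq_mono_interval[of a a t b]])
         (use Y tb in \<open>auto simp: continuous_version_def approximates_def\<close>)
    have h0: "h \<longlonglongrightarrow> 0"
      unfolding h_def using LIMSEQ_Suc[OF lim_const_over_n[of "t - a"]] by simp
    have "(\<lambda>n. ennreal (2 * (K * h n)\<^sup>2)) \<longlonglongrightarrow> ennreal (2 * (K * 0)\<^sup>2)"
      by (intro tendsto_ennrealI tendsto_intros h0)
    then have "(\<lambda>n. mean_sq M a t f * ennreal (2 * (K * h n)\<^sup>2)) \<longlonglongrightarrow> mean_sq M a t f * 0"
      using f't by (intro ennreal_tendsto_cmult) (auto simp: L2F_iff)
    moreover have "(\<lambda>n. ennreal (2 * C\<^sup>2) * ?e n) \<longlonglongrightarrow> ennreal (2 * C\<^sup>2) * 0"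
      by (intro ennreal_tendsto_cmult e0) simp
    ultimately have "(\<lambda>n. ennreal (2 * C\<^sup>2) * ?e n + ennreal (2 * (K * h n)\<^sup>2) * mean_sq M a t f) \<longlonglongrightarrow> 0"
      using tendsto_add by (fastforce simp: mult.commute)
    then show "(\<lambda>n. mean_sq M a t (\<lambda>r \<omega>. el_proc (Z n) r \<omega> - ?E r *v f r \<omega>)) \<longlonglongrightarrow> 0"
      by (rule tendsto_zero_le[OF bound])
  qed
  define y where "y n r \<omega> = el_int W (el_trunc r (ys n)) \<omega>" for n r \<omega>
  define V where "V n \<omega> r = (\<Sum>i<Suc n. indicator {s n i<..s n (Suc i)} r *\<^sub>R y n (s n i) \<omega>)" for n \<omega> r
  have y_a: "y n a \<omega> = 0" for n \<omega>
    unfolding y_def by (rule el_int_trunc_start[OF el])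
  have V_int: "has_bochner_integral lborel (\<lambda>r. bk.kh r *v V n \<omega> r) (el_int W (Z n) \<omega>)" for n \<omega>
  proof -
    have "el_int W (Z n) \<omega> = (\<Sum>i<Suc n. ?E (s n (Suc i)) *v (y n (s n (Suc i)) \<omega> - y n (s n i) \<omega>))"
      unfolding el_int_def Z_def el_sum_concat el_sum_map[OF lin] cell_def el_sum_append el_sum_map[OF l(1)] y_def
      by simp
    also have "\<dots> = (\<Sum>i<Suc n. (?E (s n i) - ?E (s n (Suc i))) *v y n (s n i) \<omega>)"
      unfolding bk.abel_sum[of "\<lambda>i. ?E (s n i)" "\<lambda>i. y n (s n i) \<omega>"] by (simp add: sN s0 y_a)
    finally have eq: "el_int W (Z n) \<omega> = (\<Sum>i<Suc n. (?E (s n i) - ?E (s n (Suc i))) *v y n (s n i) \<omega>)" .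
    have "has_bochner_integral lborel (\<lambda>r. \<Sum>i<Suc n. (indicator {s n i<..s n (Suc i)} r *\<^sub>R bk.kh r) *v y n (s n i) \<omega>)
       (\<Sum>i<Suc n. (?E (s n i) - ?E (s n (Suc i))) *v y n (s n i) \<omega>)"
    proof (rule has_bochner_integral_sum)
      fix i
      have "has_bochner_integral lborel (\<lambda>r. indicator {s n i<..s n (Suc i)} r *\<^sub>R bk.kh r) (?E (s n i) - ?E (s n (Suc i)))"
        using bk.prim_diff[OF s_a s_mono[of i "Suc i" n]] bk.kh_ind_integrable by (simp add: has_bochner_integral_iff)
      then show "has_bochner_integral lborel (\<lambda>r. (indicator {s n i<..s n (Suc i)} r *\<^sub>R bk.kh r) *v y n (s n i) \<omega>)
         ((?E (s n i) - ?E (s n (Suc i))) *v y n (s n i) \<omega>)"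
        by (rule has_bochner_integral_bounded_linear[OF bounded_bilinear.bounded_linear_left[OF bounded_bilinear_matrix_vector]])
    qed
    moreover have "(\<Sum>i<Suc n. (indicator {s n i<..s n (Suc i)} r *\<^sub>R bk.kh r) *v y n (s n i) \<omega>) = bk.kh r *v V n \<omega> r" for r
      unfolding V_def bounded_bilinear.sum_right[OF bounded_bilinear_matrix_vector]
      by (intro sum.cong refl) (simp add: scaleR_matrix_vector_assoc[symmetric] matrix_vector_mult_scaleR)
    ultimately show ?thesis unfolding eq by simp
  qed
  have lim: "AE \<omega> in M. (\<lambda>n. el_int W (Z n) \<omega>) \<longlonglongrightarrow> (LINT r:{a<..<t}|lborel. k r *v Y r \<omega>)"
  proof -
    have "AE \<omega> in M. continuous_on {a..b} (\<lambda>t. Y t \<omega>) \<and>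
        uniform_limit {a..b} (\<lambda>j t. el_int W (el_trunc t (ys j)) \<omega>) (\<lambda>t. Y t \<omega>) sequentially"
      using Y by (simp add: continuous_version_def)
    then show ?thesis
    proof eventually_elim
      case (elim \<omega>)
      have cY: "continuous_on {a..t} (\<lambda>r. Y r \<omega>)" using elim tb by (auto intro: continuous_on_subset)
      have uY: "uniform_limit {a..t} (\<lambda>n r. y n r \<omega>) (\<lambda>r. Y r \<omega>) sequentially"
        unfolding y_def using elim tb by (auto intro: uniform_limit_on_subset)
      have "uniform_limit {a<..<t} (\<lambda>n r. V n \<omega> r) (\<lambda>r. Y r \<omega>) sequentially"
      proof (rule uniform_limitI)
        fix e :: real assume "0 < e"
        then have e2: "0 < e / 2" by simp
        obtain d where d: "0 < d" "\<And>x x'. x \<in> {a..t} \<Longrightarrow> x' \<in> {a..t} \<Longrightarrow> dist x' x < d \<Longrightarrow> dist (Y x' \<omega>) (Y x \<omega>) < e / 2"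
          using compact_uniformly_continuous[OF cY compact_Icc] e2 unfolding uniformly_continuous_on_def by meson
        have h0: "h \<longlonglongrightarrow> 0"
          unfolding h_def using LIMSEQ_Suc[OF lim_const_over_n[of "t - a"]] by simp
        from order_tendstoD(2)[OF h0 d(1)] uniform_limitD[OF uY e2]
        show "\<forall>\<^sub>F n in sequentially. \<forall>r\<in>{a<..<t}. dist (V n \<omega> r) (Y r \<omega>) < e"
        proof (eventually_elim, intro ballI)
          fix n r assume hd: "h n < d" and u: "\<forall>r\<in>{a..t}. dist (y n r \<omega>) (Y r \<omega>) < e / 2" and r: "r \<in> {a<..<t}"
          obtain i where i: "i < Suc n" "s n i < r" "r \<le> s n (Suc i)"
            using grid_cell[OF h[of n], of a r "Suc n"] hN[of n] r unfolding s_def by auto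
          have "V n \<omega> r = y n (s n i) \<omega>"
            unfolding V_def using grid_sum[OF h[of n], of i "Suc n" a r "\<lambda>i. y n (s n i) \<omega>"] i by (simp only: s_def)
          then have "dist (V n \<omega> r) (Y r \<omega>) \<le> dist (y n (s n i) \<omega>) (Y (s n i) \<omega>) + dist (Y (s n i) \<omega>) (Y r \<omega>)"
            by (simp add: dist_triangle)
          also have "\<dots> < e / 2 + e / 2"
          proof (intro add_strict_mono d(2))
            show "dist (y n (s n i) \<omega>) (Y (s n i) \<omega>) < e / 2" using u s_a s_t[of i n] i by auto
            show "dist (s n i) r < d" using i s_Suc[of n i] hd by (simp add: dist_real_def)
          qed (use r s_a s_t[of i n] i in auto)
          finally show "dist (V n \<omega> r) (Y r \<omega>) < e" by simp
        qed
      qed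
      moreover have "integrable lborel (\<lambda>r. bk.kh r *v Y r \<omega>)"
      proof -
        obtain B where "\<forall>v\<in>(\<lambda>r. Y r \<omega>) ` {a..t}. norm v \<le> B"
          using compact_imp_bounded[OF compact_continuous_image[OF cY compact_Icc]] unfolding bounded_iff by blast
        then have B: "\<And>r. r \<in> {a..t} \<Longrightarrow> norm (Y r \<omega>) \<le> B" by simp
        have m: "(\<lambda>r. indicator {a..t} r *\<^sub>R Y r \<omega>) \<in> borel_measurable borel"
          by (rule borel_measurable_continuous_on_indicator[OF _ cY]) simp
        have eq: "bk.kh r *v Y r \<omega> = bk.kh r *v (indicator {a..t} r *\<^sub>R Y r \<omega>)" for r
          by (simp add: bk.kh_def indicator_def)
        show ?thesis
        proof (rule Bochner_Integration.integrable_bound)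
          show "integrable lborel (\<lambda>r. B * norm (bk.kh r))" using bk.kh_integrable by simp
          show "(\<lambda>r. bk.kh r *v Y r \<omega>) \<in> borel_measurable lborel" unfolding eq using m by measurable
          show "AE r in lborel. norm (bk.kh r *v Y r \<omega>) \<le> norm (B * norm (bk.kh r))"
          proof (rule AE_I2)
            fix r
            have "norm (bk.kh r *v Y r \<omega>) \<le> norm (bk.kh r) * norm (Y r \<omega>)" by (rule norm_matrix_vector_le)
            also have "\<dots> \<le> norm (bk.kh r) * \<bar>B\<bar>"
            proof (cases "r \<in> {a..t}")
              case True then show ?thesis using B[OF True] by (intro mult_left_mono) auto
            qed (auto simp: bk.kh_def)
            finally show "norm (bk.kh r *v Y r \<omega>) \<le> norm (B * norm (bk.kh r))" by (simp add: abs_mult mult.commute)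
          qed
        qed
      qed
      ultimately have "(\<lambda>n. \<integral>r. bk.kh r *v V n \<omega> r \<partial>lborel) \<longlonglongrightarrow> (\<integral>r. bk.kh r *v Y r \<omega> \<partial>lborel)"
        using V_int[of _ \<omega>] by (intro bk.kernel_integral_limit) (auto simp: has_bochner_integral_iff)
      moreover have "(\<integral>r. bk.kh r *v V n \<omega> r \<partial>lborel) = el_int W (Z n) \<omega>" for n
        using V_int[of n \<omega>] by (simp add: has_bochner_integral_iff)
      moreover have "(\<integral>r. bk.kh r *v Y r \<omega> \<partial>lborel) = (LINT r:{a<..<t}|lborel. k r *v Y r \<omega>)"
        unfolding set_lebesgue_integral_def bk.kh_def by (simp add: scaleR_matrix_vector_assoc)
      ultimately show ?case by simp
    qed
  qed
  have E_L2: "(\<lambda>r \<omega>. ?E r *v f r \<omega>) \<in> L2F M W a t"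
    by (rule L2F_matrix[OF bk.prim_measurable _ f't, of C]) (use bk.prim_bound in \<open>auto simp: C_def\<close>)
  define J where "J \<omega> = lim (\<lambda>n. el_int W (Z n) \<omega>)" for \<omega>
  have J_meas: "J \<in> borel_measurable M"
    unfolding J_def by (intro borel_measurable_lim_metric el_int_measurable_M[OF elZ a0])
  have J_eq: "AE \<omega> in M. J \<omega> = (LINT r:{a<..<t}|lborel. k r *v Y r \<omega>)"
    using lim by eventually_elim (simp add: J_def limI)
  have "has_ito_integral M W a t (\<lambda>r \<omega>. ?E r *v f r \<omega>) (\<lambda>\<omega>. LINT r:{a<..<t}|lborel. k r *v Y r \<omega>)"
  proof (rule has_ito_of_AE_limit[OF a0 at E_L2 approx _ lim])
    show "(\<lambda>\<omega>. LINT r:{a<..<t}|lborel. k r *v Y r \<omega>) \<in> borel_measurable M"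
      by (rule borel_measurable_AE_cong[OF J_meas], use J_eq in eventually_elim) simp
  qed
  then show ?thesis by (simp add: bk.prim_def)
qed

end

section \<open>Deterministic Volterra and delay operators\<close>

lemma set_integrable_matrix:
  fixes H :: "real \<Rightarrow> real^'n^'k" and w :: "real \<Rightarrow> real^'n"
  assumes A: "A \<in> sets borel" and H: "set_borel_measurable lborel A H" "AE s in lborel. s \<in> A \<longrightarrow> norm (H s) \<le> K"
    and w: "set_integrable lborel A w"
  shows "set_integrable lborel A (\<lambda>s. H s *v w s)"
  unfolding set_integrable_def
proof (rule Bochner_Integration.integrable_bound)
  show "integrable lborel (\<lambda>s. K * norm (indicator A s *\<^sub>R w s))"
    by (intro integrable_mult_right integrable_norm w[unfolded set_integrable_def])
  have [measurable]: "(\<lambda>s. indicator A s *\<^sub>R H s) \<in> borel_measurable borel" "(\<lambda>s. indicator A s *\<^sub>R w s) \<in> borel_measurable borel"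
    using H(1) borel_measurable_integrable[OF w[unfolded set_integrable_def]] by (simp_all add: set_borel_measurable_def)
  have "(\<lambda>s. (indicator A s *\<^sub>R H s) *v (indicator A s *\<^sub>R w s)) \<in> borel_measurable lborel" by measurable
  also have "(\<lambda>s. (indicator A s *\<^sub>R H s) *v (indicator A s *\<^sub>R w s)) = (\<lambda>s. indicator A s *\<^sub>R (H s *v w s))"
    by (auto simp: indicator_def)
  finally show "(\<lambda>s. indicator A s *\<^sub>R (H s *v w s)) \<in> borel_measurable lborel" .
  show "AE s in lborel. norm (indicator A s *\<^sub>R (H s *v w s)) \<le> norm (K * norm (indicator A s *\<^sub>R w s))"
    using H(2)
  proof eventually_elim
    case (elim s)
    show ?case
    proof (cases "s \<in> A")
      case True
      have "norm (H s *v w s) \<le> norm (H s) * norm (w s)" by (rule norm_matrix_vector_le)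
      also have "\<dots> \<le> \<bar>K\<bar> * norm (w s)" using elim True by (intro mult_right_mono) auto
      finally show ?thesis using True by (simp add: abs_mult)
    qed simp
  qed
qed

lemma set_integral_matrix_left:
  fixes w :: "real \<Rightarrow> real^'n"
  assumes "set_integrable lborel S w"
  shows "(LINT s:S|lborel. (A::real^'n^'k) *v w s) = A *v (LINT s:S|lborel. w s)"
  using integral_bounded_linear[OF matrix_vector_mul_bounded_linear assms[unfolded set_integrable_def], of A]
  by (simp add: set_lebesgue_integral_def matrix_vector_mult_scaleR)

text \<open>Fubini on the triangle \<open>a < s < r < t\<close>: a control accumulated up to time \<open>r\<close> and integrated over
  \<open>r\<close> acts on its value at \<open>s\<close> through the kernel integrated over \<open>(s, t)\<close>. The kernel is bounded
  almost everywhere and \<open>w\<close> is integrable, so the integrand on the triangle is integrable.\<close>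

lemma volterra_swap:
  fixes H :: "real \<Rightarrow> real \<Rightarrow> real^'n^'k" and w :: "real \<Rightarrow> real^'n"
  assumes H: "(\<lambda>(r, s). indicator {a<..<r} s *\<^sub>R indicator {a<..<t} r *\<^sub>R H r s) \<in> borel_measurable (borel \<Otimes>\<^sub>M borel)"
    and K: "AE r in lborel. AE s in lborel. a < s \<and> s < r \<and> r < t \<longrightarrow> norm (H r s) \<le> K"
    and w: "set_integrable lborel {a<..<t} w"
  shows "set_integrable lborel {a<..<t} (\<lambda>r. LINT s:{a<..<r}|lborel. H r s *v w s)"
    and "set_integrable lborel {a<..<t} (\<lambda>s. (LINT r:{s<..<t}|lborel. H r s) *v w s)"
    and "(LINT r:{a<..<t}|lborel. LINT s:{a<..<r}|lborel. H r s *v w s)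
       = (LINT s:{a<..<t}|lborel. (LINT r:{s<..<t}|lborel. H r s) *v w s)"
proof -
  define h where "h r s = indicator {a<..<r} s *\<^sub>R indicator {a<..<t} r *\<^sub>R H r s" for r s
  define w' where "w' s = indicator {a<..<t} s *\<^sub>R w s" for s
  have hm [measurable]: "(\<lambda>(r, s). h r s) \<in> borel_measurable (borel \<Otimes>\<^sub>M borel)" using H by (simp add: h_def)
  have hm2 [measurable]: "(\<lambda>(r, s). h s r) \<in> borel_measurable (borel \<Otimes>\<^sub>M borel)"
    using measurable_compose[OF measurable_pair_swap' hm] by (simp add: case_prod_beta')
  have w'i: "integrable lborel w'" using w by (simp add: set_integrable_def w'_def[abs_def])
  then have [measurable]: "w' \<in> borel_measurable borel" by auto
  have hK: "AE r in lborel. AE s in lborel. norm (h r s) \<le> \<bar>K\<bar> * indicator {a<..<t} r"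
    using K by eventually_elim (auto simp: h_def indicator_def elim!: eventually_mono)
  have hK2: "AE s in lborel. AE r in lborel. norm (h r s) \<le> \<bar>K\<bar> * indicator {a<..<t} r"
  proof -
    have *: "{x \<in> space (lborel \<Otimes>\<^sub>M lborel). norm (h (fst x) (snd x)) \<le> \<bar>K\<bar> * indicator {a<..<t} (fst x)} \<in> sets (lborel \<Otimes>\<^sub>M lborel)"
    proof -
      have "{x \<in> space (borel \<Otimes>\<^sub>M borel). norm (h (fst x) (snd x)) \<le> \<bar>K\<bar> * indicator {a<..<t} (fst x)} \<in> sets (borel \<Otimes>\<^sub>M borel)"
        by measurable
      then show ?thesis by (simp add: space_pair_measure cong: sets_pair_measure_cong)
    qed
    show ?thesis using lborel_pair.AE_commute[OF *] hK by simp
  qed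
  define \<Phi> where "\<Phi> r s = h r s *v w' s" for r s
  have \<Phi>m: "(\<lambda>(r, s). \<Phi> r s) \<in> borel_measurable (borel \<Otimes>\<^sub>M borel)" unfolding \<Phi>_def by measurable
  have sets_eq: "borel_measurable (lborel \<Otimes>\<^sub>M lborel) = borel_measurable (borel \<Otimes>\<^sub>M borel :: (real \<times> real) measure)"
    by (intro measurable_cong_sets sets_pair_measure_cong) auto
  have \<Phi>_bound: "AE r in lborel. AE s in lborel. norm (\<Phi> r s) \<le> \<bar>K\<bar> * indicator {a<..<t} r * norm (w' s)"
    using hK
  proof eventually_elim
    case (elim r)
    then show ?case
    proof eventually_elim
      case (elim s)
      have "norm (\<Phi> r s) \<le> norm (h r s) * norm (w' s)" unfolding \<Phi>_def by (rule norm_matrix_vector_le)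
      also have "\<dots> \<le> \<bar>K\<bar> * indicator {a<..<t} r * norm (w' s)" using elim by (intro mult_right_mono) auto
      finally show ?case .
    qed
  qed
  have m1: "\<Phi> r \<in> borel_measurable lborel" for r using measurable_Pair2[OF \<Phi>m, of r] by simp
  have i1: "AE r in lborel. integrable lborel (\<Phi> r)"
    using \<Phi>_bound
  proof eventually_elim
    case (elim r)
    show ?case
      by (rule Bochner_Integration.integrable_bound[OF integrable_mult_right[OF integrable_norm[OF w'i], of "\<bar>K\<bar> * indicator {a<..<t} r"] m1])
         (use elim in \<open>eventually_elim, auto simp: abs_mult\<close>)
  qed
  have i2: "integrable lborel (\<lambda>r. \<integral>s. norm (\<Phi> r s) \<partial>lborel)"
  proof (rule Bochner_Integration.integrable_bound)
    show "integrable lborel (\<lambda>r. \<bar>K\<bar> * (\<integral>s. norm (w' s) \<partial>lborel) * indicator {a<..<t} r)"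
      by (cases "a \<le> t") (auto simp: less_top[symmetric])
    have "(\<lambda>(r, s). norm (\<Phi> r s)) \<in> borel_measurable (lborel \<Otimes>\<^sub>M lborel)"
      unfolding sets_eq using \<Phi>m by measurable
    then show "(\<lambda>r. \<integral>s. norm (\<Phi> r s) \<partial>lborel) \<in> borel_measurable lborel"
      by (rule lborel.borel_measurable_lebesgue_integral)
    show "AE r in lborel. norm (\<integral>s. norm (\<Phi> r s) \<partial>lborel) \<le> norm (\<bar>K\<bar> * (\<integral>s. norm (w' s) \<partial>lborel) * indicator {a<..<t} r)"
      using \<Phi>_bound i1
    proof eventually_elim
      case (elim r)
      have "(\<integral>s. norm (\<Phi> r s) \<partial>lborel) \<le> (\<integral>s. \<bar>K\<bar> * indicator {a<..<t} r * norm (w' s) \<partial>lborel)"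
        using elim w'i by (intro integral_mono_AE) auto
      then show ?case by (simp add: abs_mult mult_ac)
    qed
  qed
  have int: "integrable (lborel \<Otimes>\<^sub>M lborel) (\<lambda>(r, s). \<Phi> r s)"
    by (rule lborel_pair.Fubini_integrable) (use \<Phi>m i1 i2 sets_eq in auto)
  have in1: "(\<integral>s. \<Phi> r s \<partial>lborel) = indicator {a<..<t} r *\<^sub>R (LINT s:{a<..<r}|lborel. H r s *v w s)" for r
  proof -
    have "(\<integral>s. \<Phi> r s \<partial>lborel) = (\<integral>s. indicator {a<..<t} r *\<^sub>R indicator {a<..<r} s *\<^sub>R (H r s *v w s) \<partial>lborel)"
      by (intro Bochner_Integration.integral_cong) (auto simp: \<Phi>_def h_def w'_def indicator_def)
    then show ?thesis by (cases "r \<in> {a<..<t}") (simp_all add: set_lebesgue_integral_def)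
  qed
  have h_w': "(\<integral>r. h r s \<partial>lborel) *v w' s = indicator {a<..<t} s *\<^sub>R ((LINT r:{s<..<t}|lborel. H r s) *v w s)" for s
  proof (cases "s \<in> {a<..<t}")
    case True
    have "(\<integral>r. h r s \<partial>lborel) = (LINT r:{s<..<t}|lborel. H r s)"
      unfolding set_lebesgue_integral_def h_def using True by (intro Bochner_Integration.integral_cong) (auto simp: indicator_def)
    then show ?thesis using True by (simp add: w'_def)
  qed (simp add: w'_def)
  have in2: "AE s in lborel. (\<integral>r. \<Phi> r s \<partial>lborel) = indicator {a<..<t} s *\<^sub>R ((LINT r:{s<..<t}|lborel. H r s) *v w s)"
    using hK2
  proof eventually_elim
    case (elim s)
    have hi: "integrable lborel (\<lambda>r. h r s)"
    proof (rule Bochner_Integration.integrable_bound)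
      show "integrable lborel (\<lambda>r. \<bar>K\<bar> * indicator {a<..<t} r)"
        by (cases "a \<le> t") (auto simp: less_top[symmetric])
      show "(\<lambda>r. h r s) \<in> borel_measurable lborel" using measurable_Pair1[OF hm, of s] by simp
      show "AE r in lborel. norm (h r s) \<le> norm (\<bar>K\<bar> * indicator {a<..<t} r)"
        using elim by eventually_elim (auto simp: abs_mult)
    qed
    have "(\<integral>r. \<Phi> r s \<partial>lborel) = (\<integral>r. h r s \<partial>lborel) *v w' s"
      unfolding \<Phi>_def
      using integral_bounded_linear[OF bounded_bilinear.bounded_linear_left[OF bounded_bilinear_matrix_vector, of "w' s"] hi] by simp
    then show ?case by (simp only: h_w')
  qed
  show "set_integrable lborel {a<..<t} (\<lambda>r. LINT s:{a<..<r}|lborel. H r s *v w s)"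
    unfolding set_integrable_def in1[symmetric] using lborel_pair.integrable_fst[OF int] .
  show "set_integrable lborel {a<..<t} (\<lambda>s. (LINT r:{s<..<t}|lborel. H r s) *v w s)"
    unfolding set_integrable_def
  proof (rule integrable_cong_AE_imp[OF lborel_pair.integrable_snd[OF int]])
    have m: "(\<lambda>s. \<integral>r. h r s \<partial>lborel) \<in> borel_measurable lborel"
      by (rule lborel.borel_measurable_lebesgue_integral, unfold sets_eq) (rule hm2)
    then have "(\<lambda>s. (\<integral>r. h r s \<partial>lborel) *v w' s) \<in> borel_measurable lborel" by measurable
    then show "(\<lambda>s. indicator {a<..<t} s *\<^sub>R ((LINT r:{s<..<t}|lborel. H r s) *v w s)) \<in> borel_measurable lborel"
      by (simp only: h_w')
  qed (use in2 in auto)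
  have "(LINT r:{a<..<t}|lborel. LINT s:{a<..<r}|lborel. H r s *v w s) = (\<integral>r. (\<integral>s. \<Phi> r s \<partial>lborel) \<partial>lborel)"
    unfolding in1 by (simp add: set_lebesgue_integral_def)
  also have "\<dots> = (\<integral>s. (\<integral>r. \<Phi> r s \<partial>lborel) \<partial>lborel)"
    using lborel_pair.Fubini_integral[OF int] by simp
  also have "\<dots> = (LINT s:{a<..<t}|lborel. (LINT r:{s<..<t}|lborel. H r s) *v w s)"
    unfolding set_lebesgue_integral_def[of lborel "{a<..<t}"]
    by (rule integral_cong_AE[OF _ _ in2])
       (use borel_measurable_integrable[OF lborel_pair.integrable_snd[OF int]]
          \<open>set_integrable lborel {a<..<t} (\<lambda>s. (LINT r:{s<..<t}|lborel. H r s) *v w s)\<close> in \<open>auto simp: set_integrable_def\<close>)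
  finally show "(LINT r:{a<..<t}|lborel. LINT s:{a<..<r}|lborel. H r s *v w s)
       = (LINT s:{a<..<t}|lborel. (LINT r:{s<..<t}|lborel. H r s) *v w s)" .
qed

text \<open>A function with delay splits at \<open>a + \<delta>\<close> into its initial part and a shifted function. The
  splitting point is a null set, and the substitution \<open>s \<mapsto> s + \<delta>\<close> removes the shift.\<close>

lemma shift_integrable:
  fixes p q :: "real \<Rightarrow> 'b::euclidean_space"
  assumes \<delta>: "0 < \<delta>" and p: "set_integrable lborel {a<..<a + \<delta>} p" and q: "set_integrable lborel {a<..<t} q"
  shows "set_integrable lborel {a<..<t} (\<lambda>s. if s - \<delta> \<le> a then p s else q (s - \<delta>))"
proof -
  let ?h = "\<lambda>s. if s - \<delta> \<le> a then p s else q (s - \<delta>)"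
  have q1: "integrable lborel (\<lambda>s. indicator {a+\<delta><..<t+\<delta>} s *\<^sub>R q (s - \<delta>))"
  proof -
    have "integrable lborel (\<lambda>s. indicator {a<..<t} ((- \<delta>) + 1 * s) *\<^sub>R q ((- \<delta>) + 1 * s))"
      by (rule lborel_integrable_real_affine) (use q in \<open>simp_all add: set_integrable_def\<close>)
    also have "(\<lambda>s. indicator {a<..<t} ((- \<delta>) + 1 * s) *\<^sub>R q ((- \<delta>) + 1 * s)) = (\<lambda>s. indicator {a+\<delta><..<t+\<delta>} s *\<^sub>R q (s - \<delta>))"
      by (auto simp: fun_eq_iff indicator_def algebra_simps)
    finally show ?thesis .
  qed
  have q2: "set_integrable lborel {a+\<delta><..<t} (\<lambda>s. q (s - \<delta>))"
    by (rule set_integrable_subset[OF q1[folded set_integrable_def]]) (use \<delta> in auto)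
  have p2: "set_integrable lborel {a<..<min (a+\<delta>) t} p"
    by (rule set_integrable_subset[OF p]) auto
  let ?f = "\<lambda>s. indicator {a<..<min (a+\<delta>) t} s *\<^sub>R p s" and ?g = "\<lambda>s. indicator {a+\<delta><..<t} s *\<^sub>R q (s - \<delta>)"
  have f: "integrable lborel ?f" and g: "integrable lborel ?g" using p2 q2 by (simp_all add: set_integrable_def)
  have eq: "?f s + ?g s + indicator {a+\<delta>} s *\<^sub>R (indicator {a<..<t} (a+\<delta>) *\<^sub>R ?h (a+\<delta>)) = indicator {a<..<t} s *\<^sub>R ?h s" for s
    using \<delta> by (cases s "a + \<delta>" rule: linorder_cases) (auto simp: indicator_def algebra_simps)
  have "(\<lambda>s. ?f s + ?g s + indicator {a+\<delta>} s *\<^sub>R (indicator {a<..<t} (a+\<delta>) *\<^sub>R ?h (a+\<delta>))) \<in> borel_measurable lborel"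
    using borel_measurable_integrable[OF f] borel_measurable_integrable[OF g] by measurable
  then have m: "(\<lambda>s. indicator {a<..<t} s *\<^sub>R ?h s) \<in> borel_measurable lborel" unfolding eq .
  show ?thesis
    unfolding set_integrable_def
  proof (rule integrable_cong_AE_imp[OF Bochner_Integration.integrable_add[OF f g] m])
    show "AE s in lborel. ?f s + ?g s = indicator {a<..<t} s *\<^sub>R ?h s"
      using AE_lborel_singleton[of "a + \<delta>"]
    proof eventually_elim
      case (elim s)
      then have "indicator {a + \<delta>} s = (0 :: real)" by simp
      then show ?case using eq[of s] by (simp only: scaleR_zero_left add_0_right)
    qed
  qed
qed

lemma shift_split:
  fixes p q :: "real \<Rightarrow> 'b::euclidean_space"
  assumes \<delta>: "0 < \<delta>" and h: "set_integrable lborel {a<..<t} (\<lambda>s. if s - \<delta> \<le> a then p s else q (s - \<delta>))"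
  shows "set_integrable lborel {a<..<min (a + \<delta>) t} p"
    and "set_integrable lborel {a<..<t} (\<lambda>s. indicator {..<t} (s + \<delta>) *\<^sub>R q s)"
    and "(LINT s:{a<..<t}|lborel. if s - \<delta> \<le> a then p s else q (s - \<delta>))
      = (LINT s:{a<..<min (a + \<delta>) t}|lborel. p s) + (LINT s:{a<..<t}|lborel. indicator {..<t} (s + \<delta>) *\<^sub>R q s)"
proof -
  let ?h = "\<lambda>s. if s - \<delta> \<le> a then p s else q (s - \<delta>)"
  let ?f = "\<lambda>s. indicator {a<..<min (a+\<delta>) t} s *\<^sub>R p s" and ?g = "\<lambda>s. indicator {a+\<delta><..<t} s *\<^sub>R q (s - \<delta>)"
  have f: "integrable lborel ?f"
  proof -
    have "integrable lborel (\<lambda>s. indicator {a<..<min (a+\<delta>) t} s *\<^sub>R ?h s)"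
      by (fold set_integrable_def, rule set_integrable_subset[OF h]) auto
    also have "(\<lambda>s. indicator {a<..<min (a+\<delta>) t} s *\<^sub>R ?h s) = ?f" by (auto simp: fun_eq_iff indicator_def)
    finally show ?thesis .
  qed
  have g: "integrable lborel ?g"
  proof -
    have "integrable lborel (\<lambda>s. indicator {a+\<delta><..<t} s *\<^sub>R ?h s)"
      by (fold set_integrable_def, rule set_integrable_subset[OF h]) (use \<delta> in auto)
    also have "(\<lambda>s. indicator {a+\<delta><..<t} s *\<^sub>R ?h s) = ?g" by (auto simp: fun_eq_iff indicator_def)
    finally show ?thesis .
  qed
  have geq: "?g (\<delta> + 1 * s) = indicator {a<..<t} s *\<^sub>R (indicator {..<t} (s + \<delta>) *\<^sub>R q s)" for s
    using \<delta> by (auto simp: indicator_def algebra_simps)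
  show "set_integrable lborel {a<..<min (a + \<delta>) t} p" using f by (simp add: set_integrable_def)
  show "set_integrable lborel {a<..<t} (\<lambda>s. indicator {..<t} (s + \<delta>) *\<^sub>R q s)"
    using lborel_integrable_real_affine[OF g, of 1 \<delta>] unfolding geq by (simp add: set_integrable_def)
  have sh: "(\<integral>s. ?g s \<partial>lborel) = (LINT s:{a<..<t}|lborel. indicator {..<t} (s + \<delta>) *\<^sub>R q s)"
    using lborel_integral_real_affine[of 1 ?g \<delta>] unfolding geq by (simp add: set_lebesgue_integral_def)
  have "(LINT s:{a<..<t}|lborel. ?h s) = (\<integral>s. ?f s + ?g s \<partial>lborel)"
    unfolding set_lebesgue_integral_def
  proof (rule integral_cong_AE)
    show "AE s in lborel. indicator {a<..<t} s *\<^sub>R ?h s = ?f s + ?g s"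
      using AE_lborel_singleton[of "a + \<delta>"]
    proof eventually_elim
      case (elim s)
      then show ?case using \<delta> by (cases "s < a + \<delta>") (auto simp: indicator_def)
    qed
  qed (use h f g in \<open>auto simp: set_integrable_def intro!: borel_measurable_add\<close>)
  also have "\<dots> = (\<integral>s. ?f s \<partial>lborel) + (\<integral>s. ?g s \<partial>lborel)" using f g by (rule Bochner_Integration.integral_add)
  finally show "(LINT s:{a<..<t}|lborel. ?h s)
      = (LINT s:{a<..<min (a + \<delta>) t}|lborel. p s) + (LINT s:{a<..<t}|lborel. indicator {..<t} (s + \<delta>) *\<^sub>R q s)"
    unfolding sh by (simp add: set_lebesgue_integral_def)
qed

lemma shift_initial_integrable:
  fixes \<zeta> :: "real \<Rightarrow> 'b::euclidean_space"
  assumes "set_integrable lborel {-\<delta><..<0} \<zeta>"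
  shows "set_integrable lborel {a<..<a+\<delta>} (\<lambda>s. \<zeta> (s - \<delta> - a))"
proof -
  have "integrable lborel (\<lambda>s. indicator {-\<delta><..<0} ((- a - \<delta>) + 1 * s) *\<^sub>R \<zeta> ((- a - \<delta>) + 1 * s))"
    by (rule lborel_integrable_real_affine) (use assms in \<open>simp_all add: set_integrable_def\<close>)
  also have "(\<lambda>s. indicator {-\<delta><..<0} ((- a - \<delta>) + 1 * s) *\<^sub>R \<zeta> ((- a - \<delta>) + 1 * s)) = (\<lambda>s. indicator {a<..<a+\<delta>} s *\<^sub>R \<zeta> (s - \<delta> - a))"
    by (auto simp: fun_eq_iff indicator_def algebra_simps)
  finally show ?thesis by (simp add: set_integrable_def)
qed

lemma delay_shift:
  fixes H :: "real \<Rightarrow> real^'m^'k" and w \<zeta> :: "real \<Rightarrow> real^'m"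
  assumes \<delta>: "0 < \<delta>"
    and H: "set_borel_measurable lborel {a<..<t} H" "AE s in lborel. s \<in> {a<..<t} \<longrightarrow> norm (H s) \<le> K"
    and w: "set_integrable lborel {a<..<t} w" and \<zeta>: "set_integrable lborel {-\<delta><..<0} \<zeta>"
  defines "v \<equiv> (\<lambda>s. if s - \<delta> \<le> a then \<zeta> (s - \<delta> - a) else w (s - \<delta>))"
  shows "set_integrable lborel {a<..<t} (\<lambda>s. H s *v v s)"
    and "set_integrable lborel {a<..<min (a + \<delta>) t} (\<lambda>s. H s *v \<zeta> (s - a - \<delta>))"
    and "set_integrable lborel {a<..<t} (\<lambda>s. (indicator {..<t} (s + \<delta>) *\<^sub>R H (s + \<delta>)) *v w s)"
    and "(LINT s:{a<..<t}|lborel. H s *v v s) = (LINT s:{a<..<min (a + \<delta>) t}|lborel. H s *v \<zeta> (s - a - \<delta>))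
       + (LINT s:{a<..<t}|lborel. (indicator {..<t} (s + \<delta>) *\<^sub>R H (s + \<delta>)) *v w s)"
proof -
  have "set_integrable lborel {a<..<t} v"
    unfolding v_def by (rule shift_integrable[OF \<delta> shift_initial_integrable[OF \<zeta>] w])
  then show Hv: "set_integrable lborel {a<..<t} (\<lambda>s. H s *v v s)"
    by (rule set_integrable_matrix[OF _ H, rotated]) simp
  have eq: "(\<lambda>s. H s *v v s) = (\<lambda>s. if s - \<delta> \<le> a then H s *v \<zeta> (s - a - \<delta>) else H ((s - \<delta>) + \<delta>) *v w (s - \<delta>))"
    by (auto simp: v_def fun_eq_iff algebra_simps)
  have sc: "indicator {..<t} (s + \<delta>) *\<^sub>R (H (s + \<delta>) *v w s) = (indicator {..<t} (s + \<delta>) *\<^sub>R H (s + \<delta>)) *v w s" for s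
    by (simp add: scaleR_matrix_vector_assoc)
  note sp = shift_split[OF \<delta> Hv[unfolded eq], unfolded sc]
  show "set_integrable lborel {a<..<min (a + \<delta>) t} (\<lambda>s. H s *v \<zeta> (s - a - \<delta>))" by (rule sp(1))
  show "set_integrable lborel {a<..<t} (\<lambda>s. (indicator {..<t} (s + \<delta>) *\<^sub>R H (s + \<delta>)) *v w s)" by (rule sp(2))
  show "(LINT s:{a<..<t}|lborel. H s *v v s) = (LINT s:{a<..<min (a + \<delta>) t}|lborel. H s *v \<zeta> (s - a - \<delta>))
       + (LINT s:{a<..<t}|lborel. (indicator {..<t} (s + \<delta>) *\<^sub>R H (s + \<delta>)) *v w s)"
    unfolding eq by (rule sp(3))
qed

section \<open>Block vectors\<close>

lemma sum_UNIV_Plus: "(\<Sum>x\<in>(UNIV :: ('p::finite + 'q::finite) set). g x) = (\<Sum>x\<in>UNIV. g (Inl x)) + (\<Sum>x\<in>UNIV. g (Inr x))"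
  by (simp add: UNIV_Plus_UNIV[symmetric] sum.Plus del: UNIV_Plus_UNIV)

lemma vstack3_nth: "vstack3 u v w $ i = (case i of Inl j \<Rightarrow> u $ j | Inr (Inl j) \<Rightarrow> v $ j | Inr (Inr j) \<Rightarrow> w $ j)"
  by (simp add: vstack3_def split: sum.split)

lemma vstack3_add: "vstack3 u v w + vstack3 u' v' w' = vstack3 (u + u') (v + v') (w + w')"
  by (simp add: vec_eq_iff vstack3_nth split: sum.split)

lemma vstack3_scaleR: "c *\<^sub>R vstack3 u v w = vstack3 (c *\<^sub>R u) (c *\<^sub>R v) (c *\<^sub>R w)"
  by (simp add: vec_eq_iff vstack3_nth split: sum.split)

lemma vstack3_matrix_vector: "vstack3 U V Z *v x = vstack3 (U *v x) (V *v x) (Z *v x)"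
  by (simp add: vec_eq_iff matrix_vector_mult_def vstack3_nth split: sum.split)

lemma hstack3_vector:
  fixes U :: "real^'p^'k" and V :: "real^'q^'k" and Z :: "real^'r^'k"
  shows "hstack3 U V Z *v vstack3 x y z = U *v x + V *v y + Z *v z"
  by (simp add: vec_eq_iff hstack3_def matrix_vector_mult_def vstack3_nth sum_UNIV_Plus)

lemma quad_diag3: "quad (diag3 U V Z) (vstack3 x y z) = quad U x + quad V y + quad Z z"
  by (simp add: quad_def diag3_def vstack3_matrix_vector hstack3_vector inner_vec_def vstack3_nth sum_UNIV_Plus)

lemma vstack3_split: "vstack3 u v w = vstack3 u 0 0 + vstack3 0 v 0 + vstack3 0 0 (w :: real^'r)"
  for u :: "real^'p" and v :: "real^'q"
  by (simp add: vstack3_add)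

lemma bounded_linear_vstack3:
  "bounded_linear (\<lambda>u::real^'p. vstack3 u (0::real^'q) (0::real^'r))"
  "bounded_linear (\<lambda>v::real^'q. vstack3 (0::real^'p) v (0::real^'r))"
  "bounded_linear (\<lambda>w::real^'r. vstack3 (0::real^'p) (0::real^'q) w)"
  by (auto intro!: linear_conv_bounded_linear[THEN iffD1] linearI simp: vstack3_add vstack3_scaleR)

definition block1 :: "real^('p::finite + 'q::finite + 'r::finite) \<Rightarrow> real^'p" where "block1 X = (\<chi> i. X $ Inl i)"
definition block2 :: "real^('p::finite + 'q::finite + 'r::finite) \<Rightarrow> real^'q" where "block2 X = (\<chi> i. X $ Inr (Inl i))"
definition block3 :: "real^('p::finite + 'q::finite + 'r::finite) \<Rightarrow> real^'r" where "block3 X = (\<chi> i. X $ Inr (Inr i))"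

lemma blocks: "vstack3 (block1 X) (block2 X) (block3 X) = X"
  by (simp add: vec_eq_iff vstack3_nth block1_def block2_def block3_def split: sum.split)

lemma block_vstack3 [simp]: "block1 (vstack3 u v w) = u" "block2 (vstack3 u v w) = v" "block3 (vstack3 u v w) = w"
  by (simp_all add: vec_eq_iff vstack3_nth block1_def block2_def block3_def)

lemma bounded_linear_blocks:
  "bounded_linear (block1 :: real^('p::finite + 'q::finite + 'r::finite) \<Rightarrow> _)"
  "bounded_linear (block2 :: real^('p::finite + 'q::finite + 'r::finite) \<Rightarrow> _)"
  "bounded_linear (block3 :: real^('p::finite + 'q::finite + 'r::finite) \<Rightarrow> _)"
  by (auto intro!: linear_conv_bounded_linear[THEN iffD1] linearI simp: vec_eq_iff block1_def block2_def block3_def)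

lemma set_integral_vstack3:
  fixes f :: "real \<Rightarrow> real^'p" and g :: "real \<Rightarrow> real^'q" and h :: "real \<Rightarrow> real^'r"
  assumes "set_integrable lborel A f" "set_integrable lborel A g" "set_integrable lborel A h"
  shows "(LINT s:A|lborel. vstack3 (f s) (g s) (h s)) =
    vstack3 (LINT s:A|lborel. f s) (LINT s:A|lborel. g s) (LINT s:A|lborel. h s)"
proof -
  have i: "integrable lborel (\<lambda>s. indicator A s *\<^sub>R f s)" "integrable lborel (\<lambda>s. indicator A s *\<^sub>R g s)"
    "integrable lborel (\<lambda>s. indicator A s *\<^sub>R h s)"
    using assms by (simp_all add: set_integrable_def)
  have "(LINT s:A|lborel. vstack3 (f s) (g s) (h s)) = (\<integral>s. vstack3 (indicator A s *\<^sub>R f s) 0 0 +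
     vstack3 0 (indicator A s *\<^sub>R g s) 0 + vstack3 0 0 (indicator A s *\<^sub>R h s) \<partial>lborel)"
    by (simp add: set_lebesgue_integral_def vstack3_scaleR vstack3_add)
  also have "\<dots> = vstack3 (LINT s:A|lborel. f s) 0 0 + vstack3 0 (LINT s:A|lborel. g s) 0 + vstack3 0 0 (LINT s:A|lborel. h s)"
    unfolding set_lebesgue_integral_def
  proof -
    have "has_bochner_integral lborel (\<lambda>s. vstack3 (indicator A s *\<^sub>R f s) (0::real^'q) (0::real^'r)) (vstack3 (\<integral>s. indicator A s *\<^sub>R f s \<partial>lborel) 0 0)"
      by (rule has_bochner_integral_bounded_linear[OF bounded_linear_vstack3(1) has_bochner_integral_integrable[OF i(1)]])
    moreover have "has_bochner_integral lborel (\<lambda>s. vstack3 (0::real^'p) (indicator A s *\<^sub>R g s) (0::real^'r)) (vstack3 0 (\<integral>s. indicator A s *\<^sub>R g s \<partial>lborel) 0)"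
      by (rule has_bochner_integral_bounded_linear[OF bounded_linear_vstack3(2) has_bochner_integral_integrable[OF i(2)]])
    moreover have "has_bochner_integral lborel (\<lambda>s. vstack3 (0::real^'p) (0::real^'q) (indicator A s *\<^sub>R h s)) (vstack3 0 0 (\<integral>s. indicator A s *\<^sub>R h s \<partial>lborel))"
      by (rule has_bochner_integral_bounded_linear[OF bounded_linear_vstack3(3) has_bochner_integral_integrable[OF i(3)]])
    ultimately show "(\<integral>s. vstack3 (indicator A s *\<^sub>R f s) 0 0 + vstack3 0 (indicator A s *\<^sub>R g s) 0 + vstack3 0 0 (indicator A s *\<^sub>R h s) \<partial>lborel)
      = vstack3 (\<integral>s. indicator A s *\<^sub>R f s \<partial>lborel) 0 0 + vstack3 0 (\<integral>s. indicator A s *\<^sub>R g s \<partial>lborel) 0 + vstack3 0 0 (\<integral>s. indicator A s *\<^sub>R h s \<partial>lborel)"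
      by (intro has_bochner_integral_integral_eq has_bochner_integral_add)
  qed
  finally show ?thesis by (simp add: vstack3_add)
qed

section \<open>The data of the control problem\<close>

lemma Linf_spaceD:
  assumes "f \<in> Linf_space (leb_ivl a b)"
  shows "set_borel_measurable lborel {a<..<b} f" "\<exists>K\<ge>0. AE t in lborel. t \<in> {a<..<b} \<longrightarrow> norm (f t) \<le> K"
proof -
  have f: "f \<in> borel_measurable (restrict_space lborel {a<..<b})" "\<exists>K. AE t in restrict_space lborel {a<..<b}. norm (f t) \<le> K"
    using assms by (auto simp: Linf_space_def)
  show "set_borel_measurable lborel {a<..<b} f"
    using f(1) by (subst (asm) borel_measurable_restrict_space_iff) (simp_all add: set_borel_measurable_def)
  obtain K where "AE t in restrict_space lborel {a<..<b}. norm (f t) \<le> K" using f(2) by blast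
  then have "AE t in lborel. t \<in> {a<..<b} \<longrightarrow> norm (f t) \<le> K" by (subst (asm) AE_restrict_space_iff) simp_all
  then have "AE t in lborel. t \<in> {a<..<b} \<longrightarrow> norm (f t) \<le> \<bar>K\<bar>" by eventually_elim auto
  then show "\<exists>K\<ge>0. AE t in lborel. t \<in> {a<..<b} \<longrightarrow> norm (f t) \<le> K" by (intro exI[of _ "\<bar>K\<bar>"]) simp
qed

lemma L2_spaceD:
  assumes "f \<in> L2_space (leb_ivl a b)"
  shows "set_borel_measurable lborel {a<..<b} f" "set_integrable lborel {a<..<b} (\<lambda>t. (norm (f t))\<^sup>2)"
proof -
  have f: "f \<in> borel_measurable (restrict_space lborel {a<..<b})" "integrable (restrict_space lborel {a<..<b}) (\<lambda>t. (norm (f t))\<^sup>2)"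
    using assms by (auto simp: L2_space_def)
  show "set_borel_measurable lborel {a<..<b} f"
    using f(1) by (subst (asm) borel_measurable_restrict_space_iff) (simp_all add: set_borel_measurable_def)
  show "set_integrable lborel {a<..<b} (\<lambda>t. (norm (f t))\<^sup>2)"
    using f(2) by (simp add: integrable_restrict_space set_integrable_def)
qed

lemma square_integrable_product:
  fixes A :: "real \<Rightarrow> real^'n^'k"
  assumes A: "set_borel_measurable lborel S A" "set_integrable lborel S (\<lambda>s. (norm (A s))\<^sup>2)"
    and f: "set_borel_measurable lborel S f" "set_integrable lborel S (\<lambda>s. (norm (f s))\<^sup>2)"
  shows "set_integrable lborel S (\<lambda>s. A s *v f s)"
proof (rule set_integrable_bound[OF set_integral_add(1)[OF A(2) f(2)]])
  have "(\<lambda>s. (indicator S s *\<^sub>R A s) *v (indicator S s *\<^sub>R f s)) \<in> borel_measurable lborel"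
    using A(1) f(1) unfolding set_borel_measurable_def by (rule borel_measurable_matrix_vector)
  also have "(\<lambda>s. (indicator S s *\<^sub>R A s) *v (indicator S s *\<^sub>R f s)) = (\<lambda>s. indicator S s *\<^sub>R (A s *v f s))"
    by (auto simp: indicator_def)
  finally show "set_borel_measurable lborel S (\<lambda>s. A s *v f s)" by (simp add: set_borel_measurable_def)
  have "norm (A s *v f s) \<le> norm ((norm (A s))\<^sup>2 + (norm (f s))\<^sup>2)" for s
  proof -
    have "norm (A s *v f s) \<le> norm (A s) * norm (f s)" by (rule norm_matrix_vector_le)
    also have "\<dots> \<le> (norm (A s))\<^sup>2 + (norm (f s))\<^sup>2"
      using sum_squares_bound[of "norm (A s)" "norm (f s)"] mult_nonneg_nonneg[OF norm_ge_zero norm_ge_zero, of "A s" "f s"] by linarith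
    finally show ?thesis by simp
  qed
  then show "AE s in lborel. s \<in> S \<longrightarrow> norm (A s *v f s) \<le> norm ((norm (A s))\<^sup>2 + (norm (f s))\<^sup>2)" by simp
qed

lemma square_integrable_integrable:
  fixes f :: "real \<Rightarrow> 'b::euclidean_space"
  assumes f: "set_borel_measurable lborel {a<..<b} f" "set_integrable lborel {a<..<b} (\<lambda>s. (norm (f s))\<^sup>2)"
  shows "set_integrable lborel {a<..<b} f"
proof (rule set_integrable_bound[OF _ f(1)])
  have "set_integrable lborel {a<..<b} (\<lambda>t. 1 :: real)"
    by (rule integrable_bounded_on_interval[where K=1]) (simp_all add: set_borel_measurable_def)
  then show "set_integrable lborel {a<..<b} (\<lambda>t. 1 + (norm (f t))\<^sup>2)"
    using f(2) by (rule set_integral_add)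
  have "norm (f t) \<le> norm (1 + (norm (f t))\<^sup>2)" for t
    using zero_le_power2[of "norm (f t) - 1/2"] by (simp add: power2_eq_square algebra_simps)
  then show "AE t in lborel. t \<in> {a<..<b} \<longrightarrow> norm (f t) \<le> norm (1 + (norm (f t))\<^sup>2)" by simp
qed

lemma triangle_borel: "triangle a T \<in> sets borel"
proof -
  have "open (triangle a T)"
    unfolding triangle_def by (simp add: case_prod_beta' open_Collect_conj open_Collect_less continuous_on_fst continuous_on_snd)
  then show ?thesis by simp
qed

lemma Linf_triangleD:
  fixes F :: "real \<Rightarrow> real \<Rightarrow> 'b::euclidean_space"
  assumes "(\<lambda>(t, s). F t s) \<in> Linf_space (restrict_space lborel (triangle 0 T))"
  shows "(\<lambda>(t, s). indicator (triangle 0 T) (t, s) *\<^sub>R F t s) \<in> borel_measurable (borel \<Otimes>\<^sub>M borel)"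
    "\<exists>K\<ge>0. AE t in lborel. AE s in lborel. 0 < s \<and> s < t \<and> t < T \<longrightarrow> norm (F t s) \<le> K"
proof -
  have f: "(\<lambda>(t, s). F t s) \<in> borel_measurable (restrict_space lborel (triangle 0 T))"
    "\<exists>K. AE x in restrict_space lborel (triangle 0 T). norm (case x of (t, s) \<Rightarrow> F t s) \<le> K"
    using assms by (auto simp: Linf_space_def)
  show "(\<lambda>(t, s). indicator (triangle 0 T) (t, s) *\<^sub>R F t s) \<in> borel_measurable (borel \<Otimes>\<^sub>M borel)"
    using f(1) triangle_borel[of 0 T]
    by (subst (asm) borel_measurable_restrict_space_iff) (simp_all add: case_prod_beta' borel_prod)
  obtain K where "AE x in restrict_space lborel (triangle 0 T). norm (case x of (t, s) \<Rightarrow> F t s) \<le> K" using f(2) by blast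
  then have "AE x in lborel. x \<in> triangle 0 T \<longrightarrow> norm (case x of (t, s) \<Rightarrow> F t s) \<le> K"
    using triangle_borel[of 0 T] by (subst (asm) AE_restrict_space_iff) simp_all
  then have "AE x in lborel \<Otimes>\<^sub>M lborel. x \<in> triangle 0 T \<longrightarrow> norm (case x of (t, s) \<Rightarrow> F t s) \<le> K"
    unfolding lborel_prod .
  from lborel_pair.AE_pair[OF this]
  have "AE t in lborel. AE s in lborel. 0 < s \<and> s < t \<and> t < T \<longrightarrow> norm (F t s) \<le> \<bar>K\<bar>"
    by (auto simp: triangle_def elim!: eventually_mono)
  then show "\<exists>K\<ge>0. AE t in lborel. AE s in lborel. 0 < s \<and> s < t \<and> t < T \<longrightarrow> norm (F t s) \<le> K"
    by (intro exI[of _ "\<bar>K\<bar>"]) simp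
qed

locale delay_problem = brownian M W
  for M :: "'w measure" and W :: "real \<Rightarrow> 'w \<Rightarrow> real" +
  fixes T \<delta> t0 :: real and P :: "('w, 'n::finite, 'm::finite) coeffs"
    and \<xi> :: "real \<Rightarrow> real^'n" and \<zeta> :: "real \<Rightarrow> real^'m"
  assumes \<delta>: "0 < \<delta>" and A1: "assumption_A1 M W T \<delta> P \<xi> \<zeta>" and t0: "0 \<le> t0" "t0 < T"
begin

lemma data_bounded:
  assumes "f \<in> {B1 P, B2 P, B3 P}"
  shows "set_borel_measurable lborel {0<..<T} f" "\<exists>K\<ge>0. AE t in lborel. t \<in> {0<..<T} \<longrightarrow> norm (f t) \<le> K"
  using A1 assms Linf_spaceD[of f 0 T] unfolding assumption_A1_def by auto

lemma sub_meas: "set_borel_measurable lborel {0<..<T} f \<Longrightarrow> t \<le> T \<Longrightarrow> set_borel_measurable lborel {t0<..<t} f"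
  for f :: "real \<Rightarrow> 'b::euclidean_space"
  by (rule set_borel_measurable_subset) (use t0 in auto)

lemma F'_facts:
  "(\<lambda>(t, s). indicator (triangle 0 T) (t, s) *\<^sub>R F'_ker P t s) \<in> borel_measurable (borel \<Otimes>\<^sub>M borel)"
    "\<exists>K\<ge>0. AE t in lborel. AE s in lborel. 0 < s \<and> s < t \<and> t < T \<longrightarrow> norm (F'_ker P t s) \<le> K"
  using A1 Linf_triangleD[of "F'_ker P" T] unfolding assumption_A1_def by auto

lemma F_facts:
  "(\<lambda>(t, s). indicator (triangle 0 T) (t, s) *\<^sub>R F_ker P t s) \<in> borel_measurable (borel \<Otimes>\<^sub>M borel)"
    "\<exists>K\<ge>0. AE t in lborel. AE s in lborel. 0 < s \<and> s < t \<and> t < T \<longrightarrow> norm (F_ker P t s) \<le> K"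
  using A1 Linf_triangleD[of "F_ker P" T] unfolding assumption_A1_def by auto

lemma \<zeta>_integrable: "set_integrable lborel {-\<delta><..<0} \<zeta>" "set_integrable lborel {-\<delta><..<0} (\<lambda>t. (norm (\<zeta> t))\<^sup>2)"
proof -
  have z: "set_borel_measurable lborel {-\<delta><..<0} \<zeta>" "set_integrable lborel {-\<delta><..<0} (\<lambda>t. (norm (\<zeta> t))\<^sup>2)"
    using A1 L2_spaceD[of \<zeta> "-\<delta>" 0] unfolding assumption_A1_def by auto
  show "set_integrable lborel {-\<delta><..<0} (\<lambda>t. (norm (\<zeta> t))\<^sup>2)" by (rule z(2))
  show "set_integrable lborel {-\<delta><..<0} \<zeta>" by (rule square_integrable_integrable[OF z])
qed

subsection \<open>Transport of the drift\<close>

text \<open>The drift of the delay equation along one path. Only its control terms matter for the transport,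
  so everything else is collected in the function \<open>e\<close>.\<close>

definition drift_path :: "(real \<Rightarrow> real^'n) \<Rightarrow> (real \<Rightarrow> real^'m) \<Rightarrow> real \<Rightarrow> real^'n" where
  "drift_path e w s = e s + B1 P s *v w s + B2 P s *v (if s - \<delta> \<le> t0 then \<zeta> (s - \<delta> - t0) else w (s - \<delta>))
     + B3 P s *v (LINT r:{t0<..<s}|lborel. F'_ker P s r *v w r)"

text \<open>The three terms are what direct, delayed and accumulated control contribute at time \<open>s\<close> to the
  drift integrated against \<open>G\<close> up to time \<open>t\<close>. For \<open>G = I\<close> and \<open>G = \<E>(t, \<cdot>)\<close> these are the first
  and the third block row of the Volterra kernel \<open>B(t, s)\<close>.\<close>

definition control_kernel :: "(real \<Rightarrow> real^'n^'k) \<Rightarrow> real \<Rightarrow> real \<Rightarrow> real^'m^'k" where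
  "control_kernel G t s = G s ** B1 P s + indicator {..<t} (s + \<delta>) *\<^sub>R (G (s + \<delta>) ** B2 P (s + \<delta>))
     + (LINT r:{s<..<t}|lborel. G r ** B3 P r ** F'_ker P r s)"

text \<open>Collecting all contributions of the control at its own time: the delayed control is shifted back
  by \<open>\<delta>\<close>, which leaves over the part driven by the initial trajectory \<open>\<zeta>\<close>, and the order of
  integration is exchanged in the accumulated control.\<close>

lemma drift_transport:
  fixes G :: "real \<Rightarrow> real^'n^'k"
  assumes t: "t0 < t" "t \<le> T"
    and G: "set_borel_measurable lborel {t0<..<t} G" "AE s in lborel. s \<in> {t0<..<t} \<longrightarrow> norm (G s) \<le> C"
    and e: "set_integrable lborel {t0<..<t} e" and w: "set_integrable lborel {t0<..<t} w"
  shows "set_integrable lborel {t0<..<t} (drift_path e w)"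
    and "set_integrable lborel {t0<..<t} (\<lambda>s. G s *v e s + control_kernel G t s *v w s)"
    and "set_integrable lborel {t0<..<min (t0 + \<delta>) t} (\<lambda>s. B2 P s *v \<zeta> (s - t0 - \<delta>))"
    and "(LINT s:{t0<..<t}|lborel. G s *v drift_path e w s) =
       (LINT s:{t0<..<min (t0 + \<delta>) t}|lborel. G s *v (B2 P s *v \<zeta> (s - t0 - \<delta>)))
       + (LINT s:{t0<..<t}|lborel. G s *v e s + control_kernel G t s *v w s)"
proof -
  let ?I = "{t0<..<t}"
  define v where "v s = (if s - \<delta> \<le> t0 then \<zeta> (s - \<delta> - t0) else w (s - \<delta>))" for s
  define mem where "mem r = (LINT s:{t0<..<r}|lborel. F'_ker P r s *v w s)" for r
  have b: "\<exists>K\<ge>0. AE s in lborel. s \<in> ?I \<longrightarrow> norm (f s) \<le> K" if f0: "f \<in> {B1 P, B2 P, B3 P}" for f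
  proof -
    obtain K where K: "K \<ge> 0" "AE s in lborel. s \<in> {0<..<T} \<longrightarrow> norm (f s) \<le> K" using data_bounded(2)[OF f0] by blast
    have "AE s in lborel. s \<in> ?I \<longrightarrow> norm (f s) \<le> K"
      using K(2) by eventually_elim (use t t0 in simp)
    then show ?thesis using K(1) by blast
  qed
  obtain K1 where K1: "AE s in lborel. s \<in> ?I \<longrightarrow> norm (B1 P s) \<le> K1" using b[of "B1 P"] by auto
  obtain K2 where K2: "AE s in lborel. s \<in> ?I \<longrightarrow> norm (B2 P s) \<le> K2" using b[of "B2 P"] by auto
  obtain K3 where K3: "K3 \<ge> 0" "AE s in lborel. s \<in> ?I \<longrightarrow> norm (B3 P s) \<le> K3" using b[of "B3 P"] by auto
  obtain L where L: "L \<ge> 0" "AE r in lborel. AE s in lborel. 0 < s \<and> s < r \<and> r < T \<longrightarrow> norm (F'_ker P r s) \<le> L"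
    using F'_facts(2) by auto
  have m: "set_borel_measurable lborel ?I f" if "f \<in> {B1 P, B2 P, B3 P}" for f
    by (rule sub_meas[OF data_bounded(1)[OF that] t(2)])
  note m1 = m[of "B1 P", simplified] and m2 = m[of "B2 P", simplified] and m3 = m[of "B3 P", simplified]
  obtain Q where Q: "0 < Q" "\<And>(A::real^'n^'k) (B::real^'m^'n). norm (A ** B) \<le> norm A * norm B * Q"
    using bounded_bilinear.pos_bounded[OF bounded_bilinear_matrix_mult] by blast
  obtain Q' where Q': "0 < Q'" "\<And>(A::real^'m^'k) (B::real^'m^'m). norm (A ** B) \<le> norm A * norm B * Q'"
    using bounded_bilinear.pos_bounded[OF bounded_bilinear_matrix_mult] by blast
  have i1: "set_integrable lborel ?I (\<lambda>s. B1 P s *v w s)"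
    by (rule set_integrable_matrix[OF _ m1 K1 w]) simp
  have i2: "set_integrable lborel ?I (\<lambda>s. B2 P s *v v s)"
    unfolding v_def by (rule delay_shift(1)[OF \<delta> m2 K2 w \<zeta>_integrable(1)])
  show i2': "set_integrable lborel {t0<..<min (t0 + \<delta>) t} (\<lambda>s. B2 P s *v \<zeta> (s - t0 - \<delta>))"
    by (rule delay_shift(2)[OF \<delta> m2 K2 w \<zeta>_integrable(1)])
  have F'm: "(\<lambda>(r, s). indicator {t0<..<r} s *\<^sub>R indicator ?I r *\<^sub>R F'_ker P r s) \<in> borel_measurable (borel \<Otimes>\<^sub>M borel)"
  proof -
    note F'_facts(1)[measurable]
    have "(\<lambda>x. indicator {x. t0 < snd x \<and> snd x < fst x \<and> fst x < t} x *\<^sub>R (\<lambda>(r, s). indicator (triangle 0 T) (r, s) *\<^sub>R F'_ker P r s) x) \<in> borel_measurable (borel \<Otimes>\<^sub>M borel)"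
      by measurable
    also have "(\<lambda>x. indicator {x. t0 < snd x \<and> snd x < fst x \<and> fst x < t} x *\<^sub>R (\<lambda>(r, s). indicator (triangle 0 T) (r, s) *\<^sub>R F'_ker P r s) x)
      = (\<lambda>(r, s). indicator {t0<..<r} s *\<^sub>R indicator ?I r *\<^sub>R F'_ker P r s)"
      using t t0 by (auto simp: fun_eq_iff indicator_def triangle_def)
    finally show ?thesis .
  qed
  have L': "AE r in lborel. AE s in lborel. t0 < s \<and> s < r \<and> r < t \<longrightarrow> norm (F'_ker P r s) \<le> L"
    using L(2) by (rule eventually_mono, elim eventually_mono) (use t t0 in simp)
  have imem: "set_integrable lborel ?I mem"
    unfolding mem_def by (rule volterra_swap(1)[OF F'm L' w])
  have i3: "set_integrable lborel ?I (\<lambda>s. B3 P s *v mem s)"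
    by (rule set_integrable_matrix[OF _ m3 K3(2) imem]) simp
  have dp: "drift_path e w = (\<lambda>s. e s + B1 P s *v w s + B2 P s *v v s + B3 P s *v mem s)"
    by (simp add: drift_path_def v_def mem_def fun_eq_iff)
  show "set_integrable lborel ?I (drift_path e w)"
    unfolding dp by (intro set_integral_add e i1 i2 i3)
  have Gi: "set_integrable lborel ?I (\<lambda>s. G s *v f s)" if "set_integrable lborel ?I f" for f
    by (rule set_integrable_matrix[OF _ G that]) simp
  have GB2: "set_borel_measurable lborel ?I (\<lambda>s. G s ** B2 P s)" "AE s in lborel. s \<in> ?I \<longrightarrow> norm (G s ** B2 P s) \<le> \<bar>C\<bar> * \<bar>K2\<bar> * Q"
  proof -
    have "(\<lambda>s. (indicator ?I s *\<^sub>R G s) ** (indicator ?I s *\<^sub>R B2 P s)) \<in> borel_measurable lborel"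
      using G(1) m2 unfolding set_borel_measurable_def by (rule borel_measurable_matrix_mult)
    also have "(\<lambda>s. (indicator ?I s *\<^sub>R G s) ** (indicator ?I s *\<^sub>R B2 P s)) = (\<lambda>s. indicator ?I s *\<^sub>R (G s ** B2 P s))"
      by (auto simp: indicator_def)
    finally show "set_borel_measurable lborel ?I (\<lambda>s. G s ** B2 P s)" by (simp add: set_borel_measurable_def)
    show "AE s in lborel. s \<in> ?I \<longrightarrow> norm (G s ** B2 P s) \<le> \<bar>C\<bar> * \<bar>K2\<bar> * Q"
      using G(2) K2
    proof eventually_elim
      case (elim s)
      show ?case
      proof
        assume s: "s \<in> ?I"
        have "norm (G s ** B2 P s) \<le> norm (G s) * norm (B2 P s) * Q" by (rule Q)
        also have "\<dots> \<le> \<bar>C\<bar> * \<bar>K2\<bar> * Q" using elim s Q(1) by (intro mult_right_mono mult_mono) auto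
        finally show "norm (G s ** B2 P s) \<le> \<bar>C\<bar> * \<bar>K2\<bar> * Q" .
      qed
    qed
  qed
  note sh = delay_shift[OF \<delta> GB2 w \<zeta>_integrable(1)]
  define H where "H r s = G r ** B3 P r ** F'_ker P r s" for r s
  have Hm: "(\<lambda>(r, s). indicator {t0<..<r} s *\<^sub>R indicator ?I r *\<^sub>R H r s) \<in> borel_measurable (borel \<Otimes>\<^sub>M borel)"
  proof -
    have [measurable]: "(\<lambda>r. indicator ?I r *\<^sub>R G r) \<in> borel_measurable borel" "(\<lambda>r. indicator ?I r *\<^sub>R B3 P r) \<in> borel_measurable borel"
      using G(1) m3 by (simp_all add: set_borel_measurable_def)
    note F'm[measurable]
    have "(\<lambda>x. (indicator ?I (fst x) *\<^sub>R G (fst x)) ** (indicator ?I (fst x) *\<^sub>R B3 P (fst x)) **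
        (\<lambda>(r, s). indicator {t0<..<r} s *\<^sub>R indicator ?I r *\<^sub>R F'_ker P r s) x) \<in> borel_measurable (borel \<Otimes>\<^sub>M borel)"
      by measurable
    also have "(\<lambda>x. (indicator ?I (fst x) *\<^sub>R G (fst x)) ** (indicator ?I (fst x) *\<^sub>R B3 P (fst x)) **
        (\<lambda>(r, s). indicator {t0<..<r} s *\<^sub>R indicator ?I r *\<^sub>R F'_ker P r s) x)
      = (\<lambda>(r, s). indicator {t0<..<r} s *\<^sub>R indicator ?I r *\<^sub>R H r s)"
      by (auto simp: fun_eq_iff indicator_def H_def)
    finally show ?thesis .
  qed
  have HK: "AE r in lborel. AE s in lborel. t0 < s \<and> s < r \<and> r < t \<longrightarrow> norm (H r s) \<le> \<bar>C\<bar> * K3 * Q * L * Q'"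
    using L' G(2) K3(2)
  proof eventually_elim
    case (elim r)
    note GB = elim(2,3)
    from elim(1) show ?case
    proof eventually_elim
      case (elim s)
      show ?case
      proof
        assume s: "t0 < s \<and> s < r \<and> r < t"
        have "norm (H r s) \<le> norm (G r ** B3 P r) * norm (F'_ker P r s) * Q'" unfolding H_def by (rule Q')
        also have "\<dots> \<le> (norm (G r) * norm (B3 P r) * Q) * norm (F'_ker P r s) * Q'"
          using Q'(1) by (intro mult_right_mono Q(2)) auto
        also have "\<dots> \<le> (\<bar>C\<bar> * K3 * Q) * L * Q'"
          using GB elim s Q(1) Q'(1) K3(1) L(1) by (intro mult_right_mono mult_mono) auto
        finally show "norm (H r s) \<le> \<bar>C\<bar> * K3 * Q * L * Q'" .
      qed
    qed
  qed
  note sw = volterra_swap[OF Hm HK w]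
  have GB3: "(LINT r:?I|lborel. G r *v (B3 P r *v mem r)) = (LINT r:?I|lborel. LINT s:{t0<..<r}|lborel. H r s *v w s)"
    unfolding set_lebesgue_integral_def[of lborel ?I]
  proof (rule integral_cong_AE)
    show "(\<lambda>r. indicator ?I r *\<^sub>R (G r *v (B3 P r *v mem r))) \<in> borel_measurable lborel"
      using Gi[OF i3] by (auto simp: set_integrable_def)
    show "(\<lambda>r. indicator ?I r *\<^sub>R (LINT s:{t0<..<r}|lborel. H r s *v w s)) \<in> borel_measurable lborel"
      using sw(1) by (auto simp: set_integrable_def)
    show "AE r in lborel. indicator ?I r *\<^sub>R (G r *v (B3 P r *v mem r)) = indicator ?I r *\<^sub>R (LINT s:{t0<..<r}|lborel. H r s *v w s)"
      using L'
    proof eventually_elim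
      case (elim r)
      show ?case
      proof (cases "r \<in> ?I")
        case True
        have "(\<lambda>s. indicator {t0<..<r} s *\<^sub>R indicator ?I r *\<^sub>R F'_ker P r s) \<in> borel_measurable borel"
          using measurable_Pair2[OF F'm, of r] by simp
        then have Fm: "set_borel_measurable lborel {t0<..<r} (F'_ker P r)"
          using True by (simp add: set_borel_measurable_def)
        have "set_integrable lborel {t0<..<r} (\<lambda>s. F'_ker P r s *v w s)"
        proof (rule set_integrable_matrix[OF _ Fm])
          show "AE s in lborel. s \<in> {t0<..<r} \<longrightarrow> norm (F'_ker P r s) \<le> L" using elim by eventually_elim (use True in auto)
          show "set_integrable lborel {t0<..<r} w" by (rule set_integrable_subset[OF w]) (use True in auto)
        qed simp
        then have "(LINT s:{t0<..<r}|lborel. (G r ** B3 P r) *v (F'_ker P r s *v w s)) = (G r ** B3 P r) *v mem r"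
          unfolding mem_def by (rule set_integral_matrix_left)
        then have "G r *v (B3 P r *v mem r) = (LINT s:{t0<..<r}|lborel. H r s *v w s)"
          by (simp only: H_def matrix_vector_mul_assoc)
        then show ?thesis by simp
      qed simp
    qed
  qed
  have ker: "G s *v e s + control_kernel G t s *v w s =
     G s *v e s + G s *v (B1 P s *v w s) + (indicator {..<t} (s + \<delta>) *\<^sub>R (G (s + \<delta>) ** B2 P (s + \<delta>))) *v w s
      + (LINT r:{s<..<t}|lborel. H r s) *v w s" for s
    unfolding control_kernel_def H_def by (simp add: matrix_vector_mult_add_rdistrib matrix_vector_mul_assoc)
  show "set_integrable lborel ?I (\<lambda>s. G s *v e s + control_kernel G t s *v w s)"
    unfolding ker by (intro set_integral_add Gi e i1 sh sw)
  have "(LINT s:?I|lborel. G s *v drift_path e w s) =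
      (LINT s:?I|lborel. G s *v e s + G s *v (B1 P s *v w s) + G s *v (B2 P s *v v s) + G s *v (B3 P s *v mem s))"
    unfolding dp by (simp add: matrix_vector_right_distrib)
  also have "\<dots> = (LINT s:?I|lborel. G s *v e s) + (LINT s:?I|lborel. G s *v (B1 P s *v w s)) + (LINT s:?I|lborel. G s *v (B2 P s *v v s))
      + (LINT s:?I|lborel. G s *v (B3 P s *v mem s))"
    by (simp add: set_integral_add Gi e i1 i2 i3)
  also have "(LINT s:?I|lborel. G s *v (B2 P s *v v s)) = (LINT s:{t0<..<min (t0 + \<delta>) t}|lborel. G s *v (B2 P s *v \<zeta> (s - t0 - \<delta>)))
       + (LINT s:?I|lborel. (indicator {..<t} (s + \<delta>) *\<^sub>R (G (s + \<delta>) ** B2 P (s + \<delta>))) *v w s)"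
    using sh(4) by (simp add: matrix_vector_mul_assoc v_def)
  also have "(LINT s:?I|lborel. G s *v (B3 P s *v mem s)) = (LINT s:?I|lborel. (LINT r:{s<..<t}|lborel. H r s) *v w s)"
    using GB3 sw(3) by simp
  also have "(LINT s:?I|lborel. G s *v e s) + (LINT s:?I|lborel. G s *v (B1 P s *v w s)) +
      ((LINT s:{t0<..<min (t0 + \<delta>) t}|lborel. G s *v (B2 P s *v \<zeta> (s - t0 - \<delta>)))
       + (LINT s:?I|lborel. (indicator {..<t} (s + \<delta>) *\<^sub>R (G (s + \<delta>) ** B2 P (s + \<delta>))) *v w s))
      + (LINT s:?I|lborel. (LINT r:{s<..<t}|lborel. H r s) *v w s)
     = (LINT s:{t0<..<min (t0 + \<delta>) t}|lborel. G s *v (B2 P s *v \<zeta> (s - t0 - \<delta>)))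
       + (LINT s:?I|lborel. G s *v e s + control_kernel G t s *v w s)"
    unfolding ker by (simp add: set_integral_add Gi e i1 sh sw)
  finally show "(LINT s:?I|lborel. G s *v drift_path e w s) =
       (LINT s:{t0<..<min (t0 + \<delta>) t}|lborel. G s *v (B2 P s *v \<zeta> (s - t0 - \<delta>)))
       + (LINT s:?I|lborel. G s *v e s + control_kernel G t s *v w s)" .
qed

end

subsection \<open>The three block rows along a path\<close>

lemma set_integrable_congI:
  "set_integrable N A f \<Longrightarrow> (\<And>x. x \<in> A \<Longrightarrow> f x = g x) \<Longrightarrow> set_integrable N A g"
  by (subst (asm) set_integrable_cong[OF refl refl]) auto

context bounded_kernel
begin

lemma fubini_prim:
  assumes d: "set_integrable lborel {a<..<t} d"
  shows "set_integrable lborel {a<..<t} (\<lambda>r. k r *v (LINT s:{a<..<r}|lborel. d s))"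
    and "set_integrable lborel {a<..<t} (\<lambda>s. prim s *v d s)"
    and "(LINT r:{a<..<t}|lborel. k r *v (LINT s:{a<..<r}|lborel. d s)) = (LINT s:{a<..<t}|lborel. prim s *v d s)"
proof -
  have m: "(\<lambda>(r, s). indicator {a<..<r} s *\<^sub>R indicator {a<..<t} r *\<^sub>R k r) \<in> borel_measurable (borel \<Otimes>\<^sub>M borel)"
  proof -
    have "(\<lambda>x. indicator {x. a < snd x \<and> snd x < fst x} x *\<^sub>R kh (fst x)) \<in> borel_measurable (borel \<Otimes>\<^sub>M borel)"
      by measurable
    also have "(\<lambda>x. indicator {x. a < snd x \<and> snd x < fst x} x *\<^sub>R kh (fst x)) = (\<lambda>(r, s). indicator {a<..<r} s *\<^sub>R indicator {a<..<t} r *\<^sub>R k r)"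
      by (auto simp: fun_eq_iff kh_def indicator_def)
    finally show ?thesis .
  qed
  have b: "AE r in lborel. AE s in lborel. a < s \<and> s < r \<and> r < t \<longrightarrow> norm (k r) \<le> K"
    using K by eventually_elim (auto intro!: AE_I2)
  note sw = volterra_swap[OF m b d]
  have eq: "(LINT s:{a<..<r}|lborel. k r *v d s) = k r *v (LINT s:{a<..<r}|lborel. d s)" if "r \<in> {a<..<t}" for r
    by (rule set_integral_matrix_left[OF set_integrable_subset[OF d]]) (use that in auto)
  show "set_integrable lborel {a<..<t} (\<lambda>r. k r *v (LINT s:{a<..<r}|lborel. d s))"
    by (rule set_integrable_congI[OF sw(1)]) (rule eq)
  show "set_integrable lborel {a<..<t} (\<lambda>s. prim s *v d s)" using sw(2) by (simp add: prim_def)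
  show "(LINT r:{a<..<t}|lborel. k r *v (LINT s:{a<..<r}|lborel. d s)) = (LINT s:{a<..<t}|lborel. prim s *v d s)"
  proof -
    have "(LINT r:{a<..<t}|lborel. k r *v (LINT s:{a<..<r}|lborel. d s)) = (LINT r:{a<..<t}|lborel. LINT s:{a<..<r}|lborel. k r *v d s)"
      by (rule set_lebesgue_integral_cong) (auto simp: eq)
    then show ?thesis using sw(3) by (simp add: prim_def)
  qed
qed

end

context delay_problem
begin

definition state_path :: "(real \<Rightarrow> real^'n) \<Rightarrow> (real \<Rightarrow> real^'m) \<Rightarrow> real \<Rightarrow> real^'n" where
  "state_path e w t = \<xi> 0 + (LINT s:{t0<..<t}|lborel. drift_path e w s)"

text \<open>The first two blocks of \<open>\<phi>\<close> and the three block rows of the kernel \<open>B\<close>.\<close>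

definition phi1 :: "real \<Rightarrow> real^'n" where
  "phi1 t = \<xi> 0 + (LINT s:{t0<..<t0 + \<delta>}|lborel. indicator {t0..<t} s *\<^sub>R (B2_zero T P s *v \<zeta> (s - t0 - \<delta>)))"

definition phi2 :: "real \<Rightarrow> real^'n" where
  "phi2 t = indicator {t0..t0 + \<delta>} t *\<^sub>R \<xi> (t - t0 - \<delta>) + indicator {t0 + \<delta><..} t *\<^sub>R
     (\<xi> 0 + (LINT s:{t0<..<min (t0 + \<delta>) (t - \<delta>)}|lborel. B2_zero T P s *v \<zeta> (s - t0 - \<delta>)))"

definition control_row1 :: "real \<Rightarrow> real \<Rightarrow> real^'m^'n" where
  "control_row1 t s = B1 P s + indicator {\<delta><..} (t - s) *\<^sub>R B2_zero T P (s + \<delta>) + (LINT r:{s<..<t}|lborel. B3 P r ** F'_ker P r s)"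

definition control_row2 :: "real \<Rightarrow> real \<Rightarrow> real^'m^'n" where
  "control_row2 t s = indicator {\<delta><..} (t - s) *\<^sub>R
     (B1 P s + indicator {2 * \<delta><..} (t - s) *\<^sub>R B2_zero T P (s + \<delta>) + (LINT r:{s<..<t - \<delta>}|lborel. B3 P r ** F'_ker P r s))"

definition control_row3 :: "real \<Rightarrow> real \<Rightarrow> real^'m^'n" where
  "control_row3 t s = Eker P t s ** B1 P s + Eker P t (s + \<delta>) ** B2_zero T P (s + \<delta>)
     + (LINT \<theta>:{s<..<t}|lborel. Eker P t \<theta> ** B3 P \<theta> ** F'_ker P \<theta> s)"

lemma B2_zero_eq: "s \<le> T \<Longrightarrow> B2_zero T P s = B2 P s"
  by (simp add: B2_zero_def)

lemma window_eq:
  "t \<le> T \<Longrightarrow> (LINT s:{t0<..<t0 + \<delta>}|lborel. indicator {t0..<t} s *\<^sub>R (B2_zero T P s *v \<zeta> (s - t0 - \<delta>)))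
    = (LINT s:{t0<..<min (t0 + \<delta>) t}|lborel. B2 P s *v \<zeta> (s - t0 - \<delta>))"
  unfolding set_lebesgue_integral_def
  by (intro Bochner_Integration.integral_cong) (auto simp: indicator_def B2_zero_eq)

lemma phi1_eq: "t \<le> T \<Longrightarrow> phi1 t = \<xi> 0 + (LINT s:{t0<..<min (t0 + \<delta>) t}|lborel. B2 P s *v \<zeta> (s - t0 - \<delta>))"
  unfolding phi1_def by (simp only: window_eq)

text \<open>The first row is the drift integral itself: transport with the constant factor \<open>I\<close>.\<close>

lemma state_row:
  assumes e: "set_integrable lborel {t0<..<T} e" and w: "set_integrable lborel {t0<..<T} w" and t: "t0 < t" "t \<le> T"
  shows "set_integrable lborel {t0<..<t} (\<lambda>s. e s + control_row1 t s *v w s)"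
    and "state_path e w t = phi1 t + (LINT s:{t0<..<t}|lborel. e s + control_row1 t s *v w s)"
proof -
  let ?G = "\<lambda>s::real. mat 1 :: real^'n^'n"
  have e': "set_integrable lborel {t0<..<t} e" and w': "set_integrable lborel {t0<..<t} w"
    using t by (auto intro: set_integrable_subset[OF e] set_integrable_subset[OF w])
  have G: "set_borel_measurable lborel {t0<..<t} ?G" "AE s in lborel. s \<in> {t0<..<t} \<longrightarrow> norm (?G s) \<le> norm (mat 1 :: real^'n^'n)"
    by (simp_all add: set_borel_measurable_def)
  note tr = drift_transport[OF t G e' w']
  have eq: "mat 1 *v e s + control_kernel ?G t s *v w s = e s + control_row1 t s *v w s" if "s \<in> {t0<..<t}" for s
  proof -
    have "indicator {..<t} (s + \<delta>) *\<^sub>R B2 P (s + \<delta>) = indicator {\<delta><..} (t - s) *\<^sub>R B2_zero T P (s + \<delta>)"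
      using t by (auto simp: indicator_def B2_zero_eq)
    then show ?thesis by (simp add: control_kernel_def control_row1_def)
  qed
  show "set_integrable lborel {t0<..<t} (\<lambda>s. e s + control_row1 t s *v w s)"
    by (rule set_integrable_congI[OF tr(2)]) (rule eq)
  show "state_path e w t = phi1 t + (LINT s:{t0<..<t}|lborel. e s + control_row1 t s *v w s)"
    using tr(4) set_lebesgue_integral_cong[of "{t0<..<t}" lborel "\<lambda>s. mat 1 *v e s + control_kernel ?G t s *v w s"] eq t
    by (simp add: state_path_def phi1_eq)
qed

text \<open>The second row is the first one at time \<open>t - \<delta>\<close>. The factor \<open>1\<^bsub>(\<delta>, \<infinity>)\<^esub>(t - s)\<close>
  cuts the integrals off there, and it annihilates them while \<open>t - \<delta>\<close> is before the initial time.\<close>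

lemma delay_row:
  assumes e: "set_integrable lborel {t0<..<T} e" and w: "set_integrable lborel {t0<..<T} w" and t: "t0 < t" "t \<le> T"
  shows "set_integrable lborel {t0<..<t} (\<lambda>s. indicator {\<delta><..} (t - s) *\<^sub>R e s + control_row2 t s *v w s)"
    and "(if t \<le> t0 + \<delta> then \<xi> (t - \<delta> - t0) else state_path e w (t - \<delta>))
       = phi2 t + (LINT s:{t0<..<t}|lborel. indicator {\<delta><..} (t - s) *\<^sub>R e s + control_row2 t s *v w s)"
proof -
  have eq: "indicator {t0<..<t} s *\<^sub>R (indicator {\<delta><..} (t - s) *\<^sub>R e s + control_row2 t s *v w s)
     = indicator {t0<..<t - \<delta>} s *\<^sub>R (e s + control_row1 (t - \<delta>) s *v w s)" for s
    using \<delta> by (auto simp: indicator_def control_row1_def control_row2_def algebra_simps)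
  show "set_integrable lborel {t0<..<t} (\<lambda>s. indicator {\<delta><..} (t - s) *\<^sub>R e s + control_row2 t s *v w s)"
    unfolding set_integrable_def eq
    by (cases "t \<le> t0 + \<delta>") (use state_row(1)[OF e w, of "t - \<delta>"] t \<delta> in \<open>auto simp: set_integrable_def\<close>)
  have l: "(LINT s:{t0<..<t}|lborel. indicator {\<delta><..} (t - s) *\<^sub>R e s + control_row2 t s *v w s) =
    (LINT s:{t0<..<t - \<delta>}|lborel. e s + control_row1 (t - \<delta>) s *v w s)"
    unfolding set_lebesgue_integral_def eq ..
  show "(if t \<le> t0 + \<delta> then \<xi> (t - \<delta> - t0) else state_path e w (t - \<delta>))
       = phi2 t + (LINT s:{t0<..<t}|lborel. indicator {\<delta><..} (t - s) *\<^sub>R e s + control_row2 t s *v w s)"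
  proof (cases "t \<le> t0 + \<delta>")
    case True
    then show ?thesis unfolding l phi2_def using t by (simp add: set_lebesgue_integral_def algebra_simps)
  next
    case False
    have "(LINT s:{t0<..<min (t0 + \<delta>) (t - \<delta>)}|lborel. B2_zero T P s *v \<zeta> (s - t0 - \<delta>))
      = (LINT s:{t0<..<min (t0 + \<delta>) (t - \<delta>)}|lborel. B2 P s *v \<zeta> (s - t0 - \<delta>))"
      by (intro set_lebesgue_integral_cong) (use t \<delta> in \<open>auto simp: B2_zero_eq\<close>)
    then show ?thesis unfolding l phi2_def using False state_row(2)[OF e w, of "t - \<delta>"] t \<delta>
      by (simp add: phi1_eq)
  qed
qed

text \<open>The times at which the memory is defined by a bounded kernel. As the kernel is only essentially
  bounded on the triangle, these are almost all times, but not necessarily all.\<close>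

definition good_time :: "real \<Rightarrow> bool" where
  "good_time t \<longleftrightarrow> t0 < t \<and> t < T \<and> (\<exists>K. bounded_kernel t0 t K (F_ker P t))"

lemma F_section: "t0 < t \<Longrightarrow> t < T \<Longrightarrow> set_borel_measurable lborel {t0<..<t} (F_ker P t)"
proof -
  assume t: "t0 < t" "t < T"
  have "(\<lambda>s. indicator (triangle 0 T) (t, s) *\<^sub>R F_ker P t s) \<in> borel_measurable borel"
    using measurable_Pair2[OF F_facts(1), of t] by simp
  then have "set_borel_measurable lborel {0<..<t} (F_ker P t)"
    using t by (simp add: set_borel_measurable_def triangle_def indicator_def)
  then show ?thesis by (rule set_borel_measurable_subset) (use t0 in auto)
qed

lemma AE_good_time: "AE t in lborel. t \<in> {t0<..<T} \<longrightarrow> good_time t"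
proof -
  obtain K where K: "0 \<le> K" "AE t in lborel. AE s in lborel. 0 < s \<and> s < t \<and> t < T \<longrightarrow> norm (F_ker P t s) \<le> K"
    using F_facts(2) by blast
  from K(2) show ?thesis
  proof eventually_elim
    case (elim t)
    show ?case
    proof
      assume t: "t \<in> {t0<..<T}"
      have "AE s in lborel. s \<in> {t0<..<t} \<longrightarrow> norm (F_ker P t s) \<le> K"
        using elim by eventually_elim (use t t0 in auto)
      then have "bounded_kernel t0 t K (F_ker P t)"
        using K(1) t F_section[of t] by unfold_locales auto
      then show "good_time t" using t by (auto simp: good_time_def)
    qed
  qed
qed

text \<open>Integrating the kernel against the drift integral is, by Fubini, integrating the drift against the
  primitive \<open>\<E>(t, \<cdot>)\<close> of the kernel: transport with this factor. The part of the drift that is driven by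
  the initial trajectory, here \<open>\<beta>\<close>, is transformed back and forms the memory of \<open>\<phi>\<close>.\<close>

lemma memory_row:
  assumes e: "set_integrable lborel {t0<..<T} e" and w: "set_integrable lborel {t0<..<T} w" and t: "good_time t"
  shows "set_integrable lborel {t0<..<t} (\<lambda>s. Eker P t s *v e s + control_row3 t s *v w s)"
    and "set_integrable lborel {t0<..<t} (\<lambda>s. F_ker P t s *v state_path e w s)"
    and "(LINT s:{t0<..<t}|lborel. F_ker P t s *v state_path e w s)
      = (LINT s:{t0<..<t}|lborel. F_ker P t s *v phi1 s) + (LINT s:{t0<..<t}|lborel. Eker P t s *v e s + control_row3 t s *v w s)"
proof -
  obtain K where K: "bounded_kernel t0 t K (F_ker P t)" and tt: "t0 < t" "t < T" using t by (auto simp: good_time_def)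
  interpret bk: bounded_kernel t0 t K "F_ker P t" by (rule K)
  let ?I = "{t0<..<t}"
  have e': "set_integrable lborel {t0<..<t} e" and w': "set_integrable lborel {t0<..<t} w"
    using tt by (auto intro: set_integrable_subset[OF e] set_integrable_subset[OF w])
  have prim: "bk.prim s = Eker P t s" if "t0 \<le> s" "s \<le> t" for s
    using that t0 by (simp add: bk.prim_def Eker_def)
  have G: "set_borel_measurable lborel ?I bk.prim"
    using bk.prim_measurable by (subst (asm) borel_measurable_restrict_space_iff) (simp_all add: set_borel_measurable_def)
  have Gb: "AE s in lborel. s \<in> ?I \<longrightarrow> norm (bk.prim s) \<le> K * (t - t0)"
    using bk.prim_bound by (intro AE_I2) auto
  note tr = drift_transport[OF tt(1) less_imp_le[OF tt(2)] G Gb e' w']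
  have Fi: "set_integrable lborel ?I (F_ker P t)"
    by (rule integrable_bounded_on_interval[OF bk.k_meas bk.K])
  have c: "set_integrable lborel ?I (\<lambda>s. F_ker P t s *v \<xi> 0)"
    by (rule set_integrable_matrix[OF _ bk.k_meas bk.K], simp, rule integrable_bounded_on_interval[where K="norm (\<xi> 0)"])
       (simp_all add: set_borel_measurable_def)
  define \<beta> where "\<beta> r = indicator {..<t0 + \<delta>} r *\<^sub>R (B2 P r *v \<zeta> (r - t0 - \<delta>))" for r
  have \<beta>_eq: "indicator {t0<..<r} s *\<^sub>R \<beta> s = indicator {t0<..<min (t0 + \<delta>) r} s *\<^sub>R (B2 P s *v \<zeta> (s - t0 - \<delta>))" for r s
    by (auto simp: \<beta>_def indicator_def)
  have \<beta>: "set_integrable lborel ?I \<beta>"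
    using tr(3) unfolding set_integrable_def \<beta>_eq .
  have phi1_\<beta>: "phi1 r = \<xi> 0 + (LINT s:{t0<..<r}|lborel. \<beta> s)" if "r \<le> T" for r
    unfolding phi1_eq[OF that] set_lebesgue_integral_def \<beta>_eq ..
  have F\<phi>: "(LINT s:?I|lborel. F_ker P t s *v phi1 s) = (LINT s:?I|lborel. F_ker P t s *v \<xi> 0) + (LINT s:?I|lborel. bk.prim s *v \<beta> s)"
  proof -
    have "(LINT s:?I|lborel. F_ker P t s *v phi1 s) = (LINT s:?I|lborel. F_ker P t s *v \<xi> 0 + F_ker P t s *v (LINT r:{t0<..<s}|lborel. \<beta> r))"
      by (intro set_lebesgue_integral_cong) (use tt in \<open>auto simp: phi1_\<beta> matrix_vector_right_distrib\<close>)
    also have "\<dots> = (LINT s:?I|lborel. F_ker P t s *v \<xi> 0) + (LINT s:?I|lborel. F_ker P t s *v (LINT r:{t0<..<s}|lborel. \<beta> r))"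
      by (rule set_integral_add(2)[OF c bk.fubini_prim(1)[OF \<beta>]])
    finally show ?thesis by (simp only: bk.fubini_prim(3)[OF \<beta>])
  qed
  have st: "F_ker P t s *v state_path e w s = F_ker P t s *v \<xi> 0 + F_ker P t s *v (LINT r:{t0<..<s}|lborel. drift_path e w r)" for s
    by (simp add: state_path_def matrix_vector_right_distrib)
  show "set_integrable lborel ?I (\<lambda>s. F_ker P t s *v state_path e w s)"
    unfolding st by (rule set_integral_add(1)[OF c bk.fubini_prim(1)[OF tr(1)]])
  have FS: "(LINT s:?I|lborel. F_ker P t s *v state_path e w s) = (LINT s:?I|lborel. F_ker P t s *v \<xi> 0) + (LINT s:?I|lborel. bk.prim s *v drift_path e w s)"
    unfolding st bk.fubini_prim(3)[OF tr(1), symmetric] by (rule set_integral_add(2)[OF c bk.fubini_prim(1)[OF tr(1)]])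
  have eq: "bk.prim s *v e s + control_kernel bk.prim t s *v w s = Eker P t s *v e s + control_row3 t s *v w s" if s: "s \<in> ?I" for s
  proof -
    have "indicator {..<t} (s + \<delta>) *\<^sub>R (bk.prim (s + \<delta>) ** B2 P (s + \<delta>)) = Eker P t (s + \<delta>) ** B2_zero T P (s + \<delta>)"
    proof (cases "s + \<delta> < t")
      case True
      then show ?thesis using s \<delta> tt prim[of "s + \<delta>"] by (simp add: B2_zero_eq)
    next
      case False
      then have "Eker P t (s + \<delta>) = 0" by (auto simp: Eker_def indicator_def set_lebesgue_integral_def)
      then show ?thesis using False by (simp add: matrix_matrix_mult_def vec_eq_iff)
    qed
    moreover have "(LINT r:{s<..<t}|lborel. bk.prim r ** B3 P r ** F'_ker P r s) = (LINT \<theta>:{s<..<t}|lborel. Eker P t \<theta> ** B3 P \<theta> ** F'_ker P \<theta> s)"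
      by (intro set_lebesgue_integral_cong) (use s prim in auto)
    ultimately show ?thesis using s prim[of s] by (simp add: control_kernel_def control_row3_def)
  qed
  show "set_integrable lborel ?I (\<lambda>s. Eker P t s *v e s + control_row3 t s *v w s)"
    by (rule set_integrable_congI[OF tr(2)]) (rule eq)
  have "(LINT s:?I|lborel. bk.prim s *v \<beta> s) = (LINT s:{t0<..<min (t0 + \<delta>) t}|lborel. bk.prim s *v (B2 P s *v \<zeta> (s - t0 - \<delta>)))"
    unfolding set_lebesgue_integral_def by (intro Bochner_Integration.integral_cong) (auto simp: \<beta>_def indicator_def)
  then show "(LINT s:?I|lborel. F_ker P t s *v state_path e w s)
      = (LINT s:?I|lborel. F_ker P t s *v phi1 s) + (LINT s:?I|lborel. Eker P t s *v e s + control_row3 t s *v w s)"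
    unfolding FS F\<phi> tr(4) using set_lebesgue_integral_cong[of ?I lborel "\<lambda>s. bk.prim s *v e s + control_kernel bk.prim t s *v w s"] eq
    by simp
qed

end

section \<open>The Volterra equation of a controlled path\<close>

context brownian
begin

lemma L2F_cong:
  fixes f g :: "real \<Rightarrow> 'w \<Rightarrow> 'b::euclidean_space"
  assumes f: "f \<in> L2F M W a b" and eq: "\<And>s \<omega>. s \<in> {a<..<b} \<Longrightarrow> \<omega> \<in> space M \<Longrightarrow> f s \<omega> = g s \<omega>"
  shows "g \<in> L2F M W a b"
proof -
  have "mean_sq M a b g = mean_sq M a b f"
    unfolding mean_sq_def by (intro nn_integral_cong) (auto simp: indicator_def eq)
  moreover have "jmeas M a b g" using f eq jmeas_cong[of a b M f g] by (auto simp: L2F_iff)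
  moreover have "g t \<in> borel_measurable (Fil t)" if t: "t \<in> {a<..<b}" for t
  proof -
    have "f t \<in> borel_measurable (Fil t)" using f t by (simp add: L2F_iff)
    then show ?thesis by (rule measurable_cong[THEN iffD1, rotated]) (use eq[OF t] in simp)
  qed
  ultimately show ?thesis using f by (simp add: L2F_iff)
qed

lemma has_ito_cong_strip:
  fixes f g :: "real \<Rightarrow> 'w \<Rightarrow> 'b::euclidean_space"
  assumes "a < b" "has_ito_integral M W a b f I" "\<And>s \<omega>. s \<in> {a<..<b} \<Longrightarrow> \<omega> \<in> space M \<Longrightarrow> f s \<omega> = g s \<omega>"
  shows "has_ito_integral M W a b g I"
proof (rule has_ito_cong[OF assms(1,2)])
  show "g \<in> L2F M W a b"
    by (rule L2F_cong[OF _ assms(3)]) (use assms(2) in \<open>auto simp: has_ito_integral_def\<close>)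
qed (use assms(3) in \<open>auto intro!: AE_I2\<close>)

lemma has_ito_zero:
  assumes "a < b"
  shows "has_ito_integral M W a b (\<lambda>s \<omega>. 0 :: 'b::euclidean_space) (\<lambda>\<omega>. 0)"
proof -
  have "(\<lambda>s \<omega>. 0 :: 'b) \<in> L2F M W a b"
    by (simp add: L2F_iff jmeas_def mean_sq_def case_prod_beta')
  moreover have "approximates a b (\<lambda>_. []) (\<lambda>s \<omega>. 0 :: 'b)"
    by (simp add: approximates_def mean_sq_def el_proc_def)
  ultimately show ?thesis
    unfolding has_ito_iff[OF assms] by (auto intro!: exI[of _ "\<lambda>_. []"] simp: el_int_def)
qed

lemma L2F_path_square:
  fixes f :: "real \<Rightarrow> 'w \<Rightarrow> 'b::euclidean_space"
  assumes f: "f \<in> L2F M W a b"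
  shows "AE \<omega> in M. set_borel_measurable lborel {a<..<b} (\<lambda>s. f s \<omega>) \<and> set_integrable lborel {a<..<b} (\<lambda>s. (norm (f s \<omega>))\<^sup>2)"
proof -
  have jm: "jmeas M a b f" using f by (simp add: L2F_iff)
  have "AE \<omega> in M. (\<integral>\<^sup>+s\<in>{a<..<b}. ennreal ((norm (f s \<omega>))\<^sup>2) \<partial>lborel) \<noteq> \<infinity>"
    by (rule nn_integral_PInf_AE[OF mean_sq_inner_measurable[OF jm]]) (use f in \<open>auto simp: L2F_iff mean_sq_def\<close>)
  then show ?thesis using AE_space
  proof eventually_elim
    case (elim \<omega>)
    have m: "set_borel_measurable lborel {a<..<b} (\<lambda>s. f s \<omega>)" by (rule jmeas_section_set[OF jm elim(2)])
    have "set_integrable lborel {a<..<b} (\<lambda>s. (norm (f s \<omega>))\<^sup>2)"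
      unfolding set_integrable_def
    proof (rule integrableI_bounded)
      have "(\<lambda>s. (norm (indicator {a<..<b} s *\<^sub>R f s \<omega>))\<^sup>2) \<in> borel_measurable lborel"
        using m unfolding set_borel_measurable_def by measurable
      also have "(\<lambda>s. (norm (indicator {a<..<b} s *\<^sub>R f s \<omega>))\<^sup>2) = (\<lambda>s. indicator {a<..<b} s *\<^sub>R (norm (f s \<omega>))\<^sup>2)"
        by (auto simp: indicator_def)
      finally show "(\<lambda>s. indicator {a<..<b} s *\<^sub>R (norm (f s \<omega>))\<^sup>2) \<in> borel_measurable lborel" .
      have "(\<integral>\<^sup>+s. ennreal (norm (indicator {a<..<b} s *\<^sub>R (norm (f s \<omega>))\<^sup>2)) \<partial>lborel) = (\<integral>\<^sup>+s\<in>{a<..<b}. ennreal ((norm (f s \<omega>))\<^sup>2) \<partial>lborel)"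
        by (intro nn_integral_cong) (auto simp: indicator_def)
      then show "(\<integral>\<^sup>+s. ennreal (norm (indicator {a<..<b} s *\<^sub>R (norm (f s \<omega>))\<^sup>2)) \<partial>lborel) < \<infinity>"
        using elim(1) by (simp add: less_top)
    qed
    with m show ?case by simp
  qed
qed

end

context delay_problem
begin

definition free_drift :: "(real \<Rightarrow> 'w \<Rightarrow> real^'n) \<Rightarrow> (real \<Rightarrow> 'w \<Rightarrow> real^'n) \<Rightarrow> (real \<Rightarrow> 'w \<Rightarrow> real^'n) \<Rightarrow> 'w \<Rightarrow> real \<Rightarrow> real^'n" where
  "free_drift X1 X2 X3 \<omega> s = A1 P s *v X1 s \<omega> + A2 P s *v X2 s \<omega> + A3 P s *v X3 s \<omega> + b_coeff P s \<omega>"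

definition diffusion :: "(real \<Rightarrow> 'w \<Rightarrow> real^'n) \<Rightarrow> (real \<Rightarrow> 'w \<Rightarrow> real^'n) \<Rightarrow> (real \<Rightarrow> 'w \<Rightarrow> real^'n) \<Rightarrow> (real \<Rightarrow> 'w \<Rightarrow> real^'m)
    \<Rightarrow> real \<Rightarrow> 'w \<Rightarrow> real^'n" where
  "diffusion X1 X2 X3 u s \<omega> = C1 P s *v X1 s \<omega> + C2 P s *v X2 s \<omega> + C3 P s *v X3 s \<omega> + D1 P s *v u s \<omega> + \<sigma>_coeff P s \<omega>"

abbreviation volterra_diffusion :: "(real \<Rightarrow> 'w \<Rightarrow> real^'m) \<Rightarrow> (real \<Rightarrow> 'w \<Rightarrow> real^('n + 'n + 'n)) \<Rightarrow> real \<Rightarrow> real \<Rightarrow> 'w \<Rightarrow> real^('n + 'n + 'n)" where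
  "volterra_diffusion u X t \<equiv> (\<lambda>s \<omega>. volterra_C \<delta> P t s *v X s \<omega> + volterra_D \<delta> P t s *v u s \<omega> + volterra_\<sigma> \<delta> P t s \<omega>)"

abbreviation volterra_drift :: "(real \<Rightarrow> 'w \<Rightarrow> real^'m) \<Rightarrow> (real \<Rightarrow> 'w \<Rightarrow> real^('n + 'n + 'n)) \<Rightarrow> real \<Rightarrow> real \<Rightarrow> 'w \<Rightarrow> real^('n + 'n + 'n)" where
  "volterra_drift u X t \<equiv> (\<lambda>s \<omega>. volterra_A \<delta> P t s *v X s \<omega> + volterra_B T \<delta> P t s *v u s \<omega> + volterra_b \<delta> P t s \<omega>)"

text \<open>The triple formed by a path, its delay and its memory. At times up to \<open>t0 + \<delta>\<close> the delay looks
  back at the initial trajectory.\<close>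

abbreviation augmented :: "(real \<Rightarrow> 'w \<Rightarrow> real^'n) \<Rightarrow> real \<Rightarrow> 'w \<Rightarrow> real^('n + 'n + 'n)" where
  "augmented x \<equiv> (\<lambda>t \<omega>. vstack3 (x t \<omega>) (if t \<le> t0 + \<delta> then \<xi> (t - \<delta> - t0) else x (t - \<delta>) \<omega>)
     (LINT s:{t0<..<t}|lborel. F_ker P t s *v x s \<omega>))"

lemma volterra_diffusion_eq:
  "volterra_C \<delta> P t s *v vstack3 (X1 s \<omega>) (X2 s \<omega>) (X3 s \<omega>) + volterra_D \<delta> P t s *v u s \<omega> + volterra_\<sigma> \<delta> P t s \<omega>
   = vstack3 (diffusion X1 X2 X3 u s \<omega>) (indicator {\<delta><..} (t - s) *\<^sub>R diffusion X1 X2 X3 u s \<omega>) (Eker P t s *v diffusion X1 X2 X3 u s \<omega>)"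
proof -
  have "volterra_C \<delta> P t s *v vstack3 (X1 s \<omega>) (X2 s \<omega>) (X3 s \<omega>) + volterra_D \<delta> P t s *v u s \<omega> + volterra_\<sigma> \<delta> P t s \<omega>
    = Upsilon \<delta> P t s *v diffusion X1 X2 X3 u s \<omega>"
    unfolding volterra_C_def volterra_D_def volterra_\<sigma>_def diffusion_def
    by (simp add: matrix_vector_mul_assoc[symmetric] hstack3_vector matrix_vector_right_distrib)
  then show ?thesis by (simp add: Upsilon_def vstack3_matrix_vector scaleR_matrix_vector_assoc[symmetric])
qed

lemma volterra_drift_eq:
  "volterra_A \<delta> P t s *v vstack3 (X1 s \<omega>) (X2 s \<omega>) (X3 s \<omega>) + volterra_B T \<delta> P t s *v v + volterra_b \<delta> P t s \<omega>
   = vstack3 (free_drift X1 X2 X3 \<omega> s + control_row1 t s *v v)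
      (indicator {\<delta><..} (t - s) *\<^sub>R free_drift X1 X2 X3 \<omega> s + control_row2 t s *v v)
      (Eker P t s *v free_drift X1 X2 X3 \<omega> s + control_row3 t s *v v)"
proof -
  have 1: "volterra_A \<delta> P t s *v vstack3 (X1 s \<omega>) (X2 s \<omega>) (X3 s \<omega>) + volterra_b \<delta> P t s \<omega>
    = Upsilon \<delta> P t s *v free_drift X1 X2 X3 \<omega> s"
    unfolding volterra_A_def volterra_b_def free_drift_def
    by (simp add: matrix_vector_mul_assoc[symmetric] hstack3_vector matrix_vector_right_distrib)
  have 2: "volterra_B T \<delta> P t s = vstack3 (control_row1 t s) (control_row2 t s) (control_row3 t s)"
    unfolding volterra_B_def control_row1_def control_row2_def control_row3_def ..
  have "volterra_A \<delta> P t s *v vstack3 (X1 s \<omega>) (X2 s \<omega>) (X3 s \<omega>) + volterra_B T \<delta> P t s *v v + volterra_b \<delta> P t s \<omega>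
     = Upsilon \<delta> P t s *v free_drift X1 X2 X3 \<omega> s + volterra_B T \<delta> P t s *v v"
    unfolding 1[symmetric] by simp
  then show ?thesis
    by (simp add: 2 Upsilon_def vstack3_matrix_vector vstack3_add scaleR_matrix_vector_assoc[symmetric])
qed

lemma volterra_phi_eq:
  "volterra_phi T \<delta> P t0 \<xi> \<zeta> t = vstack3 (phi1 t) (phi2 t) (LINT s:{t0<..<t}|lborel. F_ker P t s *v phi1 s)"
  unfolding volterra_phi_def phi1_def phi2_def ..

lemma diffusion_L2F:
  assumes X: "X1 \<in> L2F M W t0 T" "X2 \<in> L2F M W t0 T" "X3 \<in> L2F M W t0 T" and u: "u \<in> L2F M W t0 T"
  shows "diffusion X1 X2 X3 u \<in> L2F M W t0 T"
proof -
  have *: "(\<lambda>s \<omega>. G s *v f s \<omega>) \<in> L2F M W t0 T" if G: "G \<in> Linf_space (leb_ivl 0 T)" and f: "f \<in> L2F M W t0 T"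
    for G :: "real \<Rightarrow> real^'q^'n" and f :: "real \<Rightarrow> 'w \<Rightarrow> real^'q"
  proof -
    have m: "set_borel_measurable lborel {t0<..<T} G" by (rule sub_meas[OF Linf_spaceD(1)[OF G]]) simp
    obtain K where "AE s in lborel. s \<in> {0<..<T} \<longrightarrow> norm (G s) \<le> K" using Linf_spaceD(2)[OF G] by blast
    then have K: "AE s in lborel. s \<in> {t0<..<T} \<longrightarrow> norm (G s) \<le> K" by eventually_elim (use t0 in auto)
    have "G \<in> borel_measurable (restrict_space borel {t0<..<T})"
      using m by (subst borel_measurable_restrict_space_iff) (simp_all add: set_borel_measurable_def)
    then show ?thesis using K f by (rule L2F_matrix)
  qed
  have \<sigma>: "\<sigma>_coeff P \<in> L2F M W t0 T" using A1 t0 by (auto simp: assumption_A1_def intro: L2F_subinterval)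
  have "(\<lambda>s \<omega>. C1 P s *v X1 s \<omega> + C2 P s *v X2 s \<omega> + C3 P s *v X3 s \<omega> + D1 P s *v u s \<omega> + \<sigma>_coeff P s \<omega>) \<in> L2F M W t0 T"
    using A1 by (intro L2F_add * X u \<sigma>) (auto simp: assumption_A1_def)
  then show ?thesis by (simp add: diffusion_def[abs_def])
qed

text \<open>The coefficients \<open>A1, A2, A3\<close> and almost all paths of the state are square integrable, so their
  products are integrable; almost all paths of \<open>b\<close> are integrable because \<open>(\<integral> |b|)\<^sup>2\<close> has finite mean.\<close>

lemma path_integrable:
  fixes u :: "real \<Rightarrow> 'w \<Rightarrow> real^'m"
  assumes X: "X1 \<in> L2F M W t0 T" "X2 \<in> L2F M W t0 T" "X3 \<in> L2F M W t0 T" and u: "u \<in> L2F M W t0 T"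
  shows "AE \<omega> in M. set_integrable lborel {t0<..<T} (free_drift X1 X2 X3 \<omega>) \<and> set_integrable lborel {t0<..<T} (\<lambda>s. u s \<omega>)"
proof -
  have Ai: "set_borel_measurable lborel {t0<..<T} G \<and> set_integrable lborel {t0<..<T} (\<lambda>s. (norm (G s))\<^sup>2)"
    if "G \<in> {A1 P, A2 P, A3 P}" for G
  proof -
    have G: "G \<in> L2_space (leb_ivl 0 T)" using A1 that by (auto simp: assumption_A1_def)
    have "{t0<..<T} \<subseteq> {0<..<T}" using t0 by auto
    then show ?thesis
      using sub_meas[OF L2_spaceD(1)[OF G], of T] set_integrable_subset[OF L2_spaceD(2)[OF G], of "{t0<..<T}"] by simp
  qed
  have b: "AE \<omega> in M. set_integrable lborel {t0<..<T} (\<lambda>s. b_coeff P s \<omega>)"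
  proof -
    have jm: "jmeas M 0 T (b_coeff P)" and fin: "(\<integral>\<^sup>+\<omega>. (\<integral>\<^sup>+t\<in>{0<..<T}. ennreal (norm (b_coeff P t \<omega>)) \<partial>lborel)\<^sup>2 \<partial>M) < \<infinity>"
      using A1 by (auto simp: assumption_A1_def L2F_L1_def adapted_processes_def jmeas_def)
    have [measurable]: "(\<lambda>\<omega>. \<integral>\<^sup>+t\<in>{0<..<T}. ennreal (norm (b_coeff P t \<omega>)) \<partial>lborel) \<in> borel_measurable M"
      by (rule jmeas_nn_integral[OF jm]) measurable
    have "AE \<omega> in M. (\<integral>\<^sup>+t\<in>{0<..<T}. ennreal (norm (b_coeff P t \<omega>)) \<partial>lborel)\<^sup>2 \<noteq> \<infinity>"
      by (rule nn_integral_PInf_AE) (use fin in auto)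
    then show ?thesis using AE_space
    proof eventually_elim
      case (elim \<omega>)
      have "set_integrable lborel {0<..<T} (\<lambda>s. b_coeff P s \<omega>)"
        unfolding set_integrable_def
      proof (rule integrableI_bounded)
        show "(\<lambda>s. indicator {0<..<T} s *\<^sub>R b_coeff P s \<omega>) \<in> borel_measurable lborel"
          using jmeas_section[OF jm elim(2)] by simp
        have "(\<integral>\<^sup>+s. ennreal (norm (indicator {0<..<T} s *\<^sub>R b_coeff P s \<omega>)) \<partial>lborel) = (\<integral>\<^sup>+t\<in>{0<..<T}. ennreal (norm (b_coeff P t \<omega>)) \<partial>lborel)"
          by (intro nn_integral_cong) (auto simp: indicator_def)
        moreover have "(\<integral>\<^sup>+t\<in>{0<..<T}. ennreal (norm (b_coeff P t \<omega>)) \<partial>lborel) \<noteq> \<infinity>"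
          using elim(1) by (auto simp: power2_eq_square ennreal_mult_eq_top_iff)
        ultimately show "(\<integral>\<^sup>+s. ennreal (norm (indicator {0<..<T} s *\<^sub>R b_coeff P s \<omega>)) \<partial>lborel) < \<infinity>"
          by (simp add: less_top)
      qed
      then show ?case by (rule set_integrable_subset) (use t0 in auto)
    qed
  qed
  show ?thesis
    using L2F_path_square[OF X(1)] L2F_path_square[OF X(2)] L2F_path_square[OF X(3)] L2F_path_square[OF u] b
  proof eventually_elim
    case (elim \<omega>)
    have "set_integrable lborel {t0<..<T} (\<lambda>s. A1 P s *v X1 s \<omega> + A2 P s *v X2 s \<omega> + A3 P s *v X3 s \<omega> + b_coeff P s \<omega>)"
      using elim Ai by (intro set_integral_add square_integrable_product) auto
    then show ?case
      using elim square_integrable_integrable[of t0 T "\<lambda>s. u s \<omega>"] by (simp add: free_drift_def[abs_def])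
  qed
qed

text \<open>The state that results when the drift and the diffusion coefficient are fed with given processes
  \<open>X1, X2, X3\<close> and \<open>Y\<close> is the stochastic integral of the latter. The state equation is the fixed point
  problem in which they are this state, its delay and its memory.\<close>

definition solution :: "(real \<Rightarrow> 'w \<Rightarrow> real^'n) \<Rightarrow> (real \<Rightarrow> 'w \<Rightarrow> real^'n) \<Rightarrow> (real \<Rightarrow> 'w \<Rightarrow> real^'n) \<Rightarrow> (real \<Rightarrow> 'w \<Rightarrow> real^'m)
    \<Rightarrow> (real \<Rightarrow> 'w \<Rightarrow> real^'n) \<Rightarrow> real \<Rightarrow> 'w \<Rightarrow> real^'n" where
  "solution X1 X2 X3 u Y t \<omega> = state_path (free_drift X1 X2 X3 \<omega>) (\<lambda>s. u s \<omega>) t + Y t \<omega>"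

text \<open>The right-hand side of the Volterra equation for the input \<open>X\<close> is the augmented path of the solution
  \<open>x\<close> with this input. Since the input is arbitrary, this gives both directions: a delay state is a
  solution with itself, its delay and its memory as input, and for a Volterra state the identity says that
  the input is an augmented path. The drift is treated by the three rows. For the stochastic integral the
  identity, the cut at \<open>t - \<delta>\<close> and the stochastic Fubini theorem give the three blocks.\<close>

lemma volterra_rhs:
  assumes X: "X1 \<in> L2F M W t0 T" "X2 \<in> L2F M W t0 T" "X3 \<in> L2F M W t0 T" and u: "u \<in> L2F M W t0 T"
    and Y: "continuous_version t0 T (diffusion X1 X2 X3 u) ys Y" and t: "good_time t"
  defines "x \<equiv> solution X1 X2 X3 u Y" and "X \<equiv> (\<lambda>s \<omega>. vstack3 (X1 s \<omega>) (X2 s \<omega>) (X3 s \<omega>))"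
  shows "\<exists>I. has_ito_integral M W t0 t (volterra_diffusion u X t) I \<and>
    (AE \<omega> in M. augmented x t \<omega>
      = volterra_phi T \<delta> P t0 \<xi> \<zeta> t
        + (LINT s:{t0<..<t}|lborel. volterra_drift u X t s \<omega>)
        + I \<omega>)"
proof -
  let ?f = "diffusion X1 X2 X3 u"
  obtain K where K: "bounded_kernel t0 t K (F_ker P t)" and tt: "t0 < t" "t < T" using t by (auto simp: good_time_def)
  interpret bk: bounded_kernel t0 t K "F_ker P t" by (rule K)
  have f: "?f \<in> L2F M W t0 T" by (rule diffusion_L2F[OF X u])
  define J2 where "J2 \<omega> = (if t \<le> t0 + \<delta> then 0 else Y (t - \<delta>) \<omega>)" for \<omega>
  define J3 where "J3 \<omega> = (LINT r:{t0<..<t}|lborel. F_ker P t r *v Y r \<omega>)" for \<omega>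
  have I1: "has_ito_integral M W t0 t ?f (Y t)"
    by (rule continuous_version_has_ito[OF t0(1) f Y]) (use tt in auto)
  have I2: "has_ito_integral M W t0 t (\<lambda>s \<omega>. indicator {\<delta><..} (t - s) *\<^sub>R ?f s \<omega>) J2"
  proof (cases "t \<le> t0 + \<delta>")
    case True
    then have J: "J2 = (\<lambda>\<omega>. 0)" by (simp add: J2_def fun_eq_iff)
    show ?thesis unfolding J by (rule has_ito_cong_strip[OF tt(1) has_ito_zero[OF tt(1)]]) (use True in auto)
  next
    case False
    then have J: "J2 = Y (t - \<delta>)" by (simp add: J2_def fun_eq_iff)
    have "has_ito_integral M W t0 (t - \<delta>) ?f (Y (t - \<delta>))"
      by (rule continuous_version_has_ito[OF t0(1) f Y]) (use tt \<delta> False in auto)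
    then have "has_ito_integral M W t0 t (\<lambda>s \<omega>. if s < t - \<delta> then ?f s \<omega> else 0) (Y (t - \<delta>))"
      by (rule has_ito_zero_extend) (use False \<delta> in auto)
    then show ?thesis unfolding J by (rule has_ito_cong_strip[OF tt(1)]) auto
  qed
  have I3: "has_ito_integral M W t0 t (\<lambda>s \<omega>. Eker P t s *v ?f s \<omega>) J3"
    unfolding J3_def
    by (rule has_ito_cong_strip[OF tt(1) ito_fubini[OF t0(1) less_imp_le[OF tt(2)] f Y K]]) (use t0 in \<open>auto simp: Eker_def\<close>)
  define I where "I \<omega> = vstack3 (Y t \<omega>) (J2 \<omega>) (J3 \<omega>)" for \<omega>
  have sp: "vstack3 p q r = vstack3 p 0 0 + vstack3 0 q 0 + vstack3 0 0 r" for p q r :: "real^'n"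
    by (rule vstack3_split)
  have ito: "has_ito_integral M W t0 t (volterra_diffusion u X t) I"
    unfolding X_def volterra_diffusion_eq I_def[abs_def]
    by (subst (1 2) sp) (intro has_ito_add[OF t0(1) tt(1)] has_ito_linear[OF t0(1) tt(1) I1 bounded_linear_vstack3(1)]
      has_ito_linear[OF t0(1) tt(1) I2 bounded_linear_vstack3(2)] has_ito_linear[OF t0(1) tt(1) I3 bounded_linear_vstack3(3)])
  have Yc: "AE \<omega> in M. continuous_on {t0..T} (\<lambda>t. Y t \<omega>)" using Y by (auto simp: continuous_version_def)
  have "AE \<omega> in M. augmented x t \<omega>
      = volterra_phi T \<delta> P t0 \<xi> \<zeta> t
        + (LINT s:{t0<..<t}|lborel. volterra_drift u X t s \<omega>)
        + I \<omega>"
    using path_integrable[OF X u] Yc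
  proof eventually_elim
    case (elim \<omega>)
    let ?e = "free_drift X1 X2 X3 \<omega>" and ?w = "\<lambda>s. u s \<omega>"
    have e: "set_integrable lborel {t0<..<T} ?e" and w: "set_integrable lborel {t0<..<T} ?w" using elim by auto
    have tT: "t \<le> T" using tt by simp
    have FY: "set_integrable lborel {t0<..<t} (\<lambda>s. F_ker P t s *v Y s \<omega>)"
    proof (rule set_integrable_matrix[OF _ bk.k_meas bk.K])
      have c: "continuous_on {t0..t} (\<lambda>s. Y s \<omega>)" using elim tT by (auto intro: continuous_on_subset)
      have "set_integrable lborel {t0..t} (\<lambda>s. Y s \<omega>)" by (rule borel_integrable_compact[OF compact_Icc c, folded set_integrable_def])
      then show "set_integrable lborel {t0<..<t} (\<lambda>s. Y s \<omega>)" by (rule set_integrable_subset) auto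
    qed simp
    have 3: "(LINT s:{t0<..<t}|lborel. F_ker P t s *v x s \<omega>) = (LINT s:{t0<..<t}|lborel. F_ker P t s *v phi1 s)
        + (LINT s:{t0<..<t}|lborel. Eker P t s *v ?e s + control_row3 t s *v ?w s) + J3 \<omega>"
      using memory_row[OF e w t] FY unfolding x_def solution_def J3_def
      by (simp add: matrix_vector_right_distrib set_integral_add)
    have 2: "(if t \<le> t0 + \<delta> then \<xi> (t - \<delta> - t0) else x (t - \<delta>) \<omega>) =
        phi2 t + (LINT s:{t0<..<t}|lborel. indicator {\<delta><..} (t - s) *\<^sub>R ?e s + control_row2 t s *v ?w s) + J2 \<omega>"
      using delay_row(2)[OF e w tt(1) tT] unfolding x_def solution_def J2_def by (auto split: if_splits)
    have 1: "x t \<omega> = phi1 t + (LINT s:{t0<..<t}|lborel. ?e s + control_row1 t s *v ?w s) + Y t \<omega>"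
      using state_row(2)[OF e w tt(1) tT] unfolding x_def solution_def by simp
    show ?case
      unfolding X_def volterra_drift_eq volterra_phi_eq I_def 1 2 3
      by (subst set_integral_vstack3[OF state_row(1)[OF e w tt(1) tT] delay_row(1)[OF e w tt(1) tT] memory_row(1)[OF e w t]])
         (simp add: vstack3_add)
  qed
  with ito show ?thesis by blast
qed

end

section \<open>Delay and memory of a continuous process\<close>

text \<open>A process with continuous paths is the limit of its values at the dyadic times just below, so it is
  jointly measurable for every \<open>\<sigma>\<close>-algebra that contains its past. The paths may be discontinuous on a
  measurable set \<open>N\<close>, where they are replaced by \<open>0\<close>.\<close>

lemma continuous_paths_jmeas:
  fixes x :: "real \<Rightarrow> 'w \<Rightarrow> 'b::euclidean_space"
  assumes x: "\<And>s. s \<in> {a<..<t} \<Longrightarrow> x s \<in> borel_measurable G" and N: "N \<in> sets G"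
    and c: "\<And>\<omega>. \<omega> \<in> space G - N \<Longrightarrow> continuous_on {a<..<t} (\<lambda>s. x s \<omega>)"
  shows "(\<lambda>(s, \<omega>). indicator {a<..<t} s *\<^sub>R (indicator (space G - N) \<omega> *\<^sub>R x s \<omega>)) \<in> borel_measurable (borel \<Otimes>\<^sub>M G)"
proof -
  define q :: "nat \<Rightarrow> int \<Rightarrow> real" where "q n i = of_int i / 2 ^ n" for n :: nat and i :: int
  define v where "v n i \<omega> = (if q n i \<in> {a<..<t} then x (q n i) \<omega> else 0)" for n i \<omega>
  have vm [measurable]: "v n i \<in> borel_measurable G" for n i
  proof (cases "q n i \<in> {a<..<t}")
    case True
    then have "v n i = x (q n i)" by (simp add: v_def fun_eq_iff)
    then show ?thesis using x[OF True] by simp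
  next
    case False
    then have "v n i = (\<lambda>_. 0)" by (auto simp: v_def fun_eq_iff)
    then show ?thesis by simp
  qed
  have Nc: "(\<lambda>\<omega>. indicator (space G - N) \<omega> :: real) \<in> borel_measurable G"
    using N by (intro borel_measurable_indicator sets.Diff sets.top)
  define f where "f n p = indicator {a<..<t} (fst p) *\<^sub>R (indicator (space G - N) (snd p) *\<^sub>R v n \<lfloor>fst p * 2 ^ n\<rfloor> (snd p))" for n :: nat and p :: "real \<times> 'w"
  have fm: "f n \<in> borel_measurable (borel \<Otimes>\<^sub>M G)" for n
  proof -
    have "(\<lambda>p :: real \<times> 'w. v n \<lfloor>fst p * 2 ^ n\<rfloor> (snd p)) \<in> borel_measurable (borel \<Otimes>\<^sub>M G)"
    proof (rule measurable_compose_countable)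
      show "(\<lambda>p. v n i (snd p)) \<in> borel_measurable (borel \<Otimes>\<^sub>M G)" for i by measurable
      show "(\<lambda>p :: real \<times> 'w. \<lfloor>fst p * 2 ^ n\<rfloor>) \<in> borel \<Otimes>\<^sub>M G \<rightarrow>\<^sub>M count_space UNIV" by measurable
    qed
    moreover have "(\<lambda>p. indicator (space G - N) (snd p) :: real) \<in> borel_measurable (borel \<Otimes>\<^sub>M G)"
      by (rule measurable_compose[OF measurable_snd Nc])
    moreover have "(\<lambda>p. indicator {a<..<t} (fst p) :: real) \<in> borel_measurable (borel \<Otimes>\<^sub>M G)" by measurable
    ultimately show ?thesis unfolding f_def by (intro borel_measurable_scaleR)
  qed
  show ?thesis
  proof (rule borel_measurable_LIMSEQ_metric[OF fm])
    fix p :: "real \<times> 'w"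
    obtain s \<omega> where so: "p = (s, \<omega>)" by (cases p)
    show "(\<lambda>n. f n p) \<longlonglongrightarrow> (case p of (s, \<omega>) \<Rightarrow> indicator {a<..<t} s *\<^sub>R (indicator (space G - N) \<omega> *\<^sub>R x s \<omega>))"
    proof (cases "s \<in> {a<..<t} \<and> \<omega> \<in> space G - N")
      case True
      then have s: "a < s" "s < t" and w: "\<omega> \<in> space G - N" by auto
      have lim: "(\<lambda>n. q n \<lfloor>s * 2 ^ n\<rfloor>) \<longlonglongrightarrow> s" unfolding q_def by (rule floor_dyadic)
      have ev: "\<forall>\<^sub>F n in sequentially. q n \<lfloor>s * 2 ^ n\<rfloor> \<in> {a<..<t}"
        using order_tendstoD(1)[OF lim s(1)] order_tendstoD(2)[OF lim s(2)] by eventually_elim auto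
      have "(\<lambda>n. x (q n \<lfloor>s * 2 ^ n\<rfloor>) \<omega>) \<longlonglongrightarrow> x s \<omega>"
        by (rule continuous_on_tendsto_compose[OF c[OF w] lim _ ev]) (use s in auto)
      moreover have "\<forall>\<^sub>F n in sequentially. x (q n \<lfloor>s * 2 ^ n\<rfloor>) \<omega> = f n p"
        using ev by eventually_elim (use s w in \<open>simp add: f_def v_def so\<close>)
      ultimately have "(\<lambda>n. f n p) \<longlonglongrightarrow> x s \<omega>" by (rule Lim_transform_eventually)
      then show ?thesis using s w by (simp add: so)
    next
      case False
      then have "f n p = 0" for n by (auto simp: f_def so)
      moreover have "(case p of (s, \<omega>) \<Rightarrow> indicator {a<..<t} s *\<^sub>R (indicator (space G - N) \<omega> *\<^sub>R x s \<omega>)) = 0"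
        using False by (auto simp: so)
      ultimately show ?thesis by simp
    qed
  qed
qed

text \<open>Cauchy-Schwarz against the constant function, from \<open>0 \<le> \<integral> (g - m)\<^sup>2\<close> with \<open>m\<close> the mean value of \<open>g\<close>.\<close>

lemma square_of_integral_le:
  fixes g :: "real \<Rightarrow> real"
  assumes ab: "a < b" and g: "set_integrable lborel {a<..<b} g" "set_integrable lborel {a<..<b} (\<lambda>s. (g s)\<^sup>2)"
  shows "(LINT s:{a<..<b}|lborel. g s)\<^sup>2 \<le> (b - a) * (LINT s:{a<..<b}|lborel. (g s)\<^sup>2)"
proof -
  define c where "c = (LINT s:{a<..<b}|lborel. g s)"
  define m where "m = c / (b - a)"
  have one: "set_integrable lborel {a<..<b} (\<lambda>s. m\<^sup>2)"
    by (rule integrable_bounded_on_interval[where K="m\<^sup>2"]) (simp_all add: set_borel_measurable_def)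
  have "0 \<le> (LINT s:{a<..<b}|lborel. (g s - m)\<^sup>2)"
    unfolding set_lebesgue_integral_def by (intro Bochner_Integration.integral_nonneg) auto
  also have "\<dots> = (LINT s:{a<..<b}|lborel. (g s)\<^sup>2 + ((- 2 * m) * g s + m\<^sup>2))"
    by (intro arg_cong2[where f="set_lebesgue_integral lborel"] refl ext) (simp add: power2_eq_square algebra_simps)
  also have "\<dots> = (LINT s:{a<..<b}|lborel. (g s)\<^sup>2) + ((- 2 * m) * c + m\<^sup>2 * (b - a))"
  proof -
    have "set_integrable lborel {a<..<b} (\<lambda>s. (- 2 * m) * g s)" using g(1) by (rule set_integrable_mult_right)
    moreover have "(LINT s:{a<..<b}|lborel. m\<^sup>2) = m\<^sup>2 * (b - a)" using ab by (simp add: set_lebesgue_integral_def)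
    ultimately show ?thesis using g one by (simp add: set_integral_add c_def del: mult_minus_left)
  qed
  finally have *: "0 \<le> (LINT s:{a<..<b}|lborel. (g s)\<^sup>2) + ((- 2 * m) * c + m\<^sup>2 * (b - a))" .
  have mc: "m * (b - a) = c" using ab by (simp add: m_def)
  have "m\<^sup>2 * (b - a) = m * c" unfolding mc[symmetric] by (simp add: power2_eq_square)
  with * have "0 \<le> (LINT s:{a<..<b}|lborel. (g s)\<^sup>2) - m * c" by (simp add: mult.commute)
  then have "0 \<le> (b - a) * ((LINT s:{a<..<b}|lborel. (g s)\<^sup>2) - m * c)" using ab by simp
  also have "\<dots> = (b - a) * (LINT s:{a<..<b}|lborel. (g s)\<^sup>2) - (m * (b - a)) * c" by (simp add: algebra_simps)
  finally show ?thesis unfolding mc by (simp add: c_def power2_eq_square)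
qed

context delay_problem
begin

lemma memory_jmeas:
  assumes x: "jmeas M t0 T x"
  shows "jmeas M t0 T (memory t0 (F_ker P) x)"
proof -
  have [measurable]: "(\<lambda>(t, \<omega>). indicator {t0<..<T} t *\<^sub>R x t \<omega>) \<in> borel_measurable (borel \<Otimes>\<^sub>M M)"
    using x by (simp add: jmeas_iff)
  note F_facts(1)[measurable]
  have "(\<lambda>(p, s). indicator {q. t0 < snd q} (p, s) *\<^sub>R ((\<lambda>(t, s). indicator (triangle 0 T) (t, s) *\<^sub>R F_ker P t s) (fst p, s) *v
      (\<lambda>(t, \<omega>). indicator {t0<..<T} t *\<^sub>R x t \<omega>) (s, snd p))) \<in> borel_measurable ((borel \<Otimes>\<^sub>M M) \<Otimes>\<^sub>M lborel)"
    by measurable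
  then have m: "(\<lambda>p. \<integral>s. indicator {q. t0 < snd q} (p, s) *\<^sub>R ((\<lambda>(t, s). indicator (triangle 0 T) (t, s) *\<^sub>R F_ker P t s) (fst p, s) *v
      (\<lambda>(t, \<omega>). indicator {t0<..<T} t *\<^sub>R x t \<omega>) (s, snd p)) \<partial>lborel) \<in> borel_measurable (borel \<Otimes>\<^sub>M M)"
    by (rule lborel.borel_measurable_lebesgue_integral)
  have "(\<lambda>p. indicator {t0<..<T} (fst p) *\<^sub>R (\<integral>s. indicator {q. t0 < snd q} (p, s) *\<^sub>R ((\<lambda>(t, s). indicator (triangle 0 T) (t, s) *\<^sub>R F_ker P t s) (fst p, s) *v
      (\<lambda>(t, \<omega>). indicator {t0<..<T} t *\<^sub>R x t \<omega>) (s, snd p)) \<partial>lborel)) \<in> borel_measurable (borel \<Otimes>\<^sub>M M)"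
    by (intro borel_measurable_scaleR m) measurable
  also have "(\<lambda>p. indicator {t0<..<T} (fst p) *\<^sub>R (\<integral>s. indicator {q. t0 < snd q} (p, s) *\<^sub>R ((\<lambda>(t, s). indicator (triangle 0 T) (t, s) *\<^sub>R F_ker P t s) (fst p, s) *v
      (\<lambda>(t, \<omega>). indicator {t0<..<T} t *\<^sub>R x t \<omega>) (s, snd p)) \<partial>lborel))
     = (\<lambda>(t, \<omega>). indicator {t0<..<T} t *\<^sub>R memory t0 (F_ker P) x t \<omega>)"
  proof
    fix p :: "real \<times> 'w"
    obtain t \<omega> where p: "p = (t, \<omega>)" by (cases p)
    show "indicator {t0<..<T} (fst p) *\<^sub>R (\<integral>s. indicator {q. t0 < snd q} (p, s) *\<^sub>R ((\<lambda>(t, s). indicator (triangle 0 T) (t, s) *\<^sub>R F_ker P t s) (fst p, s) *v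
      (\<lambda>(t, \<omega>). indicator {t0<..<T} t *\<^sub>R x t \<omega>) (s, snd p)) \<partial>lborel) = (\<lambda>(t, \<omega>). indicator {t0<..<T} t *\<^sub>R memory t0 (F_ker P) x t \<omega>) p"
    proof (cases "t \<in> {t0<..<T}")
      case True
      have "(\<integral>s. indicator {q. t0 < snd q} (p, s) *\<^sub>R ((\<lambda>(t, s). indicator (triangle 0 T) (t, s) *\<^sub>R F_ker P t s) (fst p, s) *v
      (\<lambda>(t, \<omega>). indicator {t0<..<T} t *\<^sub>R x t \<omega>) (s, snd p)) \<partial>lborel) = memory t0 (F_ker P) x t \<omega>"
        unfolding memory_def set_lebesgue_integral_def
        by (intro Bochner_Integration.integral_cong refl) (use True t0 in \<open>auto simp: p indicator_def triangle_def\<close>)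
      then show ?thesis by (simp add: p)
    qed (simp add: p)
  qed
  finally show ?thesis by (simp add: jmeas_iff)
qed

text \<open>The integral over \<open>(t0, t)\<close> is measurable at time \<open>t\<close> if its integrand is jointly measurable for the
  \<open>\<sigma>\<close>-algebra at time \<open>t\<close>. Adaptedness and joint measurability for \<open>M\<close> do not give this directly, but
  continuity of the paths does; the exceptional null set belongs to the \<open>\<sigma>\<close>-algebra.\<close>

lemma memory_adapted:
  assumes x: "\<And>s. s \<in> {t0<..<T} \<Longrightarrow> x s \<in> borel_measurable (Fil s)"
    and c: "AE \<omega> in M. continuous_on {t0<..<T} (\<lambda>s. x s \<omega>)" and t: "t \<in> {t0<..<T}"
  shows "memory t0 (F_ker P) x t \<in> borel_measurable (Fil t)"
proof -
  define N where "N = {\<omega> \<in> space M. \<not> continuous_on {t0<..<T} (\<lambda>s. x s \<omega>)}"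
  have N: "N \<in> null_sets M" using c unfolding AE_iff_null_sets N_def .
  have m [measurable]: "(\<lambda>(s, \<omega>). indicator {t0<..<t} s *\<^sub>R (indicator (space (Fil t) - N) \<omega> *\<^sub>R x s \<omega>)) \<in> borel_measurable (borel \<Otimes>\<^sub>M Fil t)"
  proof (rule continuous_paths_jmeas)
    show "x s \<in> borel_measurable (Fil t)" if "s \<in> {t0<..<t}" for s
      by (rule measurable_Fil_mono[OF x]) (use that t in auto)
    show "N \<in> sets (Fil t)" by (rule null_sets_Fil[OF N])
    show "continuous_on {t0<..<t} (\<lambda>s. x s \<omega>)" if "\<omega> \<in> space (Fil t) - N" for \<omega>
      using that t by (auto simp: N_def intro: continuous_on_subset)
  qed
  have [measurable]: "(\<lambda>s. indicator {t0<..<t} s *\<^sub>R F_ker P t s) \<in> borel_measurable borel"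
    using F_section[of t] t by (simp add: set_borel_measurable_def)
  have "(\<lambda>(\<omega>, s). (indicator {t0<..<t} s *\<^sub>R F_ker P t s) *v
      (\<lambda>(s, \<omega>). indicator {t0<..<t} s *\<^sub>R (indicator (space (Fil t) - N) \<omega> *\<^sub>R x s \<omega>)) (s, \<omega>)) \<in> borel_measurable (Fil t \<Otimes>\<^sub>M lborel)"
    by measurable
  then have "(\<lambda>\<omega>. \<integral>s. (indicator {t0<..<t} s *\<^sub>R F_ker P t s) *v
      (\<lambda>(s, \<omega>). indicator {t0<..<t} s *\<^sub>R (indicator (space (Fil t) - N) \<omega> *\<^sub>R x s \<omega>)) (s, \<omega>) \<partial>lborel) \<in> borel_measurable (Fil t)"
    by (rule lborel.borel_measurable_lebesgue_integral)
  then show ?thesis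
  proof (rule measurable_Fil_AE_cong)
    have "AE \<omega> in M. \<omega> \<notin> N" by (rule AE_not_in[OF N])
    then show "AE \<omega> in M. memory t0 (F_ker P) x t \<omega> = (\<integral>s. (indicator {t0<..<t} s *\<^sub>R F_ker P t s) *v
      (\<lambda>(s, \<omega>). indicator {t0<..<t} s *\<^sub>R (indicator (space (Fil t) - N) \<omega> *\<^sub>R x s \<omega>)) (s, \<omega>) \<partial>lborel)"
      using AE_space
    proof eventually_elim
      case (elim \<omega>)
      then show ?case unfolding memory_def set_lebesgue_integral_def
        by (intro Bochner_Integration.integral_cong refl) (auto simp: indicator_def)
    qed
  qed
qed

text \<open>If the kernel is bounded by \<open>K\<close>, then by \<open>square_of_integral_le\<close> the square of the memory at almost
  every time is at most \<open>K\<^sup>2 (T - t0) \<integral> |x|\<^sup>2\<close>, and integration over \<open>(t0, T)\<close> gives another factor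
  \<open>T - t0\<close>.\<close>

lemma memory_L2F:
  assumes x: "x \<in> L2F M W t0 T" and c: "AE \<omega> in M. continuous_on {t0<..<T} (\<lambda>s. x s \<omega>)"
  shows "memory t0 (F_ker P) x \<in> L2F M W t0 T"
proof -
  have jm: "jmeas M t0 T x" using x by (simp add: L2F_iff)
  obtain K where K: "0 \<le> K" "AE t in lborel. AE s in lborel. 0 < s \<and> s < t \<and> t < T \<longrightarrow> norm (F_ker P t s) \<le> K"
    using F_facts(2) by blast
  let ?S = "\<lambda>\<omega>. \<integral>\<^sup>+s\<in>{t0<..<T}. ennreal ((norm (x s \<omega>))\<^sup>2) \<partial>lborel"
  define c where "c = K\<^sup>2 * (T - t0) * (T - t0)"
  have le: "AE \<omega> in M. (\<integral>\<^sup>+t\<in>{t0<..<T}. ennreal ((norm (memory t0 (F_ker P) x t \<omega>))\<^sup>2) \<partial>lborel) \<le> ennreal c * ?S \<omega>"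
    using L2F_path_square[OF x]
  proof eventually_elim
    case (elim \<omega>)
    define n where "n = (LINT s:{t0<..<T}|lborel. norm (x s \<omega>))"
    define S where "S = (LINT s:{t0<..<T}|lborel. (norm (x s \<omega>))\<^sup>2)"
    have xi: "set_integrable lborel {t0<..<T} (\<lambda>s. x s \<omega>)"
      using square_integrable_integrable[of t0 T "\<lambda>s. x s \<omega>"] elim by blast
    then have ni: "set_integrable lborel {t0<..<T} (\<lambda>s. norm (x s \<omega>))" by (rule set_integrable_norm)
    have nS: "n\<^sup>2 \<le> (T - t0) * S"
      unfolding n_def S_def by (rule square_of_integral_le[OF t0(2) ni]) (use elim in auto)
    have S: "?S \<omega> = ennreal S" "0 \<le> S"
    proof -
      have "integrable lborel (\<lambda>s. indicator {t0<..<T} s *\<^sub>R (norm (x s \<omega>))\<^sup>2)" using elim by (simp add: set_integrable_def)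
      then have "(\<integral>\<^sup>+s. ennreal (indicator {t0<..<T} s *\<^sub>R (norm (x s \<omega>))\<^sup>2) \<partial>lborel) = ennreal S"
        unfolding S_def set_lebesgue_integral_def by (intro nn_integral_eq_integral) auto
      moreover have "(\<integral>\<^sup>+s. ennreal (indicator {t0<..<T} s *\<^sub>R (norm (x s \<omega>))\<^sup>2) \<partial>lborel) = ?S \<omega>"
        by (intro nn_integral_cong) (auto simp: indicator_def)
      ultimately show "?S \<omega> = ennreal S" by simp
      show "0 \<le> S" unfolding S_def set_lebesgue_integral_def by (intro Bochner_Integration.integral_nonneg) auto
    qed
    have "(\<integral>\<^sup>+t\<in>{t0<..<T}. ennreal ((norm (memory t0 (F_ker P) x t \<omega>))\<^sup>2) \<partial>lborel)
      \<le> (\<integral>\<^sup>+t\<in>{t0<..<T}. ennreal (K\<^sup>2 * (T - t0) * S) \<partial>lborel)"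
    proof (rule nn_integral_mono_AE, use K(2) in eventually_elim)
      fix t assume Ft: "AE s in lborel. 0 < s \<and> s < t \<and> t < T \<longrightarrow> norm (F_ker P t s) \<le> K"
      show "ennreal ((norm (memory t0 (F_ker P) x t \<omega>))\<^sup>2) * indicator {t0<..<T} t \<le> ennreal (K\<^sup>2 * (T - t0) * S) * indicator {t0<..<T} t"
      proof (cases "t \<in> {t0<..<T}")
        case True
        have "norm (memory t0 (F_ker P) x t \<omega>) \<le> (\<integral>s. norm (indicator {t0<..<t} s *\<^sub>R (F_ker P t s *v x s \<omega>)) \<partial>lborel)"
          unfolding memory_def set_lebesgue_integral_def by (rule integral_norm_bound)
        also have "\<dots> \<le> (\<integral>s. K * (indicator {t0<..<T} s *\<^sub>R norm (x s \<omega>)) \<partial>lborel)"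
        proof (rule integral_mono_AE')
          show "integrable lborel (\<lambda>s. K * (indicator {t0<..<T} s *\<^sub>R norm (x s \<omega>)))"
            using ni by (intro integrable_mult_right) (simp add: set_integrable_def)
          show "AE s in lborel. norm (indicator {t0<..<t} s *\<^sub>R (F_ker P t s *v x s \<omega>)) \<le> K * (indicator {t0<..<T} s *\<^sub>R norm (x s \<omega>))"
            using Ft
          proof eventually_elim
            case (elim s)
            have "norm (F_ker P t s *v x s \<omega>) \<le> K * norm (x s \<omega>)" if "s \<in> {t0<..<t}"
            proof -
              have "norm (F_ker P t s *v x s \<omega>) \<le> norm (F_ker P t s) * norm (x s \<omega>)" by (rule norm_matrix_vector_le)
              also have "\<dots> \<le> K * norm (x s \<omega>)" using elim that True t0 by (intro mult_right_mono) auto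
              finally show ?thesis .
            qed
            then show ?case using True K(1) by (auto simp: indicator_def)
          qed
        qed (auto simp: K(1))
        also have "\<dots> = K * n" by (simp add: n_def set_lebesgue_integral_def)
        finally have "(norm (memory t0 (F_ker P) x t \<omega>))\<^sup>2 \<le> (K * n)\<^sup>2" by (intro power_mono) auto
        also have "\<dots> = K\<^sup>2 * n\<^sup>2" by (simp add: power_mult_distrib)
        also have "\<dots> \<le> K\<^sup>2 * ((T - t0) * S)" by (intro mult_left_mono nS) auto
        finally show ?thesis using True by (simp add: ennreal_leI mult.assoc)
      qed simp
    qed
    also have "\<dots> = ennreal (K\<^sup>2 * (T - t0) * S) * ennreal (T - t0)"
      using t0 by (simp add: nn_integral_cmult_indicator)
    also have "\<dots> = ennreal (K\<^sup>2 * (T - t0) * S * (T - t0))"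
      using S(2) t0 by (intro ennreal_mult[symmetric]) auto
    also have "\<dots> = ennreal (c * S)" by (simp add: c_def mult_ac)
    also have "\<dots> = ennreal c * ?S \<omega>"
      using S t0 by (simp add: ennreal_mult c_def)
    finally show ?case .
  qed
  have "mean_sq M t0 T (memory t0 (F_ker P) x) \<le> (\<integral>\<^sup>+\<omega>. ennreal c * ?S \<omega> \<partial>M)"
    unfolding mean_sq_def by (rule nn_integral_mono_AE[OF le])
  also have "\<dots> = ennreal c * mean_sq M t0 T x"
    unfolding mean_sq_def by (rule nn_integral_cmult[OF mean_sq_inner_measurable[OF jm]])
  also have "\<dots> < \<infinity>" using x by (auto simp: L2F_iff ennreal_mult_less_top)
  finally show ?thesis
    unfolding L2F_iff using memory_jmeas[OF jm] memory_adapted[OF _ \<open>AE \<omega> in M. continuous_on {t0<..<T} (\<lambda>s. x s \<omega>)\<close>] x by (auto simp: L2F_iff)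
qed

lemma \<xi>_bound: "\<exists>C. \<forall>s\<in>{-\<delta>..0}. norm (\<xi> s) \<le> C"
proof -
  have "continuous_on {-\<delta>..0} \<xi>" using A1 by (simp add: assumption_A1_def)
  from compact_imp_bounded[OF compact_continuous_image[OF this compact_Icc]] show ?thesis
    unfolding bounded_iff by blast
qed

definition follows_initial :: "(real \<Rightarrow> 'w \<Rightarrow> real^'n) \<Rightarrow> bool" where
  "follows_initial x \<longleftrightarrow> (\<forall>\<omega>\<in>space M. \<forall>t\<in>{t0 - \<delta>..t0}. x t \<omega> = \<xi> (t - t0))"

lemma delayed_eq:
  assumes "follows_initial x" "\<omega> \<in> space M" "t0 < t"
  shows "delayed \<delta> x t \<omega> = (if t \<le> t0 + \<delta> then \<xi> (t - \<delta> - t0) else x (t - \<delta>) \<omega>)"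
  using assms \<delta> by (auto simp: delayed_def follows_initial_def)

text \<open>Up to \<open>t0 + \<delta>\<close> the delayed process is the initial trajectory, which is bounded by continuity, and
  after that it is a shift of \<open>x\<close>.\<close>

lemma delayed_L2F:
  assumes x: "x \<in> L2F M W t0 T" and i: "follows_initial x"
  shows "delayed \<delta> x \<in> L2F M W t0 T"
proof -
  have [measurable]: "(\<lambda>(t, \<omega>). indicator {t0<..<T} t *\<^sub>R x t \<omega>) \<in> borel_measurable (borel \<Otimes>\<^sub>M M)"
    using x by (simp add: L2F_iff jmeas_iff)
  obtain C where C: "\<And>s. s \<in> {-\<delta>..0} \<Longrightarrow> norm (\<xi> s) \<le> C" using \<xi>_bound by blast
  have "norm (\<xi> 0) \<le> C" using \<delta> by (intro C) simp
  then have C0: "0 \<le> C" by (rule order_trans[OF norm_ge_zero])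
  have \<xi>m: "(\<lambda>s. indicator {-\<delta>..0} s *\<^sub>R \<xi> s) \<in> borel_measurable borel"
    by (rule borel_measurable_continuous_on_indicator) (use A1 in \<open>auto simp: assumption_A1_def\<close>)
  have m2: "(\<lambda>t. indicator {t0<..<T} t *\<^sub>R indicator {-\<delta>..0} (t - \<delta> - t0) *\<^sub>R \<xi> (t - \<delta> - t0)) \<in> borel_measurable borel"
    by (intro borel_measurable_scaleR measurable_compose[OF _ \<xi>m]) measurable
  have m1: "(\<lambda>p. indicator {t0<..<T} (fst p) *\<^sub>R (\<lambda>(t, \<omega>). indicator {t0<..<T} t *\<^sub>R x t \<omega>) (fst p - \<delta>, snd p)) \<in> borel_measurable (borel \<Otimes>\<^sub>M M)"
    by measurable
  have "(\<lambda>p. indicator {t0<..<T} (fst p) *\<^sub>R (\<lambda>(t, \<omega>). indicator {t0<..<T} t *\<^sub>R x t \<omega>) (fst p - \<delta>, snd p)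
      + indicator {t0<..<T} (fst p) *\<^sub>R indicator {-\<delta>..0} (fst p - \<delta> - t0) *\<^sub>R \<xi> (fst p - \<delta> - t0)) \<in> borel_measurable (borel \<Otimes>\<^sub>M M)"
    by (intro borel_measurable_add m1 measurable_compose[OF measurable_fst m2])
  also have "?this \<longleftrightarrow> (\<lambda>(t, \<omega>). indicator {t0<..<T} t *\<^sub>R delayed \<delta> x t \<omega>) \<in> borel_measurable (borel \<Otimes>\<^sub>M M)"
  proof (rule measurable_cong)
    fix p :: "real \<times> 'w" assume "p \<in> space (borel \<Otimes>\<^sub>M M)"
    then obtain t \<omega> where p: "p = (t, \<omega>)" "\<omega> \<in> space M" by (cases p) (auto simp: space_pair_measure)
    show "indicator {t0<..<T} (fst p) *\<^sub>R (\<lambda>(t, \<omega>). indicator {t0<..<T} t *\<^sub>R x t \<omega>) (fst p - \<delta>, snd p)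
      + indicator {t0<..<T} (fst p) *\<^sub>R indicator {-\<delta>..0} (fst p - \<delta> - t0) *\<^sub>R \<xi> (fst p - \<delta> - t0)
      = (\<lambda>(t, \<omega>). indicator {t0<..<T} t *\<^sub>R delayed \<delta> x t \<omega>) p"
      using delayed_eq[OF i p(2), of t] \<delta> by (auto simp: p indicator_def)
  qed
  finally have jm: "jmeas M t0 T (delayed \<delta> x)" by (simp add: jmeas_iff)
  have ad: "delayed \<delta> x t \<in> borel_measurable (Fil t)" if t: "t \<in> {t0<..<T}" for t
  proof (cases "t \<le> t0 + \<delta>")
    case True
    have "(\<lambda>_. \<xi> (t - \<delta> - t0)) \<in> borel_measurable (Fil t)" by simp
    then show ?thesis by (rule measurable_Fil_AE_cong) (use True delayed_eq[OF i, of _ t] t in \<open>auto intro!: AE_I2\<close>)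
  next
    case False
    then have "x (t - \<delta>) \<in> borel_measurable (Fil (t - \<delta>))" using x t \<delta> by (auto simp: L2F_iff)
    then have "x (t - \<delta>) \<in> borel_measurable (Fil t)" by (rule measurable_Fil_mono) (use \<delta> in simp)
    then show ?thesis by (simp add: delayed_def[abs_def])
  qed
  have xm: "(\<lambda>s. ennreal ((norm (x s \<omega>))\<^sup>2) * indicator {t0<..<T} s) \<in> borel_measurable lborel" if "\<omega> \<in> space M" for \<omega>
    by (rule jmeas_inner_measurable[OF _ that]) (use x in \<open>simp add: L2F_iff\<close>)
  have le: "(\<integral>\<^sup>+t\<in>{t0<..<T}. ennreal ((norm (delayed \<delta> x t \<omega>))\<^sup>2) \<partial>lborel)
     \<le> ennreal (C\<^sup>2 * (T - t0)) + (\<integral>\<^sup>+s\<in>{t0<..<T}. ennreal ((norm (x s \<omega>))\<^sup>2) \<partial>lborel)" if w: "\<omega> \<in> space M" for \<omega>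
  proof -
    let ?g = "\<lambda>s. ennreal ((norm (x s \<omega>))\<^sup>2) * indicator {t0<..<T} s"
    have gs: "(\<lambda>t. ?g (- \<delta> + 1 * t)) \<in> borel_measurable lborel"
      by (rule measurable_compose[OF _ xm[OF w]]) simp
    have "(\<integral>\<^sup>+t\<in>{t0<..<T}. ennreal ((norm (delayed \<delta> x t \<omega>))\<^sup>2) \<partial>lborel)
      \<le> (\<integral>\<^sup>+t. ennreal (C\<^sup>2) * indicator {t0<..<T} t + ?g (- \<delta> + 1 * t) \<partial>lborel)"
    proof (rule nn_integral_mono)
      fix t
      show "ennreal ((norm (delayed \<delta> x t \<omega>))\<^sup>2) * indicator {t0<..<T} t \<le> ennreal (C\<^sup>2) * indicator {t0<..<T} t + ?g (- \<delta> + 1 * t)"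
      proof (cases "t \<in> {t0<..<T}")
        case True
        show ?thesis
        proof (cases "t \<le> t0 + \<delta>")
          case le: True
          have "norm (\<xi> (t - \<delta> - t0)) \<le> C" by (rule C) (use True le in auto)
          then have "(norm (\<xi> (t - \<delta> - t0)))\<^sup>2 \<le> C\<^sup>2" by (intro power_mono) auto
          then show ?thesis using True le delayed_eq[OF i w, of t] by (auto intro!: ennreal_leI add_increasing2)
        next
          case False
          then show ?thesis using True delayed_eq[OF i w, of t] \<delta> by (auto simp: indicator_def)
        qed
      qed simp
    qed
    also have "\<dots> = ennreal (C\<^sup>2) * ennreal (T - t0) + (\<integral>\<^sup>+t. ?g (- \<delta> + 1 * t) \<partial>lborel)"
      using t0 gs by (subst nn_integral_add) (auto simp: nn_integral_cmult_indicator)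
    also have "(\<integral>\<^sup>+t. ?g (- \<delta> + 1 * t) \<partial>lborel) = (\<integral>\<^sup>+s. ?g s \<partial>lborel)"
      using nn_integral_real_affine[of ?g 1 "-\<delta>"] xm[OF w] by simp
    finally show ?thesis using t0 by (simp add: ennreal_mult)
  qed
  have "mean_sq M t0 T (delayed \<delta> x) \<le> (\<integral>\<^sup>+\<omega>. ennreal (C\<^sup>2 * (T - t0)) + (\<integral>\<^sup>+s\<in>{t0<..<T}. ennreal ((norm (x s \<omega>))\<^sup>2) \<partial>lborel) \<partial>M)"
    unfolding mean_sq_def by (rule nn_integral_mono[OF le])
  also have "\<dots> = ennreal (C\<^sup>2 * (T - t0)) + mean_sq M t0 T x"
    unfolding mean_sq_def using x mean_sq_inner_measurable[of t0 T x] by (subst nn_integral_add) (auto simp: L2F_iff emeasure_space_1)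
  also have "\<dots> < \<infinity>" using x by (auto simp: L2F_iff)
  finally show ?thesis unfolding L2F_iff using jm ad by blast
qed

end

section \<open>Equality of the costs\<close>

lemma quad_bound: "\<bar>quad S v\<bar> \<le> norm S * (norm v)\<^sup>2"
proof -
  have "\<bar>quad S v\<bar> \<le> norm v * norm (S *v v)" unfolding quad_def by (rule Cauchy_Schwarz_ineq2)
  also have "\<dots> \<le> norm v * (norm S * norm v)" by (intro mult_left_mono norm_matrix_vector_le) auto
  finally show ?thesis by (simp add: power2_eq_square mult_ac)
qed

lemma quad_zero [simp]: "quad S 0 = 0"
  by (simp add: quad_def)

lemma quad_add_left: "quad (S + S') v = quad S v + quad S' v"
  by (simp add: quad_def matrix_vector_mult_add_rdistrib inner_add_right)

lemma quad_scaleR_left: "quad (c *\<^sub>R S) v = c * quad S v"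
  by (simp add: quad_def scaleR_matrix_vector_assoc[symmetric])

lemma borel_measurable_quad [measurable]:
  assumes "S \<in> borel_measurable N" "v \<in> borel_measurable N"
  shows "(\<lambda>x. quad (S x) (v x)) \<in> borel_measurable N"
  unfolding quad_def using assms by measurable

lemma set_integrable_quad:
  fixes S :: "real \<Rightarrow> real^'k^'k"
  assumes A: "A \<in> sets borel" and S: "set_borel_measurable lborel A S" "AE t in lborel. t \<in> A \<longrightarrow> norm (S t) \<le> K"
    and v: "set_borel_measurable lborel A v" "set_integrable lborel A (\<lambda>t. (norm (v t))\<^sup>2)"
  shows "set_integrable lborel A (\<lambda>t. quad (S t) (v t))"
  unfolding set_integrable_def
proof (rule Bochner_Integration.integrable_bound)
  show "integrable lborel (\<lambda>t. K * (indicator A t *\<^sub>R (norm (v t))\<^sup>2))"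
    by (intro integrable_mult_right v(2)[unfolded set_integrable_def])
  have "(\<lambda>t. quad (indicator A t *\<^sub>R S t) (indicator A t *\<^sub>R v t)) \<in> borel_measurable lborel"
    using S(1) v(1) unfolding set_borel_measurable_def by (rule borel_measurable_quad)
  also have "(\<lambda>t. quad (indicator A t *\<^sub>R S t) (indicator A t *\<^sub>R v t)) = (\<lambda>t. indicator A t *\<^sub>R quad (S t) (v t))"
    by (auto simp: indicator_def quad_def)
  finally show "(\<lambda>t. indicator A t *\<^sub>R quad (S t) (v t)) \<in> borel_measurable lborel" .
  show "AE t in lborel. norm (indicator A t *\<^sub>R quad (S t) (v t)) \<le> norm (K * (indicator A t *\<^sub>R (norm (v t))\<^sup>2))"
    using S(2)
  proof eventually_elim
    case (elim t)
    show ?case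
    proof (cases "t \<in> A")
      case True
      have "\<bar>quad (S t) (v t)\<bar> \<le> norm (S t) * (norm (v t))\<^sup>2" by (rule quad_bound)
      also have "\<dots> \<le> \<bar>K\<bar> * (norm (v t))\<^sup>2" using elim True by (intro mult_right_mono) auto
      finally show ?thesis using True by (simp add: abs_mult)
    qed simp
  qed
qed

lemma integrable_quad_process:
  fixes S :: "real \<Rightarrow> real^'k^'k" and v :: "real \<Rightarrow> 'w \<Rightarrow> real^'k"
  assumes M: "prob_space M" and S: "set_borel_measurable lborel {a<..<b} S" "AE t in lborel. t \<in> {a<..<b} \<longrightarrow> norm (S t) \<le> K"
    and v: "jmeas M a b v" "mean_sq M a b v < \<infinity>"
  shows "integrable M (\<lambda>\<omega>. LINT t:{a<..<b}|lborel. quad (S t) (v t \<omega>))"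
proof -
  interpret prob_space M by (rule M)
  have [measurable]: "(\<lambda>(t, \<omega>). indicator {a<..<b} t *\<^sub>R v t \<omega>) \<in> borel_measurable (borel \<Otimes>\<^sub>M M)"
    using v by (simp add: jmeas_iff)
  have [measurable]: "(\<lambda>t. indicator {a<..<b} t *\<^sub>R S t) \<in> borel_measurable borel" using S(1) by (simp add: set_borel_measurable_def)
  have "(\<lambda>(\<omega>, t). quad (indicator {a<..<b} t *\<^sub>R S t) ((\<lambda>(t, \<omega>). indicator {a<..<b} t *\<^sub>R v t \<omega>) (t, \<omega>))) \<in> borel_measurable (M \<Otimes>\<^sub>M lborel)"
    by measurable
  then have "(\<lambda>\<omega>. \<integral>t. quad (indicator {a<..<b} t *\<^sub>R S t) ((\<lambda>(t, \<omega>). indicator {a<..<b} t *\<^sub>R v t \<omega>) (t, \<omega>)) \<partial>lborel) \<in> borel_measurable M"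
    by (rule lborel.borel_measurable_lebesgue_integral)
  also have "(\<lambda>\<omega>. \<integral>t. quad (indicator {a<..<b} t *\<^sub>R S t) ((\<lambda>(t, \<omega>). indicator {a<..<b} t *\<^sub>R v t \<omega>) (t, \<omega>)) \<partial>lborel)
     = (\<lambda>\<omega>. LINT t:{a<..<b}|lborel. quad (S t) (v t \<omega>))"
    unfolding set_lebesgue_integral_def by (intro ext Bochner_Integration.integral_cong) (auto simp: indicator_def)
  finally have m: "(\<lambda>\<omega>. LINT t:{a<..<b}|lborel. quad (S t) (v t \<omega>)) \<in> borel_measurable M" .
  have "(\<integral>\<^sup>+\<omega>. ennreal (norm (LINT t:{a<..<b}|lborel. quad (S t) (v t \<omega>))) \<partial>M)
    \<le> (\<integral>\<^sup>+\<omega>. ennreal \<bar>K\<bar> * (\<integral>\<^sup>+t\<in>{a<..<b}. ennreal ((norm (v t \<omega>))\<^sup>2) \<partial>lborel) \<partial>M)"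
  proof (rule nn_integral_mono)
    fix \<omega> assume w: "\<omega> \<in> space M"
    have "ennreal (norm (LINT t:{a<..<b}|lborel. quad (S t) (v t \<omega>))) \<le> (\<integral>\<^sup>+t. ennreal (norm (indicator {a<..<b} t *\<^sub>R quad (S t) (v t \<omega>))) \<partial>lborel)"
    proof (cases "integrable lborel (\<lambda>t. indicator {a<..<b} t *\<^sub>R quad (S t) (v t \<omega>))")
      case True
      then show ?thesis unfolding set_lebesgue_integral_def by (rule integral_norm_bound_ennreal)
    qed (simp add: set_lebesgue_integral_def not_integrable_integral_eq)
    also have "\<dots> \<le> (\<integral>\<^sup>+t. ennreal \<bar>K\<bar> * (ennreal ((norm (v t \<omega>))\<^sup>2) * indicator {a<..<b} t) \<partial>lborel)"
    proof (rule nn_integral_mono_AE, use S(2) in eventually_elim)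
      fix t assume n: "t \<in> {a<..<b} \<longrightarrow> norm (S t) \<le> K"
      show "ennreal (norm (indicator {a<..<b} t *\<^sub>R quad (S t) (v t \<omega>))) \<le> ennreal \<bar>K\<bar> * (ennreal ((norm (v t \<omega>))\<^sup>2) * indicator {a<..<b} t)"
      proof (cases "t \<in> {a<..<b}")
        case True
        have "\<bar>quad (S t) (v t \<omega>)\<bar> \<le> norm (S t) * (norm (v t \<omega>))\<^sup>2" by (rule quad_bound)
        also have "\<dots> \<le> \<bar>K\<bar> * (norm (v t \<omega>))\<^sup>2" using n True by (intro mult_right_mono) auto
        finally show ?thesis using True by (simp add: ennreal_mult[symmetric] ennreal_leI)
      qed simp
    qed
    also have "\<dots> = ennreal \<bar>K\<bar> * (\<integral>\<^sup>+t\<in>{a<..<b}. ennreal ((norm (v t \<omega>))\<^sup>2) \<partial>lborel)"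
      by (rule nn_integral_cmult[OF jmeas_inner_measurable[OF v(1) w]])
    finally show "ennreal (norm (LINT t:{a<..<b}|lborel. quad (S t) (v t \<omega>))) \<le> ennreal \<bar>K\<bar> * (\<integral>\<^sup>+t\<in>{a<..<b}. ennreal ((norm (v t \<omega>))\<^sup>2) \<partial>lborel)" .
  qed
  also have "\<dots> = ennreal \<bar>K\<bar> * mean_sq M a b v"
    unfolding mean_sq_def by (rule nn_integral_cmult[OF mean_sq_inner_measurable[OF v(1)]])
  also have "\<dots> < \<infinity>" using v(2) by (auto simp: ennreal_mult_less_top)
  finally show ?thesis using m by (intro integrableI_bounded)
qed

context delay_problem
begin

lemma weight_facts:
  fixes G :: "real \<Rightarrow> real^'q^'q"
  assumes "G \<in> Linf_space (leb_ivl 0 T)"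
  shows "set_borel_measurable lborel {t0<..<T} G" "\<exists>K. AE t in lborel. t \<in> {t0<..<T} \<longrightarrow> norm (G t) \<le> K"
    "set_borel_measurable lborel {t0<..<T} (\<lambda>t. indicator {0..<T - \<delta>} t *\<^sub>R G (t + \<delta>))"
    "\<exists>K. AE t in lborel. t \<in> {t0<..<T} \<longrightarrow> norm (indicator {0..<T - \<delta>} t *\<^sub>R G (t + \<delta>)) \<le> K"
proof -
  show m: "set_borel_measurable lborel {t0<..<T} G" by (rule sub_meas[OF Linf_spaceD(1)[OF assms]]) simp
  obtain K where K: "K \<ge> 0" "AE t in lborel. t \<in> {0<..<T} \<longrightarrow> norm (G t) \<le> K" using Linf_spaceD(2)[OF assms] by blast
  have "AE t in lborel. t \<in> {t0<..<T} \<longrightarrow> norm (G t) \<le> K" using K(2) by eventually_elim (use t0 in auto)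
  then show "\<exists>K. AE t in lborel. t \<in> {t0<..<T} \<longrightarrow> norm (G t) \<le> K" by blast
  have Gm: "(\<lambda>t. indicator {0<..<T} t *\<^sub>R G t) \<in> borel_measurable borel"
    using Linf_spaceD(1)[OF assms] by (simp add: set_borel_measurable_def)
  have Gs: "(\<lambda>t. indicator {0<..<T} (\<delta> + 1 * t) *\<^sub>R G (\<delta> + 1 * t)) \<in> borel_measurable borel"
    by (rule measurable_compose[OF _ Gm]) simp
  have "(\<lambda>t. indicator {t0<..<T} t *\<^sub>R (indicator {0..<T - \<delta>} t *\<^sub>R (indicator {0<..<T} (\<delta> + 1 * t) *\<^sub>R G (\<delta> + 1 * t)))) \<in> borel_measurable borel"
    by (intro borel_measurable_scaleR Gs) measurable
  also have "(\<lambda>t. indicator {t0<..<T} t *\<^sub>R (indicator {0..<T - \<delta>} t *\<^sub>R (indicator {0<..<T} (\<delta> + 1 * t) *\<^sub>R G (\<delta> + 1 * t))))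
     = (\<lambda>t. indicator {t0<..<T} t *\<^sub>R (indicator {0..<T - \<delta>} t *\<^sub>R G (t + \<delta>)))"
    using t0 \<delta> by (auto simp: fun_eq_iff indicator_def add.commute)
  finally show "set_borel_measurable lborel {t0<..<T} (\<lambda>t. indicator {0..<T - \<delta>} t *\<^sub>R G (t + \<delta>))"
    by (simp add: set_borel_measurable_def)
  have "AE t in lborel. norm (indicator {0<..<T} t *\<^sub>R G t) \<le> K"
    using K(2) by eventually_elim (use K(1) in \<open>auto simp: indicator_def\<close>)
  then have "AE t in lborel. norm (indicator {0<..<T} (\<delta> + 1 * t) *\<^sub>R G (\<delta> + 1 * t)) \<le> K"
    by (intro AE_borel_affine) (use Gm in measurable)
  then have "AE t in lborel. t \<in> {t0<..<T} \<longrightarrow> norm (indicator {0..<T - \<delta>} t *\<^sub>R G (t + \<delta>)) \<le> K"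
    by eventually_elim (use K(1) t0 \<delta> in \<open>auto simp: indicator_def add.commute\<close>)
  then show "\<exists>K. AE t in lborel. t \<in> {t0<..<T} \<longrightarrow> norm (indicator {0..<T - \<delta>} t *\<^sub>R G (t + \<delta>)) \<le> K" by blast
qed

text \<open>Splitting at \<open>t0 + \<delta>\<close> and shifting back by \<open>\<delta>\<close>, as for the delayed control in the drift. The
  shifted weight lives on \<open>[0, T - \<delta>)\<close>, as controls after \<open>T - \<delta>\<close> act beyond the horizon.\<close>

lemma delayed_control_cost:
  assumes u: "set_borel_measurable lborel {t0<..<T} w" "set_integrable lborel {t0<..<T} (\<lambda>t. (norm (w t))\<^sup>2)"
  defines "\<nu> \<equiv> (\<lambda>t. if t - \<delta> \<le> t0 then \<zeta> (t - \<delta> - t0) else w (t - \<delta>))"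
  shows "set_integrable lborel {t0<..<T} (\<lambda>t. quad (R2 P t) (\<nu> t))"
    and "set_integrable lborel {t0<..<T} (\<lambda>t. indicator {0..<T - \<delta>} t * quad (R2 P (t + \<delta>)) (w t))"
    and "(LINT t:{t0<..<T}|lborel. quad (R2 P t) (\<nu> t)) = (LINT t:{t0<..<min (t0 + \<delta>) T}|lborel. quad (R2 P t) (\<zeta> (t - t0 - \<delta>)))
      + (LINT t:{t0<..<T}|lborel. indicator {0..<T - \<delta>} t * quad (R2 P (t + \<delta>)) (w t))"
proof -
  have R2: "R2 P \<in> Linf_space (leb_ivl 0 T)" using A1 by (simp add: assumption_A1_def)
  obtain K where K: "AE t in lborel. t \<in> {t0<..<T} \<longrightarrow> norm (R2 P t) \<le> K" using weight_facts(2)[OF R2] by blast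
  have "set_integrable lborel {t0<..<T} \<nu>"
    unfolding \<nu>_def by (rule shift_integrable[OF \<delta> shift_initial_integrable[OF \<zeta>_integrable(1)] square_integrable_integrable[OF u]])
  then have m: "set_borel_measurable lborel {t0<..<T} \<nu>" by (auto simp: set_integrable_def set_borel_measurable_def)
  have "set_integrable lborel {t0<..<T} (\<lambda>t. if t - \<delta> \<le> t0 then (norm (\<zeta> (t - \<delta> - t0)))\<^sup>2 else (norm (w (t - \<delta>)))\<^sup>2)"
    by (rule shift_integrable[OF \<delta> shift_initial_integrable[OF \<zeta>_integrable(2)] u(2)])
  also have "(\<lambda>t. if t - \<delta> \<le> t0 then (norm (\<zeta> (t - \<delta> - t0)))\<^sup>2 else (norm (w (t - \<delta>)))\<^sup>2) = (\<lambda>t. (norm (\<nu> t))\<^sup>2)"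
    by (auto simp: \<nu>_def fun_eq_iff)
  finally have n: "set_integrable lborel {t0<..<T} (\<lambda>t. (norm (\<nu> t))\<^sup>2)" .
  show i: "set_integrable lborel {t0<..<T} (\<lambda>t. quad (R2 P t) (\<nu> t))"
    by (rule set_integrable_quad[OF _ weight_facts(1)[OF R2] K m n]) simp
  have eq: "(\<lambda>t. quad (R2 P t) (\<nu> t)) = (\<lambda>t. if t - \<delta> \<le> t0 then quad (R2 P t) (\<zeta> (t - t0 - \<delta>)) else quad (R2 P ((t - \<delta>) + \<delta>)) (w (t - \<delta>)))"
    by (auto simp: \<nu>_def fun_eq_iff algebra_simps)
  note sp = shift_split[OF \<delta> i[unfolded eq]]
  have ind: "indicator {t0<..<T} t *\<^sub>R (indicator {..<T} (t + \<delta>) *\<^sub>R quad (R2 P (t + \<delta>)) (w t)) =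
     indicator {t0<..<T} t *\<^sub>R (indicator {0..<T - \<delta>} t * quad (R2 P (t + \<delta>)) (w t))" for t
    using t0 by (auto simp: indicator_def algebra_simps)
  show "set_integrable lborel {t0<..<T} (\<lambda>t. indicator {0..<T - \<delta>} t * quad (R2 P (t + \<delta>)) (w t))"
    using sp(2) unfolding set_integrable_def ind .
  have "(LINT t:{t0<..<T}|lborel. indicator {..<T} (t + \<delta>) *\<^sub>R quad (R2 P (t + \<delta>)) (w t))
    = (LINT t:{t0<..<T}|lborel. indicator {0..<T - \<delta>} t * quad (R2 P (t + \<delta>)) (w t))"
    unfolding set_lebesgue_integral_def ind ..
  then show "(LINT t:{t0<..<T}|lborel. quad (R2 P t) (\<nu> t)) = (LINT t:{t0<..<min (t0 + \<delta>) T}|lborel. quad (R2 P t) (\<zeta> (t - t0 - \<delta>)))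
      + (LINT t:{t0<..<T}|lborel. indicator {0..<T - \<delta>} t * quad (R2 P (t + \<delta>)) (w t))"
    unfolding eq using sp(3) by simp
qed

lemma quad_volterra_Q: "quad (volterra_Q P t) X = quad (Q1 P t) (block1 X) + quad (Q2 P t) (block2 X) + quad (Q3 P t) (block3 X)"
  using quad_diag3[of "Q1 P t" "Q2 P t" "Q3 P t" "block1 X" "block2 X" "block3 X"] by (simp only: blocks volterra_Q_def)

lemma AE_quad_integral:
  fixes G :: "real \<Rightarrow> real^'q^'q"
  assumes G: "G \<in> Linf_space (leb_ivl 0 T)" and v: "v \<in> L2F M W t0 T"
  shows "AE \<omega> in M. set_integrable lborel {t0<..<T} (\<lambda>t. quad (G t) (v t \<omega>))"
    and "integrable M (\<lambda>\<omega>. LINT t:{t0<..<T}|lborel. quad (G t) (v t \<omega>))"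
proof -
  obtain K where K: "AE t in lborel. t \<in> {t0<..<T} \<longrightarrow> norm (G t) \<le> K" using weight_facts(2)[OF G] by blast
  show "AE \<omega> in M. set_integrable lborel {t0<..<T} (\<lambda>t. quad (G t) (v t \<omega>))"
    using L2F_path_square[OF v] by eventually_elim (intro set_integrable_quad[OF _ weight_facts(1)[OF G] K], auto)
  show "integrable M (\<lambda>\<omega>. LINT t:{t0<..<T}|lborel. quad (G t) (v t \<omega>))"
    by (rule integrable_quad_process[OF prob_space_axioms weight_facts(1)[OF G] K]) (use v in \<open>auto simp: L2F_iff\<close>)
qed

lemma quad_integral_cong:
  assumes "set_integrable lborel {t0<..<T} (\<lambda>t. quad (G t) (v t))" "set_integrable lborel {t0<..<T} (\<lambda>t. quad (G t) (w t))"
    and "AE t in lborel. t \<in> {t0<..<T} \<longrightarrow> v t = w t"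
  shows "(LINT t:{t0<..<T}|lborel. quad (G t) (v t)) = (LINT t:{t0<..<T}|lborel. quad (G t) (w t))"
  unfolding set_lebesgue_integral_def
  by (rule integral_cong_AE)
     (use assms(1,2) in \<open>auto simp: set_integrable_def intro!: eventually_mono[OF assms(3)] simp: indicator_def\<close>)

text \<open>Blockwise the weight \<open>Q\<close> gives the three state costs, and the cost of the delayed control is moved
  to the undelayed one, which adds the shifted weight to \<open>R\<close> and leaves over the constant \<open>c\<close>, the cost of
  the initial trajectory. The blocks of \<open>X\<close> need to agree with the state, its delay and its memory only
  almost everywhere.\<close>

lemma costs_equal:
  fixes X :: "real \<Rightarrow> 'w \<Rightarrow> real^('n + 'n + 'n)"
  assumes x: "x \<in> L2F M W t0 T" "delayed \<delta> x \<in> L2F M W t0 T" "memory t0 (F_ker P) x \<in> L2F M W t0 T"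
    and u: "u \<in> L2F M W t0 T" and X: "X \<in> L2F M W t0 T"
    and eq: "AE \<omega> in M. AE t in lborel. t \<in> {t0<..<T} \<longrightarrow> block1 (X t \<omega>) = x t \<omega>"
      "AE \<omega> in M. AE t in lborel. t \<in> {t0<..<T} \<longrightarrow> block2 (X t \<omega>) = delayed \<delta> x t \<omega>"
      "AE \<omega> in M. AE t in lborel. t \<in> {t0<..<T} \<longrightarrow> block3 (X t \<omega>) = memory t0 (F_ker P) x t \<omega>"
  shows "volterra_cost M T \<delta> P t0 \<zeta> u X = delay_cost M T \<delta> P t0 \<zeta> u x"
proof -
  let ?I = "{t0<..<T}"
  let ?y = "delayed \<delta> x" and ?z = "memory t0 (F_ker P) x"
  let ?\<nu> = "delayed \<delta> (extended_control t0 \<zeta> u)"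
  define c where "c = (LINT t:{t0<..<min (t0 + \<delta>) T}|lborel. quad (R2 P t) (\<zeta> (t - t0 - \<delta>)))"
  define q1 where "q1 \<omega> = (LINT t:?I|lborel. quad (Q1 P t) (x t \<omega>))" for \<omega>
  define q2 where "q2 \<omega> = (LINT t:?I|lborel. quad (Q2 P t) (?y t \<omega>))" for \<omega>
  define q3 where "q3 \<omega> = (LINT t:?I|lborel. quad (Q3 P t) (?z t \<omega>))" for \<omega>
  define r1 where "r1 \<omega> = (LINT t:?I|lborel. quad (R1 P t) (u t \<omega>))" for \<omega>
  define r2 where "r2 \<omega> = (LINT t:?I|lborel. quad (indicator {0..<T - \<delta>} t *\<^sub>R R2 P (t + \<delta>)) (u t \<omega>))" for \<omega>
  define s where "s \<omega> = q1 \<omega> + q2 \<omega> + q3 \<omega> + r1 \<omega> + r2 \<omega>" for \<omega>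
  have L: "Q1 P \<in> Linf_space (leb_ivl 0 T)" "Q2 P \<in> Linf_space (leb_ivl 0 T)" "Q3 P \<in> Linf_space (leb_ivl 0 T)"
    "R1 P \<in> Linf_space (leb_ivl 0 T)" "R2 P \<in> Linf_space (leb_ivl 0 T)"
    using A1 by (simp_all add: assumption_A1_def)
  obtain K where K: "AE t in lborel. t \<in> {t0<..<T} \<longrightarrow> norm (indicator {0..<T - \<delta>} t *\<^sub>R R2 P (t + \<delta>)) \<le> K"
    using weight_facts(4)[OF L(5)] by blast
  have "integrable M r2"
    unfolding r2_def[abs_def]
    by (rule integrable_quad_process[OF prob_space_axioms weight_facts(3)[OF L(5)] K]) (use u in \<open>auto simp: L2F_iff\<close>)
  then have s: "integrable M s"
    unfolding s_def[abs_def] q1_def q2_def q3_def r1_def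
    by (intro Bochner_Integration.integrable_add AE_quad_integral(2) L x u)
  have XL: "(\<lambda>t \<omega>. block1 (X t \<omega>)) \<in> L2F M W t0 T" "(\<lambda>t \<omega>. block2 (X t \<omega>)) \<in> L2F M W t0 T" "(\<lambda>t \<omega>. block3 (X t \<omega>)) \<in> L2F M W t0 T"
    by (rule L2F_linear[OF X bounded_linear_blocks(1)], rule L2F_linear[OF X bounded_linear_blocks(2)], rule L2F_linear[OF X bounded_linear_blocks(3)])
  have control: "AE \<omega> in M. set_integrable lborel ?I (\<lambda>t. quad (R2 P t) (?\<nu> t \<omega>)) \<and>
      set_integrable lborel ?I (\<lambda>t. indicator {0..<T - \<delta>} t * quad (R2 P (t + \<delta>)) (u t \<omega>)) \<and>
      (LINT t:?I|lborel. quad (R2 P t) (?\<nu> t \<omega>)) = c + r2 \<omega>"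
    using L2F_path_square[OF u]
  proof eventually_elim
    case (elim \<omega>)
    have \<nu>: "?\<nu> t \<omega> = (if t - \<delta> \<le> t0 then \<zeta> (t - \<delta> - t0) else u (t - \<delta>) \<omega>)" for t
      by (simp add: delayed_def extended_control_def)
    show ?case
      unfolding \<nu> c_def r2_def quad_scaleR_left using delayed_control_cost[of "\<lambda>t. u t \<omega>"] elim by simp
  qed
  have delay: "AE \<omega> in M.
     (LINT t:?I|lborel. quad (Q1 P t) (x t \<omega>) + quad (Q2 P t) (?y t \<omega>) + quad (Q3 P t) (?z t \<omega>) + quad (R1 P t) (u t \<omega>) + quad (R2 P t) (?\<nu> t \<omega>))
       = s \<omega> + c"
    using AE_quad_integral(1)[OF L(1) x(1)] AE_quad_integral(1)[OF L(2) x(2)] AE_quad_integral(1)[OF L(3) x(3)]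
      AE_quad_integral(1)[OF L(4) u] control
    by eventually_elim (simp add: set_integral_add s_def q1_def q2_def q3_def r1_def)
  have volterra: "AE \<omega> in M.
     (LINT t:?I|lborel. quad (volterra_Q P t) (X t \<omega>) + quad (volterra_R T \<delta> P t) (u t \<omega>)) = s \<omega>"
    using AE_quad_integral(1)[OF L(1) x(1)] AE_quad_integral(1)[OF L(2) x(2)] AE_quad_integral(1)[OF L(3) x(3)]
      AE_quad_integral(1)[OF L(1) XL(1)] AE_quad_integral(1)[OF L(2) XL(2)] AE_quad_integral(1)[OF L(3) XL(3)]
      AE_quad_integral(1)[OF L(4) u] control eq
  proof eventually_elim
    case (elim \<omega>)
    have "(LINT t:?I|lborel. quad (Q1 P t) (block1 (X t \<omega>))) = q1 \<omega>"
      unfolding q1_def by (rule quad_integral_cong[OF elim(4,1,9)])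
    moreover have "(LINT t:?I|lborel. quad (Q2 P t) (block2 (X t \<omega>))) = q2 \<omega>"
      unfolding q2_def by (rule quad_integral_cong[OF elim(5,2,10)])
    moreover have "(LINT t:?I|lborel. quad (Q3 P t) (block3 (X t \<omega>))) = q3 \<omega>"
      unfolding q3_def by (rule quad_integral_cong[OF elim(6,3,11)])
    ultimately show ?case
      using elim(4-8) by (simp add: quad_volterra_Q volterra_R_def quad_add_left quad_scaleR_left set_integral_add s_def r1_def r2_def)
  qed
  have "volterra_cost M T \<delta> P t0 \<zeta> u X = (\<integral>\<omega>. s \<omega> \<partial>M) + (\<integral>\<omega>. c \<partial>M)"
  proof -
    have "(\<lambda>\<omega>. LINT t:?I|lborel. quad (volterra_Q P t) (X t \<omega>) + quad (volterra_R T \<delta> P t) (u t \<omega>)) \<in> borel_measurable M"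
      by (rule borel_measurable_AE_cong[OF borel_measurable_integrable[OF s] volterra])
    from integral_cong_AE[OF this borel_measurable_integrable[OF s] volterra]
    show ?thesis by (simp add: volterra_cost_def c_def)
  qed
  also have "\<dots> = (\<integral>\<omega>. s \<omega> + c \<partial>M)" using s by (simp add: Bochner_Integration.integral_add)
  also have "\<dots> = delay_cost M T \<delta> P t0 \<zeta> u x"
  proof -
    have sc: "(\<lambda>\<omega>. s \<omega> + c) \<in> borel_measurable M" using borel_measurable_integrable[OF s] by measurable
    have "(\<lambda>\<omega>. LINT t:?I|lborel. quad (Q1 P t) (x t \<omega>) + quad (Q2 P t) (?y t \<omega>) + quad (Q3 P t) (?z t \<omega>) + quad (R1 P t) (u t \<omega>) + quad (R2 P t) (?\<nu> t \<omega>)) \<in> borel_measurable M"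
      by (rule borel_measurable_AE_cong[OF sc delay])
    from integral_cong_AE[OF this sc delay] show ?thesis by (simp add: delay_cost_def)
  qed
  finally show ?thesis .
qed

end

section \<open>Equivalence of the two state equations\<close>

lemma continuous_on_indefinite_integral:
  fixes f :: "real \<Rightarrow> 'b::euclidean_space"
  assumes f: "set_integrable lborel {a<..<b} f"
  shows "continuous_on {a..b} (\<lambda>t. LINT s:{a<..<t}|lborel. f s)"
proof -
  have "f integrable_on {a<..<b}" using set_borel_integral_eq_integral(1)[OF f] .
  then have "continuous_on {a..b} (\<lambda>t. integral {a..t} f)"
    by (intro indefinite_integral_continuous_1) (simp add: integrable_on_open_interval_real)
  moreover have "integral {a..t} f = (LINT s:{a<..<t}|lborel. f s)" if "t \<in> {a..b}" for t
  proof -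
    have "set_integrable lborel {a<..<t} f" by (rule set_integrable_subset[OF f]) (use that in auto)
    then show ?thesis using set_borel_integral_eq_integral(2) integral_open_interval_real by metis
  qed
  ultimately show ?thesis by (rule continuous_on_cong[THEN iffD1, OF refl, rotated]) auto
qed

context delay_problem
begin

lemma drift_path_continuous:
  assumes e: "set_integrable lborel {t0<..<T} e" and w: "set_integrable lborel {t0<..<T} w"
  shows "set_integrable lborel {t0<..<T} (drift_path e w)" "continuous_on {t0..T} (state_path e w)"
proof -
  have G: "set_borel_measurable lborel {t0<..<T} (\<lambda>s. mat 1 :: real^'n^'n)" "AE s in lborel. s \<in> {t0<..<T} \<longrightarrow> norm (mat 1 :: real^'n^'n) \<le> norm (mat 1 :: real^'n^'n)"
    by (simp_all add: set_borel_measurable_def)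
  show d: "set_integrable lborel {t0<..<T} (drift_path e w)"
    by (rule drift_transport(1)[OF t0(2) order_refl G e w])
  show "continuous_on {t0..T} (state_path e w)"
    unfolding state_path_def[abs_def] by (intro continuous_intros continuous_on_indefinite_integral d)
qed

lemma solution_continuous:
  fixes u :: "real \<Rightarrow> 'w \<Rightarrow> real^'m"
  assumes X: "X1 \<in> L2F M W t0 T" "X2 \<in> L2F M W t0 T" "X3 \<in> L2F M W t0 T" and u: "u \<in> L2F M W t0 T"
    and Y: "continuous_version t0 T f ys Y"
  shows "AE \<omega> in M. continuous_on {t0..T} (\<lambda>t. solution X1 X2 X3 u Y t \<omega>) \<and> solution X1 X2 X3 u Y t0 \<omega> = \<xi> 0"
proof -
  have Yc: "AE \<omega> in M. continuous_on {t0..T} (\<lambda>t. Y t \<omega>)" and Y0: "\<And>\<omega>. Y t0 \<omega> = 0"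
    using Y by (auto simp: continuous_version_def)
  from path_integrable[OF X u] Yc show ?thesis
  proof eventually_elim
    case (elim \<omega>)
    then have "continuous_on {t0..T} (\<lambda>t. state_path (free_drift X1 X2 X3 \<omega>) (\<lambda>s. u s \<omega>) t + Y t \<omega>)"
      by (intro continuous_on_add drift_path_continuous(2)) auto
    then show ?case by (simp add: solution_def Y0 state_path_def set_lebesgue_integral_def)
  qed
qed

lemma delay_diffusion_eq: "delay_diffusion \<delta> P t0 u x = diffusion x (delayed \<delta> x) (memory t0 (F_ker P) x) u"
  by (simp add: fun_eq_iff delay_diffusion_def diffusion_def)

lemma delay_drift_eq:
  "delay_drift \<delta> P t0 \<zeta> u x s \<omega> = drift_path (free_drift x (delayed \<delta> x) (memory t0 (F_ker P) x) \<omega>) (\<lambda>s. u s \<omega>) s"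
  by (simp add: delay_drift_def drift_path_def free_drift_def delayed_def extended_control_def memory_def)

text \<open>A delay state coincides at every time almost surely with the solution that has its own triple as
  input, by uniqueness of the Ito integral. Both have continuous paths, so almost surely they coincide at
  all times together. Hence the augmented path of the solution is the triple itself.\<close>

lemma delay_to_volterra:
  assumes u: "u \<in> L2F M W t0 T" and st: "delay_state M W T \<delta> P t0 \<xi> \<zeta> u x"
  defines "X \<equiv> (\<lambda>t \<omega>. vstack3 (x t \<omega>) (delayed \<delta> x t \<omega>) (memory t0 (F_ker P) x t \<omega>))"
  shows "volterra_state M W T \<delta> P t0 \<xi> \<zeta> u X" "volterra_cost M T \<delta> P t0 \<zeta> u X = delay_cost M T \<delta> P t0 \<zeta> u x"
proof -
  let ?y = "delayed \<delta> x" and ?z = "memory t0 (F_ker P) x" and ?I = "{t0<..<T}"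
  have x: "x \<in> L2F M W t0 T" and cx: "AE \<omega> in M. continuous_on {t0 - \<delta>..T} (\<lambda>t. x t \<omega>)" and fi: "follows_initial x"
    and eqn: "\<And>t. t \<in> ?I \<Longrightarrow> \<exists>I. has_ito_integral M W t0 t (delay_diffusion \<delta> P t0 u x) I \<and>
        (AE \<omega> in M. x t \<omega> = \<xi> 0 + (LINT s:{t0<..<t}|lborel. delay_drift \<delta> P t0 \<zeta> u x s \<omega>) + I \<omega>)"
    using st by (auto simp: delay_state_def follows_initial_def)
  have cx': "AE \<omega> in M. continuous_on ?I (\<lambda>t. x t \<omega>)"
    using cx by eventually_elim (rule continuous_on_subset, use \<delta> in auto)
  have y: "?y \<in> L2F M W t0 T" by (rule delayed_L2F[OF x fi])
  have z: "?z \<in> L2F M W t0 T" by (rule memory_L2F[OF x cx'])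
  let ?f = "diffusion x ?y ?z u"
  have f: "?f \<in> L2F M W t0 T" by (rule diffusion_L2F[OF x y z u])
  have "AE t in lborel. t \<in> ?I \<longrightarrow> (\<exists>I. has_ito_integral M W t0 t ?f I)"
    using eqn by (auto simp: delay_diffusion_eq intro!: AE_I2)
  then obtain xs where "approximates t0 T xs ?f" using approximates_extend[OF f t0(2)] by blast
  then obtain ys Y where Y: "continuous_version t0 T ?f ys Y" using ito_continuous_version[OF t0 f] by blast
  let ?s = "solution x ?y ?z u Y"
  have at: "AE \<omega> in M. x t \<omega> = ?s t \<omega>" if t: "t \<in> ?I" for t
  proof -
    obtain I where I: "has_ito_integral M W t0 t ?f I"
      "AE \<omega> in M. x t \<omega> = \<xi> 0 + (LINT s:{t0<..<t}|lborel. delay_drift \<delta> P t0 \<zeta> u x s \<omega>) + I \<omega>"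
      using eqn[OF t] by (auto simp: delay_diffusion_eq)
    have "has_ito_integral M W t0 t ?f (Y t)"
      by (rule continuous_version_has_ito[OF t0(1) f Y]) (use t in auto)
    then have "AE \<omega> in M. I \<omega> = Y t \<omega>" using has_ito_unique[OF t0(1) _ I(1)] t by auto
    with I(2) show ?thesis
      by eventually_elim (simp add: solution_def state_path_def delay_drift_eq)
  qed
  have "AE \<omega> in M. \<forall>q\<in>\<rat>. q \<in> ?I \<longrightarrow> x q \<omega> = ?s q \<omega>"
    using at by (subst AE_ball_countable[OF countable_rat]) auto
  with cx' solution_continuous[OF x y z u Y] have xs_eq: "AE \<omega> in M. \<forall>t\<in>?I. x t \<omega> = ?s t \<omega>"
  proof eventually_elim
    case (elim \<omega>)
    have c: "continuous_on ?I (\<lambda>t. x t \<omega> - ?s t \<omega>)"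
      using elim by (intro continuous_on_diff) (auto intro: continuous_on_subset)
    show ?case
    proof
      fix t assume t: "t \<in> ?I"
      have "\<exists>q. c < q \<and> q < t \<and> q \<in> \<rat>" if "c < t" for c
        using Rats_dense_in_real[OF that] by blast
      then obtain q where q: "\<And>n. t0 < q n" "\<And>n. q n < t" "\<And>n. q n \<in> \<rat>" "q \<longlonglongrightarrow> t"
        using dense_left_sequence[of t0 t "\<lambda>q. q \<in> \<rat>"] t by auto
      have qI: "q n \<in> ?I" for n using q(1,2)[of n] t by auto
      have "(\<lambda>n. x (q n) \<omega> - ?s (q n) \<omega>) \<longlonglongrightarrow> x t \<omega> - ?s t \<omega>"
        by (rule continuous_on_tendsto_compose[OF c q(4) t]) (use qI in \<open>auto intro!: always_eventually\<close>)
      moreover have "x (q n) \<omega> - ?s (q n) \<omega> = 0" for n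
        using elim q(3) qI by auto
      ultimately have "(\<lambda>n. 0) \<longlonglongrightarrow> x t \<omega> - ?s t \<omega>" by simp
      then show "x t \<omega> = ?s t \<omega>" using LIMSEQ_unique[OF tendsto_const] by fastforce
    qed
  qed
  have XL: "X \<in> L2F M W t0 T"
  proof -
    have "(\<lambda>t \<omega>. vstack3 (x t \<omega>) 0 0 + vstack3 0 (?y t \<omega>) 0 + vstack3 0 0 (?z t \<omega>)) \<in> L2F M W t0 T"
      by (intro L2F_add L2F_linear[OF x bounded_linear_vstack3(1)] L2F_linear[OF y bounded_linear_vstack3(2)] L2F_linear[OF z bounded_linear_vstack3(3)])
    then show ?thesis by (simp add: X_def vstack3_add)
  qed
  show "volterra_state M W T \<delta> P t0 \<xi> \<zeta> u X"
    unfolding volterra_state_def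
  proof (intro conjI XL)
    show "AE t in lborel. t \<in> ?I \<longrightarrow> (\<exists>I.
        has_ito_integral M W t0 t (volterra_diffusion u X t) I \<and>
        (AE \<omega> in M. X t \<omega> = volterra_phi T \<delta> P t0 \<xi> \<zeta> t
           + (LINT s:{t0<..<t}|lborel. volterra_drift u X t s \<omega>) + I \<omega>))"
      using AE_good_time
    proof eventually_elim
      case (elim t)
      show ?case
      proof
        assume t: "t \<in> ?I"
        then have "good_time t" using elim by simp
        from volterra_rhs[OF x y z u Y this] obtain I where I: "has_ito_integral M W t0 t
            (volterra_diffusion u X t) I"
          and eq: "AE \<omega> in M. augmented ?s t \<omega>
            = volterra_phi T \<delta> P t0 \<xi> \<zeta> t
           + (LINT s:{t0<..<t}|lborel. volterra_drift u X t s \<omega>) + I \<omega>"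
          unfolding X_def by blast
        from eq xs_eq AE_space have "AE \<omega> in M. X t \<omega> = volterra_phi T \<delta> P t0 \<xi> \<zeta> t
           + (LINT s:{t0<..<t}|lborel. volterra_drift u X t s \<omega>) + I \<omega>"
        proof eventually_elim
          case (elim \<omega>)
          have "?z t \<omega> = (LINT s:{t0<..<t}|lborel. F_ker P t s *v ?s s \<omega>)"
            unfolding memory_def[of t0 "F_ker P" x t \<omega>] by (rule set_lebesgue_integral_cong) (use elim(2) t in auto)
          moreover have "?y t \<omega> = (if t \<le> t0 + \<delta> then \<xi> (t - \<delta> - t0) else ?s (t - \<delta>) \<omega>)"
            using delayed_eq[OF fi elim(3), of t] elim(2) t \<delta> by auto
          ultimately have "X t \<omega> = augmented ?s t \<omega>"
            using elim(2) t by (simp add: X_def)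
          then show ?case using elim(1) by simp
        qed
        with I show "\<exists>I. has_ito_integral M W t0 t (volterra_diffusion u X t) I \<and>
          (AE \<omega> in M. X t \<omega> = volterra_phi T \<delta> P t0 \<xi> \<zeta> t
           + (LINT s:{t0<..<t}|lborel. volterra_drift u X t s \<omega>) + I \<omega>)" by blast
      qed
    qed
  qed
  show "volterra_cost M T \<delta> P t0 \<zeta> u X = delay_cost M T \<delta> P t0 \<zeta> u x"
    by (rule costs_equal[OF x y z u XL]) (simp_all add: X_def)
qed

text \<open>The blocks of a Volterra state serve as input. The first block of its stochastic integral provides the
  integral of the diffusion coefficient, so the solution \<open>x\<close> exists, and at almost every time the state is
  the augmented path of \<open>x\<close>. The input of \<open>x\<close> is thus, up to null sets, \<open>x\<close> with its delay and its
  memory, and exchanging equivalent inputs changes neither the drift integral nor the Ito integral.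
  The path \<open>x\<close> is adapted as a limit of the first block, which is adapted, along times at which the two agree.\<close>

lemma volterra_to_delay:
  assumes u: "u \<in> L2F M W t0 T" and st: "volterra_state M W T \<delta> P t0 \<xi> \<zeta> u X"
  shows "\<exists>x. delay_state M W T \<delta> P t0 \<xi> \<zeta> u x \<and> delay_cost M T \<delta> P t0 \<zeta> u x = volterra_cost M T \<delta> P t0 \<zeta> u X"
proof -
  let ?I = "{t0<..<T}"
  have X: "X \<in> L2F M W t0 T" and eqn: "AE t in lborel. t \<in> ?I \<longrightarrow> (\<exists>I.
        has_ito_integral M W t0 t (volterra_diffusion u X t) I \<and>
        (AE \<omega> in M. X t \<omega> = volterra_phi T \<delta> P t0 \<xi> \<zeta> t
           + (LINT s:{t0<..<t}|lborel. volterra_drift u X t s \<omega>) + I \<omega>))"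
    using st by (auto simp: volterra_state_def)
  define X1 where "X1 = (\<lambda>t \<omega>. block1 (X t \<omega>))"
  define X2 where "X2 = (\<lambda>t \<omega>. block2 (X t \<omega>))"
  define X3 where "X3 = (\<lambda>t \<omega>. block3 (X t \<omega>))"
  have XL: "X1 \<in> L2F M W t0 T" "X2 \<in> L2F M W t0 T" "X3 \<in> L2F M W t0 T"
    unfolding X1_def X2_def X3_def
    by (rule L2F_linear[OF X bounded_linear_blocks(1)], rule L2F_linear[OF X bounded_linear_blocks(2)], rule L2F_linear[OF X bounded_linear_blocks(3)])
  have XV: "X t \<omega> = vstack3 (X1 t \<omega>) (X2 t \<omega>) (X3 t \<omega>)" for t \<omega> by (simp add: X1_def X2_def X3_def blocks)
  let ?f = "diffusion X1 X2 X3 u"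
  have f: "?f \<in> L2F M W t0 T" by (rule diffusion_L2F[OF XL u])
  have f_ito: "AE t in lborel. t \<in> ?I \<longrightarrow> (\<exists>I. has_ito_integral M W t0 t ?f I)"
    using eqn
  proof eventually_elim
    case (elim t)
    show ?case
    proof
      assume t: "t \<in> ?I"
      then obtain I where "has_ito_integral M W t0 t (volterra_diffusion u X t) I"
        using elim by blast
      from has_ito_linear[OF t0(1) _ this bounded_linear_blocks(1)] t
      have "has_ito_integral M W t0 t ?f (\<lambda>\<omega>. block1 (I \<omega>))" by (simp add: XV volterra_diffusion_eq)
      then show "\<exists>I. has_ito_integral M W t0 t ?f I" by blast
    qed
  qed
  obtain xs where "approximates t0 T xs ?f" using approximates_extend[OF f t0(2) f_ito] by blast
  then obtain ys Y where Y: "continuous_version t0 T ?f ys Y" using ito_continuous_version[OF t0 f] by blast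
  let ?s = "solution X1 X2 X3 u Y"
  have X_sol: "AE t in lborel. t \<in> ?I \<longrightarrow> (AE \<omega> in M. X t \<omega> =
      augmented ?s t \<omega>)"
    using eqn AE_good_time
  proof eventually_elim
    case (elim t)
    show ?case
    proof
      assume t: "t \<in> ?I"
      let ?r = "\<lambda>\<omega>. volterra_phi T \<delta> P t0 \<xi> \<zeta> t + (LINT s:{t0<..<t}|lborel. volterra_drift u X t s \<omega>)"
      obtain I where I: "has_ito_integral M W t0 t (volterra_diffusion u X t) I" "AE \<omega> in M. X t \<omega> = ?r \<omega> + I \<omega>" using elim t by blast
      have "good_time t" using elim t by simp
      from volterra_rhs[OF XL u Y this] obtain J where J: "has_ito_integral M W t0 t (volterra_diffusion u X t) J"
        "AE \<omega> in M. augmented ?s t \<omega> = ?r \<omega> + J \<omega>"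
        unfolding XV[symmetric] by blast
      have "AE \<omega> in M. I \<omega> = J \<omega>" by (rule has_ito_unique[OF t0(1) _ I(1) J(1)]) (use t in simp)
      with I(2) J(2) show "AE \<omega> in M. X t \<omega> =
        augmented ?s t \<omega>"
        by eventually_elim simp
    qed
  qed
  \<comment> \<open>off the null set \<open>N\<close> the state is the solution; the value \<open>0\<close> on \<open>N\<close> makes it jointly measurable\<close>
  define N where "N = {\<omega> \<in> space M. \<not> (continuous_on {t0..T} (\<lambda>t. ?s t \<omega>) \<and> ?s t0 \<omega> = \<xi> 0)}"
  have N: "N \<in> null_sets M"
    using solution_continuous[OF XL u Y] unfolding AE_iff_null_sets N_def .
  have AEN: "AE \<omega> in M. \<omega> \<notin> N" by (rule AE_not_in[OF N])
  define x where "x t \<omega> = (if t \<le> t0 then \<xi> (t - t0) else if \<omega> \<in> N then 0 else ?s t \<omega>)" for t \<omega>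
  have fi: "follows_initial x" by (simp add: follows_initial_def x_def)
  have x_s: "x t \<omega> = ?s t \<omega>" if "t0 < t" "\<omega> \<notin> N" for t \<omega> using that by (simp add: x_def)
  have x_cont: "continuous_on {t0 - \<delta>..T} (\<lambda>t. x t \<omega>)" if w: "\<omega> \<in> space M - N" for \<omega>
  proof -
    have c1: "continuous_on {t0 - \<delta>..t0} (\<lambda>t. \<xi> (t - t0))"
    proof -
      have "continuous_on {-\<delta>..0} \<xi>" using A1 by (simp add: assumption_A1_def)
      then show ?thesis by (rule continuous_on_compose2) (auto intro!: continuous_intros)
    qed
    have c2: "continuous_on {t0..T} (\<lambda>t. ?s t \<omega>)" and s0: "?s t0 \<omega> = \<xi> 0" using w by (auto simp: N_def)
    have "continuous_on ({t0 - \<delta>..t0} \<union> {t0..T}) (\<lambda>t. if t \<le> t0 then \<xi> (t - t0) else ?s t \<omega>)"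
    proof (rule continuous_on_If[OF _ _ c1 c2])
      fix t assume "t \<in> {t0..T}" "t \<le> t0"
      then have "t = t0" by simp
      then show "\<xi> (t - t0) = ?s t \<omega>" using s0 by simp
    qed auto
    moreover have "{t0 - \<delta>..t0} \<union> {t0..T} = {t0 - \<delta>..T}" using \<delta> t0 by auto
    moreover have "(\<lambda>t. if t \<le> t0 then \<xi> (t - t0) else ?s t \<omega>) = (\<lambda>t. x t \<omega>)" using w by (auto simp: x_def fun_eq_iff)
    ultimately show ?thesis by (simp only:)
  qed
  have cx: "AE \<omega> in M. continuous_on {t0 - \<delta>..T} (\<lambda>t. x t \<omega>)"
    using AEN AE_space by eventually_elim (use x_cont in auto)
  have cx': "AE \<omega> in M. continuous_on ?I (\<lambda>t. x t \<omega>)"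
    using cx by eventually_elim (rule continuous_on_subset, use \<delta> in auto)
  have X1_x: "AE t in lborel. t \<in> ?I \<longrightarrow> (AE \<omega> in M. X1 t \<omega> = x t \<omega>)"
    using X_sol
  proof eventually_elim
    case (elim t)
    show ?case
    proof
      assume t: "t \<in> ?I"
      with elim have "AE \<omega> in M. X t \<omega> = augmented ?s t \<omega>"
        by blast
      with AEN show "AE \<omega> in M. X1 t \<omega> = x t \<omega>"
        by eventually_elim (use t in \<open>simp add: X1_def x_s\<close>)
    qed
  qed
  have x_ad: "x t \<in> borel_measurable (Fil t)" if t: "t \<in> ?I" for t
  proof -
    have X1t: "AE q in lborel. q \<in> {t0<..<t} \<longrightarrow> (AE \<omega> in M. X1 q \<omega> = x q \<omega>)"
      using X1_x by eventually_elim (use t in auto)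
    have "t0 < t" using t by simp
    from dense_left_sequence[OF this AE_interval_obtains[OF X1t]] obtain q where q: "\<And>n. t0 < q n" "\<And>n. q n < t" "\<And>n. AE \<omega> in M. X1 (q n) \<omega> = x (q n) \<omega>" and ql: "q \<longlonglongrightarrow> t"
      by auto
    have qI: "q n \<in> ?I" for n using q(1,2)[of n] t by auto
    have "X1 (q n) \<in> borel_measurable (Fil t)" for n
      by (rule measurable_Fil_mono[of _ "q n"]) (use XL(1) qI q(2)[of n] in \<open>auto simp: L2F_iff\<close>)
    then have "(\<lambda>\<omega>. lim (\<lambda>n. X1 (q n) \<omega>)) \<in> borel_measurable (Fil t)" by (rule borel_measurable_lim_metric)
    then show ?thesis
    proof (rule measurable_Fil_AE_cong)
      have "AE \<omega> in M. \<forall>n. X1 (q n) \<omega> = x (q n) \<omega>" using q(3) by (simp add: AE_all_countable)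
      with cx' show "AE \<omega> in M. x t \<omega> = lim (\<lambda>n. X1 (q n) \<omega>)"
      proof eventually_elim
        case (elim \<omega>)
        have "(\<lambda>n. x (q n) \<omega>) \<longlonglongrightarrow> x t \<omega>"
          by (rule continuous_on_tendsto_compose[OF elim(1) ql t]) (use qI in \<open>auto intro!: always_eventually\<close>)
        then show ?case using elim(2) by (simp add: limI)
      qed
    qed
  qed
  have x_jm: "jmeas M t0 T x"
  proof -
    have "(\<lambda>(s, \<omega>). indicator ?I s *\<^sub>R (indicator (space M - N) \<omega> *\<^sub>R x s \<omega>)) \<in> borel_measurable (borel \<Otimes>\<^sub>M M)"
    proof (rule continuous_paths_jmeas)
      show "x s \<in> borel_measurable M" if "s \<in> ?I" for s by (rule measurable_FilD[OF x_ad[OF that]])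
      show "N \<in> sets M" using N by auto
      show "continuous_on ?I (\<lambda>s. x s \<omega>)" if "\<omega> \<in> space M - N" for \<omega>
        by (rule continuous_on_subset[OF x_cont[OF that]]) (use \<delta> in auto)
    qed
    also have "?this \<longleftrightarrow> (\<lambda>(s, \<omega>). indicator ?I s *\<^sub>R x s \<omega>) \<in> borel_measurable (borel \<Otimes>\<^sub>M M)"
      by (rule measurable_cong) (auto simp: space_pair_measure x_def indicator_def)
    finally show ?thesis by (simp add: jmeas_iff)
  qed
  have X1_x': "AE \<omega> in M. AE t in lborel. t \<in> ?I \<longrightarrow> X1 t \<omega> = x t \<omega>"
    using jmeas_AE_swap[of t0 T X1 x] XL(1) x_jm X1_x by (simp add: L2F_iff)
  have x: "x \<in> L2F M W t0 T"
    unfolding L2F_iff using x_jm x_ad XL(1) mean_sq_cong_AE[OF X1_x'] by (auto simp: L2F_iff)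
  let ?y = "delayed \<delta> x" and ?z = "memory t0 (F_ker P) x"
  have y: "?y \<in> L2F M W t0 T" by (rule delayed_L2F[OF x fi])
  have z: "?z \<in> L2F M W t0 T" by (rule memory_L2F[OF x cx'])
  have yz: "AE t in lborel. t \<in> ?I \<longrightarrow> (AE \<omega> in M. X2 t \<omega> = ?y t \<omega> \<and> X3 t \<omega> = ?z t \<omega>)"
    using X_sol
  proof eventually_elim
    case (elim t)
    show ?case
    proof
      assume t: "t \<in> ?I"
      with elim have "AE \<omega> in M. X t \<omega> = augmented ?s t \<omega>"
        by blast
      with AEN AE_space show "AE \<omega> in M. X2 t \<omega> = ?y t \<omega> \<and> X3 t \<omega> = ?z t \<omega>"
      proof eventually_elim
        case (elim \<omega>)
        have "?z t \<omega> = (LINT s:{t0<..<t}|lborel. F_ker P t s *v ?s s \<omega>)"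
          unfolding memory_def[of t0 "F_ker P" x t \<omega>] by (rule set_lebesgue_integral_cong) (use elim(1) x_s in auto)
        moreover have "?y t \<omega> = (if t \<le> t0 + \<delta> then \<xi> (t - \<delta> - t0) else ?s (t - \<delta>) \<omega>)"
          using delayed_eq[OF fi elim(2), of t] elim(1) t \<delta> x_s by auto
        ultimately show ?case using elim(3) by (simp add: X2_def X3_def)
      qed
    qed
  qed
  have X2_y: "AE \<omega> in M. AE t in lborel. t \<in> ?I \<longrightarrow> X2 t \<omega> = ?y t \<omega>"
    and X3_z: "AE \<omega> in M. AE t in lborel. t \<in> ?I \<longrightarrow> X3 t \<omega> = ?z t \<omega>"
  proof -
    have "AE t in lborel. t \<in> ?I \<longrightarrow> (AE \<omega> in M. X2 t \<omega> = ?y t \<omega>)" "AE t in lborel. t \<in> ?I \<longrightarrow> (AE \<omega> in M. X3 t \<omega> = ?z t \<omega>)"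
      using yz by (auto elim!: eventually_mono)
    then show "AE \<omega> in M. AE t in lborel. t \<in> ?I \<longrightarrow> X2 t \<omega> = ?y t \<omega>" "AE \<omega> in M. AE t in lborel. t \<in> ?I \<longrightarrow> X3 t \<omega> = ?z t \<omega>"
      using jmeas_AE_swap[of t0 T X2 ?y] jmeas_AE_swap[of t0 T X3 ?z] XL(2,3) y z by (simp_all add: L2F_iff)
  qed
  let ?g = "diffusion x ?y ?z u"
  have g: "?g \<in> L2F M W t0 T" by (rule diffusion_L2F[OF x y z u])
  have fg: "AE \<omega> in M. AE t in lborel. t \<in> ?I \<longrightarrow> ?f t \<omega> = ?g t \<omega>"
    using X1_x' X2_y X3_z
  proof eventually_elim
    case (elim \<omega>)
    from elim show ?case by eventually_elim (simp add: diffusion_def)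
  qed
  have drift_eq: "AE \<omega> in M. \<forall>t\<in>?I. state_path (free_drift X1 X2 X3 \<omega>) (\<lambda>s. u s \<omega>) t = \<xi> 0 + (LINT s:{t0<..<t}|lborel. delay_drift \<delta> P t0 \<zeta> u x s \<omega>)"
    using path_integrable[OF XL u] path_integrable[OF x y z u] X1_x' X2_y X3_z
  proof eventually_elim
    case (elim \<omega>)
    let ?d1 = "drift_path (free_drift X1 X2 X3 \<omega>) (\<lambda>s. u s \<omega>)" and ?d2 = "drift_path (free_drift x ?y ?z \<omega>) (\<lambda>s. u s \<omega>)"
    have d: "set_integrable lborel ?I ?d1" "set_integrable lborel ?I ?d2"
      using elim by (auto intro: drift_path_continuous(1))
    have ae: "AE s in lborel. s \<in> ?I \<longrightarrow> ?d1 s = ?d2 s"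
      using elim(3-5) by eventually_elim (simp add: drift_path_def free_drift_def)
    show ?case
    proof
      fix t assume t: "t \<in> ?I"
      have di: "set_integrable lborel {t0<..<t} ?d1" "set_integrable lborel {t0<..<t} ?d2"
        using t by (auto intro: set_integrable_subset[OF d(1)] set_integrable_subset[OF d(2)])
      have "(LINT s:{t0<..<t}|lborel. ?d1 s) = (LINT s:{t0<..<t}|lborel. ?d2 s)"
        unfolding set_lebesgue_integral_def
      proof (rule integral_cong_AE)
        show "AE s in lborel. indicator {t0<..<t} s *\<^sub>R ?d1 s = indicator {t0<..<t} s *\<^sub>R ?d2 s"
          using ae by eventually_elim (use t in \<open>auto simp: indicator_def\<close>)
      qed (use di in \<open>auto simp: set_integrable_def\<close>)
      then show "state_path (free_drift X1 X2 X3 \<omega>) (\<lambda>s. u s \<omega>) t = \<xi> 0 + (LINT s:{t0<..<t}|lborel. delay_drift \<delta> P t0 \<zeta> u x s \<omega>)"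
        by (simp add: state_path_def delay_drift_eq)
    qed
  qed
  have "delay_state M W T \<delta> P t0 \<xi> \<zeta> u x"
    unfolding delay_state_def
  proof (intro conjI x cx ballI)
    show "x t \<omega> = \<xi> (t - t0)" if "\<omega> \<in> space M" "t \<in> {t0 - \<delta>..t0}" for t \<omega> using that by (simp add: x_def)
    fix t assume t: "t \<in> ?I"
    have "has_ito_integral M W t0 t ?f (Y t)"
      by (rule continuous_version_has_ito[OF t0(1) f Y]) (use t in auto)
    then have "has_ito_integral M W t0 t ?g (Y t)"
    proof (rule has_ito_cong[rotated])
      show "?g \<in> L2F M W t0 t" by (rule L2F_subinterval[OF g order_refl]) (use t in simp)
      show "AE \<omega> in M. AE s in lborel. s \<in> {t0<..<t} \<longrightarrow> ?f s \<omega> = ?g s \<omega>"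
        using fg
      proof eventually_elim
        case (elim \<omega>)
        then show ?case by eventually_elim (use t in auto)
      qed
    qed (use t in auto)
    moreover have "AE \<omega> in M. x t \<omega> = \<xi> 0 + (LINT s:{t0<..<t}|lborel. delay_drift \<delta> P t0 \<zeta> u x s \<omega>) + Y t \<omega>"
      using drift_eq AEN
    proof eventually_elim
      case (elim \<omega>)
      then have "x t \<omega> = state_path (free_drift X1 X2 X3 \<omega>) (\<lambda>s. u s \<omega>) t + Y t \<omega>" using t x_s by (simp add: solution_def)
      then show ?case using elim t by simp
    qed
    ultimately show "\<exists>I. has_ito_integral M W t0 t (delay_diffusion \<delta> P t0 u x) I \<and>
        (AE \<omega> in M. x t \<omega> = \<xi> 0 + (LINT s:{t0<..<t}|lborel. delay_drift \<delta> P t0 \<zeta> u x s \<omega>) + I \<omega>)"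
      unfolding delay_diffusion_eq by blast
  qed
  moreover have "volterra_cost M T \<delta> P t0 \<zeta> u X = delay_cost M T \<delta> P t0 \<zeta> u x"
    by (rule costs_equal[OF x y z u X]) (use X1_x' X2_y X3_z in \<open>simp_all add: X1_def X2_def X3_def\<close>)
  ultimately show ?thesis by auto
qed

end

lemma is_minimizer_transfer:
  assumes min: "is_minimizer U S J u"
    and forth: "\<And>v x. v \<in> U \<Longrightarrow> S v x \<Longrightarrow> \<exists>X. S' v X \<and> J' v X = J v x"
    and conv: "\<And>v X. v \<in> U \<Longrightarrow> S' v X \<Longrightarrow> \<exists>x. S v x \<and> J v x = J' v X"
  shows "is_minimizer U S' J' u"
proof -
  obtain x where x: "u \<in> U" "S u x" "\<And>v y. v \<in> U \<Longrightarrow> S v y \<Longrightarrow> J u x \<le> J v y"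
    using min by (auto simp: is_minimizer_def)
  obtain X where X: "S' u X" "J' u X = J u x" using forth[OF x(1,2)] by blast
  have "J' u X \<le> J' v Y" if v: "v \<in> U" "S' v Y" for v Y
  proof -
    obtain y where "S v y" "J v y = J' v Y" using conv[OF v] by blast
    with x(3)[OF v(1)] X(2) show ?thesis by metis
  qed
  with x(1) X(1) show ?thesis by (auto simp: is_minimizer_def)
qed

theorem proposition3p1:
  fixes M :: "'w measure" and W :: "real \<Rightarrow> 'w \<Rightarrow> real"
    and P :: "('w, 'n::finite, 'm::finite) coeffs"
    and \<xi> :: "real \<Rightarrow> real^'n" and \<zeta> :: "real \<Rightarrow> real^'m"
    and T \<delta> t0 :: real and u :: "real \<Rightarrow> 'w \<Rightarrow> real^'m"
  assumes "prob_space M" and "complete_measure M"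
    and "brownian_motion M W"
    and "T > 0" and "\<delta> > 0"
    and "assumption_A1 M W T \<delta> P \<xi> \<zeta>"
    and "0 \<le> t0" and "t0 < T"
  shows "is_minimizer (L2F M W t0 T) (delay_state M W T \<delta> P t0 \<xi> \<zeta>) (delay_cost M T \<delta> P t0 \<zeta>) u
     \<longleftrightarrow> is_minimizer (L2F M W t0 T) (volterra_state M W T \<delta> P t0 \<xi> \<zeta>)
           (volterra_cost M T \<delta> P t0 \<zeta>) u"
proof -
  interpret prob_space M by fact
  interpret complete_measure M by fact
  interpret delay_problem M W T \<delta> t0 P \<xi> \<zeta>
    by unfold_locales (use assms in auto)
  have 1: "\<exists>X. volterra_state M W T \<delta> P t0 \<xi> \<zeta> v X \<and> volterra_cost M T \<delta> P t0 \<zeta> v X = delay_cost M T \<delta> P t0 \<zeta> v x"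
    if "v \<in> L2F M W t0 T" "delay_state M W T \<delta> P t0 \<xi> \<zeta> v x" for v x
    using delay_to_volterra[OF that] by blast
  have 2: "\<exists>x. delay_state M W T \<delta> P t0 \<xi> \<zeta> v x \<and> delay_cost M T \<delta> P t0 \<zeta> v x = volterra_cost M T \<delta> P t0 \<zeta> v X"
    if "v \<in> L2F M W t0 T" "volterra_state M W T \<delta> P t0 \<xi> \<zeta> v X" for v X
    by (rule volterra_to_delay[OF that])
  show ?thesis
    by (rule iffI) (erule is_minimizer_transfer, fact 1, fact 2, erule is_minimizer_transfer, fact 2, fact 1)
qed

end
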